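(* Let $\sigma\in(0,\infty)$ and let $n\geqslant 1$ be an integer with $\frac{4}{3}\sigma<n\leqslant\frac{10}{3}\sigma$. Consider the semilinear Cauchy problem $(\mathrm{P}_\epsilon)$ with $\eta\in(1,\infty)$ and $(u_0,u_1,u_2)\in\mathcal{B}_{\sigma}$. Let the exponent $p$ satisfy $$p_{\mathrm{crit}}(n,\sigma)<p\leqslant \frac{3n}{(3n-8\sigma)_+}.$$ Then there exist a constant $C>0$ and $\epsilon_0>0$ such that for all $\epsilon\in(0,\epsilon_0]$ and all data with $\|(u_0,u_1,u_2)\|_{\mathcal{B}_{\sigma}}\leqslant C$, there is a uniquely determined (mild) solution $$u\in\mathcal{C}\big([0,\infty),H^{\frac{4}{3}\sigma}\big)$$ of $(\mathrm{P}_\epsilon)$; in particular the lifespan is $T_{\epsilon}=\infty$. Moreover, for all $t\geqslant0$, $$\|u(t,\cdot)\|_{L^2}\lesssim \begin{cases} \epsilon\ln (\mathrm{e}+t)\|(u_0,u_1,u_2)\|_{\mathcal{B}_{\sigma}}&\mbox{if } n=\frac{8}{3}\sigma \mbox{ and } \eta\in(3,\infty),\\ \epsilon (1+t)^{-\frac{3n-8\sigma}{4\sigma}}\|(u_0,u_1,u_2)\|_{\mathcal{B}_{\sigma}}&\mbox{otherwise,} \end{cases}$$ and $$\|u(t,\cdot)\|_{\dot{H}^{\frac{4}{3}\sigma}}\lesssim\epsilon (1+t)^{-\frac{3n}{4\sigma}}\|(u_0,u_1,u_2)\|_{\mathcal{B}_{\sigma}}.$$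
   Context: For $\sigma>0$ and $\alpha\in[0,1]$, $\mathcal{A}^{\alpha}=(-\Delta)^{\sigma\alpha}$ denotes the Fourier multiplier $\mathcal{A}^{\alpha}u=\mathcal{F}^{-1}_{\xi\to x}(|\xi|^{2\sigma\alpha}\mathcal{F}_{x\to\xi}u)$, with $\mathcal{A}=(-\Delta)^\sigma$. For $\eta>0$, $p>1$, $\epsilon>0$, the semilinear Cauchy problem $(\mathrm{P}_\epsilon)$ is $$u_{ttt}+\mathcal{A}u+\eta\mathcal{A}^{\frac{1}{3}}u_{tt}+\eta\mathcal{A}^{\frac{2}{3}}u_t=|u|^p,\quad x\in\mathbb{R}^n,\ t>0,$$ $$u(0,x)=\epsilon u_0(x),\ u_t(0,x)=\epsilon u_1(x),\ u_{tt}(0,x)=\epsilon u_2(x).$$ The linear problem is the same equation with right-hand side $0$ and data $v(0)=v_0,v_t(0)=v_1,v_{tt}(0)=v_2$, solved via partial Fourier transform in $x$. For $j=0,1,2$, $E_j(t,x)$ denotes the fundamental solution of the linear problem with data $v_j=\delta_0$ and $v_k=0$ for $k\neq j$. A mild solution of $(\mathrm{P}_\epsilon)$ on $[0,T]$ is $u\in\mathcal{C}([0,T],H^{\frac{4}{3}\sigma})$ with $$u(t,x)=\epsilon\sum_{j=0,1,2}E_j(t,\cdot)\ast_{(x)}u_j+\int_0^tE_2(t-\tau,\cdot)\ast_{(x)}|u(\tau,\cdot)|^p\,\mathrm{d}\tau .$$ The lifespan $T_\epsilon$ is the supremum of $T>0$ such that a unique local solution exists on $[0,T)$. Notation: $(x)_+=\max\{x,0\}$,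 with the convention $\frac{1}{(x)_+}=\infty$ if $x\leqslant 0$; $p_{\mathrm{crit}}(n,\sigma):=1+\frac{6\sigma}{(3n-4\sigma)_+}$. The data space is $\mathcal{B}_{\sigma}:=(H^{\frac{4}{3}\sigma}\cap L^1)\times (H^{\frac{2}{3}\sigma}\cap L^1)\times (L^2\cap L^1)$ with the sum norm. $\dot H^s$ is the homogeneous Sobolev space with norm $\||\xi|^s\hat f\|_{L^2}$. $f\lesssim g$ means $f\leqslant Cg$ with $C$ independent of $t$, $\epsilon$ and the data. *)

theory Defs
  imports "HOL-Analysis.Analysis"
begin

definition L1 :: "('a::euclidean_space \<Rightarrow> real) \<Rightarrow> bool" where
  "L1 f \<longleftrightarrow> integrable lborel f"

definition L1norm :: "('a::euclidean_space \<Rightarrow> real) \<Rightarrow> real" where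
  "L1norm f = (\<integral>x. \<bar>f x\<bar> \<partial>lborel)"

definition L2 :: "('a::euclidean_space \<Rightarrow> real) \<Rightarrow> bool" where
  "L2 f \<longleftrightarrow> f \<in> borel_measurable lborel \<and> integrable lborel (\<lambda>x. (f x)\<^sup>2)"

definition L2norm :: "('a::euclidean_space \<Rightarrow> real) \<Rightarrow> real" where
  "L2norm f = sqrt (\<integral>x. (f x)\<^sup>2 \<partial>lborel)"

definition ft1 :: "('a::euclidean_space \<Rightarrow> real) \<Rightarrow> 'a \<Rightarrow> complex" where
  "ft1 f \<xi> = (\<integral>x. complex_of_real (f x) * cis (- (x \<bullet> \<xi>)) \<partial>lborel)"

text \<open>U is (a representative of) the L2 Fourier transform of f, characterised
  weakly by Parseval duality against all test functions in L1 and L2.\<close>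
definition fourier_rel :: "('a::euclidean_space \<Rightarrow> real) \<Rightarrow> ('a \<Rightarrow> complex) \<Rightarrow> bool" where
  "fourier_rel f U \<longleftrightarrow> U \<in> borel_measurable lborel \<and>
     integrable lborel (\<lambda>\<xi>. (cmod (U \<xi>))\<^sup>2) \<and>
     (\<forall>\<phi>. integrable lborel \<phi> \<and> L2 \<phi> \<longrightarrow>
        (\<integral>\<xi>. U \<xi> * complex_of_real (\<phi> \<xi>) \<partial>lborel) =
        (\<integral>x. complex_of_real (f x) * ft1 \<phi> x \<partial>lborel))"

definition FT :: "('a::euclidean_space \<Rightarrow> real) \<Rightarrow> 'a \<Rightarrow> complex" where
  "FT f = (SOME U. fourier_rel f U)"

definition Hs :: "real \<Rightarrow> ('a::euclidean_space \<Rightarrow> real) \<Rightarrow> bool" where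
  "Hs s f \<longleftrightarrow> L2 f \<and>
     integrable lborel (\<lambda>\<xi>. (1 + (norm \<xi>)\<^sup>2) powr s * (cmod (FT f \<xi>))\<^sup>2)"

definition Hsnorm :: "real \<Rightarrow> ('a::euclidean_space \<Rightarrow> real) \<Rightarrow> real" where
  "Hsnorm s f = sqrt (\<integral>\<xi>. (1 + (norm \<xi>)\<^sup>2) powr s * (cmod (FT f \<xi>))\<^sup>2 \<partial>lborel)"

definition Hdotnorm :: "real \<Rightarrow> ('a::euclidean_space \<Rightarrow> real) \<Rightarrow> real" where
  "Hdotnorm s f = sqrt (\<integral>\<xi>. (norm \<xi>) powr (2 * s) * (cmod (FT f \<xi>))\<^sup>2 \<partial>lborel)"

text \<open>For a = |xi|^(2 sigma/3), the Fourier transform of E_j(t,.) at xi is the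
  solution y of  y''' + eta a y'' + eta a^2 y' + a^3 y = 0 with y^(k)(0) = delta_jk.\<close>
definition fund_ode :: "real \<Rightarrow> real \<Rightarrow> nat \<Rightarrow> (real \<Rightarrow> real) \<Rightarrow> bool" where
  "fund_ode \<eta> a j y \<longleftrightarrow> (\<exists>y1 y2 y3. \<forall>t.
      (y has_real_derivative y1 t) (at t) \<and>
      (y1 has_real_derivative y2 t) (at t) \<and>
      (y2 has_real_derivative y3 t) (at t) \<and>
      y3 t + \<eta> * a * y2 t + \<eta> * a\<^sup>2 * y1 t + a ^ 3 * y t = 0 \<and>
      y 0 = (if j = 0 then 1 else 0) \<and> y1 0 = (if j = 1 then 1 else 0) \<and>
      y2 0 = (if j = 2 then 1 else 0))"

definition Kfun :: "real \<Rightarrow> real \<Rightarrow> nat \<Rightarrow> real \<Rightarrow> real" where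
  "Kfun \<eta> a j = (THE y. fund_ode \<eta> a j y)"

definition hatE :: "real \<Rightarrow> real \<Rightarrow> nat \<Rightarrow> real \<Rightarrow> 'a::euclidean_space \<Rightarrow> real" where
  "hatE \<sigma> \<eta> j t \<xi> = Kfun \<eta> (norm \<xi> powr (2 * \<sigma> / 3)) j t"

text \<open>u is a mild solution of (P_eps) on the time interval I (I = [0,T], [0,T) or
  [0,inf)): u in C(I, H^(4 sigma/3)) and the Duhamel formula holds, written on the
  Fourier side (convolution with E_j = multiplication by hat E_j).\<close>
definition mild_sol :: "real \<Rightarrow> real \<Rightarrow> real \<Rightarrow> real \<Rightarrow>
    ('a::euclidean_space \<Rightarrow> real) \<Rightarrow> ('a \<Rightarrow> real) \<Rightarrow> ('a \<Rightarrow> real) \<Rightarrow>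
    real set \<Rightarrow> (real \<Rightarrow> 'a \<Rightarrow> real) \<Rightarrow> bool" where
  "mild_sol \<sigma> \<eta> p \<epsilon> u0 u1 u2 I u \<longleftrightarrow>
     (\<forall>t\<in>I. Hs (4 * \<sigma> / 3) (u t)) \<and>
     (\<forall>t\<in>I. ((\<lambda>s. Hsnorm (4 * \<sigma> / 3) (\<lambda>x. u s x - u t x)) \<longlongrightarrow> 0) (at t within I)) \<and>
     (\<forall>t\<in>I. AE \<xi> in lborel.
        FT (u t) \<xi> =
          complex_of_real \<epsilon> *
            (complex_of_real (hatE \<sigma> \<eta> 0 t \<xi>) * ft1 u0 \<xi> +
             complex_of_real (hatE \<sigma> \<eta> 1 t \<xi>) * ft1 u1 \<xi> +
             complex_of_real (hatE \<sigma> \<eta> 2 t \<xi>) * ft1 u2 \<xi>)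
          + set_lebesgue_integral lborel {0..t}
              (\<lambda>\<tau>. complex_of_real (hatE \<sigma> \<eta> 2 (t - \<tau>) \<xi>) *
                    ft1 (\<lambda>x. \<bar>u \<tau> x\<bar> powr p) \<xi>))"

definition lifespan :: "real \<Rightarrow> real \<Rightarrow> real \<Rightarrow> real \<Rightarrow>
    ('a::euclidean_space \<Rightarrow> real) \<Rightarrow> ('a \<Rightarrow> real) \<Rightarrow> ('a \<Rightarrow> real) \<Rightarrow> ereal" where
  "lifespan \<sigma> \<eta> p \<epsilon> u0 u1 u2 = Sup {ereal T | T. T > 0 \<and>
      (\<exists>v. mild_sol \<sigma> \<eta> p \<epsilon> u0 u1 u2 {0..<T} v \<and>
        (\<forall>w. mild_sol \<sigma> \<eta> p \<epsilon> u0 u1 u2 {0..<T} w \<longrightarrow>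
           (\<forall>t\<in>{0..<T}. AE x in lborel. w t x = v t x)))}"

definition in_B :: "real \<Rightarrow> ('a::euclidean_space \<Rightarrow> real) \<Rightarrow> ('a \<Rightarrow> real) \<Rightarrow> ('a \<Rightarrow> real) \<Rightarrow> bool" where
  "in_B \<sigma> u0 u1 u2 \<longleftrightarrow> Hs (4 * \<sigma> / 3) u0 \<and> L1 u0 \<and> Hs (2 * \<sigma> / 3) u1 \<and> L1 u1 \<and>
     L2 u2 \<and> L1 u2"

definition B_norm :: "real \<Rightarrow> ('a::euclidean_space \<Rightarrow> real) \<Rightarrow> ('a \<Rightarrow> real) \<Rightarrow> ('a \<Rightarrow> real) \<Rightarrow> real" where
  "B_norm \<sigma> u0 u1 u2 = Hsnorm (4 * \<sigma> / 3) u0 + L1norm u0 + Hsnorm (2 * \<sigma> / 3) u1 + L1norm u1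
     + L2norm u2 + L1norm u2"

text \<open>1/(x)_+ = infinity for x <= 0.\<close>
definition p_crit :: "real \<Rightarrow> real \<Rightarrow> ereal" where
  "p_crit n \<sigma> = (if 3 * n - 4 * \<sigma> \<le> 0 then \<infinity> else ereal (1 + 6 * \<sigma> / (3 * n - 4 * \<sigma>)))"

definition p_upper :: "real \<Rightarrow> real \<Rightarrow> ereal" where
  "p_upper n \<sigma> = (if 3 * n - 8 * \<sigma> \<le> 0 then \<infinity> else ereal (3 * n / (3 * n - 8 * \<sigma>)))"

end

(* On the Fourier side the linear flow is given by K_j(t, xi) = t^j kappa_j(a t) with a = |xi|^(s/2)
   and s = 4 sigma / 3. The characteristic polynomial (x + 1)(x^2 + (eta - 1) x + 1) is stable for
   eta > 1, so kappa_j decays exponentially. Hence at time t only the frequencies |xi|^s <~ (1+t)^(-2)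
   matter, and everything is measured with the multiplier weight Lambda^(-2) + |xi|^s at the scale
   Lambda = 1 + t: data in L1 (bounded Fourier transform) produce decay Lambda^(-nu) with nu = n / s.
   The Sobolev inequality for L^(2p), with L^2 interpolation, bounds the nonlinearity at time t
   in L1 by (1+t)^(-gamma) and in L2 by (1+t)^(-gamma-nu), where gamma = 2(p-1) nu - 2p. The
   condition p > p_crit says exactly gamma > 1, so the Duhamel integral converges and keeps the linear
   decay rate; the upper bound on p is the Sobolev restriction nu (1 - 1/p) <= 2. For small data
   the Picard iteration then contracts, with the same rate as the linear solution for all eta > 1; in
   particular the logarithm admitted when n = 8 sigma / 3 does not occur. *)
theory Submission
  imports Defs "HOL-Probability.Characteristic_Functions"
begin

text \<open>The linear flow is written as a power series and not through the roots of its
  characteristic polynomial. The quadratic factor has complex roots for \<eta> < 3, the double root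
  -1 for \<eta> = 3 and real roots beyond; root formulas would divide by differences of roots and by
  powers of |xi|. Splitting off t^j from an entire function treats all cases alike. It also bounds
  the low frequencies by t^2, where |xi|^(-s) would cost a logarithm at n = 2 s.

  The restriction n \<le> 10 \<sigma> / 3 forces p \<ge> 2, and this is what lets |u|^p be bounded
  in L1 by interpolation between L2 and L^(2p).

  \<open>FT\<close> is a choice among functions characterised weakly by duality. Plancherel's
  theorem, inversion and surjectivity are therefore developed for the relation between a function
  and a transform of it. The iteration acts on the Fourier side; surjectivity brings each iterate
  back, and Hermitian symmetry keeps it real.

  Smallness drives existence only. Competing solutions are arbitrary, so uniqueness is a separate
  argument on bounded time intervals with an exponential weight.\<close>

section \<open>Square-integrable functions\<close>

text \<open>A predicate rather than a norm, because the Bochner integral is 0 for functions that are not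
  square integrable.\<close>

definition l2b :: "('a::euclidean_space \<Rightarrow> 'b::euclidean_space) \<Rightarrow> real \<Rightarrow> bool" where
  "l2b g A \<longleftrightarrow> g \<in> borel_measurable borel \<and> 0 \<le> A \<and>
     (\<integral>\<^sup>+x. ennreal ((norm (g x))\<^sup>2) \<partial>lborel) \<le> ennreal (A\<^sup>2)"

lemma l2b_measurable: "l2b g A \<Longrightarrow> g \<in> borel_measurable borel"
  by (simp add: l2b_def)

lemma l2b_nonneg: "l2b g A \<Longrightarrow> 0 \<le> A"
  by (simp add: l2b_def)

lemma l2b_integrable:
  assumes "l2b g A"
  shows "integrable lborel (\<lambda>x. (norm (g x))\<^sup>2)"
proof (rule integrableI_nonneg)
  show "(\<lambda>x. (norm (g x))\<^sup>2) \<in> borel_measurable lborel"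
    using l2b_measurable[OF assms] by simp
  show "(\<integral>\<^sup>+x. ennreal ((norm (g x))\<^sup>2) \<partial>lborel) < \<infinity>"
    using assms le_less_trans[OF _ ennreal_less_top, of _ "A\<^sup>2"] by (simp add: l2b_def)
qed auto

lemma l2b_integral:
  assumes "l2b g A"
  shows "(\<integral>x. (norm (g x))\<^sup>2 \<partial>lborel) \<le> A\<^sup>2"
proof -
  have "ennreal (\<integral>x. (norm (g x))\<^sup>2 \<partial>lborel) = (\<integral>\<^sup>+x. ennreal ((norm (g x))\<^sup>2) \<partial>lborel)"
    by (rule nn_integral_eq_integral[symmetric]) (auto intro: l2b_integrable[OF assms])
  also have "\<dots> \<le> ennreal (A\<^sup>2)"
    using assms by (simp add: l2b_def)
  finally show ?thesis
    by (subst (asm) ennreal_le_iff) auto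
qed

lemma l2bI:
  assumes "g \<in> borel_measurable borel" "0 \<le> A"
    and i: "integrable lborel (\<lambda>x. (norm (g x))\<^sup>2)" and "(\<integral>x. (norm (g x))\<^sup>2 \<partial>lborel) \<le> A\<^sup>2"
  shows "l2b g A"
proof -
  have "(\<integral>\<^sup>+x. ennreal ((norm (g x))\<^sup>2) \<partial>lborel) = ennreal (\<integral>x. (norm (g x))\<^sup>2 \<partial>lborel)"
    by (rule nn_integral_eq_integral[OF i]) auto
  then show ?thesis
    using assms by (simp add: l2b_def ennreal_leI)
qed

lemma l2bI_sqrt:
  assumes "g \<in> borel_measurable borel" "integrable lborel (\<lambda>x. (norm (g x))\<^sup>2)"
  shows "l2b g (sqrt (\<integral>x. (norm (g x))\<^sup>2 \<partial>lborel))"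
  by (rule l2bI) (use assms in auto)

lemma l2b_mono: "l2b g A \<Longrightarrow> A \<le> B \<Longrightarrow> l2b g B"
  unfolding l2b_def by (meson ennreal_leI order_trans power_mono)

lemma l2b_dominated:
  assumes g: "l2b g A" and f: "f \<in> borel_measurable borel" and c: "0 \<le> c"
    and le: "AE x in lborel. norm (f x) \<le> c * norm (g x)"
  shows "l2b f (c * A)"
proof -
  have "(\<integral>\<^sup>+x. ennreal ((norm (f x))\<^sup>2) \<partial>lborel) \<le> (\<integral>\<^sup>+x. ennreal (c\<^sup>2) * ennreal ((norm (g x))\<^sup>2) \<partial>lborel)"
  proof (rule nn_integral_mono_AE)
    show "AE x in lborel. ennreal ((norm (f x))\<^sup>2) \<le> ennreal (c\<^sup>2) * ennreal ((norm (g x))\<^sup>2)"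
      using le
    proof eventually_elim
      case (elim x)
      then have "(norm (f x))\<^sup>2 \<le> (c * norm (g x))\<^sup>2"
        by (intro power_mono) auto
      then show ?case
        by (simp add: power_mult_distrib ennreal_mult'[symmetric] ennreal_leI)
    qed
  qed
  also have "\<dots> = ennreal (c\<^sup>2) * (\<integral>\<^sup>+x. ennreal ((norm (g x))\<^sup>2) \<partial>lborel)"
    by (rule nn_integral_cmult) (use l2b_measurable[OF g] in auto)
  also have "\<dots> \<le> ennreal (c\<^sup>2) * ennreal (A\<^sup>2)"
    using g by (intro mult_left_mono) (auto simp: l2b_def)
  also have "\<dots> = ennreal ((c * A)\<^sup>2)"
    by (simp add: power_mult_distrib ennreal_mult'[symmetric])
  finally show ?thesis
    using f c l2b_nonneg[OF g] by (simp add: l2b_def)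
qed

lemma l2b_dominated1:
  assumes "l2b g A" "f \<in> borel_measurable borel" "\<And>x. norm (f x) \<le> norm (g x)"
  shows "l2b f A"
  using l2b_dominated[OF assms(1,2), of 1] assms(3) by simp

lemma l2b_cong_AE:
  assumes "l2b g A" "f \<in> borel_measurable borel" "AE x in lborel. f x = g x"
  shows "l2b f A"
proof -
  have "AE x in lborel. norm (f x) \<le> 1 * norm (g x)"
    using assms(3) by eventually_elim simp
  then show ?thesis
    using l2b_dominated[OF assms(1,2), of 1] by simp
qed

lemma l2b_scaleR: "l2b g A \<Longrightarrow> l2b (\<lambda>x. c *\<^sub>R g x) (\<bar>c\<bar> * A)"
  by (rule l2b_dominated) (auto dest: l2b_measurable)

lemma l2b_cmult:
  fixes g :: "'a::euclidean_space \<Rightarrow> complex"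
  shows "l2b g A \<Longrightarrow> l2b (\<lambda>x. c * g x) (cmod c * A)"
  by (rule l2b_dominated) (auto dest: l2b_measurable simp: norm_mult)

lemma l2b_zero: "0 \<le> A \<Longrightarrow> l2b (\<lambda>x. 0) A"
  by (simp add: l2b_def)

text \<open>Allows a bound to be reached with arbitrarily small slack, so that other estimates may
  divide by the bounds involved.\<close>

lemma l2b_limit:
  assumes "\<And>e. 0 < e \<Longrightarrow> l2b g (A + e)" "0 \<le> A"
  shows "l2b g A"
proof -
  have m: "g \<in> borel_measurable borel"
    using assms(1)[of 1] by (auto dest: l2b_measurable)
  have i: "integrable lborel (\<lambda>x. (norm (g x))\<^sup>2)"
    using assms(1)[of 1] by (auto intro: l2b_integrable)
  have "((\<lambda>e. (A + e)\<^sup>2) \<longlongrightarrow> (A + 0)\<^sup>2) (at_right 0)"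
    by (intro tendsto_intros)
  moreover have "\<forall>\<^sub>F e in at_right 0. (\<integral>x. (norm (g x))\<^sup>2 \<partial>lborel) \<le> (A + e)\<^sup>2"
    using assms(1) by (auto simp: eventually_at_right_field intro!: exI[of _ 1] l2b_integral)
  ultimately have "(\<integral>x. (norm (g x))\<^sup>2 \<partial>lborel) \<le> (A + 0)\<^sup>2"
    by (rule tendsto_lowerbound) auto
  then show ?thesis
    using m i assms(2) by (intro l2bI) auto
qed

text \<open>Cauchy-Schwarz with weights \<open>A\<close> and \<open>B\<close>. When the two squares
  integrate to at most \<open>A\<^sup>2\<close> and \<open>B\<^sup>2\<close>, the right-hand side
  integrates to at most \<open>(A + B)\<^sup>2\<close>: this is Minkowski's inequality with its
  exact constant.\<close>

lemma norm_add_sq_le: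
  fixes a b :: "'b::real_normed_vector"
  assumes "0 < A" "0 < B"
  shows "(norm (a + b))\<^sup>2 \<le> (A + B) * ((norm a)\<^sup>2 / A + (norm b)\<^sup>2 / B)"
proof -
  have "(norm (a + b))\<^sup>2 \<le> (norm a + norm b)\<^sup>2"
    by (intro power_mono norm_triangle_ineq) auto
  also have "\<dots> \<le> (A + B) * ((norm a)\<^sup>2 / A + (norm b)\<^sup>2 / B)"
  proof -
    have "0 \<le> (B * norm a - A * norm b)\<^sup>2 / (A * B)"
      using assms by simp
    also have "\<dots> = (A + B) * ((norm a)\<^sup>2 / A + (norm b)\<^sup>2 / B) - (norm a + norm b)\<^sup>2"
      using assms by (simp add: field_simps power2_eq_square)
    finally show ?thesis by simp
  qed
  finally show ?thesis .
qed

lemma l2b_add: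
  assumes f: "l2b f A" and g: "l2b g B"
  shows "l2b (\<lambda>x. f x + g x) (A + B)"
proof -
  have pos: "l2b (\<lambda>x. f x + g x) (A + B)" if f: "l2b f A" and g: "l2b g B" and "0 < A" "0 < B" for A B
  proof -
    note [simp] = l2b_integrable[OF f] l2b_integrable[OF g]
    have [measurable]: "f \<in> borel_measurable borel" "g \<in> borel_measurable borel"
      using f g by (auto dest: l2b_measurable)
    have m: "(\<lambda>x. f x + g x) \<in> borel_measurable borel" by measurable
    have i: "integrable lborel (\<lambda>x. (A + B) * ((norm (f x))\<^sup>2 / A + (norm (g x))\<^sup>2 / B))"
      by simp
    have i': "integrable lborel (\<lambda>x. (norm (f x + g x))\<^sup>2)"
    proof (rule Bochner_Integration.integrable_bound[OF i])
      show "AE x in lborel. norm ((norm (f x + g x))\<^sup>2) \<le> norm ((A + B) * ((norm (f x))\<^sup>2 / A + (norm (g x))\<^sup>2 / B))"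
        unfolding real_norm_def abs_power2 power2_abs
        by (rule AE_I2) (rule order_trans[OF norm_add_sq_le[OF that(3,4)] abs_ge_self])
    qed (use m in simp)
    have "(\<integral>x. (norm (f x + g x))\<^sup>2 \<partial>lborel) \<le> (\<integral>x. (A + B) * ((norm (f x))\<^sup>2 / A + (norm (g x))\<^sup>2 / B) \<partial>lborel)"
      by (rule integral_mono[OF i' i norm_add_sq_le[OF that(3,4)]])
    also have "\<dots> = (A + B) * ((\<integral>x. (norm (f x))\<^sup>2 \<partial>lborel) / A + (\<integral>x. (norm (g x))\<^sup>2 \<partial>lborel) / B)"
      by simp
    also have "\<dots> \<le> (A + B) * (A\<^sup>2 / A + B\<^sup>2 / B)"
      using that(3,4) l2b_integral[OF f] l2b_integral[OF g]
      by (intro mult_left_mono add_mono divide_right_mono) auto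
    also have "\<dots> = (A + B)\<^sup>2"
      using that(3,4) by (simp add: power2_eq_square)
    finally show ?thesis
      using m i' that(3,4) by (intro l2bI) auto
  qed
  show ?thesis
  \<comment> \<open>Bounds equal to 0 cannot serve as weights, so each bound is enlarged by
    \<open>e / 2\<close>.\<close>
  proof (rule l2b_limit)
    fix e :: real assume "0 < e"
    have "l2b (\<lambda>x. f x + g x) ((A + e / 2) + (B + e / 2))"
      using \<open>0 < e\<close> l2b_nonneg[OF f] l2b_nonneg[OF g] by (intro pos l2b_mono[OF f] l2b_mono[OF g]) auto
    then show "l2b (\<lambda>x. f x + g x) (A + B + e)"
      by (simp add: algebra_simps)
  qed (use l2b_nonneg[OF f] l2b_nonneg[OF g] in auto)
qed

lemma l2b_minus: "l2b g A \<Longrightarrow> l2b (\<lambda>x. - g x) A"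
  using l2b_scaleR[of g A "-1"] by simp

lemma l2b_diff: "l2b f A \<Longrightarrow> l2b g B \<Longrightarrow> l2b (\<lambda>x. f x - g x) (A + B)"
  using l2b_add[OF _ l2b_minus, of f A g B] by simp

section \<open>Cauchy-Schwarz, limit theorems and completeness\<close>

lemma ennreal_le_of_square_le:
  assumes "I\<^sup>2 \<le> (ennreal c)\<^sup>2" "0 \<le> c"
  shows "I \<le> ennreal c"
proof (cases I)
  case (real r)
  have "ennreal (r\<^sup>2) \<le> ennreal (c\<^sup>2)"
    using assms(1) unfolding real(2) ennreal_power[OF real(1)] ennreal_power[OF assms(2)] .
  then have "r\<^sup>2 \<le> c\<^sup>2"
    by (subst (asm) ennreal_le_iff) auto
  then have "r \<le> c"
    using assms(2) by (rule power2_le_imp_le)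
  then show ?thesis
    unfolding real(2) by (rule ennreal_leI)
next
  case top
  have "(top::ennreal)\<^sup>2 = top" by (simp add: power2_eq_square ennreal_top_mult)
  then show ?thesis
    using assms unfolding top ennreal_power[OF assms(2)] by (simp add: top_unique)
qed

lemma l2b_Cauchy_Schwarz:
  assumes f: "l2b f A" and g: "l2b g B"
  shows "integrable lborel (\<lambda>x. norm (f x) * norm (g x))"
    and "(\<integral>x. norm (f x) * norm (g x) \<partial>lborel) \<le> A * B"
proof -
  have [measurable]: "f \<in> borel_measurable borel" "g \<in> borel_measurable borel"
    using f g by (auto dest: l2b_measurable)
  have AB: "0 \<le> A" "0 \<le> B" "0 \<le> A * B" using l2b_nonneg[OF f] l2b_nonneg[OF g] by auto
  define I where "I = (\<integral>\<^sup>+x. ennreal (norm (f x)) * ennreal (norm (g x)) \<partial>lborel)"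
  have "I\<^sup>2 \<le> (\<integral>\<^sup>+x. ennreal (norm (f x)) ^ 2 \<partial>lborel) * (\<integral>\<^sup>+x. ennreal (norm (g x)) ^ 2 \<partial>lborel)"
    unfolding I_def by (rule Cauchy_Schwarz_nn_integral) auto
  also have "\<dots> = (\<integral>\<^sup>+x. ennreal ((norm (f x))\<^sup>2) \<partial>lborel) * (\<integral>\<^sup>+x. ennreal ((norm (g x))\<^sup>2) \<partial>lborel)"
    by (simp only: ennreal_power[OF norm_ge_zero])
  also have "\<dots> \<le> ennreal (A\<^sup>2) * ennreal (B\<^sup>2)"
    using f g by (intro mult_mono) (auto simp: l2b_def)
  also have "\<dots> = (ennreal (A * B))\<^sup>2"
    by (simp only: ennreal_mult'[symmetric, OF zero_le_power2] ennreal_power[OF AB(3)] power_mult_distrib)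
  finally have le: "I \<le> ennreal (A * B)"
    using AB(3) by (rule ennreal_le_of_square_le)
  have eq: "I = (\<integral>\<^sup>+x. ennreal (norm (f x) * norm (g x)) \<partial>lborel)"
    unfolding I_def by (simp only: ennreal_mult'[OF norm_ge_zero])
  show i: "integrable lborel (\<lambda>x. norm (f x) * norm (g x))"
  proof (rule integrableI_nonneg)
    show "(\<integral>\<^sup>+x. ennreal (norm (f x) * norm (g x)) \<partial>lborel) < \<infinity>"
      unfolding eq[symmetric] infinity_ennreal_def by (rule le_less_trans[OF le ennreal_less_top])
  qed auto
  have "ennreal (\<integral>x. norm (f x) * norm (g x) \<partial>lborel) \<le> ennreal (A * B)"
    using le unfolding eq by (subst (asm) nn_integral_eq_integral[OF i]) auto
  then show "(\<integral>x. norm (f x) * norm (g x) \<partial>lborel) \<le> A * B"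
    using AB(3) by (subst (asm) ennreal_le_iff) auto
qed

lemma l2b_Fatou:
  assumes g: "\<And>k. l2b (g k) A" and h: "h \<in> borel_measurable borel"
    and lim: "AE x in lborel. (\<lambda>k. g k x) \<longlonglongrightarrow> h x"
  shows "l2b h A"
proof -
  have "(\<integral>\<^sup>+x. ennreal ((norm (h x))\<^sup>2) \<partial>lborel) = (\<integral>\<^sup>+x. liminf (\<lambda>k. ennreal ((norm (g k x))\<^sup>2)) \<partial>lborel)"
  proof (rule nn_integral_cong_AE)
    show "AE x in lborel. ennreal ((norm (h x))\<^sup>2) = liminf (\<lambda>k. ennreal ((norm (g k x))\<^sup>2))"
      using lim
    proof eventually_elim
      case (elim x)
      then have "(\<lambda>k. ennreal ((norm (g k x))\<^sup>2)) \<longlonglongrightarrow> ennreal ((norm (h x))\<^sup>2)"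
        by (intro tendsto_ennrealI tendsto_intros)
      then show ?case
        by (metis lim_imp_Liminf trivial_limit_sequentially)
    qed
  qed
  also have "\<dots> \<le> liminf (\<lambda>k. \<integral>\<^sup>+x. ennreal ((norm (g k x))\<^sup>2) \<partial>lborel)"
    by (rule nn_integral_liminf) (use l2b_measurable[OF g] in simp)
  also have "\<dots> \<le> liminf (\<lambda>k. ennreal (A\<^sup>2))"
    by (intro Liminf_mono always_eventually allI) (use g in \<open>auto simp: l2b_def\<close>)
  also have "\<dots> = ennreal (A\<^sup>2)"
    by (simp add: Liminf_const)
  finally show ?thesis
    using h g[of 0] by (simp add: l2b_def)
qed

lemma l2b_dominated_convergence:
  fixes g :: "nat \<Rightarrow> 'a::euclidean_space \<Rightarrow> 'b::euclidean_space"
  assumes g: "\<And>k. g k \<in> borel_measurable borel" and f: "f \<in> borel_measurable borel"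
    and lim: "AE x in lborel. (\<lambda>k. g k x) \<longlonglongrightarrow> f x"
    and h: "l2b h B" and dom: "\<And>k. AE x in lborel. norm (g k x) \<le> norm (h x)"
  shows "(\<lambda>k. \<integral>x. (norm (g k x - f x))\<^sup>2 \<partial>lborel) \<longlonglongrightarrow> 0"
    and "\<And>k. integrable lborel (\<lambda>x. (norm (g k x - f x))\<^sup>2)"
proof -
  have i: "integrable lborel (\<lambda>x. 4 * (norm (h x))\<^sup>2)"
    by (intro integrable_mult_right l2b_integrable[OF h])
  have "AE x in lborel. \<forall>k. norm (g k x) \<le> norm (h x)"
    using dom by (simp add: AE_all_countable)
  then have *: "AE x in lborel. \<forall>k. (norm (g k x - f x))\<^sup>2 \<le> 4 * (norm (h x))\<^sup>2"
    using lim
  proof eventually_elim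
    case (elim x)
    have "norm (f x) \<le> norm (h x)"
      by (rule LIMSEQ_le_const2[OF tendsto_norm[OF elim(2)]]) (use elim(1) in auto)
    then have "norm (g k x - f x) \<le> 2 * norm (h x)" for k
      using elim(1)[rule_format, of k] norm_triangle_ineq4[of "g k x" "f x"] by linarith
    then show ?case
      using power_mono[of "norm (g _ x - f x)" "2 * norm (h x)" 2] by (simp add: power_mult_distrib)
  qed
  show "(\<lambda>k. \<integral>x. (norm (g k x - f x))\<^sup>2 \<partial>lborel) \<longlonglongrightarrow> 0"
  proof -
    have "(\<lambda>k. \<integral>x. (norm (g k x - f x))\<^sup>2 \<partial>lborel) \<longlonglongrightarrow> (\<integral>x. (0::real) \<partial>(lborel::'a measure))"
    proof (rule integral_dominated_convergence[OF _ _ i])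
      show "AE x in lborel. (\<lambda>k. (norm (g k x - f x))\<^sup>2) \<longlonglongrightarrow> 0"
        using lim
      proof eventually_elim
        case (elim x)
        have "(\<lambda>k. (norm (g k x - f x))\<^sup>2) \<longlonglongrightarrow> (norm (f x - f x))\<^sup>2"
          by (intro tendsto_intros elim)
        then show ?case by simp
      qed
      show "AE x in lborel. norm ((norm (g k x - f x))\<^sup>2) \<le> 4 * (norm (h x))\<^sup>2" for k
        using * by eventually_elim auto
    qed (use g f in auto)
    then show ?thesis by simp
  qed
  show "integrable lborel (\<lambda>x. (norm (g k x - f x))\<^sup>2)" for k
    by (rule Bochner_Integration.integrable_bound[OF i])
       (use g f in \<open>auto intro!: AE_mp[OF * AE_I2]\<close>)
qed

text \<open>Riesz-Fischer. Along a subsequence whose increments \<open>d k\<close> have norm at most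
  2^(-k), the sum of 2^k |d k|^2 has a finite integral, hence is finite almost everywhere, and this
  makes the increments absolutely summable pointwise. Fatou's lemma then compares the whole sequence
  with the pointwise limit.\<close>

lemma l2_complete:
  fixes g :: "nat \<Rightarrow> 'a::euclidean_space \<Rightarrow> 'b::euclidean_space"
  assumes m[measurable]: "\<And>k. g k \<in> borel_measurable borel"
    and cauchy: "\<And>e. 0 < e \<Longrightarrow> \<exists>N. \<forall>m\<ge>N. \<forall>n\<ge>N. l2b (\<lambda>x. g m x - g n x) e"
  shows "\<exists>h\<in>borel_measurable borel. \<forall>e>0. \<exists>N. \<forall>n\<ge>N. l2b (\<lambda>x. g n x - h x) e"
proof -
  have "\<exists>r. \<forall>k. \<forall>m\<ge>r k. \<forall>n\<ge>r k. l2b (\<lambda>x. g m x - g n x) ((1/2)^k)"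
    by (intro choice allI cauchy) simp
  then obtain r0 :: "nat \<Rightarrow> nat"
    where r0: "\<And>k m n. r0 k \<le> m \<Longrightarrow> r0 k \<le> n \<Longrightarrow> l2b (\<lambda>x. g m x - g n x) ((1/2)^k)" by blast
  \<comment> \<open>The sum makes the indices increasing and at least \<open>r0 k\<close>; the extra
    \<open>k\<close> lets them exceed any given \<open>N\<close>.\<close>
  define r where "r k = (\<Sum>i\<le>k. r0 i) + k" for k
  have r_ge: "r0 k \<le> r k" "k \<le> r k" "r k \<le> r (Suc k)" for k
    using member_le_sum[of k "{..k}" r0] by (simp_all add: r_def)
  define d where "d k x = g (r (Suc k)) x - g (r k) x" for k x
  have [measurable]: "d k \<in> borel_measurable borel" for k
    unfolding d_def[abs_def] by measurable
  have d: "l2b (d k) ((1/2)^k)" for k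
    unfolding d_def[abs_def] by (rule r0) (use r_ge[of k] in linarith)+
  have "(\<integral>\<^sup>+x. (\<Sum>k. ennreal (2^k * (norm (d k x))\<^sup>2)) \<partial>lborel)
      = (\<Sum>k. \<integral>\<^sup>+x. ennreal (2^k * (norm (d k x))\<^sup>2) \<partial>lborel)"
    by (rule nn_integral_suminf) auto
  also have "\<dots> \<le> (\<Sum>k. ennreal ((1/2)^k))"
  proof (intro suminf_le summableI)
    fix k
    have "(\<integral>\<^sup>+x. ennreal (2^k * (norm (d k x))\<^sup>2) \<partial>lborel) = ennreal (2^k) * (\<integral>\<^sup>+x. ennreal ((norm (d k x))\<^sup>2) \<partial>lborel)"
      unfolding ennreal_mult'[OF zero_le_power[OF zero_le_numeral]] by (rule nn_integral_cmult) simp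
    also have "\<dots> \<le> ennreal (2^k) * ennreal (((1/2)^k)\<^sup>2)"
      using d[of k] by (intro mult_left_mono) (auto simp: l2b_def)
    also have "\<dots> = ennreal ((1/2)^k)"
      unfolding ennreal_mult'[symmetric, OF zero_le_power[OF zero_le_numeral]]
      by (rule arg_cong[where f = ennreal]) (simp add: power2_eq_square power_one_over)
    finally show "(\<integral>\<^sup>+x. ennreal (2^k * (norm (d k x))\<^sup>2) \<partial>lborel) \<le> ennreal ((1/2)^k)" .
  qed
  also have "\<dots> = ennreal (\<Sum>k. (1/2)^k)"
    by (rule suminf_ennreal2) (auto simp: summable_geometric)
  also have "\<dots> < \<infinity>" by simp
  finally have "AE x in lborel. (\<Sum>k. ennreal (2^k * (norm (d k x))\<^sup>2)) \<noteq> \<infinity>"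
    by (intro nn_integral_PInf_AE) auto
  then have conv: "AE x in lborel. convergent (\<lambda>k. g (r k) x)"
  proof eventually_elim
    case (elim x)
    have s: "summable (\<lambda>k. 2^k * (norm (d k x))\<^sup>2)"
      by (rule summable_suminf_not_top) (use elim in auto)
    have "summable (\<lambda>k. norm (d k x))"
    proof (rule summable_comparison_test'[of _ 0])
      show "summable (\<lambda>k. (1/2)^k + 2^k * (norm (d k x))\<^sup>2 :: real)"
        by (intro summable_add s summable_geometric) auto
      fix k
      \<comment> \<open>The inequality a \<le> 1 + a^2 for a = 2^k |d k|, divided by 2^k, bounds |d
        k| by two summable terms.\<close>
      let ?a = "2^k * norm (d k x)"
      have "?a \<le> 1 + ?a\<^sup>2"
        using zero_le_power2[of "?a - 1/2"] by (simp only: power2_diff) (simp add: field_simps)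
      then have "?a / 2^k \<le> (1 + ?a\<^sup>2) / 2^k"
        by (intro divide_right_mono) auto
      then show "norm (norm (d k x)) \<le> (1/2)^k + 2^k * (norm (d k x))\<^sup>2"
        by (simp add: power2_eq_square add_divide_distrib power_one_over ac_simps)
    qed
    then have "summable (\<lambda>k. d k x)" by (rule summable_norm_cancel)
    then have "convergent (\<lambda>n. \<Sum>k<n. d k x)"
      by (simp add: summable_iff_convergent)
    moreover have "(\<Sum>k<n. d k x) = g (r n) x - g (r 0) x" for n
      unfolding d_def by (rule sum_lessThan_telescope)
    ultimately have "convergent (\<lambda>n. g (r n) x - g (r 0) x)" by simp
    then show ?case
      by (simp add: convergent_diff_const_right_iff)
  qed
  define h where "h x = lim (\<lambda>k. g (r k) x)" for x
  have [measurable]: "h \<in> borel_measurable borel"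
    unfolding h_def[abs_def] by measurable
  have lim: "AE x in lborel. (\<lambda>k. g (r k) x) \<longlonglongrightarrow> h x"
    using conv by (auto simp: h_def convergent_LIMSEQ_iff)
  have "\<exists>N. \<forall>n\<ge>N. l2b (\<lambda>x. g n x - h x) e" if "0 < e" for e
  proof -
    obtain N where N: "\<forall>m\<ge>N. \<forall>n\<ge>N. l2b (\<lambda>x. g m x - g n x) e" using cauchy[OF \<open>0 < e\<close>] by blast
    have "l2b (\<lambda>x. g n x - h x) e" if "N \<le> n" for n
    proof (rule l2b_Fatou)
      show "l2b (\<lambda>x. g n x - g (r (k + N)) x) e" for k
        using N that r_ge(2)[of "k + N"] by auto
      show "AE x in lborel. (\<lambda>k. g n x - g (r (k + N)) x) \<longlonglongrightarrow> g n x - h x"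
        using lim
      proof eventually_elim
        case (elim x)
        then show ?case
          by (intro tendsto_intros LIMSEQ_ignore_initial_segment[where f = "\<lambda>k. g (r k) x"])
      qed
    qed measurable
    then show ?thesis by blast
  qed
  then show ?thesis by (intro bexI[of _ h]) auto
qed

text \<open>Cauchy-Schwarz in \<tau> with weight \<open>v\<close> bounds |G|^2 by the integral of
  \<open>v\<close> times that of |g|^2 / v, and Tonelli's theorem integrates this in x. The weight
  must be positive, so \<open>v\<close> exceeds \<open>w\<close> by a constant that contributes at
  most \<open>e'\<close>, which \<open>l2b_limit\<close> absorbs.\<close>

lemma l2b_Minkowski_integral:
  fixes g :: "real \<Rightarrow> 'a::euclidean_space \<Rightarrow> 'b::euclidean_space"
  assumes gm[measurable]: "(\<lambda>(\<tau>, x). g \<tau> x) \<in> borel_measurable (borel \<Otimes>\<^sub>M borel)"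
    and w[measurable]: "w \<in> borel_measurable borel" and wnn: "\<And>\<tau>. \<tau> \<in> {a..b} \<Longrightarrow> 0 \<le> w \<tau>"
    and g: "\<And>\<tau>. \<tau> \<in> {a..b} \<Longrightarrow> l2b (g \<tau>) (w \<tau>)"
    and W: "(\<integral>\<^sup>+\<tau>\<in>{a..b}. ennreal (w \<tau>) \<partial>lborel) \<le> ennreal W" and Wnn: "0 \<le> W" and ab: "a \<le> b"
  shows "l2b (\<lambda>x. set_lebesgue_integral lborel {a..b} (\<lambda>\<tau>. g \<tau> x)) W"
proof (rule l2b_limit[OF _ Wnn])
  fix e' :: real assume e': "0 < e'"
  define e where "e = e' / (b - a + 1)"
  have e: "0 < e" "e * (b - a) \<le> e'"
    using e' ab by (auto simp: e_def field_simps)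
  define v where "v \<tau> = w \<tau> + e" for \<tau>
  have [measurable]: "v \<in> borel_measurable borel" unfolding v_def[abs_def] by measurable
  have v: "0 < v \<tau>" "w \<tau> \<le> v \<tau>" if "\<tau> \<in> {a..b}" for \<tau>
    using wnn[OF that] e by (auto simp: v_def)
  have "(\<integral>\<^sup>+\<tau>\<in>{a..b}. ennreal (v \<tau>) \<partial>lborel) = (\<integral>\<^sup>+\<tau>. ennreal (w \<tau>) * indicator {a..b} \<tau> + ennreal e * indicator {a..b} \<tau> \<partial>lborel)"
    by (rule nn_integral_cong) (use wnn e in \<open>auto simp: v_def indicator_def ennreal_plus\<close>)
  also have "\<dots> = (\<integral>\<^sup>+\<tau>\<in>{a..b}. ennreal (w \<tau>) \<partial>lborel) + ennreal e * ennreal (b - a)"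
    using ab by (subst nn_integral_add) (auto simp: nn_integral_cmult_indicator)
  also have "\<dots> \<le> ennreal W + ennreal e'"
    using W e by (intro add_mono) (auto simp: ennreal_mult'[symmetric] intro!: ennreal_leI)
  also have "\<dots> = ennreal (W + e')"
    using Wnn e' by simp
  finally have V: "(\<integral>\<^sup>+\<tau>\<in>{a..b}. ennreal (v \<tau>) \<partial>lborel) \<le> ennreal (W + e')" .
  have gm': "(\<lambda>\<tau>. g \<tau> x) \<in> borel_measurable borel" for x
    using measurable_compose[of "\<lambda>\<tau>. (\<tau>, x)" borel "borel \<Otimes>\<^sub>M borel" "\<lambda>(\<tau>, x). g \<tau> x" borel, OF _ gm] by simp
  note [measurable] = gm'
  define G where "G x = set_lebesgue_integral lborel {a..b} (\<lambda>\<tau>. g \<tau> x)" for x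
  have Gm: "G \<in> borel_measurable borel"
    unfolding G_def[abs_def] set_lebesgue_integral_def by measurable
  have pt: "ennreal ((norm (G x))\<^sup>2) \<le> ennreal (W + e') * (\<integral>\<^sup>+\<tau>\<in>{a..b}. ennreal ((norm (g \<tau> x))\<^sup>2 / v \<tau>) \<partial>lborel)" for x
  proof -
    have "ennreal (norm (G x)) \<le> (\<integral>\<^sup>+\<tau>. ennreal (norm (indicator {a..b} \<tau> *\<^sub>R g \<tau> x)) \<partial>lborel)"
    proof (cases "integrable lborel (\<lambda>\<tau>. indicator {a..b} \<tau> *\<^sub>R g \<tau> x)")
      case True
      then show ?thesis unfolding G_def set_lebesgue_integral_def by (rule integral_norm_bound_ennreal)
    next
      \<comment> \<open>A non-integrable section has integral 0 by convention, so the bound is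
        trivial.\<close>
      case False
      then show ?thesis by (simp add: G_def set_lebesgue_integral_def not_integrable_integral_eq)
    qed
    also have "\<dots> = (\<integral>\<^sup>+\<tau>. ennreal (indicator {a..b} \<tau> * sqrt (v \<tau>)) * ennreal (indicator {a..b} \<tau> * norm (g \<tau> x) / sqrt (v \<tau>)) \<partial>lborel)"
    proof (rule nn_integral_cong)
      fix \<tau>
      show "ennreal (norm (indicator {a..b} \<tau> *\<^sub>R g \<tau> x)) = ennreal (indicator {a..b} \<tau> * sqrt (v \<tau>)) * ennreal (indicator {a..b} \<tau> * norm (g \<tau> x) / sqrt (v \<tau>))"
        using v[of \<tau>] by (cases "\<tau> \<in> {a..b}") (simp_all add: ennreal_mult'[symmetric])
    qed
    finally have "ennreal (norm (G x)) ^ 2 \<le> (\<integral>\<^sup>+\<tau>. ennreal (indicator {a..b} \<tau> * sqrt (v \<tau>)) * ennreal (indicator {a..b} \<tau> * norm (g \<tau> x) / sqrt (v \<tau>)) \<partial>lborel)\<^sup>2"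
      by (rule power_mono) auto
    also have "\<dots> \<le> (\<integral>\<^sup>+\<tau>. ennreal (indicator {a..b} \<tau> * sqrt (v \<tau>))^2 \<partial>lborel) * (\<integral>\<^sup>+\<tau>. ennreal (indicator {a..b} \<tau> * norm (g \<tau> x) / sqrt (v \<tau>))^2 \<partial>lborel)"
      by (rule Cauchy_Schwarz_nn_integral) measurable
    also have "(\<integral>\<^sup>+\<tau>. ennreal (indicator {a..b} \<tau> * sqrt (v \<tau>))^2 \<partial>lborel) = (\<integral>\<^sup>+\<tau>\<in>{a..b}. ennreal (v \<tau>) \<partial>lborel)"
    proof (rule nn_integral_cong)
      fix \<tau>
      show "ennreal (indicator {a..b} \<tau> * sqrt (v \<tau>))^2 = ennreal (v \<tau>) * indicator {a..b} \<tau>"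
        using v[of \<tau>] by (cases "\<tau> \<in> {a..b}") (simp_all add: ennreal_power)
    qed
    also have "(\<integral>\<^sup>+\<tau>. ennreal (indicator {a..b} \<tau> * norm (g \<tau> x) / sqrt (v \<tau>))^2 \<partial>lborel) = (\<integral>\<^sup>+\<tau>\<in>{a..b}. ennreal ((norm (g \<tau> x))\<^sup>2 / v \<tau>) \<partial>lborel)"
    proof (rule nn_integral_cong)
      fix \<tau>
      show "ennreal (indicator {a..b} \<tau> * norm (g \<tau> x) / sqrt (v \<tau>))^2 = ennreal ((norm (g \<tau> x))\<^sup>2 / v \<tau>) * indicator {a..b} \<tau>"
        using v[of \<tau>] by (cases "\<tau> \<in> {a..b}") (simp_all add: ennreal_power power_divide)
    qed
    also have "(\<integral>\<^sup>+\<tau>\<in>{a..b}. ennreal (v \<tau>) \<partial>lborel) * \<dots> \<le> ennreal (W + e') * \<dots>"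
      by (intro mult_right_mono V) auto
    finally show ?thesis by (simp add: ennreal_power)
  qed
  have "(\<integral>\<^sup>+x. ennreal ((norm (G x))\<^sup>2) \<partial>lborel) \<le> (\<integral>\<^sup>+x. ennreal (W + e') * (\<integral>\<^sup>+\<tau>. ennreal ((norm (g \<tau> x))\<^sup>2 / v \<tau>) * indicator {a..b} \<tau> \<partial>lborel) \<partial>lborel)"
    by (intro nn_integral_mono pt)
  also have "\<dots> = ennreal (W + e') * (\<integral>\<^sup>+x. (\<integral>\<^sup>+\<tau>. ennreal ((norm (g \<tau> x))\<^sup>2 / v \<tau>) * indicator {a..b} \<tau> \<partial>lborel) \<partial>lborel)"
    by (rule nn_integral_cmult) measurable
  also have "(\<integral>\<^sup>+x. (\<integral>\<^sup>+\<tau>. ennreal ((norm (g \<tau> x))\<^sup>2 / v \<tau>) * indicator {a..b} \<tau> \<partial>lborel) \<partial>lborel)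
     = (\<integral>\<^sup>+\<tau>. (\<integral>\<^sup>+x. ennreal ((norm (g \<tau> x))\<^sup>2 / v \<tau>) * indicator {a..b} \<tau> \<partial>lborel) \<partial>lborel)"
    by (rule lborel_pair.Fubini') measurable
  also have "\<dots> \<le> (\<integral>\<^sup>+\<tau>\<in>{a..b}. ennreal (v \<tau>) \<partial>lborel)"
  proof (rule nn_integral_mono)
    fix \<tau> :: real
    show "(\<integral>\<^sup>+x. ennreal ((norm (g \<tau> x))\<^sup>2 / v \<tau>) * indicator {a..b} \<tau> \<partial>lborel) \<le> ennreal (v \<tau>) * indicator {a..b} \<tau>"
    proof (cases "\<tau> \<in> {a..b}")
      case True
      note \<tau> = v[OF True] g[OF True] wnn[OF True]
      have [measurable]: "g \<tau> \<in> borel_measurable borel" using \<tau> by (auto dest: l2b_measurable)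
      have "(\<integral>\<^sup>+x. ennreal ((norm (g \<tau> x))\<^sup>2 / v \<tau>) \<partial>lborel) = (\<integral>\<^sup>+x. ennreal (1 / v \<tau>) * ennreal ((norm (g \<tau> x))\<^sup>2) \<partial>lborel)"
        using \<tau> by (intro nn_integral_cong) (simp add: ennreal_mult'[symmetric])
      also have "\<dots> = ennreal (1 / v \<tau>) * (\<integral>\<^sup>+x. ennreal ((norm (g \<tau> x))\<^sup>2) \<partial>lborel)"
        by (rule nn_integral_cmult) auto
      also have "\<dots> \<le> ennreal (1 / v \<tau>) * ennreal ((v \<tau>)\<^sup>2)"
        using l2b_mono[OF \<tau>(3,2)] by (intro mult_left_mono) (auto simp: l2b_def)
      also have "\<dots> = ennreal (v \<tau>)"
        using \<tau> by (simp add: ennreal_mult'[symmetric] power2_eq_square)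
      finally show ?thesis using True by simp
    qed simp
  qed
  also note V
  also have "ennreal (W + e') * ennreal (W + e') = ennreal ((W + e')\<^sup>2)"
    using Wnn e' by (simp add: ennreal_mult'[symmetric] power2_eq_square del: ennreal_plus)
  finally have "(\<integral>\<^sup>+x. ennreal ((norm (G x))\<^sup>2) \<partial>lborel) \<le> ennreal ((W + e')\<^sup>2)"
    by (simp add: mult_left_mono)
  then show "l2b (\<lambda>x. set_lebesgue_integral lborel {a..b} (\<lambda>\<tau>. g \<tau> x)) (W + e')"
    using Gm Wnn e' by (simp add: l2b_def G_def[abs_def])
qed

section \<open>Translations, dilations and the Fourier transform of integrable functions\<close>

lemma
  fixes f :: "'a::euclidean_space \<Rightarrow> 'b::{banach, second_countable_topology}"
  assumes c: "c \<noteq> 0" and f[measurable]: "f \<in> borel_measurable borel"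
  shows integrable_lborel_affine: "integrable lborel (\<lambda>x. f (h + c *\<^sub>R x)) \<longleftrightarrow> integrable lborel f"
    and integral_lborel_affine: "(\<integral>x. f (h + c *\<^sub>R x) \<partial>lborel) = (1 / \<bar>c\<bar> ^ DIM('a)) *\<^sub>R (\<integral>x. f x \<partial>lborel)"
proof -
  let ?D = "distr lborel borel (\<lambda>x::'a. h + c *\<^sub>R x)"
  have L: "lborel = density ?D (\<lambda>_. ennreal (\<bar>c\<bar> ^ DIM('a)))"
    using lborel_affine[OF c, of h] by (simp add: ennreal_power)
  have "integrable lborel f \<longleftrightarrow> integrable (density ?D (\<lambda>_. ennreal (\<bar>c\<bar> ^ DIM('a)))) f"
    using L by simp
  also have "\<dots> \<longleftrightarrow> integrable ?D (\<lambda>x. (\<bar>c\<bar> ^ DIM('a)) *\<^sub>R f x)"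
    by (rule integrable_density) auto
  also have "\<dots> \<longleftrightarrow> integrable ?D f"
  proof
    assume "integrable ?D (\<lambda>x. (\<bar>c\<bar> ^ DIM('a)) *\<^sub>R f x)"
    from integrable_scaleR_right[OF this, of "1 / \<bar>c\<bar> ^ DIM('a)"] show "integrable ?D f"
      using c by simp
  qed (rule integrable_scaleR_right)
  also have "\<dots> \<longleftrightarrow> integrable lborel (\<lambda>x. f (h + c *\<^sub>R x))"
    by (rule integrable_distr_eq) auto
  finally show "integrable lborel (\<lambda>x. f (h + c *\<^sub>R x)) \<longleftrightarrow> integrable lborel f" ..
  have "(\<integral>x. f x \<partial>lborel) = (\<integral>x. f x \<partial>density ?D (\<lambda>_. ennreal (\<bar>c\<bar> ^ DIM('a))))"
    using L by simp
  also have "\<dots> = (\<integral>x. (\<bar>c\<bar> ^ DIM('a)) *\<^sub>R f x \<partial>?D)"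
    by (rule integral_density) auto
  also have "\<dots> = (\<bar>c\<bar> ^ DIM('a)) *\<^sub>R (\<integral>x. f x \<partial>?D)"
    by simp
  also have "(\<integral>x. f x \<partial>?D) = (\<integral>x. f (h + c *\<^sub>R x) \<partial>lborel)"
    by (rule integral_distr) auto
  finally show "(\<integral>x. f (h + c *\<^sub>R x) \<partial>lborel) = (1 / \<bar>c\<bar> ^ DIM('a)) *\<^sub>R (\<integral>x. f x \<partial>lborel)"
    using c by simp
qed

lemma
  fixes f :: "'a::euclidean_space \<Rightarrow> 'b::{banach, second_countable_topology}"
  assumes f: "f \<in> borel_measurable borel"
  shows integrable_lborel_translate: "integrable lborel (\<lambda>x. f (x + h)) \<longleftrightarrow> integrable lborel f"
    and integral_lborel_translate: "(\<integral>x. f (x + h) \<partial>lborel) = (\<integral>x. f x \<partial>lborel)"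
    and integrable_lborel_reflect: "integrable lborel (\<lambda>x. f (- x)) \<longleftrightarrow> integrable lborel f"
    and integral_lborel_reflect: "(\<integral>x. f (- x) \<partial>lborel) = (\<integral>x. f x \<partial>lborel)"
  using integrable_lborel_affine[of 1 f h] integral_lborel_affine[of 1 f h]
    integrable_lborel_affine[of "-1" f 0] integral_lborel_affine[of "-1" f 0] f
  by (simp_all add: add.commute)

lemma AE_lborel_reflect:
  assumes "AE x in lborel. P (x::'a::euclidean_space)"
  shows "AE x in lborel. P (- x)"
proof -
  obtain N where N: "N \<in> null_sets lborel" "{x \<in> space lborel. \<not> P x} \<subseteq> N"
    using assms by (auto simp: eventually_ae_filter)
  have Nm: "N \<in> sets borel" using N by auto
  have "integral\<^sup>L lborel (\<lambda>x. indicator N (- x) :: real) = 0" "integrable lborel (\<lambda>x. indicator N (- x) :: real)"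
    using Nm N integral_lborel_reflect[of "indicator N :: 'a \<Rightarrow> real"] integrable_lborel_reflect[of "indicator N :: 'a \<Rightarrow> real"]
    by (auto simp: measure_def null_sets_def integrable_indicator_iff)
  then have "AE x in lborel. (indicator N (- x) :: real) = 0"
    by (subst (asm) integral_nonneg_eq_0_iff_AE) auto
  then show ?thesis
    by eventually_elim (use N(2) in \<open>auto simp: indicator_def split: if_splits\<close>)
qed

section \<open>Continuity of translations in the mean\<close>

definition L1_continuous :: "('a::euclidean_space \<Rightarrow> 'b::{banach, second_countable_topology}) \<Rightarrow> bool" where
  "L1_continuous f \<longleftrightarrow>
     (\<forall>h. h \<longlonglongrightarrow> 0 \<longrightarrow> (\<lambda>k::nat. \<integral>x. norm (f (x + h k) - f x) \<partial>lborel) \<longlonglongrightarrow> 0)"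

lemma L1_continuous_approx:
  fixes f :: "'a::euclidean_space \<Rightarrow> 'b::{banach, second_countable_topology}"
  assumes f: "integrable lborel f"
    and ap: "\<And>e. 0 < e \<Longrightarrow> \<exists>g. integrable lborel g \<and> L1_continuous g \<and> (\<integral>x. norm (f x - g x) \<partial>lborel) \<le> e"
  shows "L1_continuous f"
  unfolding L1_continuous_def
proof (intro allI impI)
  fix h :: "nat \<Rightarrow> 'a" assume h: "h \<longlonglongrightarrow> 0"
  have fm[measurable]: "f \<in> borel_measurable borel" using f by auto
  show "(\<lambda>k. \<integral>x. norm (f (x + h k) - f x) \<partial>lborel) \<longlonglongrightarrow> 0"
  proof (rule LIMSEQ_I)
    fix e :: real assume e: "0 < e"
    obtain g where g: "integrable lborel g" "L1_continuous g" "(\<integral>x. norm (f x - g x) \<partial>lborel) \<le> e / 4"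
      using ap[of "e / 4"] e by auto
    have gm[measurable]: "g \<in> borel_measurable borel" using g(1) by auto
    have "(\<lambda>k. \<integral>x. norm (g (x + h k) - g x) \<partial>lborel) \<longlonglongrightarrow> 0"
      using g(2) h by (auto simp: L1_continuous_def)
    from LIMSEQ_D[OF this, of "e / 4"] e obtain N
      where N: "\<And>k. N \<le> k \<Longrightarrow> norm ((\<integral>x. norm (g (x + h k) - g x) \<partial>lborel) - 0) < e / 4" by auto
    have "norm ((\<integral>x. norm (f (x + h k) - f x) \<partial>lborel) - 0) < e" if "N \<le> k" for k
    proof -
      have i: "integrable lborel (\<lambda>x. f (x + h k))" "integrable lborel (\<lambda>x. g (x + h k))"
        using f g(1) by (simp_all add: integrable_lborel_translate)
      have i2: "integrable lborel (\<lambda>x. norm (f (x + h k) - g (x + h k)))" "integrable lborel (\<lambda>x. norm (f x - g x))"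
        "integrable lborel (\<lambda>x. norm (g (x + h k) - g x))"
        using i f g(1) by auto
      have "(\<integral>x. norm (f (x + h k) - f x) \<partial>lborel) \<le> (\<integral>x. norm (f (x + h k) - g (x + h k)) + norm (g (x + h k) - g x) + norm (f x - g x) \<partial>lborel)"
      proof (rule integral_mono)
        show "integrable lborel (\<lambda>x. norm (f (x + h k) - f x))" using i f by auto
        show "integrable lborel (\<lambda>x. norm (f (x + h k) - g (x + h k)) + norm (g (x + h k) - g x) + norm (f x - g x))"
          using i2 by auto
        show "norm (f (x + h k) - f x) \<le> norm (f (x + h k) - g (x + h k)) + norm (g (x + h k) - g x) + norm (f x - g x)" for x
          using norm_triangle_ineq[of "f (x + h k) - g (x + h k)" "g (x + h k) - g x"]
            norm_triangle_ineq4[of "f (x + h k) - g x" "f x - g x"] by simp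
      qed
      also have "\<dots> = (\<integral>x. norm (f (x + h k) - g (x + h k)) \<partial>lborel) + (\<integral>x. norm (g (x + h k) - g x) \<partial>lborel) + (\<integral>x. norm (f x - g x) \<partial>lborel)"
        using i2 by simp
      also have "(\<integral>x. norm (f (x + h k) - g (x + h k)) \<partial>lborel) = (\<integral>x. norm (f x - g x) \<partial>lborel)"
        by (rule integral_lborel_translate[of "\<lambda>x. norm (f x - g x)"]) measurable
      finally show ?thesis
        using g(3) N[OF that] e by (simp add: abs_less_iff)
    qed
    then show "\<exists>N. \<forall>k\<ge>N. norm ((\<integral>x. norm (f (x + h k) - f x) \<partial>lborel) - 0) < e" by blast
  qed
qed

text \<open>The indicator of an open set is lower semicontinuous, so dominated convergence controls the
  positive part of the difference; the negative part has the same integral.\<close>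

lemma L1_continuous_indicator_open:
  fixes c :: "'b::{banach, second_countable_topology}"
  assumes U: "open U" and fin: "emeasure lborel (U::'a::euclidean_space set) < \<infinity>"
  shows "L1_continuous (\<lambda>x::'a. indicator U x *\<^sub>R c)"
  unfolding L1_continuous_def
proof (intro allI impI)
  fix h :: "nat \<Rightarrow> 'a" assume h: "h \<longlonglongrightarrow> 0"
  let ?u = "indicator U :: 'a \<Rightarrow> real"
  have [measurable]: "U \<in> sets borel" using U by auto
  have iu: "integrable lborel ?u" using fin by (simp add: integrable_indicator_iff)
  have iut: "integrable lborel (\<lambda>x. ?u (x + h k))" for k using iu by (simp add: integrable_lborel_translate)
  define p where "p k x = max (?u x - ?u (x + h k)) 0" for k x
  have ip: "integrable lborel (p k)" for k
    unfolding p_def[abs_def] by (intro integrable_max Bochner_Integration.integrable_diff iu iut integrable_zero)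
  have "(\<lambda>k. \<integral>x. p k x \<partial>lborel) \<longlonglongrightarrow> (\<integral>x. 0 \<partial>(lborel::'a measure))"
  proof (rule integral_dominated_convergence[where w = ?u])
    show "AE x in lborel. (\<lambda>k. p k x) \<longlonglongrightarrow> 0"
    proof (rule AE_I2)
      fix x
      show "(\<lambda>k. p k x) \<longlonglongrightarrow> 0"
      proof (cases "x \<in> U")
        case True
        have "(\<lambda>k. x + h k) \<longlonglongrightarrow> x + 0" by (intro tendsto_intros h)
        then have "\<forall>\<^sub>F k in sequentially. x + h k \<in> U"
          using topological_tendstoD[OF _ U] True by auto
        then have "\<forall>\<^sub>F k in sequentially. p k x = 0"
          by eventually_elim (use True in \<open>simp add: p_def\<close>)
        then show ?thesis by (rule tendsto_eventually)
      qed (simp add: p_def)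
    qed
    show "AE x in lborel. norm (p k x) \<le> ?u x" for k
      by (rule AE_I2) (simp add: p_def indicator_def)
  qed (use iu ip in auto)
  then have lim: "(\<lambda>k. 2 * norm c * (\<integral>x. p k x \<partial>lborel)) \<longlonglongrightarrow> 2 * norm c * 0"
    by (intro tendsto_intros) simp
  have "(\<integral>x. norm (indicator U (x + h k) *\<^sub>R c - indicator U x *\<^sub>R c) \<partial>lborel) = 2 * norm c * (\<integral>x. p k x \<partial>lborel)" for k
  proof -
    have "(\<integral>x. norm (indicator U (x + h k) *\<^sub>R c - indicator U x *\<^sub>R c) \<partial>lborel) = (\<integral>x. norm c * (2 * p k x - (?u x - ?u (x + h k))) \<partial>lborel)"
      by (rule Bochner_Integration.integral_cong) (auto simp: p_def indicator_def)
    also have "\<dots> = norm c * (2 * (\<integral>x. p k x \<partial>lborel) - ((\<integral>x. ?u x \<partial>lborel) - (\<integral>x. ?u (x + h k) \<partial>lborel)))"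
      using ip[of k] iu iut[of k] by simp
    also have "(\<integral>x. ?u (x + h k) \<partial>lborel) = (\<integral>x. ?u x \<partial>lborel)"
      by (rule integral_lborel_translate) measurable
    finally show ?thesis by simp
  qed
  then show "(\<lambda>k. \<integral>x. norm (indicator U (x + h k) *\<^sub>R c - indicator U x *\<^sub>R c) \<partial>lborel) \<longlonglongrightarrow> 0"
    using lim by simp
qed

lemma L1_continuous_add:
  fixes f g :: "'a::euclidean_space \<Rightarrow> 'b::{banach, second_countable_topology}"
  assumes f: "integrable lborel f" "L1_continuous f" and g: "integrable lborel g" "L1_continuous g"
  shows "L1_continuous (\<lambda>x. f x + g x)"
  unfolding L1_continuous_def
proof (intro allI impI)
  fix h :: "nat \<Rightarrow> 'a" assume h: "h \<longlonglongrightarrow> 0"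
  have [measurable]: "f \<in> borel_measurable borel" "g \<in> borel_measurable borel" using f g by auto
  have i: "integrable lborel (\<lambda>x. f (x + h k))" "integrable lborel (\<lambda>x. g (x + h k))" for k
    using f(1) g(1) by (simp_all add: integrable_lborel_translate)
  have lim: "(\<lambda>k. (\<integral>x. norm (f (x + h k) - f x) \<partial>lborel) + (\<integral>x. norm (g (x + h k) - g x) \<partial>lborel)) \<longlonglongrightarrow> 0"
    using f(2) g(2) h by (auto simp: L1_continuous_def intro!: tendsto_add_zero)
  show "(\<lambda>k. \<integral>x. norm (f (x + h k) + g (x + h k) - (f x + g x)) \<partial>lborel) \<longlonglongrightarrow> 0"
  proof (rule tendsto_sandwich[OF _ _ tendsto_const lim]; intro always_eventually allI)
    fix k
    show "0 \<le> (\<integral>x. norm (f (x + h k) + g (x + h k) - (f x + g x)) \<partial>lborel)" by simp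
    have "(\<integral>x. norm (f (x + h k) + g (x + h k) - (f x + g x)) \<partial>lborel) \<le> (\<integral>x. norm (f (x + h k) - f x) + norm (g (x + h k) - g x) \<partial>lborel)"
    proof (rule integral_mono)
      show "norm (f (x + h k) + g (x + h k) - (f x + g x)) \<le> norm (f (x + h k) - f x) + norm (g (x + h k) - g x)" for x
        using norm_triangle_ineq[of "f (x + h k) - f x" "g (x + h k) - g x"] by (simp add: algebra_simps)
    qed (use i[of k] f g in auto)
    also have "\<dots> = (\<integral>x. norm (f (x + h k) - f x) \<partial>lborel) + (\<integral>x. norm (g (x + h k) - g x) \<partial>lborel)"
      using i[of k] f g by simp
    finally show "(\<integral>x. norm (f (x + h k) + g (x + h k) - (f x + g x)) \<partial>lborel) \<le> (\<integral>x. norm (f (x + h k) - f x) \<partial>lborel) + (\<integral>x. norm (g (x + h k) - g x) \<partial>lborel)" .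
  qed
qed

text \<open>Indicators of open sets play the part usually given to continuous functions: outer
  regularity approximates a Borel set of finite measure by an open one, and simple functions do the
  rest.\<close>

lemma L1_continuous:
  fixes f :: "'a::euclidean_space \<Rightarrow> 'b::{banach, second_countable_topology}"
  assumes "integrable lborel f"
  shows "L1_continuous f"
  using assms
proof (induct rule: integrable_induct)
  case (base A c)
  have [measurable]: "A \<in> sets borel" using base by auto
  have iA: "integrable lborel (indicator A :: 'a \<Rightarrow> real)"
    using base by (simp add: integrable_indicator_iff)
  show ?case
  proof (rule L1_continuous_approx)
    show "integrable lborel (\<lambda>x. indicator A x *\<^sub>R c)" using iA by simp
    fix e :: real assume e: "0 < e"
    define e' where "e' = e / (norm c + 1)"
    have "0 < norm c + 1" by (rule add_nonneg_pos) auto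
    then have e': "0 < e'" "e' * norm c \<le> e"
      using e by (auto simp: e'_def pos_divide_le_eq intro!: mult_left_mono)
    have Al: "A \<in> sets lebesgue" by simp
    obtain U where U: "open U" "A \<subseteq> U" "emeasure lebesgue (U - A) < ennreal e'"
      by (rule sets_lebesgue_outer_open[OF Al e'(1)]) (rule that, assumption+)
    have [measurable]: "U \<in> sets borel" using U by auto
    have UA: "emeasure lborel (U - A) < ennreal e'"
      using U(3) by simp
    have "emeasure lborel (A \<union> (U - A)) \<le> emeasure lborel A + emeasure lborel (U - A)"
      by (rule emeasure_subadditive) auto
    moreover have "A \<union> (U - A) = U" using U(2) by blast
    ultimately have "emeasure lborel U \<le> emeasure lborel A + emeasure lborel (U - A)" by (simp only:)
    also have "\<dots> < \<infinity>"
      using base UA by (auto simp: less_top[symmetric])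
    finally have Ufin: "emeasure lborel U < \<infinity>" .
    have iU: "integrable lborel (indicator U :: 'a \<Rightarrow> real)"
      using Ufin by (simp add: integrable_indicator_iff)
    have "(\<integral>x. norm (indicator A x *\<^sub>R c - indicator U x *\<^sub>R c) \<partial>lborel) = (\<integral>x. indicator (U - A) x * norm c \<partial>lborel)"
      by (rule Bochner_Integration.integral_cong) (use U(2) in \<open>auto simp: indicator_def\<close>)
    also have "\<dots> = measure lborel (U - A) * norm c" by simp
    also have "\<dots> \<le> e' * norm c"
      using UA e'(1) by (intro mult_right_mono) (auto simp: measure_def enn2real_leI less_imp_le)
    also note e'(2)
    finally show "\<exists>g. integrable lborel g \<and> L1_continuous g \<and> (\<integral>x. norm (indicator A x *\<^sub>R c - g x) \<partial>lborel) \<le> e"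
      using iU L1_continuous_indicator_open[OF U(1) Ufin, of c] by (intro exI[of _ "\<lambda>x. indicator U x *\<^sub>R c"]) simp
  qed
next
  case (add f g)
  then show ?case by (intro L1_continuous_add)
next
  case (lim f s)
  have [measurable]: "f \<in> borel_measurable borel" "\<And>i. s i \<in> borel_measurable borel" using lim by auto
  have "(\<lambda>i. \<integral>x. norm (f x - s i x) \<partial>lborel) \<longlonglongrightarrow> (\<integral>x. 0 \<partial>(lborel::'a measure))"
  \<comment> \<open>The simple functions \<open>s i\<close> are bounded by
    \<open>2 * norm (f x)\<close>, hence the factor 3.\<close>
  proof (rule integral_dominated_convergence[where w = "\<lambda>x. 3 * norm (f x)"])
    show "AE x in lborel. (\<lambda>i. norm (f x - s i x)) \<longlonglongrightarrow> 0"
    proof (rule AE_I2)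
      fix x :: 'a
      have "(\<lambda>i. norm (f x - s i x)) \<longlonglongrightarrow> norm (f x - f x)"
        by (intro tendsto_intros lim(3)) simp
      then show "(\<lambda>i. norm (f x - s i x)) \<longlonglongrightarrow> 0" by simp
    qed
    show "AE x in lborel. norm (norm (f x - s i x)) \<le> 3 * norm (f x)" for i
    proof (rule AE_I2)
      fix x :: 'a
      show "norm (norm (f x - s i x)) \<le> 3 * norm (f x)"
        using lim(4)[of x i] norm_triangle_ineq4[of "f x" "s i x"] by simp
    qed
  qed (use lim in auto)
  then have l0: "(\<lambda>i. \<integral>x. norm (f x - s i x) \<partial>lborel) \<longlonglongrightarrow> 0" by simp
  show ?case
  proof (rule L1_continuous_approx[OF lim(5)])
    fix e :: real assume "0 < e"
    with LIMSEQ_D[OF l0, of e] obtain i where "norm ((\<integral>x. norm (f x - s i x) \<partial>lborel) - 0) < e" by auto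
    then show "\<exists>g. integrable lborel g \<and> L1_continuous g \<and> (\<integral>x. norm (f x - g x) \<partial>lborel) \<le> e"
      using lim(1,2) by (intro exI[of _ "s i"]) auto
  qed
qed

text \<open>The map taking a to |a| a is strongly monotone: the inner product of the difference of
  its values with a - b is at least (|a| + |b|) |a - b|^2 / 2. As it takes square-integrable
  functions to integrable ones, it carries continuity of translations from L1 to L2.\<close>

lemma norm_diff_sq_le_signed_squares:
  fixes a b :: "'b::real_inner"
  shows "(norm (a - b))\<^sup>2 \<le> 2 * norm (norm a *\<^sub>R a - norm b *\<^sub>R b)"
proof (cases "a = b")
  case False
  let ?n = "norm (a - b)"
  have ab: "a \<bullet> b = ((norm a)\<^sup>2 + (norm b)\<^sup>2 - ?n\<^sup>2) / 2"
    by (simp add: power2_norm_eq_inner inner_diff_left inner_diff_right inner_commute)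
  have "(norm a *\<^sub>R a - norm b *\<^sub>R b) \<bullet> (a - b) = norm a * (norm a)\<^sup>2 + norm b * (norm b)\<^sup>2 - (norm a + norm b) * (a \<bullet> b)"
    by (simp add: power2_norm_eq_inner inner_diff_left inner_diff_right inner_commute algebra_simps)
  also have "\<dots> = (norm a + norm b) * (norm a - norm b)\<^sup>2 / 2 + (norm a + norm b) * ?n\<^sup>2 / 2"
    unfolding ab by (simp add: power2_eq_square algebra_simps add_divide_distrib diff_divide_distrib)
  finally have "(norm a + norm b) * ?n\<^sup>2 / 2 \<le> (norm a *\<^sub>R a - norm b *\<^sub>R b) \<bullet> (a - b)" by simp
  moreover have "?n * ?n\<^sup>2 \<le> (norm a + norm b) * ?n\<^sup>2"
    by (intro mult_right_mono norm_triangle_ineq4) auto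
  moreover have "(norm a *\<^sub>R a - norm b *\<^sub>R b) \<bullet> (a - b) \<le> norm (norm a *\<^sub>R a - norm b *\<^sub>R b) * ?n"
    by (rule norm_cauchy_schwarz)
  ultimately have "?n * ?n\<^sup>2 \<le> 2 * (norm (norm a *\<^sub>R a - norm b *\<^sub>R b) * ?n)" by linarith
  then have "?n * ?n\<^sup>2 \<le> ?n * (2 * norm (norm a *\<^sub>R a - norm b *\<^sub>R b))" by (simp only: ac_simps)
  then show ?thesis
    using False by simp
qed simp

lemma L2_translate_tendsto:
  fixes f :: "'a::euclidean_space \<Rightarrow> 'b::euclidean_space"
  assumes f: "l2b f A" and h: "h \<longlonglongrightarrow> 0"
  shows "(\<lambda>k::nat. \<integral>x. (norm (f (x + h k) - f x))\<^sup>2 \<partial>lborel) \<longlonglongrightarrow> 0"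
proof -
  have [measurable]: "f \<in> borel_measurable borel" using f by (rule l2b_measurable)
  let ?g = "\<lambda>x. norm (f x) *\<^sub>R f x"
  have ig: "integrable lborel ?g"
    by (rule Bochner_Integration.integrable_bound[OF l2b_integrable[OF f]]) (auto simp: power2_eq_square)
  have igt: "integrable lborel (\<lambda>x. ?g (x + h k))" for k
    by (subst integrable_lborel_translate[of ?g]) (use ig in auto)
  have "(\<lambda>k. \<integral>x. norm (?g (x + h k) - ?g x) \<partial>lborel) \<longlonglongrightarrow> 0"
    using L1_continuous[OF ig] h by (simp add: L1_continuous_def)
  then have lim: "(\<lambda>k. 2 * (\<integral>x. norm (?g (x + h k) - ?g x) \<partial>lborel)) \<longlonglongrightarrow> 0"
    by (rule tendsto_mult_right_zero)
  show ?thesis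
  proof (rule tendsto_sandwich[OF _ _ tendsto_const lim]; intro always_eventually allI)
    fix k
    have ib: "integrable lborel (\<lambda>x. 2 * norm (?g (x + h k) - ?g x))"
      using ig igt[of k] by simp
    have "(\<integral>x. (norm (f (x + h k) - f x))\<^sup>2 \<partial>lborel) \<le> (\<integral>x. 2 * norm (?g (x + h k) - ?g x) \<partial>lborel)"
      by (rule integral_mono_AE'[OF ib]) (auto intro!: AE_I2 norm_diff_sq_le_signed_squares)
    then show "(\<integral>x. (norm (f (x + h k) - f x))\<^sup>2 \<partial>lborel) \<le> 2 * (\<integral>x. norm (?g (x + h k) - ?g x) \<partial>lborel)"
      by simp
  qed simp
qed

section \<open>The Fourier integral of complex-valued functions\<close>

definition ft :: "('a::euclidean_space \<Rightarrow> complex) \<Rightarrow> 'a \<Rightarrow> complex" where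
  "ft g \<xi> = (\<integral>x. g x * cis (- (x \<bullet> \<xi>)) \<partial>lborel)"

lemma ft1_eq_ft: "ft1 f = ft (\<lambda>x. complex_of_real (f x))"
  by (simp add: fun_eq_iff ft1_def ft_def)

lemma cis_measurable[measurable]: "cis \<in> borel_measurable borel"
  by (intro borel_measurable_continuous_onI continuous_intros)

lemma integrable_ft:
  fixes g :: "'a::euclidean_space \<Rightarrow> complex"
  assumes "integrable lborel g"
  shows "integrable lborel (\<lambda>x. g x * cis (c * (x \<bullet> \<xi>)))"
  by (rule Bochner_Integration.integrable_bound[OF assms]) (use assms in \<open>auto simp: norm_mult\<close>)

lemma integrable_ft': "integrable lborel g \<Longrightarrow> integrable lborel (\<lambda>x. g x * cis (- (x \<bullet> \<xi>)))"
  using integrable_ft[of g "-1" \<xi>] by simp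

lemma norm_ft_le: "integrable lborel g \<Longrightarrow> norm (ft g \<xi>) \<le> (\<integral>x. norm (g x) \<partial>lborel)"
  unfolding ft_def by (rule order_trans[OF integral_norm_bound]) (simp add: norm_mult)

lemma continuous_ft:
  assumes g: "integrable lborel g"
  shows "continuous_on UNIV (ft g)"
proof (rule continuous_on_sequentiallyI)
  fix u :: "nat \<Rightarrow> 'a" and a :: 'a assume u: "u \<longlonglongrightarrow> a"
  show "(\<lambda>n. ft g (u n)) \<longlonglongrightarrow> ft g a"
    unfolding ft_def
  proof (rule integral_dominated_convergence[where w = "\<lambda>x. norm (g x)"])
    show "AE x in lborel. (\<lambda>n. g x * cis (- (x \<bullet> u n))) \<longlonglongrightarrow> g x * cis (- (x \<bullet> a))"
      by (intro AE_I2 tendsto_intros u)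
  qed (use g in \<open>auto simp: norm_mult\<close>)
qed

lemma ft_measurable[measurable]: "integrable lborel g \<Longrightarrow> ft g \<in> borel_measurable borel"
  by (intro borel_measurable_continuous_onI continuous_ft)

lemma ft_diff: "integrable lborel f \<Longrightarrow> integrable lborel g \<Longrightarrow> ft (\<lambda>x. f x - g x) \<xi> = ft f \<xi> - ft g \<xi>"
  unfolding ft_def left_diff_distrib by (rule Bochner_Integration.integral_diff) (auto intro: integrable_ft')

lemma ft_cnj: "ft (\<lambda>x. cnj (g x)) \<xi> = cnj (ft g (- \<xi>))"
proof -
  have "(\<integral>x. cnj (g x * cis (- (x \<bullet> - \<xi>))) \<partial>lborel) = cnj (ft g (- \<xi>))"
    unfolding ft_def by (rule integral_bounded_linear'[OF bounded_linear_cnj bounded_linear_cnj]) simp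
  then show ?thesis
    by (simp add: ft_def cis_cnj)
qed

lemma ft_reflect:
  assumes "g \<in> borel_measurable borel"
  shows "ft (\<lambda>x. g (- x)) \<xi> = ft g (- \<xi>)"
  using integral_lborel_reflect[of "\<lambda>x. g x * cis (x \<bullet> \<xi>)"] assms unfolding ft_def by simp

text \<open>The Fubini identity that \<open>frel\<close> later takes as the weak definition of a
  transform.\<close>

lemma ft_multiplication:
  fixes g h :: "'a::euclidean_space \<Rightarrow> complex"
  assumes g: "integrable lborel g" and h: "integrable lborel h"
  shows "(\<integral>\<xi>. ft g \<xi> * h \<xi> \<partial>lborel) = (\<integral>x. g x * ft h x \<partial>lborel)"
proof -
  have [measurable]: "g \<in> borel_measurable borel" "h \<in> borel_measurable borel" using g h by auto
  let ?F = "\<lambda>x \<xi>. g x * cis (- (x \<bullet> \<xi>)) * h \<xi>"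
  have "integrable (lborel \<Otimes>\<^sub>M lborel) (case_prod ?F)"
  proof (rule lborel_pair.Fubini_integrable)
    show "integrable lborel (\<lambda>x. \<integral>\<xi>. norm (case (x, \<xi>) of (x, \<xi>) \<Rightarrow> ?F x \<xi>) \<partial>lborel)"
      using g by (simp add: norm_mult)
    show "AE x in lborel. integrable lborel (\<lambda>\<xi>. case (x, \<xi>) of (x, \<xi>) \<Rightarrow> ?F x \<xi>)"
    proof (rule AE_I2)
      fix x
      show "integrable lborel (\<lambda>\<xi>. case (x, \<xi>) of (x, \<xi>) \<Rightarrow> ?F x \<xi>)"
        using integrable_mult_right[OF integrable_ft'[OF h, of x], of "g x"]
        by (simp add: ac_simps inner_commute)
    qed
  qed measurable
  then have "(\<integral>\<xi>. (\<integral>x. ?F x \<xi> \<partial>lborel) \<partial>lborel) = (\<integral>x. (\<integral>\<xi>. ?F x \<xi> \<partial>lborel) \<partial>lborel)"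
    by (rule lborel_pair.Fubini_integral)
  moreover have "(\<integral>x. ?F x \<xi> \<partial>lborel) = ft g \<xi> * h \<xi>" for \<xi>
    unfolding ft_def by (rule integral_mult_left_zero)
  moreover have "(\<integral>\<xi>. ?F x \<xi> \<partial>lborel) = g x * ft h x" for x
    unfolding ft_def integral_mult_right_zero[symmetric] by (simp add: ac_simps inner_commute)
  ultimately show ?thesis by (simp only:)
qed

section \<open>Plancherel's theorem\<close>

lemma cnj_measurable[measurable]: "cnj \<in> borel_measurable borel"
  by (intro borel_measurable_continuous_onI continuous_intros)

section \<open>Gaussians and their transforms\<close>

lemma
  fixes g :: "'a::euclidean_space \<Rightarrow> real \<Rightarrow> complex"
  assumes g: "\<And>b. b \<in> Basis \<Longrightarrow> integrable lborel (g b)"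
  shows integrable_lborel_prod: "integrable lborel (\<lambda>x::'a. \<Prod>b\<in>Basis. g b (x \<bullet> b))"
    and integral_lborel_prod: "(\<integral>x. (\<Prod>b\<in>Basis. g b (x \<bullet> b)) \<partial>lborel) = (\<Prod>b\<in>Basis. \<integral>x. g b x \<partial>lborel)"
proof -
  interpret product_sigma_finite "\<lambda>b::'a. lborel :: real measure" ..
  have gm[measurable]: "g b \<in> borel_measurable borel" if "b \<in> Basis" for b
    using g[OF that] by auto
  let ?P = "\<Pi>\<^sub>M b\<in>(Basis::'a set). (lborel::real measure)"
  let ?T = "\<lambda>f. \<Sum>b\<in>(Basis::'a set). f b *\<^sub>R b"
  have T[measurable]: "?T \<in> measurable ?P borel" by measurable
  have m[measurable]: "(\<lambda>x::'a. \<Prod>b\<in>Basis. g b (x \<bullet> b)) \<in> borel_measurable borel"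
    by (intro borel_measurable_prod measurable_compose[OF _ gm]) auto
  have e: "(\<Prod>b\<in>Basis. g b (?T f \<bullet> b)) = (\<Prod>b\<in>Basis. g b (f b))" for f
    by (intro prod.cong refl) (simp add: inner_sum_left_Basis)
  have "integrable (distr ?P borel ?T) (\<lambda>x::'a. \<Prod>b\<in>Basis. g b (x \<bullet> b)) \<longleftrightarrow> integrable ?P (\<lambda>f. \<Prod>b\<in>Basis. g b (f b))"
    by (subst integrable_distr_eq) (auto simp: e)
  then show "integrable lborel (\<lambda>x::'a. \<Prod>b\<in>Basis. g b (x \<bullet> b))"
    using product_integrable_prod[of Basis g] g by (subst lborel_eq) simp
  have "(\<integral>x. (\<Prod>b\<in>Basis. g b (x \<bullet> b)) \<partial>(distr ?P borel ?T)) = (\<integral>f. (\<Prod>b\<in>Basis. g b (f b)) \<partial>?P)"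
    by (subst integral_distr) (auto simp: e)
  also have "\<dots> = (\<Prod>b\<in>Basis. \<integral>x. g b x \<partial>lborel)"
    by (rule product_integral_prod) (auto intro: g)
  finally show "(\<integral>x. (\<Prod>b\<in>Basis. g b (x \<bullet> b)) \<partial>lborel) = (\<Prod>b\<in>Basis. \<integral>x. g b x \<partial>lborel)"
    by (subst lborel_eq) simp
qed

text \<open>Up to the normalising factor \<open>sqrt (2 * pi)\<close> this is the characteristic
  function of the standard normal distribution.\<close>

lemma
  shows integrable_gaussian_real: "integrable lborel (\<lambda>x::real. complex_of_real (exp (- x\<^sup>2 / 2)) * cis (- (x * u)))"
    and integral_gaussian_real: "(\<integral>x. complex_of_real (exp (- x\<^sup>2 / 2)) * cis (- (x * u)) \<partial>lborel) = complex_of_real (sqrt (2 * pi) * exp (- u\<^sup>2 / 2))"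
proof -
  let ?e = "\<lambda>x::real. complex_of_real (exp (- x\<^sup>2 / 2)) * cis (- (x * u))"
  have i: "integrable lborel (\<lambda>x. std_normal_density x)" by (rule integrable_normal_density) simp
  have eq: "?e x = complex_of_real (sqrt (2 * pi)) * (std_normal_density x *\<^sub>R iexp (- u * x))" for x
    by (simp add: std_normal_density_def cis_conv_exp scaleR_conv_of_real ac_simps)
  have "integrable lborel (\<lambda>x. std_normal_density x *\<^sub>R iexp (- u * x))"
    by (rule Bochner_Integration.integrable_bound[OF i]) (auto simp: norm_mult)
  then show "integrable lborel ?e"
    unfolding eq by (rule integrable_mult_right)
  have "char std_normal_distribution (- u) = (\<integral>x. std_normal_density x *\<^sub>R iexp (- u * x) \<partial>lborel)"
    unfolding char_def by (rule integral_density) auto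
  then show "(\<integral>x. ?e x \<partial>lborel) = complex_of_real (sqrt (2 * pi) * exp (- u\<^sup>2 / 2))"
    unfolding eq integral_mult_right_zero by (simp add: char_std_normal_distribution)
qed

definition gauss :: "'a::euclidean_space \<Rightarrow> real" where
  "gauss x = exp (- (norm x)\<^sup>2 / 2)"

lemma gauss_bounds: "0 < gauss x" "gauss x \<le> 1"
  by (auto simp: gauss_def)

lemma gauss_measurable[measurable]: "gauss \<in> borel_measurable borel"
  unfolding gauss_def[abs_def] by measurable

lemma gauss_cis_eq_prod:
  "complex_of_real (gauss x) * cis (- (x \<bullet> \<xi>)) = (\<Prod>b\<in>Basis. complex_of_real (exp (- (x \<bullet> b)\<^sup>2 / 2)) * cis (- ((x \<bullet> b) * (\<xi> \<bullet> b))))"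
  for x :: "'a::euclidean_space"
proof -
  have n: "(norm x)\<^sup>2 = (\<Sum>b\<in>Basis. (x \<bullet> b)\<^sup>2)"
    unfolding power2_norm_eq_inner by (subst euclidean_inner) (simp add: power2_eq_square)
  have g: "gauss x = (\<Prod>b\<in>Basis. exp (- (x \<bullet> b)\<^sup>2 / 2))"
    unfolding gauss_def n exp_sum[OF finite_Basis, symmetric] by (simp add: sum_negf sum_divide_distrib)
  have c: "cis (- (x \<bullet> \<xi>)) = (\<Prod>b\<in>Basis. cis (- ((x \<bullet> b) * (\<xi> \<bullet> b))))"
    unfolding cis_conv_exp exp_sum[OF finite_Basis, symmetric]
    by (subst euclidean_inner) (simp add: sum_negf sum_distrib_left)
  show ?thesis
    unfolding g c by (simp add: prod.distrib)
qed

text \<open>The Plancherel constant: \<open>ft\<close> carries no factor, so it multiplies the L2 norm by this number.\<close>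

definition pc :: "'a::euclidean_space itself \<Rightarrow> real" where
  "pc _ = sqrt (2 * pi) ^ DIM('a)"

lemma pc_pos: "0 < pc TYPE('a::euclidean_space)"
  by (simp add: pc_def)

lemma
  shows integrable_gauss_cis: "integrable lborel (\<lambda>x::'a::euclidean_space. complex_of_real (gauss x) * cis (- (x \<bullet> \<xi>)))"
    and ft_gauss: "ft (\<lambda>x::'a. complex_of_real (gauss x)) \<xi> = complex_of_real (pc TYPE('a) * gauss \<xi>)"
proof -
  show "integrable lborel (\<lambda>x::'a. complex_of_real (gauss x) * cis (- (x \<bullet> \<xi>)))"
    unfolding gauss_cis_eq_prod by (rule integrable_lborel_prod[of "\<lambda>b y. complex_of_real (exp (- y\<^sup>2 / 2)) * cis (- (y * (\<xi> \<bullet> b)))"]) (rule integrable_gaussian_real)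
  have "ft (\<lambda>x::'a. complex_of_real (gauss x)) \<xi> = (\<Prod>b\<in>Basis. complex_of_real (sqrt (2 * pi) * exp (- (\<xi> \<bullet> b)\<^sup>2 / 2)))"
    unfolding ft_def gauss_cis_eq_prod integral_gaussian_real[symmetric]
    by (rule integral_lborel_prod[of "\<lambda>b y. complex_of_real (exp (- y\<^sup>2 / 2)) * cis (- (y * (\<xi> \<bullet> b)))"]) (rule integrable_gaussian_real)
  also have "\<dots> = complex_of_real (sqrt (2 * pi)) ^ DIM('a) * (\<Prod>b\<in>Basis. complex_of_real (exp (- (\<xi> \<bullet> b)\<^sup>2 / 2)) * cis (- ((\<xi> \<bullet> b) * ((0::'a) \<bullet> b))))"
    by (simp add: prod.distrib)
  also have "\<dots> = complex_of_real (pc TYPE('a) * gauss \<xi>)"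
    unfolding gauss_cis_eq_prod[symmetric] by (simp add: pc_def)
  finally show "ft (\<lambda>x::'a. complex_of_real (gauss x)) \<xi> = complex_of_real (pc TYPE('a) * gauss \<xi>)" .
qed

lemma
  shows integrable_gauss: "integrable lborel (gauss :: 'a::euclidean_space \<Rightarrow> real)"
    and integral_gauss: "(\<integral>x. gauss (x::'a) \<partial>lborel) = pc TYPE('a)"
proof -
  have i: "integrable lborel (\<lambda>x::'a. complex_of_real (gauss x))"
    using integrable_gauss_cis[of "0::'a"] by simp
  show "integrable lborel (gauss :: 'a \<Rightarrow> real)"
    using integrable_norm[OF i] by (simp add: gauss_bounds less_imp_le)
  have "complex_of_real (\<integral>x. gauss (x::'a) \<partial>lborel) = complex_of_real (pc TYPE('a))"
    using ft_gauss[of "0::'a"] by (simp add: ft_def gauss_def)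
  then show "(\<integral>x. gauss (x::'a) \<partial>lborel) = pc TYPE('a)" by (simp only: of_real_eq_iff)
qed

lemma
  fixes f g :: "'a::euclidean_space \<Rightarrow> complex"
  assumes f: "l2b f A" and g: "l2b g B"
  shows l2b_mult_integrable: "integrable lborel (\<lambda>x. f x * g x)"
    and l2b_mult_integral: "norm (\<integral>x. f x * g x \<partial>lborel) \<le> A * B"
proof -
  have [measurable]: "f \<in> borel_measurable borel" "g \<in> borel_measurable borel"
    using l2b_measurable f g by auto
  show i: "integrable lborel (\<lambda>x. f x * g x)"
    by (rule Bochner_Integration.integrable_bound[OF l2b_Cauchy_Schwarz(1)[OF f g]]) (auto simp: norm_mult)
  have "norm (\<integral>x. f x * g x \<partial>lborel) \<le> (\<integral>x. norm (f x * g x) \<partial>lborel)" by (rule integral_norm_bound)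
  also have "\<dots> \<le> A * B" using l2b_Cauchy_Schwarz(2)[OF f g] by (simp add: norm_mult)
  finally show "norm (\<integral>x. f x * g x \<partial>lborel) \<le> A * B" .
qed

lemma l2b_cnj: "l2b f A \<Longrightarrow> l2b (\<lambda>x. cnj (f x)) A"
  by (rule l2b_dominated1) (auto dest!: l2b_measurable intro: measurable_compose[OF _ cnj_measurable])

lemma l2b_translate:
  assumes "l2b f A" shows "l2b (\<lambda>x. f (x + h)) A"
proof -
  have [measurable]: "f \<in> borel_measurable borel" using l2b_measurable assms by auto
  show ?thesis
    using integrable_lborel_translate[of "\<lambda>x. (norm (f x))\<^sup>2" h] integral_lborel_translate[of "\<lambda>x. (norm (f x))\<^sup>2" h]
      l2b_integrable[OF assms] l2b_integral[OF assms] l2b_nonneg[OF assms]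
    by (intro l2bI) simp_all
qed

lemma l2b_reflect:
  assumes "l2b f A" shows "l2b (\<lambda>x. f (- x)) A"
proof -
  have [measurable]: "f \<in> borel_measurable borel" using l2b_measurable assms by auto
  show ?thesis
    using integrable_lborel_reflect[of "\<lambda>x. (norm (f x))\<^sup>2"] integral_lborel_reflect[of "\<lambda>x. (norm (f x))\<^sup>2"]
      l2b_integrable[OF assms] l2b_integral[OF assms] l2b_nonneg[OF assms]
    by (intro l2bI) simp_all
qed

text \<open>The Gaussian factor makes the double integral absolutely convergent. The transform of a
  dilated Gaussian is a Gaussian of width \<open>e\<close>, so the right-hand side averages the
  autocorrelation of \<open>\<phi>\<close> over shifts of size \<open>e\<close>.\<close>

lemma integral_ft_gauss:
  fixes \<phi> :: "'a::euclidean_space \<Rightarrow> complex"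
  assumes i: "integrable lborel \<phi>" and l: "l2b \<phi> A" and e: "0 < e"
  shows "integrable lborel (\<lambda>\<xi>. (norm (ft \<phi> \<xi>))\<^sup>2 * gauss (e *\<^sub>R \<xi>))"
    and "complex_of_real (\<integral>\<xi>. (norm (ft \<phi> \<xi>))\<^sup>2 * gauss (e *\<^sub>R \<xi>) \<partial>lborel) =
      (\<integral>w. complex_of_real (pc TYPE('a) * gauss w) * (\<integral>x. \<phi> x * cnj (\<phi> (x + e *\<^sub>R w)) \<partial>lborel) \<partial>lborel)"
proof -
  have [measurable]: "\<phi> \<in> borel_measurable borel" using i by auto
  have [measurable]: "ft \<phi> \<in> borel_measurable borel" using i by measurable
  define N where "N = (\<integral>x. norm (\<phi> x) \<partial>lborel)"
  have ig: "integrable lborel (\<lambda>\<xi>::'a. gauss (e *\<^sub>R \<xi>))"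
    using integrable_lborel_affine[of e "gauss :: 'a \<Rightarrow> real" 0] e integrable_gauss by simp
  have igc: "integrable lborel (\<lambda>\<xi>::'a. complex_of_real (gauss (e *\<^sub>R \<xi>)))"
    using ig by (rule integrable_of_real)
  show "integrable lborel (\<lambda>\<xi>. (norm (ft \<phi> \<xi>))\<^sup>2 * gauss (e *\<^sub>R \<xi>))"
  proof (rule Bochner_Integration.integrable_bound[OF integrable_mult_right[OF ig, of "N\<^sup>2"]])
    show "AE \<xi> in lborel. norm ((norm (ft \<phi> \<xi>))\<^sup>2 * gauss (e *\<^sub>R \<xi>)) \<le> norm (N\<^sup>2 * gauss (e *\<^sub>R \<xi>))"
      using norm_ft_le[OF i] gauss_bounds
      by (intro AE_I2) (simp add: N_def abs_mult less_imp_le mult_right_mono power_mono)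
  qed measurable
  define h where "h \<xi> = cnj (ft \<phi> \<xi>) * complex_of_real (gauss (e *\<^sub>R \<xi>))" for \<xi>
  have [measurable]: "h \<in> borel_measurable borel" unfolding h_def[abs_def] by measurable
  have ih: "integrable lborel h"
  proof (rule Bochner_Integration.integrable_bound[OF integrable_mult_right[OF ig, of "N"]])
    show "AE \<xi> in lborel. norm (h \<xi>) \<le> norm (N * gauss (e *\<^sub>R \<xi>))"
      using norm_ft_le[OF i] gauss_bounds
      by (intro AE_I2) (simp add: N_def h_def norm_mult abs_mult less_imp_le mult_right_mono)
  qed measurable
  have fh: "ft h x = (\<integral>w. complex_of_real (pc TYPE('a) * gauss w) * cnj (\<phi> (x + e *\<^sub>R w)) \<partial>lborel)" for x
  proof -
    let ?m = "\<lambda>\<xi>. complex_of_real (gauss (e *\<^sub>R \<xi>)) * cis (\<xi> \<bullet> x)"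
    have im: "integrable lborel ?m"
      using integrable_ft[OF igc, of 1 x] by simp
    have fm: "ft ?m y = complex_of_real ((1 / e ^ DIM('a)) * (pc TYPE('a) * gauss ((1 / e) *\<^sub>R (y - x))))" for y
    proof -
      let ?k = "\<lambda>\<eta>. complex_of_real (gauss \<eta>) * cis (- (\<eta> \<bullet> ((1 / e) *\<^sub>R (y - x))))"
      have "ft ?m y = (\<integral>\<xi>. ?k (0 + e *\<^sub>R \<xi>) \<partial>lborel)"
        unfolding ft_def
      proof (intro Bochner_Integration.integral_cong refl)
        fix \<xi> :: 'a
        have "(e *\<^sub>R \<xi>) \<bullet> ((1 / e) *\<^sub>R (y - x)) = \<xi> \<bullet> (y - x)" using e by simp
        then show "?m \<xi> * cis (- (\<xi> \<bullet> y)) = ?k (0 + e *\<^sub>R \<xi>)"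
          by (simp add: cis_mult inner_diff_right mult.assoc del: inner_scaleR_left inner_scaleR_right)
      qed
      also have "\<dots> = (1 / \<bar>e\<bar> ^ DIM('a)) *\<^sub>R (\<integral>\<eta>. ?k \<eta> \<partial>lborel)"
        by (rule integral_lborel_affine) (use e in auto)
      also have "(\<integral>\<eta>. ?k \<eta> \<partial>lborel) = complex_of_real (pc TYPE('a) * gauss ((1 / e) *\<^sub>R (y - x)))"
        using ft_gauss[of "(1 / e) *\<^sub>R (y - x)"] by (simp add: ft_def)
      finally show ?thesis using e by (simp add: scaleR_conv_of_real)
    qed
    have "ft h x = cnj (\<integral>\<xi>. ft \<phi> \<xi> * ?m \<xi> \<partial>lborel)"
      unfolding ft_def[of h] h_def Bochner_Integration.integral_cnj[symmetric]
      by (intro Bochner_Integration.integral_cong refl) (simp add: cis_cnj)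
    also have "(\<integral>\<xi>. ft \<phi> \<xi> * ?m \<xi> \<partial>lborel) = (\<integral>y. \<phi> y * ft ?m y \<partial>lborel)"
      by (rule ft_multiplication[OF i im])
    also have "\<dots> = complex_of_real (1 / e ^ DIM('a)) * (\<integral>y. \<phi> y * complex_of_real (pc TYPE('a) * gauss ((1 / e) *\<^sub>R (y - x))) \<partial>lborel)"
      unfolding fm integral_mult_right_zero[symmetric]
      by (intro Bochner_Integration.integral_cong refl) simp
    \<comment> \<open>The substitution y = x + e w absorbs the factor
      \<open>1 / e ^ DIM('a)\<close>.\<close>
    also have "\<dots> = (\<integral>w. \<phi> (x + e *\<^sub>R w) * complex_of_real (pc TYPE('a) * gauss ((1 / e) *\<^sub>R (x + e *\<^sub>R w - x))) \<partial>lborel)"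
      using e by (subst integral_lborel_affine[where f = "\<lambda>y. \<phi> y * complex_of_real (pc TYPE('a) * gauss ((1 / e) *\<^sub>R (y - x)))"])
        (simp_all add: scaleR_conv_of_real)
    finally show ?thesis
      using e unfolding Bochner_Integration.integral_cnj[symmetric] by (simp add: mult.commute)
  qed
  have "complex_of_real (\<integral>\<xi>. (norm (ft \<phi> \<xi>))\<^sup>2 * gauss (e *\<^sub>R \<xi>) \<partial>lborel) = (\<integral>\<xi>. ft \<phi> \<xi> * h \<xi> \<partial>lborel)"
    unfolding integral_complex_of_real[symmetric] h_def
    by (intro Bochner_Integration.integral_cong refl) (simp add: complex_norm_square flip: of_real_power)
  also have "\<dots> = (\<integral>x. \<phi> x * ft h x \<partial>lborel)"
    by (rule ft_multiplication[OF i ih])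
  also have "\<dots> = (\<integral>x. (\<integral>w. complex_of_real (pc TYPE('a) * gauss w) * (\<phi> x * cnj (\<phi> (x + e *\<^sub>R w))) \<partial>lborel) \<partial>lborel)"
    unfolding fh integral_mult_right_zero[symmetric] by (simp add: ac_simps)
  also have "\<dots> = (\<integral>w. (\<integral>x. complex_of_real (pc TYPE('a) * gauss w) * (\<phi> x * cnj (\<phi> (x + e *\<^sub>R w))) \<partial>lborel) \<partial>lborel)"
  proof (rule lborel_pair.Fubini_integral)
    let ?F = "\<lambda>w x. complex_of_real (pc TYPE('a) * gauss w) * (\<phi> x * cnj (\<phi> (x + e *\<^sub>R w)))"
    have sh: "l2b (\<lambda>x. cnj (\<phi> (x + e *\<^sub>R w))) A" for w
      by (intro l2b_cnj l2b_translate l)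
    show "integrable (lborel \<Otimes>\<^sub>M lborel) (case_prod ?F)"
    proof (rule lborel_pair.Fubini_integrable)
      show "integrable lborel (\<lambda>w. \<integral>x. norm (case (w, x) of (w, x) \<Rightarrow> ?F w x) \<partial>lborel)"
      proof (rule Bochner_Integration.integrable_bound[OF integrable_mult_right[OF integrable_gauss, of "pc TYPE('a) * A\<^sup>2"]])
        show "AE w in lborel. norm (\<integral>x. norm (case (w, x) of (w, x) \<Rightarrow> ?F w x) \<partial>lborel) \<le> norm (pc TYPE('a) * A\<^sup>2 * gauss (w::'a))"
        proof (rule AE_I2)
          fix w :: 'a
          have "norm (\<integral>x. norm (case (w, x) of (w, x) \<Rightarrow> ?F w x) \<partial>lborel) = (pc TYPE('a) * gauss w) * (\<integral>x. norm (\<phi> x) * norm (cnj (\<phi> (x + e *\<^sub>R w))) \<partial>lborel)"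
            using pc_pos[where 'a='a] gauss_bounds(1)[of w] by (simp add: norm_mult abs_mult)
          also have "\<dots> \<le> (pc TYPE('a) * gauss w) * (A * A)"
            using pc_pos[where 'a='a] gauss_bounds(1)[of w] by (intro mult_left_mono l2b_Cauchy_Schwarz(2)[OF l sh]) simp
          also have "\<dots> = norm (pc TYPE('a) * A\<^sup>2 * gauss w)"
            using pc_pos[where 'a='a] gauss_bounds(1)[of w] by (simp add: abs_mult power2_eq_square)
          finally show "norm (\<integral>x. norm (case (w, x) of (w, x) \<Rightarrow> ?F w x) \<partial>lborel) \<le> norm (pc TYPE('a) * A\<^sup>2 * gauss w)" .
        qed
      qed measurable
      show "AE w in lborel. integrable lborel (\<lambda>x. case (w, x) of (w, x) \<Rightarrow> ?F w x)"
        unfolding prod.case by (intro AE_I2 integrable_mult_right l2b_mult_integrable[OF l sh])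
    qed measurable
  qed
  finally show "complex_of_real (\<integral>\<xi>. (norm (ft \<phi> \<xi>))\<^sup>2 * gauss (e *\<^sub>R \<xi>) \<partial>lborel) =
      (\<integral>w. complex_of_real (pc TYPE('a) * gauss w) * (\<integral>x. \<phi> x * cnj (\<phi> (x + e *\<^sub>R w)) \<partial>lborel) \<partial>lborel)"
    by simp
qed

text \<open>The Gaussian damping is relaxed to 1 from below. On the left monotone convergence yields
  integrability together with the value; on the right the autocorrelation is continuous at 0 by
  \<open>L2_translate_tendsto\<close>. One factor \<open>pc\<close> comes from the transform of the
  Gaussian, the other from its integral.\<close>

theorem Plancherel_L1_L2:
  fixes \<phi> :: "'a::euclidean_space \<Rightarrow> complex"
  assumes i: "integrable lborel \<phi>" and l: "l2b \<phi> A"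
  shows "integrable lborel (\<lambda>\<xi>. (norm (ft \<phi> \<xi>))\<^sup>2)"
    and "(\<integral>\<xi>. (norm (ft \<phi> \<xi>))\<^sup>2 \<partial>lborel) = (pc TYPE('a))\<^sup>2 * (\<integral>x. (norm (\<phi> x))\<^sup>2 \<partial>lborel)"
proof -
  have [measurable]: "\<phi> \<in> borel_measurable borel" using i by auto
  have [measurable]: "ft \<phi> \<in> borel_measurable borel" using i by measurable
  define e where "e k = 1 / (real k + 1)" for k
  have e: "0 < e k" for k by (simp add: e_def)
  have e0: "e \<longlonglongrightarrow> 0"
    unfolding e_def using LIMSEQ_inverse_real_of_nat by (simp add: inverse_eq_divide add.commute)
  define R where "R h = (\<integral>x. \<phi> x * cnj (\<phi> (x + h)) \<partial>lborel)" for h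
  have [measurable]: "R \<in> borel_measurable borel"
    unfolding R_def[abs_def] by measurable
  have R0: "R 0 = complex_of_real (\<integral>x. (norm (\<phi> x))\<^sup>2 \<partial>lborel)"
    unfolding R_def integral_complex_of_real[symmetric]
    by (intro Bochner_Integration.integral_cong refl) (simp add: complex_norm_square flip: of_real_power)
  have Rlim: "(\<lambda>k. R (h k)) \<longlonglongrightarrow> R 0" if h: "h \<longlonglongrightarrow> 0" for h :: "nat \<Rightarrow> 'a"
  proof (rule Lim_transform_bound[where g = "\<lambda>k. A * sqrt (\<integral>x. (norm (\<phi> (x + h k) - \<phi> x))\<^sup>2 \<partial>lborel)", THEN LIM_zero_cancel])
    let ?q = "\<lambda>k. \<integral>x. (norm (\<phi> (x + h k) - \<phi> x))\<^sup>2 \<partial>lborel"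
    have "(\<lambda>k. A * sqrt (?q k)) \<longlonglongrightarrow> A * sqrt 0"
      by (intro tendsto_intros L2_translate_tendsto[OF l h])
    then show "(\<lambda>k. A * sqrt (?q k)) \<longlonglongrightarrow> 0" by simp
    show "\<forall>\<^sub>F k in sequentially. norm (R (h k) - R 0) \<le> norm (A * sqrt (?q k))"
    proof (intro always_eventually allI)
      fix k
      have d: "l2b (\<lambda>x. \<phi> (x + h k) - \<phi> x) (sqrt (?q k))"
        by (rule l2bI_sqrt) (use l2b_integrable[OF l2b_diff[OF l2b_translate[OF l] l], of "h k"] in auto)
      have "R (h k) - R 0 = (\<integral>x. \<phi> x * cnj (\<phi> (x + h k)) - \<phi> x * cnj (\<phi> (x + 0)) \<partial>lborel)"
        unfolding R_def by (rule Bochner_Integration.integral_diff[symmetric, OF l2b_mult_integrable[OF l l2b_cnj[OF l2b_translate[OF l]]] l2b_mult_integrable[OF l l2b_cnj[OF l2b_translate[OF l]]]])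
      also have "\<dots> = (\<integral>x. \<phi> x * cnj (\<phi> (x + h k) - \<phi> x) \<partial>lborel)"
        by (simp add: algebra_simps)
      finally have "norm (R (h k) - R 0) \<le> A * sqrt (?q k)"
        using l2b_mult_integral[OF l l2b_cnj[OF d]] by simp
      then show "norm (R (h k) - R 0) \<le> norm (A * sqrt (?q k))" by simp
    qed
  qed
  have Rb: "norm (R h) \<le> A * A" for h
    unfolding R_def by (intro l2b_mult_integral[OF l l2b_cnj] l2b_translate[OF l])
  have "(\<lambda>k. \<integral>w. complex_of_real (pc TYPE('a) * gauss w) * R (e k *\<^sub>R w) \<partial>lborel)
     \<longlonglongrightarrow> (\<integral>w. complex_of_real (pc TYPE('a) * gauss (w::'a)) * R 0 \<partial>lborel)"
  proof (rule integral_dominated_convergence[where w = "\<lambda>w. pc TYPE('a) * (A * A) * gauss w"])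
    show "AE w in lborel. (\<lambda>k. complex_of_real (pc TYPE('a) * gauss w) * R (e k *\<^sub>R w)) \<longlonglongrightarrow> complex_of_real (pc TYPE('a) * gauss w) * R 0"
    proof (rule AE_I2)
      fix w :: 'a
      have "(\<lambda>k. e k *\<^sub>R w) \<longlonglongrightarrow> 0 *\<^sub>R w" by (intro tendsto_intros e0)
      then show "(\<lambda>k. complex_of_real (pc TYPE('a) * gauss w) * R (e k *\<^sub>R w)) \<longlonglongrightarrow> complex_of_real (pc TYPE('a) * gauss w) * R 0"
        by (intro tendsto_mult tendsto_const Rlim) simp
    qed
    show "AE w in lborel. norm (complex_of_real (pc TYPE('a) * gauss w) * R (e k *\<^sub>R w)) \<le> pc TYPE('a) * (A * A) * gauss w" for k
    proof (rule AE_I2)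
      fix w :: 'a
      have "(pc TYPE('a) * gauss w) * norm (R (e k *\<^sub>R w)) \<le> (pc TYPE('a) * gauss w) * (A * A)"
        using pc_pos[where 'a='a] gauss_bounds(1)[of w] by (intro mult_left_mono Rb) simp
      then show "norm (complex_of_real (pc TYPE('a) * gauss w) * R (e k *\<^sub>R w)) \<le> pc TYPE('a) * (A * A) * gauss w"
        using pc_pos[where 'a='a] gauss_bounds(1)[of w] by (simp add: norm_mult abs_mult ac_simps)
    qed
    show "integrable lborel (\<lambda>w::'a. pc TYPE('a) * (A * A) * gauss w)"
      by (intro integrable_mult_right integrable_gauss)
  qed measurable
  also have "(\<integral>w. complex_of_real (pc TYPE('a) * gauss (w::'a)) * R 0 \<partial>lborel) = complex_of_real ((pc TYPE('a))\<^sup>2 * (\<integral>x. (norm (\<phi> x))\<^sup>2 \<partial>lborel))"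
    unfolding R0 by (simp add: integral_gauss power2_eq_square)
  finally have "(\<lambda>k. complex_of_real (\<integral>\<xi>. (norm (ft \<phi> \<xi>))\<^sup>2 * gauss (e k *\<^sub>R \<xi>) \<partial>lborel)) \<longlonglongrightarrow> complex_of_real ((pc TYPE('a))\<^sup>2 * (\<integral>x. (norm (\<phi> x))\<^sup>2 \<partial>lborel))"
    unfolding integral_ft_gauss(2)[OF i l e] R_def .
  then have lim: "(\<lambda>k. \<integral>\<xi>. (norm (ft \<phi> \<xi>))\<^sup>2 * gauss (e k *\<^sub>R \<xi>) \<partial>lborel) \<longlonglongrightarrow> (pc TYPE('a))\<^sup>2 * (\<integral>x. (norm (\<phi> x))\<^sup>2 \<partial>lborel)"
    by (simp only: tendsto_of_real_iff)
  have emono: "e n \<le> e m" if "m \<le> n" for m n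
    using that by (simp add: e_def frac_le)
  have mono: "AE \<xi> in lborel. mono (\<lambda>k. (norm (ft \<phi> \<xi>))\<^sup>2 * gauss (e k *\<^sub>R \<xi>))"
  proof (intro AE_I2 monoI mult_left_mono)
    fix \<xi> :: 'a and m n :: nat assume "m \<le> n"
    have "(e n * norm \<xi>)\<^sup>2 \<le> (e m * norm \<xi>)\<^sup>2"
      using e[of n] emono[OF \<open>m \<le> n\<close>] by (intro power_mono mult_right_mono) (auto simp: less_imp_le)
    then show "gauss (e m *\<^sub>R \<xi>) \<le> gauss (e n *\<^sub>R \<xi>)"
      using e[of n] e[of m] by (simp add: gauss_def less_imp_le)
  qed auto
  have ptlim: "AE \<xi> in lborel. (\<lambda>k. (norm (ft \<phi> \<xi>))\<^sup>2 * gauss (e k *\<^sub>R \<xi>)) \<longlonglongrightarrow> (norm (ft \<phi> \<xi>))\<^sup>2"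
  proof (rule AE_I2)
    fix \<xi> :: 'a
    have "(\<lambda>k. (norm (ft \<phi> \<xi>))\<^sup>2 * gauss (e k *\<^sub>R \<xi>)) \<longlonglongrightarrow> (norm (ft \<phi> \<xi>))\<^sup>2 * gauss (0 *\<^sub>R \<xi>)"
      unfolding gauss_def by (intro tendsto_intros e0) simp
    then show "(\<lambda>k. (norm (ft \<phi> \<xi>))\<^sup>2 * gauss (e k *\<^sub>R \<xi>)) \<longlonglongrightarrow> (norm (ft \<phi> \<xi>))\<^sup>2"
      by (simp add: gauss_def)
  qed
  show "integrable lborel (\<lambda>\<xi>. (norm (ft \<phi> \<xi>))\<^sup>2)"
    by (rule integrable_monotone_convergence[OF integral_ft_gauss(1)[OF i l e] mono ptlim lim]) measurable
  show "(\<integral>\<xi>. (norm (ft \<phi> \<xi>))\<^sup>2 \<partial>lborel) = (pc TYPE('a))\<^sup>2 * (\<integral>x. (norm (\<phi> x))\<^sup>2 \<partial>lborel)"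
    by (rule integral_monotone_convergence[OF integral_ft_gauss(1)[OF i l e] mono ptlim lim]) measurable
qed

section \<open>The Fourier transform on square-integrable functions\<close>

definition l2 :: "('a::euclidean_space \<Rightarrow> 'b::euclidean_space) \<Rightarrow> bool" where
  "l2 g \<longleftrightarrow> (\<exists>A. l2b g A)"

lemma l2b_imp_l2: "l2b g A \<Longrightarrow> l2 g"
  by (auto simp: l2_def)

lemma l2_measurable: "l2 g \<Longrightarrow> g \<in> borel_measurable borel"
  by (auto simp: l2_def dest: l2b_measurable)

lemma l2_add: "l2 f \<Longrightarrow> l2 g \<Longrightarrow> l2 (\<lambda>x. f x + g x)"
  unfolding l2_def using l2b_add by blast

lemma l2_diff: "l2 f \<Longrightarrow> l2 g \<Longrightarrow> l2 (\<lambda>x. f x - g x)"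
  unfolding l2_def using l2b_diff by blast

lemma l2_cmult: "l2 f \<Longrightarrow> l2 (\<lambda>x. c * f x)" for f :: "'a::euclidean_space \<Rightarrow> complex"
  unfolding l2_def using l2b_cmult by blast

lemma l2_cnj: "l2 f \<Longrightarrow> l2 (\<lambda>x. cnj (f x))"
  unfolding l2_def using l2b_cnj by blast

lemma l2_reflect: "l2 f \<Longrightarrow> l2 (\<lambda>x. f (- x))"
  unfolding l2_def using l2b_reflect by blast

lemma l2_mult_integrable: "l2 f \<Longrightarrow> l2 g \<Longrightarrow> integrable lborel (\<lambda>x. f x * g x)"
  for f g :: "'a::euclidean_space \<Rightarrow> complex"
  unfolding l2_def using l2b_mult_integrable by blast

lemma L2_iff_l2: "L2 f \<longleftrightarrow> l2 (\<lambda>x. complex_of_real (f x))"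
proof
  assume L: "L2 f"
  then have [measurable]: "f \<in> borel_measurable borel" by (simp add: L2_def)
  have "l2b (\<lambda>x. complex_of_real (f x)) (sqrt (\<integral>x. (norm (complex_of_real (f x)))\<^sup>2 \<partial>lborel))"
    by (rule l2bI_sqrt) (use L in \<open>simp_all add: L2_def\<close>)
  then show "l2 (\<lambda>x. complex_of_real (f x))" by (rule l2b_imp_l2)
next
  assume "l2 (\<lambda>x. complex_of_real (f x))"
  then obtain A where A: "l2b (\<lambda>x. complex_of_real (f x)) A" by (auto simp: l2_def)
  have "(\<lambda>x. Re (complex_of_real (f x))) \<in> borel_measurable borel"
    using l2b_measurable[OF A] by measurable
  then show "L2 f"
    using l2b_integrable[OF A] by (simp add: L2_def)
qed

lemma ft_l2b:
  fixes \<phi> :: "'a::euclidean_space \<Rightarrow> complex"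
  assumes i: "integrable lborel \<phi>" and l: "l2b \<phi> A"
  shows "l2b (ft \<phi>) (pc TYPE('a) * A)"
proof (rule l2bI)
  show "(\<integral>x. (norm (ft \<phi> x))\<^sup>2 \<partial>lborel) \<le> (pc TYPE('a) * A)\<^sup>2"
    unfolding Plancherel_L1_L2(2)[OF i l] power_mult_distrib
    by (intro mult_left_mono l2b_integral[OF l]) auto
qed (use i l Plancherel_L1_L2(1)[OF i l] pc_pos[where 'a='a] in \<open>auto dest: l2b_nonneg intro: ft_measurable simp: less_imp_le\<close>)

lemma ft_l2b_iff:
  fixes \<phi> :: "'a::euclidean_space \<Rightarrow> complex"
  assumes i: "integrable lborel \<phi>" and l: "l2b \<phi> B" and U: "l2b (ft \<phi>) (pc TYPE('a) * A)" and A: "0 \<le> A"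
  shows "l2b \<phi> A"
proof (rule l2bI)
  have "(pc TYPE('a))\<^sup>2 * (\<integral>x. (norm (\<phi> x))\<^sup>2 \<partial>lborel) \<le> (pc TYPE('a))\<^sup>2 * A\<^sup>2"
    using l2b_integral[OF U] unfolding Plancherel_L1_L2(2)[OF i l] power_mult_distrib .
  then show "(\<integral>x. (norm (\<phi> x))\<^sup>2 \<partial>lborel) \<le> A\<^sup>2"
    using pc_pos[where 'a='a] by simp
qed (use l A in \<open>auto dest: l2b_measurable l2b_integrable\<close>)

section \<open>Truncation to balls\<close>

lemma cball_sets_borel[measurable]: "cball (a::'a::euclidean_space) r \<in> sets borel"
  by (rule borel_closed) (rule closed_cball)

definition truncate :: "nat \<Rightarrow> ('a::euclidean_space \<Rightarrow> complex) \<Rightarrow> 'a \<Rightarrow> complex" where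
  "truncate k g x = indicator (cball 0 (real k)) x * g x"

lemma norm_truncate_le: "norm (truncate k g x) \<le> norm (g x)"
  by (simp add: truncate_def indicator_def)

lemma truncate_measurable[measurable]:
  assumes [measurable]: "g \<in> borel_measurable borel"
  shows "truncate k g \<in> borel_measurable borel"
  unfolding truncate_def[abs_def] by measurable

lemma l2b_truncate: "l2b g A \<Longrightarrow> l2b (truncate k g) A"
  by (rule l2b_dominated1[OF _ truncate_measurable norm_truncate_le]) (auto dest: l2b_measurable)

lemma l2b_indicator_cball:
  "l2b (indicator (cball 0 r) :: 'a::euclidean_space \<Rightarrow> complex) (sqrt (measure lborel (cball 0 r :: 'a set)))"
proof (rule l2bI)
  have eq: "(norm (indicator (cball 0 r) x :: complex))\<^sup>2 = indicator (cball 0 r) x" for x :: 'a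
    by (simp add: indicator_def)
  have f: "emeasure lborel (cball 0 r :: 'a set) < \<infinity>"
    by (rule emeasure_bounded_finite) simp
  show "integrable lborel (\<lambda>x::'a. (norm (indicator (cball 0 r) x :: complex))\<^sup>2)"
    unfolding eq using f by (simp add: integrable_indicator_iff)
  show "(\<integral>x. (norm (indicator (cball 0 r) (x::'a) :: complex))\<^sup>2 \<partial>lborel) \<le> (sqrt (measure lborel (cball 0 r :: 'a set)))\<^sup>2"
    unfolding eq by simp
  show "(indicator (cball 0 r) :: 'a \<Rightarrow> complex) \<in> borel_measurable borel"
    by (rule borel_measurable_indicator) (rule cball_sets_borel)
  show "0 \<le> sqrt (measure lborel (cball 0 r :: 'a set))"
    by (rule real_sqrt_ge_zero) (rule measure_nonneg)
qed

lemma integrable_truncate: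
  assumes g: "l2b g A" shows "integrable lborel (truncate k g)"
  unfolding truncate_def[abs_def] by (rule l2b_mult_integrable[OF l2b_indicator_cball g])

lemma eventually_l2b:
  assumes m: "\<And>k. d k \<in> borel_measurable borel" and i: "\<And>k. integrable lborel (\<lambda>x. (norm (d k x))\<^sup>2)"
    and lim: "(\<lambda>k. \<integral>x. (norm (d k x))\<^sup>2 \<partial>lborel) \<longlonglongrightarrow> 0" and e: "0 < e"
  shows "\<forall>\<^sub>F k in sequentially. l2b (d k) e"
proof -
  have "\<forall>\<^sub>F k in sequentially. (\<integral>x. (norm (d k x))\<^sup>2 \<partial>lborel) < e\<^sup>2"
    using lim e by (intro order_tendstoD(2)[OF lim]) simp
  then show ?thesis
    by eventually_elim (use m i e in \<open>auto intro!: l2bI\<close>)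
qed

lemma truncate_tendsto:
  assumes g: "l2b g A" and e: "0 < e"
  shows "\<forall>\<^sub>F k in sequentially. l2b (\<lambda>x. truncate k g x - g x) e"
proof (rule eventually_l2b[OF _ _ _ e])
  have [measurable]: "g \<in> borel_measurable borel" using l2b_measurable[OF g] .
  have lim: "AE x in lborel. (\<lambda>k. truncate k g x) \<longlonglongrightarrow> g x"
  proof (rule AE_I2)
    fix x :: 'a
    obtain N where "norm x \<le> real N" using real_arch_simple by blast
    then have "\<forall>\<^sub>F k in sequentially. truncate k g x = g x"
      by (intro eventually_sequentiallyI[of N]) (auto simp: truncate_def)
    then show "(\<lambda>k. truncate k g x) \<longlonglongrightarrow> g x" by (rule tendsto_eventually)
  qed
  note dc = l2b_dominated_convergence[OF truncate_measurable _ lim g AE_I2[OF norm_truncate_le]]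
  show "(\<lambda>k. \<integral>x. (norm (truncate k g x - g x))\<^sup>2 \<partial>lborel) \<longlonglongrightarrow> 0" by (rule dc(1)) measurable
  show "integrable lborel (\<lambda>x. (norm (truncate k g x - g x))\<^sup>2)" for k by (rule dc(2)) measurable
  show "(\<lambda>x. truncate k g x - g x) \<in> borel_measurable borel" for k by measurable
qed

text \<open>The complex counterpart of \<open>fourier_rel\<close>, with complex test functions and
  with square integrability of both sides built in. As a relation it lets a transform be established
  by exhibiting a candidate.\<close>

definition frel :: "('a::euclidean_space \<Rightarrow> complex) \<Rightarrow> ('a \<Rightarrow> complex) \<Rightarrow> bool" where
  "frel g U \<longleftrightarrow> l2 g \<and> l2 U \<and> (\<forall>\<phi>. integrable lborel \<phi> \<and> l2 \<phi> \<longrightarrow>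
     (\<integral>\<xi>. U \<xi> * \<phi> \<xi> \<partial>lborel) = (\<integral>x. g x * ft \<phi> x \<partial>lborel))"

lemma frelD:
  assumes "frel g U"
  shows "l2 g" "l2 U" "integrable lborel \<phi> \<Longrightarrow> l2 \<phi> \<Longrightarrow> (\<integral>\<xi>. U \<xi> * \<phi> \<xi> \<partial>lborel) = (\<integral>x. g x * ft \<phi> x \<partial>lborel)"
  using assms by (auto simp: frel_def)

lemma l2_ft: "integrable lborel \<phi> \<Longrightarrow> l2 \<phi> \<Longrightarrow> l2 (ft \<phi>)"
  unfolding l2_def using ft_l2b by blast

lemma frel_ft: "integrable lborel g \<Longrightarrow> l2 g \<Longrightarrow> frel g (ft g)"
  by (simp add: frel_def ft_multiplication l2_ft)

text \<open>The real and imaginary parts of \<open>D\<close>, cut off to a ball, are themselves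
  admissible test functions, and with them the vanishing integral becomes that of a square.\<close>

lemma AE_eq_zero_of_tests:
  assumes D: "l2 D"
    and test: "\<And>\<phi>. integrable lborel \<phi> \<Longrightarrow> L2 \<phi> \<Longrightarrow> (\<integral>\<xi>. D \<xi> * complex_of_real (\<phi> \<xi>) \<partial>lborel) = 0"
  shows "AE \<xi> in lborel. D \<xi> = 0"
proof -
  have [measurable]: "D \<in> borel_measurable borel" using l2_measurable[OF D] .
  obtain A where A: "l2b D A" using D by (auto simp: l2_def)
  have part: "AE \<xi> in lborel. p (D \<xi>) = 0"
    if p: "bounded_linear p" "\<And>z. \<bar>p z\<bar> \<le> norm z" "\<And>z r. p (z * complex_of_real r) = p z * r" for p :: "complex \<Rightarrow> real"
  proof -
    have pm: "p \<in> borel_measurable borel"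
      using p(1) by (intro borel_measurable_continuous_onI linear_continuous_on)
    note [measurable] = measurable_compose[OF _ pm]
    have ind: "AE \<xi> in lborel. indicator (cball 0 (real k)) \<xi> * (p (D \<xi>))\<^sup>2 = 0" for k
    proof -
      define \<phi> where "\<phi> \<xi> = indicator (cball 0 (real k)) \<xi> * p (D \<xi>)" for \<xi>
      have [measurable]: "\<phi> \<in> borel_measurable borel" unfolding \<phi>_def[abs_def] by measurable
      have b: "\<bar>\<phi> \<xi>\<bar> \<le> norm (truncate k D \<xi>)" for \<xi>
        using p(2)[of "D \<xi>"] by (simp add: \<phi>_def truncate_def indicator_def)
      have i: "integrable lborel \<phi>"
        by (rule Bochner_Integration.integrable_bound[OF integrable_truncate[OF A, of k]]) (use b in auto)
      have "l2b (\<lambda>x. complex_of_real (\<phi> x)) A"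
        by (rule l2b_dominated1[OF l2b_truncate[OF A, of k]]) (use b in auto)
      then have l: "l2 (\<lambda>x. complex_of_real (\<phi> x))" by (rule l2b_imp_l2)
      then have "(\<integral>\<xi>. D \<xi> * complex_of_real (\<phi> \<xi>) \<partial>lborel) = 0"
        using test i by (simp add: L2_iff_l2)
      moreover have i2: "integrable lborel (\<lambda>\<xi>. D \<xi> * complex_of_real (\<phi> \<xi>))"
        by (rule l2_mult_integrable[OF D l])
      ultimately have "(\<integral>\<xi>. p (D \<xi> * complex_of_real (\<phi> \<xi>)) \<partial>lborel) = 0"
        using integral_bounded_linear[OF p(1) i2] bounded_linear.linear[OF p(1)] by (simp add: linear_0)
      moreover have "p (D \<xi> * complex_of_real (\<phi> \<xi>)) = indicator (cball 0 (real k)) \<xi> * (p (D \<xi>))\<^sup>2" for \<xi>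
        unfolding p(3) by (simp add: \<phi>_def power2_eq_square)
      moreover have "integrable lborel (\<lambda>\<xi>. p (D \<xi> * complex_of_real (\<phi> \<xi>)))"
        by (rule integrable_bounded_linear[OF p(1) i2])
      ultimately show ?thesis
        by (subst integral_nonneg_eq_0_iff_AE[symmetric]) simp_all
    qed
    then have "AE \<xi> in lborel. \<forall>k::nat. indicator (cball 0 (real k)) \<xi> * (p (D \<xi>))\<^sup>2 = 0"
      by (subst AE_all_countable) (rule allI, rule ind)
    then show ?thesis
    proof eventually_elim
      case (elim \<xi>)
      obtain N where "norm \<xi> \<le> real N" using real_arch_simple by blast
      then show ?case using elim[rule_format, of N] by simp
    qed
  qed
  have "AE \<xi> in lborel. Re (D \<xi>) = 0"
    by (rule part) (auto simp: bounded_linear_Re abs_Re_le_cmod)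
  moreover have "AE \<xi> in lborel. Im (D \<xi>) = 0"
    by (rule part) (auto simp: bounded_linear_Im abs_Im_le_cmod)
  ultimately show ?thesis
    by eventually_elim (simp add: complex_eq_iff)
qed

lemma fourier_rel_unique:
  assumes "fourier_rel f U" "fourier_rel f V"
  shows "AE \<xi> in lborel. U \<xi> = V \<xi>"
proof -
  have l: "l2 U" "l2 V"
    using assms by (auto simp: fourier_rel_def intro!: l2b_imp_l2[OF l2bI_sqrt])
  have "AE \<xi> in lborel. U \<xi> - V \<xi> = 0"
  proof (rule AE_eq_zero_of_tests[OF l2_diff[OF l]])
    fix \<phi> :: "'a \<Rightarrow> real" assume \<phi>: "integrable lborel \<phi>" "L2 \<phi>"
    have l\<phi>: "l2 (\<lambda>x. complex_of_real (\<phi> x))" using \<phi> by (simp add: L2_iff_l2)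
    show "(\<integral>\<xi>. (U \<xi> - V \<xi>) * complex_of_real (\<phi> \<xi>) \<partial>lborel) = 0"
      unfolding left_diff_distrib
      by (subst Bochner_Integration.integral_diff) (use \<phi> assms l l\<phi> in \<open>auto simp: fourier_rel_def intro!: l2_mult_integrable\<close>)
  qed
  then show ?thesis by eventually_elim simp
qed

lemma frel_imp_fourier_rel: "frel (\<lambda>x. complex_of_real (f x)) U \<Longrightarrow> fourier_rel f U"
  unfolding fourier_rel_def frel_def
  by (auto simp: L2_iff_l2 ft1_eq_ft l2_measurable intro!: integrable_of_real) (auto simp: l2_def dest: l2b_integrable)

lemma frel_unique:
  assumes U: "frel g U" and V: "frel g V"
  shows "AE \<xi> in lborel. U \<xi> = V \<xi>"
proof -
  note l = frelD(2)[OF U] frelD(2)[OF V]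
  have "AE \<xi> in lborel. U \<xi> - V \<xi> = 0"
  proof (rule AE_eq_zero_of_tests[OF l2_diff[OF l]])
    fix \<phi> :: "'a \<Rightarrow> real" assume \<phi>: "integrable lborel \<phi>" "L2 \<phi>"
    have l\<phi>: "l2 (\<lambda>x. complex_of_real (\<phi> x))" using \<phi> by (simp add: L2_iff_l2)
    have i\<phi>: "integrable lborel (\<lambda>x. complex_of_real (\<phi> x))" using \<phi> by simp
    show "(\<integral>\<xi>. (U \<xi> - V \<xi>) * complex_of_real (\<phi> \<xi>) \<partial>lborel) = 0"
      unfolding left_diff_distrib
      by (subst Bochner_Integration.integral_diff) (simp_all add: l2_mult_integrable l l\<phi> frelD(3)[OF U i\<phi> l\<phi>] frelD(3)[OF V i\<phi> l\<phi>])
  qed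
  then show ?thesis by eventually_elim simp
qed

text \<open>The transforms of the truncations of \<open>g\<close> form a Cauchy sequence with limit
  \<open>U\<close>. Norm bounds in both directions are recorded here because they are inherited from
  the approximants; uniqueness then transfers them to every transform of \<open>g\<close>.\<close>

lemma frel_exists_aux:
  fixes g :: "'a::euclidean_space \<Rightarrow> complex"
  assumes g: "l2 g"
  shows "\<exists>U. frel g U \<and> (\<forall>A. l2b g A \<longrightarrow> l2b U (pc TYPE('a) * A)) \<and> (\<forall>A\<ge>0. l2b U (pc TYPE('a) * A) \<longrightarrow> l2b g A)"
proof -
  let ?c = "pc TYPE('a)"
  have c: "0 < ?c" by (rule pc_pos)
  obtain B where B: "l2b g B" using g by (auto simp: l2_def)
  note B0 = l2b_nonneg[OF B]
  let ?t = "\<lambda>k. truncate k g"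
  have it: "integrable lborel (?t k)" for k by (rule integrable_truncate[OF B])
  have [measurable]: "ft (?t k) \<in> borel_measurable borel" for k using it by (rule ft_measurable)
  have "\<exists>U\<in>borel_measurable borel. \<forall>e>0. \<exists>N. \<forall>n\<ge>N. l2b (\<lambda>\<xi>. ft (?t n) \<xi> - U \<xi>) e"
  proof (rule l2_complete)
    fix e :: real assume e: "0 < e"
    have "0 < e / (2 * ?c)" using e c by simp
    from truncate_tendsto[OF B this] obtain N where N: "\<And>n. N \<le> n \<Longrightarrow> l2b (\<lambda>x. ?t n x - g x) (e / (2 * ?c))"
      by (auto simp: eventually_sequentially)
    have "l2b (\<lambda>x. ft (?t m) x - ft (?t n) x) e" if mn: "N \<le> m" "N \<le> n" for m n
    proof -
      have "l2b (\<lambda>x. (?t m x - g x) - (?t n x - g x)) (e / (2 * ?c) + e / (2 * ?c))"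
        by (intro l2b_diff N mn)
      then have "l2b (\<lambda>x. ?t m x - ?t n x) (e / ?c)" using c by (simp add: field_simps)
      then have "l2b (ft (\<lambda>x. ?t m x - ?t n x)) (?c * (e / ?c))"
        by (intro ft_l2b Bochner_Integration.integrable_diff it)
      moreover have "ft (\<lambda>x. ?t m x - ?t n x) = (\<lambda>x. ft (?t m) x - ft (?t n) x)"
        by (rule ext) (rule ft_diff[OF it it])
      ultimately show ?thesis using c by simp
    qed
    then show "\<exists>N. \<forall>m\<ge>N. \<forall>n\<ge>N. l2b (\<lambda>x. ft (?t m) x - ft (?t n) x) e" by blast
  qed measurable
  then obtain U where Um: "U \<in> borel_measurable borel" and U: "\<And>e. 0 < e \<Longrightarrow> \<exists>N. \<forall>n\<ge>N. l2b (\<lambda>\<xi>. ft (?t n) \<xi> - U \<xi>) e"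
    by auto
  have ap: "\<exists>k. l2b (\<lambda>\<xi>. ft (?t k) \<xi> - U \<xi>) e \<and> l2b (\<lambda>x. ?t k x - g x) e" if "0 < e" for e
  proof -
    obtain N where "\<forall>n\<ge>N. l2b (\<lambda>\<xi>. ft (?t n) \<xi> - U \<xi>) e" using U[OF \<open>0 < e\<close>] by blast
    moreover obtain M where "\<And>n. M \<le> n \<Longrightarrow> l2b (\<lambda>x. ?t n x - g x) e"
      using truncate_tendsto[OF B \<open>0 < e\<close>] by (auto simp: eventually_sequentially)
    ultimately show ?thesis by (intro exI[of _ "max N M"]) auto
  qed
  have bd: "l2b U (?c * A)" if A: "l2b g A" for A
  proof (rule l2b_limit)
    fix e :: real assume "0 < e"
    obtain k where k: "l2b (\<lambda>\<xi>. ft (?t k) \<xi> - U \<xi>) e" using ap[OF \<open>0 < e\<close>] by blast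
    have "l2b (\<lambda>\<xi>. ft (?t k) \<xi> - (ft (?t k) \<xi> - U \<xi>)) (?c * A + e)"
      by (intro l2b_diff k ft_l2b it l2b_truncate A)
    then show "l2b U (?c * A + e)" by simp
  qed (use c l2b_nonneg[OF A] in simp)
  have bd2: "l2b g A" if A: "l2b U (?c * A)" "0 \<le> A" for A
  proof (rule l2b_limit[OF _ A(2)])
    fix e :: real assume e: "0 < e"
    \<comment> \<open>Two errors occur: the one on the frequency side costs \<open>e' / ?c\<close>
      after going back to space, the one on the space side costs \<open>e'\<close>.\<close>
    define e' where "e' = e / (1 / ?c + 1)"
    have c1: "0 < 1 / ?c + 1" using c by (simp add: add_pos_pos)
    have e': "0 < e'" "e' / ?c + e' = e"
      using e c1 unfolding e'_def by (simp, metis (no_types, lifting) c1 distrib_left less_irrefl mult.right_neutral nonzero_mult_div_cancel_right times_divide_eq_left times_divide_eq_right)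
    obtain k where k: "l2b (\<lambda>\<xi>. ft (?t k) \<xi> - U \<xi>) e'" "l2b (\<lambda>x. ?t k x - g x) e'" using ap[OF e'(1)] by blast
    have "l2b (\<lambda>\<xi>. (ft (?t k) \<xi> - U \<xi>) + U \<xi>) (e' + ?c * A)" by (intro l2b_add k A)
    then have "l2b (ft (?t k)) (?c * (e' / ?c + A))" using c by (simp add: distrib_left)
    then have "l2b (?t k) (e' / ?c + A)"
      by (rule ft_l2b_iff[OF it l2b_truncate[OF B]]) (use e' c A in simp)
    from l2b_diff[OF this k(2)] have "l2b g (e' / ?c + A + e')" by simp
    then show "l2b g (A + e)" using e'(2) by (simp add: algebra_simps)
  qed
  have lU: "l2 U" using bd[OF B] by (rule l2b_imp_l2)
  have "(\<integral>\<xi>. U \<xi> * \<phi> \<xi> \<partial>lborel) = (\<integral>x. g x * ft \<phi> x \<partial>lborel)" if \<phi>: "integrable lborel \<phi>" "l2 \<phi>" for \<phi>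
  proof -
    obtain C where C: "l2b \<phi> C" using \<phi> by (auto simp: l2_def)
    note C0 = l2b_nonneg[OF C]
    have fC: "l2b (ft \<phi>) (?c * C)" by (rule ft_l2b[OF \<phi>(1) C])
    have "norm ((\<integral>x. g x * ft \<phi> x \<partial>lborel) - (\<integral>\<xi>. U \<xi> * \<phi> \<xi> \<partial>lborel)) \<le> e" if e: "0 < e" for e
    proof -
      \<comment> \<open>The two approximation errors are tested against \<open>\<phi>\<close> and
        its transform, of norms \<open>C\<close> and \<open>?c * C\<close>; the 1 keeps the
        denominator positive.\<close>
      define e' where "e' = e / (C + ?c * C + 1)"
      have "0 < C + ?c * C + 1" using C0 c by (simp add: add_nonneg_pos)
      then have e': "0 < e'" "e' * (C + ?c * C) \<le> e"
        using e C0 c by (auto simp: e'_def divide_le_eq mult_left_mono)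
      obtain k where k: "l2b (\<lambda>\<xi>. ft (?t k) \<xi> - U \<xi>) e'" "l2b (\<lambda>x. ?t k x - g x) e'" using ap[OF e'(1)] by blast
      note lt = l2b_truncate[OF B, of k]
      have "(\<integral>\<xi>. (ft (?t k) \<xi> - U \<xi>) * \<phi> \<xi> \<partial>lborel) = (\<integral>\<xi>. ft (?t k) \<xi> * \<phi> \<xi> \<partial>lborel) - (\<integral>\<xi>. U \<xi> * \<phi> \<xi> \<partial>lborel)"
        unfolding left_diff_distrib
        by (intro Bochner_Integration.integral_diff l2b_mult_integrable[OF ft_l2b[OF it lt] C] l2b_mult_integrable[OF bd[OF B] C])
      moreover have "(\<integral>x. (?t k x - g x) * ft \<phi> x \<partial>lborel) = (\<integral>x. ?t k x * ft \<phi> x \<partial>lborel) - (\<integral>x. g x * ft \<phi> x \<partial>lborel)"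
        unfolding left_diff_distrib
        by (intro Bochner_Integration.integral_diff l2b_mult_integrable[OF lt fC] l2b_mult_integrable[OF B fC])
      moreover have "(\<integral>\<xi>. ft (?t k) \<xi> * \<phi> \<xi> \<partial>lborel) = (\<integral>x. ?t k x * ft \<phi> x \<partial>lborel)"
        by (rule ft_multiplication[OF it \<phi>(1)])
      ultimately have "(\<integral>x. g x * ft \<phi> x \<partial>lborel) - (\<integral>\<xi>. U \<xi> * \<phi> \<xi> \<partial>lborel) =
        (\<integral>\<xi>. (ft (?t k) \<xi> - U \<xi>) * \<phi> \<xi> \<partial>lborel) - (\<integral>x. (?t k x - g x) * ft \<phi> x \<partial>lborel)" by simp
      also have "norm \<dots> \<le> e' * C + e' * (?c * C)"
        by (intro order_trans[OF norm_triangle_ineq4] add_mono l2b_mult_integral[OF k(1) C] l2b_mult_integral[OF k(2) fC])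
      also have "\<dots> \<le> e" using e' by (simp add: distrib_left)
      finally show ?thesis .
    qed
    then have "norm ((\<integral>x. g x * ft \<phi> x \<partial>lborel) - (\<integral>\<xi>. U \<xi> * \<phi> \<xi> \<partial>lborel)) \<le> 0"
      by (rule field_le_epsilon[where y = 0, simplified])
    then show ?thesis by simp
  qed
  then have "frel g U" using g lU by (simp add: frel_def)
  then show ?thesis using bd bd2 by blast
qed

lemma frel_exists: "l2 g \<Longrightarrow> \<exists>U. frel g U"
  using frel_exists_aux by blast

lemma
  fixes g :: "'a::euclidean_space \<Rightarrow> complex"
  assumes U: "frel g U"
  shows frel_l2b: "l2b g A \<Longrightarrow> l2b U (pc TYPE('a) * A)"
    and frel_l2b': "l2b U (pc TYPE('a) * A) \<Longrightarrow> 0 \<le> A \<Longrightarrow> l2b g A"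
proof -
  obtain V where V: "frel g V" "\<And>A. l2b g A \<Longrightarrow> l2b V (pc TYPE('a) * A)" "\<And>A. 0 \<le> A \<Longrightarrow> l2b V (pc TYPE('a) * A) \<Longrightarrow> l2b g A"
    using frel_exists_aux[OF frelD(1)[OF U]] by blast
  have eq: "AE \<xi> in lborel. U \<xi> = V \<xi>" by (rule frel_unique[OF U V(1)])
  have eq': "AE \<xi> in lborel. V \<xi> = U \<xi>" using eq by eventually_elim simp
  show "l2b U (pc TYPE('a) * A)" if "l2b g A"
    by (rule l2b_cong_AE[OF V(2)[OF that] l2_measurable[OF frelD(2)[OF U]] eq])
  show "l2b g A" if "l2b U (pc TYPE('a) * A)" "0 \<le> A"
    by (rule V(3)[OF that(2) l2b_cong_AE[OF that(1) l2_measurable[OF frelD(2)[OF V(1)]] eq']])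
qed

section \<open>Algebraic rules, Parseval's identity and inversion\<close>

lemma frel_add:
  assumes U: "frel f U" and V: "frel g V" shows "frel (\<lambda>x. f x + g x) (\<lambda>\<xi>. U \<xi> + V \<xi>)"
proof -
  note [simp] = frelD(1,2)[OF U] frelD(1,2)[OF V]
  show ?thesis
    unfolding frel_def distrib_right
    by (auto simp: l2_add l2_mult_integrable l2_ft frelD(3)[OF U] frelD(3)[OF V])
qed

lemma frel_cmult:
  assumes U: "frel f U" shows "frel (\<lambda>x. c * f x) (\<lambda>\<xi>. c * U \<xi>)"
proof -
  note [simp] = frelD(1,2)[OF U]
  show ?thesis
    unfolding frel_def mult.assoc by (auto simp: l2_cmult frelD(3)[OF U])
qed

lemma frel_diff:
  assumes U: "frel f U" and V: "frel g V" shows "frel (\<lambda>x. f x - g x) (\<lambda>\<xi>. U \<xi> - V \<xi>)"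
  using frel_add[OF U frel_cmult[OF V, of "-1"]] by simp

lemma frel_reflect:
  assumes U: "frel f U" shows "frel (\<lambda>x. f (- x)) (\<lambda>\<xi>. U (- \<xi>))"
  unfolding frel_def
proof (intro conjI allI impI)
  note l = frelD(1,2)[OF U]
  show "l2 (\<lambda>x. f (- x))" "l2 (\<lambda>\<xi>. U (- \<xi>))" using l by (auto intro: l2_reflect)
  fix \<phi> :: "'a \<Rightarrow> complex" assume \<phi>: "integrable lborel \<phi> \<and> l2 \<phi>"
  have [measurable]: "U \<in> borel_measurable borel" "f \<in> borel_measurable borel" "\<phi> \<in> borel_measurable borel" "ft \<phi> \<in> borel_measurable borel"
    using l \<phi> by (auto intro: l2_measurable ft_measurable)
  have "(\<integral>\<xi>. U (- \<xi>) * \<phi> \<xi> \<partial>lborel) = (\<integral>\<xi>. U \<xi> * \<phi> (- \<xi>) \<partial>lborel)"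
    using integral_lborel_reflect[of "\<lambda>\<xi>. U \<xi> * \<phi> (- \<xi>)"] by simp
  also have "\<dots> = (\<integral>x. f x * ft (\<lambda>\<xi>. \<phi> (- \<xi>)) x \<partial>lborel)"
    by (rule frelD(3)[OF U]) (use \<phi> in \<open>auto simp: integrable_lborel_reflect intro: l2_reflect\<close>)
  also have "\<dots> = (\<integral>x. f x * ft \<phi> (- x) \<partial>lborel)"
    by (subst ft_reflect) auto
  also have "\<dots> = (\<integral>x. f (- x) * ft \<phi> x \<partial>lborel)"
    using integral_lborel_reflect[of "\<lambda>x. f x * ft \<phi> (- x)"] by simp
  finally show "(\<integral>\<xi>. U (- \<xi>) * \<phi> \<xi> \<partial>lborel) = (\<integral>x. f (- x) * ft \<phi> x \<partial>lborel)" .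
qed

lemma frel_cnj:
  assumes U: "frel f U" shows "frel (\<lambda>x. cnj (f x)) (\<lambda>\<xi>. cnj (U (- \<xi>)))"
  unfolding frel_def
proof (intro conjI allI impI)
  note l = frelD(1,2)[OF U]
  note R = frel_reflect[OF U]
  show "l2 (\<lambda>x. cnj (f x))" "l2 (\<lambda>\<xi>. cnj (U (- \<xi>)))" using l by (auto intro: l2_reflect l2_cnj)
  fix \<phi> :: "'a \<Rightarrow> complex" assume \<phi>: "integrable lborel \<phi> \<and> l2 \<phi>"
  have [measurable]: "f \<in> borel_measurable borel" "ft \<phi> \<in> borel_measurable borel"
    using l \<phi> by (auto intro: l2_measurable ft_measurable)
  have "(\<integral>\<xi>. cnj (U (- \<xi>)) * \<phi> \<xi> \<partial>lborel) = (\<integral>\<xi>. cnj (U (- \<xi>) * cnj (\<phi> \<xi>)) \<partial>lborel)" by simp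
  also have "\<dots> = cnj (\<integral>\<xi>. U (- \<xi>) * cnj (\<phi> \<xi>) \<partial>lborel)" by (rule Bochner_Integration.integral_cnj)
  also have "(\<integral>\<xi>. U (- \<xi>) * cnj (\<phi> \<xi>) \<partial>lborel) = (\<integral>x. f (- x) * ft (\<lambda>\<xi>. cnj (\<phi> \<xi>)) x \<partial>lborel)"
    by (rule frelD(3)[OF R]) (use \<phi> in \<open>auto intro: l2_cnj\<close>)
  also have "\<dots> = (\<integral>x. f (- x) * cnj (ft \<phi> (- x)) \<partial>lborel)"
    by (simp add: ft_cnj)
  also have "\<dots> = (\<integral>x. f x * cnj (ft \<phi> x) \<partial>lborel)"
    by (rule integral_lborel_reflect[of "\<lambda>x. f x * cnj (ft \<phi> x)"]) measurable
  also have "cnj \<dots> = (\<integral>x. cnj (f x) * ft \<phi> x \<partial>lborel)"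
    unfolding Bochner_Integration.integral_cnj[symmetric] by simp
  finally show "(\<integral>\<xi>. cnj (U (- \<xi>)) * \<phi> \<xi> \<partial>lborel) = (\<integral>x. cnj (f x) * ft \<phi> x \<partial>lborel)" .
qed

lemma frel_Plancherel:
  fixes g :: "'a::euclidean_space \<Rightarrow> complex"
  assumes U: "frel g U"
  shows "(\<integral>\<xi>. (norm (U \<xi>))\<^sup>2 \<partial>lborel) = (pc TYPE('a))\<^sup>2 * (\<integral>x. (norm (g x))\<^sup>2 \<partial>lborel)"
proof (rule antisym)
  let ?c = "pc TYPE('a)" and ?U = "\<integral>\<xi>. (norm (U \<xi>))\<^sup>2 \<partial>lborel" and ?g = "\<integral>x. (norm (g x))\<^sup>2 \<partial>lborel"
  have c: "0 < ?c" by (rule pc_pos)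
  have g: "l2b g (sqrt ?g)" and Ub: "l2b U (sqrt ?U)"
    using frelD(1,2)[OF U] by (auto simp: l2_def intro!: l2bI_sqrt dest: l2b_measurable l2b_integrable)
  have nn: "0 \<le> ?g" "0 \<le> ?U" by (auto intro: integral_nonneg)
  show "?U \<le> ?c\<^sup>2 * ?g"
    using l2b_integral[OF frel_l2b[OF U g]] nn by (simp add: power_mult_distrib)
  have "l2b U (?c * (sqrt ?U / ?c))" using Ub c by simp
  then have "l2b g (sqrt ?U / ?c)" by (rule frel_l2b'[OF U]) (use c nn in simp)
  from l2b_integral[OF this] have "?g \<le> ?U / ?c\<^sup>2" using nn by (simp add: power_divide)
  then show "?c\<^sup>2 * ?g \<le> ?U" using c by (simp add: field_simps)
qed

text \<open>Polarisation of \<open>frel_Plancherel\<close> gives the real parts; the imaginary parts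
  are real parts for \<open>\<i> * g\<close>.\<close>

lemma frel_Parseval:
  fixes g h :: "'a::euclidean_space \<Rightarrow> complex"
  assumes U: "frel g U" and V: "frel h V"
  shows "(\<integral>\<xi>. U \<xi> * cnj (V \<xi>) \<partial>lborel) = complex_of_real ((pc TYPE('a))\<^sup>2) * (\<integral>x. g x * cnj (h x) \<partial>lborel)"
proof -
  let ?c = "(pc TYPE('a))\<^sup>2"
  have pol: "4 * Re (\<integral>x. f x * cnj (k x) \<partial>lborel) = (\<integral>x. (norm (f x + k x))\<^sup>2 \<partial>lborel) - (\<integral>x. (norm (f x - k x))\<^sup>2 \<partial>lborel)"
    if "l2 f" "l2 k" for f k :: "'a \<Rightarrow> complex"
  proof -
    have i: "integrable lborel (\<lambda>x. f x * cnj (k x))" by (intro l2_mult_integrable l2_cnj that)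
    have i2: "integrable lborel (\<lambda>x. (norm (f x + k x))\<^sup>2)" "integrable lborel (\<lambda>x. (norm (f x - k x))\<^sup>2)"
      using l2_add[OF that] l2_diff[OF that] by (auto simp: l2_def dest: l2b_integrable)
    have pt: "4 * Re (a * cnj b) = (norm (a + b))\<^sup>2 - (norm (a - b))\<^sup>2" for a b :: complex
      unfolding cmod_power2 by (simp add: power2_eq_square algebra_simps)
    have "4 * Re (\<integral>x. f x * cnj (k x) \<partial>lborel) = (\<integral>x. 4 * Re (f x * cnj (k x)) \<partial>lborel)"
      unfolding integral_bounded_linear[OF bounded_linear_Re i, symmetric] by (rule integral_mult_right_zero[symmetric])
    also have "\<dots> = (\<integral>x. (norm (f x + k x))\<^sup>2 - (norm (f x - k x))\<^sup>2 \<partial>lborel)" unfolding pt ..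
    finally show ?thesis using i2 by simp
  qed
  have re: "Re (\<integral>\<xi>. W \<xi> * cnj (V \<xi>) \<partial>lborel) = ?c * Re (\<integral>x. k x * cnj (h x) \<partial>lborel)" if W: "frel k W" for k W
  proof -
    have "4 * Re (\<integral>\<xi>. W \<xi> * cnj (V \<xi>) \<partial>lborel) = ?c * (4 * Re (\<integral>x. k x * cnj (h x) \<partial>lborel))"
      unfolding pol[OF frelD(1)[OF W] frelD(1)[OF V]] pol[OF frelD(2)[OF W] frelD(2)[OF V]]
        frel_Plancherel[OF frel_add[OF W V]] frel_Plancherel[OF frel_diff[OF W V]]
      by (simp add: right_diff_distrib)
    then show ?thesis by simp
  qed
  have "Im (\<integral>\<xi>. U \<xi> * cnj (V \<xi>) \<partial>lborel) = - Re (\<integral>\<xi>. \<i> * U \<xi> * cnj (V \<xi>) \<partial>lborel)"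
    unfolding mult.assoc integral_mult_right_zero by simp
  also have "\<dots> = - (?c * Re (\<integral>x. \<i> * g x * cnj (h x) \<partial>lborel))"
    unfolding re[OF frel_cmult[OF U]] ..
  also have "\<dots> = ?c * Im (\<integral>x. g x * cnj (h x) \<partial>lborel)"
    unfolding mult.assoc integral_mult_right_zero by simp
  finally show ?thesis
    using re[OF U] by (simp add: complex_eq_iff)
qed

text \<open>Reflecting and conjugating a test function conjugates its transform, so Parseval's
  identity with this function is the defining identity for a transform of \<open>U\<close>.\<close>

lemma frel_inversion:
  fixes g :: "'a::euclidean_space \<Rightarrow> complex"
  assumes U: "frel g U"
  shows "frel U (\<lambda>x. complex_of_real ((pc TYPE('a))\<^sup>2) * g (- x))"
  unfolding frel_def
proof (intro conjI allI impI)
  note l = frelD(1,2)[OF U]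
  show "l2 U" "l2 (\<lambda>x. complex_of_real ((pc TYPE('a))\<^sup>2) * g (- x))" using l by (auto intro: l2_cmult l2_reflect)
  fix \<phi> :: "'a \<Rightarrow> complex" assume \<phi>: "integrable lborel \<phi> \<and> l2 \<phi>"
  have [measurable]: "g \<in> borel_measurable borel" "\<phi> \<in> borel_measurable borel"
    using l \<phi> by (auto intro: l2_measurable)
  have "frel \<phi> (ft \<phi>)" using \<phi> by (auto intro: frel_ft)
  from frel_cnj[OF frel_reflect[OF this]] have V: "frel (\<lambda>x. cnj (\<phi> (- x))) (\<lambda>x. cnj (ft \<phi> x))" by simp
  have "complex_of_real ((pc TYPE('a))\<^sup>2) * (\<integral>x. g x * \<phi> (- x) \<partial>lborel) = (\<integral>\<xi>. U \<xi> * ft \<phi> \<xi> \<partial>lborel)"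
    using frel_Parseval[OF U V] by simp
  moreover have "(\<integral>x. g x * \<phi> (- x) \<partial>lborel) = (\<integral>x. g (- x) * \<phi> x \<partial>lborel)"
    using integral_lborel_reflect[of "\<lambda>x. g x * \<phi> (- x)"] by simp
  ultimately show "(\<integral>x. complex_of_real ((pc TYPE('a))\<^sup>2) * g (- x) * \<phi> x \<partial>lborel) = (\<integral>\<xi>. U \<xi> * ft \<phi> \<xi> \<partial>lborel)"
    unfolding mult.assoc by simp
qed

text \<open>Transforming twice reflects and multiplies by the square of \<open>pc\<close>; undoing
  both gives a preimage. This is what turns a formula on the Fourier side into a function of
  x.\<close>

lemma frel_surj:
  fixes U :: "'a::euclidean_space \<Rightarrow> complex"
  assumes U: "l2 U"
  shows "\<exists>g. frel g U"
proof -
  let ?c = "complex_of_real ((pc TYPE('a))\<^sup>2)"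
  obtain V where "frel U V" using frel_exists[OF U] by blast
  from frel_cmult[OF frel_reflect[OF frel_inversion[OF this]], of "1 / ?c"]
  have "frel (\<lambda>x. 1 / ?c * V (- x)) (\<lambda>\<xi>. 1 / ?c * (?c * U \<xi>))" by simp
  moreover have "1 / ?c * (?c * U \<xi>) = U \<xi>" for \<xi> using pc_pos[where 'a='a] by simp
  ultimately show ?thesis by auto
qed

lemma frel_cong_AE:
  assumes U: "frel g U" and e: "AE x in lborel. g x = h x" "AE \<xi> in lborel. U \<xi> = V \<xi>"
    and m: "h \<in> borel_measurable borel" "V \<in> borel_measurable borel"
  shows "frel h V"
  unfolding frel_def
proof (intro conjI allI impI)
  have e': "AE x in lborel. h x = g x" "AE \<xi> in lborel. V \<xi> = U \<xi>"
    using e by (auto elim: eventually_mono)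
  show l: "l2 h" "l2 V"
    using frelD(1,2)[OF U] l2b_cong_AE[OF _ m(1) e'(1)] l2b_cong_AE[OF _ m(2) e'(2)] by (auto simp: l2_def)
  fix \<phi> :: "'a \<Rightarrow> complex" assume \<phi>: "integrable lborel \<phi> \<and> l2 \<phi>"
  then have [measurable]: "\<phi> \<in> borel_measurable borel" "ft \<phi> \<in> borel_measurable borel"
    by (auto intro: l2_measurable ft_measurable)
  note [measurable] = m l2_measurable[OF frelD(1)[OF U]] l2_measurable[OF frelD(2)[OF U]]
  have "(\<integral>\<xi>. V \<xi> * \<phi> \<xi> \<partial>lborel) = (\<integral>\<xi>. U \<xi> * \<phi> \<xi> \<partial>lborel)"
    by (rule integral_cong_AE) (use e'(2) in \<open>auto elim!: eventually_mono\<close>)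
  also have "\<dots> = (\<integral>x. g x * ft \<phi> x \<partial>lborel)" using \<phi> by (auto intro: frelD(3)[OF U])
  also have "\<dots> = (\<integral>x. h x * ft \<phi> x \<partial>lborel)"
    by (rule integral_cong_AE) (use e(1) in \<open>auto elim!: eventually_mono\<close>)
  finally show "(\<integral>\<xi>. V \<xi> * \<phi> \<xi> \<partial>lborel) = (\<integral>x. h x * ft \<phi> x \<partial>lborel)" .
qed

lemma frel_inj:
  fixes g h :: "'a::euclidean_space \<Rightarrow> complex"
  assumes "frel g U" "frel h V" "AE \<xi> in lborel. U \<xi> = V \<xi>"
  shows "AE x in lborel. g x = h x"
proof -
  have d: "frel (\<lambda>x. g x - h x) (\<lambda>\<xi>. U \<xi> - V \<xi>)" by (rule frel_diff[OF assms(1,2)])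
  have "AE \<xi> in lborel. U \<xi> - V \<xi> = 0" using assms(3) by eventually_elim simp
  then have "l2b (\<lambda>\<xi>. U \<xi> - V \<xi>) 0"
    using l2b_cong_AE[OF l2b_zero[of 0] l2_measurable[OF frelD(2)[OF d]]] by simp
  then have "l2b (\<lambda>\<xi>. U \<xi> - V \<xi>) (pc TYPE('a) * 0)" by simp
  then have z: "l2b (\<lambda>x. g x - h x) 0" by (rule frel_l2b'[OF d]) simp
  have "(\<integral>x. (norm (g x - h x))\<^sup>2 \<partial>lborel) = 0"
    using l2b_integral[OF z] by (intro antisym integral_nonneg) auto
  then have "AE x in lborel. (norm (g x - h x))\<^sup>2 = 0"
    using l2b_integrable[OF z] by (subst (asm) integral_nonneg_eq_0_iff_AE) auto
  then show ?thesis by eventually_elim simp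
qed

text \<open>For Hermitian \<open>U\<close> a preimage and its conjugate have the same transform, so
  the preimage is real almost everywhere.\<close>

lemma frel_surj_real:
  assumes U: "l2 U" and herm: "AE \<xi> in lborel. U (- \<xi>) = cnj (U \<xi>)"
  shows "\<exists>f. frel (\<lambda>x. complex_of_real (f x)) U"
proof -
  obtain g where g: "frel g U" using frel_surj[OF U] by blast
  have "AE \<xi> in lborel. cnj (U (- \<xi>)) = U \<xi>" using herm by eventually_elim simp
  from frel_inj[OF frel_cnj[OF g] g this] have "AE x in lborel. g x = complex_of_real (Re (g x))"
    by eventually_elim (simp add: complex_eq_iff)
  then have "frel (\<lambda>x. complex_of_real (Re (g x))) U"
    by (rule frel_cong_AE[OF g]) (use l2_measurable[OF frelD(1)[OF g]] l2_measurable[OF U] in auto)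
  then show ?thesis by (intro exI[of _ "\<lambda>x. Re (g x)"])
qed

text \<open>Existence makes the choice in \<open>FT\<close> meaningful. Only real test functions
  enter \<open>fourier_rel\<close>, but they already determine a transform almost everywhere, so
  \<open>FT f\<close> agrees with one in the sense of \<open>frel\<close>.\<close>

lemma FT_frel:
  assumes "L2 f" shows "frel (\<lambda>x. complex_of_real (f x)) (FT f)"
proof -
  have l: "l2 (\<lambda>x. complex_of_real (f x))" using assms by (simp add: L2_iff_l2)
  then obtain U where U: "frel (\<lambda>x. complex_of_real (f x)) U" using frel_exists by blast
  note rU = frel_imp_fourier_rel[OF U]
  have F: "fourier_rel f (FT f)" unfolding FT_def by (rule someI[of "fourier_rel f", OF rU])
  then have m: "FT f \<in> borel_measurable borel" by (simp add: fourier_rel_def)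
  show ?thesis
    by (rule frel_cong_AE[OF U _ fourier_rel_unique[OF rU F] l2_measurable[OF l] m]) simp
qed

lemma FT_eq_AE:
  assumes "frel (\<lambda>x. complex_of_real (f x)) U"
  shows "AE \<xi> in lborel. FT f \<xi> = U \<xi>"
proof -
  have "L2 f" using frelD(1)[OF assms] by (simp add: L2_iff_l2)
  then show ?thesis by (rule frel_unique[OF FT_frel assms])
qed

section \<open>The fundamental solutions on the Fourier side\<close>

text \<open>The exponential generating function of \<open>d\<close>: differentiation shifts the
  coefficients, so a linear equation with constant coefficients becomes a recurrence.\<close>

definition eser :: "(nat \<Rightarrow> real) \<Rightarrow> real \<Rightarrow> real" where
  "eser d r = (\<Sum>m. d m / fact m * r ^ m)"

lemma eser_summable:
  fixes d :: "nat \<Rightarrow> real"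
  assumes "\<And>m. \<bar>d m\<bar> \<le> C * B ^ m"
  shows "summable (\<lambda>m. d m / fact m * r ^ m)"
proof (rule summable_comparison_test'[of _ 0])
  show "summable (\<lambda>m. C * (inverse (fact m) * (\<bar>B\<bar> * \<bar>r\<bar>) ^ m))"
    by (intro summable_mult summable_exp)
  fix m :: nat
  have "\<bar>d m\<bar> \<le> \<bar>C\<bar> * \<bar>B\<bar> ^ m"
    using assms[of m] abs_ge_self[of "C * B ^ m"] by (simp add: abs_mult power_abs)
  moreover have "0 \<le> C" using assms[of 0] by simp
  ultimately have "\<bar>d m\<bar> * \<bar>r\<bar> ^ m / fact m \<le> C * \<bar>B\<bar> ^ m * \<bar>r\<bar> ^ m / fact m"
    by (intro divide_right_mono mult_right_mono) auto
  then show "norm (d m / fact m * r ^ m) \<le> C * (inverse (fact m) * (\<bar>B\<bar> * \<bar>r\<bar>) ^ m)"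
    by (simp add: abs_mult power_abs power_mult_distrib field_simps)
qed

lemma eser_deriv:
  assumes "\<And>m. \<bar>d m\<bar> \<le> C * B ^ m"
  shows "(eser d has_real_derivative eser (\<lambda>m. d (Suc m)) r) (at r)"
proof -
  have "((\<lambda>x. \<Sum>n. (d n / fact n) * x ^ n) has_field_derivative (\<Sum>n. diffs (\<lambda>n. d n / fact n) n * r ^ n)) (at r)"
    by (rule termdiffs_strong_converges_everywhere) (rule eser_summable[OF assms])
  moreover have "diffs (\<lambda>n. d n / fact n) n = d (Suc n) / fact n" for n
    by (simp add: diffs_def field_simps del: of_nat_Suc)
  ultimately show ?thesis by (simp add: eser_def[abs_def])
qed

lemma eser_0: "eser d 0 = d 0"
  unfolding eser_def using powser_zero[of "\<lambda>m. d m / fact m"] by simp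

text \<open>The derivatives at 0 of the solution with data number j and a = 1.\<close>

fun kcoef :: "real \<Rightarrow> nat \<Rightarrow> nat \<Rightarrow> real" where
  "kcoef \<eta> j 0 = (if j = 0 then 1 else 0)"
| "kcoef \<eta> j (Suc 0) = (if j = 1 then 1 else 0)"
| "kcoef \<eta> j (Suc (Suc 0)) = (if j = 2 then 1 else 0)"
| "kcoef \<eta> j (Suc (Suc (Suc m))) = - (\<eta> * kcoef \<eta> j (Suc (Suc m)) + \<eta> * kcoef \<eta> j (Suc m) + kcoef \<eta> j m)"

text \<open>The base is the sum of the absolute values of the recurrence coefficients. Geometric
  growth makes the exponential series converge everywhere.\<close>

lemma kcoef_bound: "\<bar>kcoef \<eta> j m\<bar> \<le> (2 * \<bar>\<eta>\<bar> + 1) ^ m"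
proof (induction \<eta> j m rule: kcoef.induct)
  case (4 \<eta> j m)
  let ?B = "2 * \<bar>\<eta>\<bar> + 1"
  have p: "?B ^ m \<le> ?B ^ Suc (Suc m)" "?B ^ Suc m \<le> ?B ^ Suc (Suc m)"
    by (intro power_increasing; simp)+
  have "\<bar>kcoef \<eta> j (Suc (Suc (Suc m)))\<bar> \<le> \<bar>\<eta>\<bar> * \<bar>kcoef \<eta> j (Suc (Suc m))\<bar> + \<bar>\<eta>\<bar> * \<bar>kcoef \<eta> j (Suc m)\<bar> + \<bar>kcoef \<eta> j m\<bar>"
  proof -
    have "\<bar>- (x + y + z)\<bar> \<le> \<bar>x\<bar> + \<bar>y\<bar> + \<bar>z\<bar>" for x y z :: real by arith
    from this[of "\<eta> * kcoef \<eta> j (Suc (Suc m))" "\<eta> * kcoef \<eta> j (Suc m)" "kcoef \<eta> j m"]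
    show ?thesis unfolding kcoef.simps(4) by (simp only: abs_mult)
  qed
  also have "\<dots> \<le> \<bar>\<eta>\<bar> * ?B ^ Suc (Suc m) + \<bar>\<eta>\<bar> * ?B ^ Suc (Suc m) + ?B ^ Suc (Suc m)"
    using 4 p by (intro add_mono mult_left_mono) auto
  also have "\<dots> = ?B ^ Suc (Suc (Suc m))" by (simp add: algebra_simps)
  finally show ?case .
next
  case (3 \<eta> j)
  show ?case using one_le_power[of "2 * \<bar>\<eta>\<bar> + 1" 2] by (simp add: power2_eq_square)
qed auto

lemma kcoef_eq_0: "j \<le> 2 \<Longrightarrow> m < j \<Longrightarrow> kcoef \<eta> j m = 0"
  by (cases m rule: nat.exhaust; cases "m - 1" rule: nat.exhaust) (auto simp: numeral_2_eq_2 less_Suc_eq le_Suc_eq)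

text \<open>By homogeneity the solution of the equation with parameter a is obtained from the one with a = 1;
  truncated subtraction is harmless because the coefficients of index below j vanish.\<close>

definition acoef :: "real \<Rightarrow> real \<Rightarrow> nat \<Rightarrow> nat \<Rightarrow> real" where
  "acoef \<eta> a j m = a ^ (m - j) * kcoef \<eta> j m"

lemma acoef_rec:
  assumes j: "j \<le> 2"
  shows "acoef \<eta> a j (Suc (Suc (Suc m))) = - (\<eta> * a * acoef \<eta> a j (Suc (Suc m)) + \<eta> * a\<^sup>2 * acoef \<eta> a j (Suc m) + a ^ 3 * acoef \<eta> a j m)"
proof -
  have "a ^ (Suc (Suc (Suc m)) - j) * kcoef \<eta> j (Suc (Suc m)) = a * acoef \<eta> a j (Suc (Suc m))"
    using j by (auto simp: acoef_def Suc_diff_le)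
  moreover have "a ^ (Suc (Suc (Suc m)) - j) * kcoef \<eta> j (Suc m) = a\<^sup>2 * acoef \<eta> a j (Suc m)"
    using kcoef_eq_0[OF j, of "Suc m" \<eta>] by (cases "j \<le> Suc m") (auto simp: acoef_def Suc_diff_le power2_eq_square)
  moreover have "a ^ (Suc (Suc (Suc m)) - j) * kcoef \<eta> j m = a ^ 3 * acoef \<eta> a j m"
    using kcoef_eq_0[OF j, of m \<eta>] by (cases "j \<le> m") (auto simp: acoef_def Suc_diff_le power3_eq_cube)
  ultimately show ?thesis
    by (subst acoef_def) (simp add: algebra_simps)
qed

lemma acoef_bound: "\<bar>acoef \<eta> a j m\<bar> \<le> 1 * ((2 * \<bar>\<eta>\<bar> + 1) * (1 + \<bar>a\<bar>)) ^ m"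
proof -
  have "\<bar>a\<bar> ^ (m - j) \<le> (1 + \<bar>a\<bar>) ^ (m - j)" by (intro power_mono) auto
  also have "\<dots> \<le> (1 + \<bar>a\<bar>) ^ m" by (intro power_increasing) auto
  finally have "\<bar>a\<bar> ^ (m - j) * \<bar>kcoef \<eta> j m\<bar> \<le> (1 + \<bar>a\<bar>) ^ m * (2 * \<bar>\<eta>\<bar> + 1) ^ m"
    by (intro mult_mono kcoef_bound) auto
  then show ?thesis by (simp add: acoef_def abs_mult power_abs power_mult_distrib mult.commute)
qed

lemma shift_bound:
  fixes d :: "nat \<Rightarrow> real"
  assumes "\<And>m. \<bar>d m\<bar> \<le> C * B ^ m"
  shows "\<bar>d (Suc m)\<bar> \<le> (C * B) * B ^ m"
  using assms[of "Suc m"] by (simp add: ac_simps)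

lemma fund_ode_eser:
  assumes j: "j \<le> 2"
  shows "fund_ode \<eta> a j (eser (acoef \<eta> a j))"
  unfolding fund_ode_def
proof (intro exI allI conjI)
  let ?d = "acoef \<eta> a j"
  note b0 = acoef_bound[of \<eta> a j] note b1 = shift_bound[OF b0] note b2 = shift_bound[OF b1] note b3 = shift_bound[OF b2]
  fix t
  show "(eser ?d has_real_derivative eser (\<lambda>m. ?d (Suc m)) t) (at t)" by (rule eser_deriv[OF b0])
  show "(eser (\<lambda>m. ?d (Suc m)) has_real_derivative eser (\<lambda>m. ?d (Suc (Suc m))) t) (at t)" by (rule eser_deriv[OF b1])
  show "(eser (\<lambda>m. ?d (Suc (Suc m))) has_real_derivative eser (\<lambda>m. ?d (Suc (Suc (Suc m)))) t) (at t)" by (rule eser_deriv[OF b2])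
  note s0 = eser_summable[OF b0, of t] note s1 = eser_summable[OF b1, of t] note s2 = eser_summable[OF b2, of t]
    note s3 = eser_summable[OF b3, of t]
  have "eser (\<lambda>m. ?d (Suc (Suc (Suc m)))) t + \<eta> * a * eser (\<lambda>m. ?d (Suc (Suc m))) t + \<eta> * a\<^sup>2 * eser (\<lambda>m. ?d (Suc m)) t + a ^ 3 * eser ?d t
    = (\<Sum>m. ?d (Suc (Suc (Suc m))) / fact m * t ^ m + \<eta> * a * (?d (Suc (Suc m)) / fact m * t ^ m) + \<eta> * a\<^sup>2 * (?d (Suc m) / fact m * t ^ m) + a ^ 3 * (?d m / fact m * t ^ m))"
    unfolding eser_def
    by (simp add: suminf_mult[symmetric] suminf_add[symmetric] s0 s1 s2 s3 summable_mult summable_add del: times_divide_eq_left)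
  also have "\<dots> = (\<Sum>m. 0)"
    by (intro suminf_cong) (simp add: acoef_rec[OF j] field_simps)
  finally show "eser (\<lambda>m. ?d (Suc (Suc (Suc m)))) t + \<eta> * a * eser (\<lambda>m. ?d (Suc (Suc m))) t + \<eta> * a\<^sup>2 * eser (\<lambda>m. ?d (Suc m)) t + a ^ 3 * eser ?d t = 0"
    by simp
  show "eser ?d 0 = (if j = 0 then 1 else 0)" by (simp add: eser_0 acoef_def)
  show "eser (\<lambda>m. ?d (Suc m)) 0 = (if j = 1 then 1 else 0)" by (simp add: eser_0 acoef_def)
  show "eser (\<lambda>m. ?d (Suc (Suc m))) 0 = (if j = 2 then 1 else 0)" by (simp add: eser_0 acoef_def)
qed

section \<open>Uniqueness for the third-order equation\<close>

lemma abs_energy_deriv: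
  fixes x y z c1 c2 c3 :: real
  shows "\<bar>2 * x * y + 2 * y * z + 2 * z * (- (c1 * z + c2 * y + c3 * x))\<bar> \<le> (2 + 2 * \<bar>c1\<bar> + \<bar>c2\<bar> + \<bar>c3\<bar>) * (x\<^sup>2 + y\<^sup>2 + z\<^sup>2)"
proof -
  have p: "\<bar>2 * u * v\<bar> \<le> u\<^sup>2 + v\<^sup>2" for u v :: real
    using sum_squares_bound[of "\<bar>u\<bar>" "\<bar>v\<bar>"] by (simp add: abs_mult)
  have "\<bar>2 * x * y + 2 * y * z + 2 * z * (- (c1 * z + c2 * y + c3 * x))\<bar>
     = \<bar>2 * x * y + 2 * y * z - c1 * (2 * z * z) - c2 * (2 * z * y) - c3 * (2 * z * x)\<bar>" by (simp add: algebra_simps)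
  also have "\<dots> \<le> \<bar>2 * x * y\<bar> + \<bar>2 * y * z\<bar> + \<bar>c1\<bar> * \<bar>2 * z * z\<bar> + \<bar>c2\<bar> * \<bar>2 * z * y\<bar> + \<bar>c3\<bar> * \<bar>2 * z * x\<bar>"
    unfolding abs_mult[symmetric] by (simp only: abs_mult[symmetric])
  also have "\<dots> \<le> (x\<^sup>2 + y\<^sup>2) + (y\<^sup>2 + z\<^sup>2) + \<bar>c1\<bar> * (z\<^sup>2 + z\<^sup>2) + \<bar>c2\<bar> * (z\<^sup>2 + y\<^sup>2) + \<bar>c3\<bar> * (z\<^sup>2 + x\<^sup>2)"
    by (intro add_mono mult_left_mono p) auto
  also have "\<dots> \<le> (2 + 2 * \<bar>c1\<bar> + \<bar>c2\<bar> + \<bar>c3\<bar>) * (x\<^sup>2 + y\<^sup>2 + z\<^sup>2)"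
    by (simp add: algebra_simps)
  finally show ?thesis .
qed

text \<open>Gronwall's argument for the energy y^2 + y1^2 + y2^2. Both directions of time are needed
  because \<open>fund_ode\<close> poses the equation on the whole line.\<close>

lemma ode3_zero:
  fixes y y1 y2 y3 :: "real \<Rightarrow> real"
  assumes d: "\<And>t. (y has_real_derivative y1 t) (at t)" "\<And>t. (y1 has_real_derivative y2 t) (at t)"
    "\<And>t. (y2 has_real_derivative y3 t) (at t)" and eq: "\<And>t. y3 t + c1 * y2 t + c2 * y1 t + c3 * y t = 0"
    and z: "y 0 = 0" "y1 0 = 0" "y2 0 = 0"
  shows "y t = 0"
proof -
  define C where "C = 2 + 2 * \<bar>c1\<bar> + \<bar>c2\<bar> + \<bar>c3\<bar>"
  define E where "E t = (y t)\<^sup>2 + (y1 t)\<^sup>2 + (y2 t)\<^sup>2" for t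
  define E' where "E' t = 2 * y t * y1 t + 2 * y1 t * y2 t + 2 * y2 t * y3 t" for t
  have dE: "(E has_real_derivative E' t) (at t)" for t
    unfolding E_def[abs_def] E'_def by (auto intro!: derivative_eq_intros d)
  have y3: "y3 t = - (c1 * y2 t + c2 * y1 t + c3 * y t)" for t using eq[of t] by simp
  have E': "\<bar>E' t\<bar> \<le> C * E t" for t
    unfolding E'_def y3 E_def C_def by (rule abs_energy_deriv)
  have E0: "E 0 = 0" using z by (simp add: E_def)
  have "E t \<le> 0"
  proof (cases "0 \<le> t")
    case True
    let ?g = "\<lambda>t. E t * exp (- C * t)"
    have "?g t \<le> ?g 0"
    proof (rule DERIV_nonpos_imp_nonincreasing[OF True])
      fix s
      have "(?g has_real_derivative (E' s - C * E s) * exp (- C * s)) (at s)"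
        by (auto intro!: derivative_eq_intros dE simp: algebra_simps)
      moreover have "(E' s - C * E s) * exp (- C * s) \<le> 0"
        using E'[of s] by (intro mult_nonpos_nonneg) auto
      ultimately show "\<exists>v. (?g has_real_derivative v) (at s) \<and> v \<le> 0" by blast
    qed
    then show ?thesis using E0 by (simp add: mult_le_0_iff)
  next
    case False
    let ?g = "\<lambda>t. E t * exp (C * t)"
    have "?g t \<le> ?g 0"
    proof (rule DERIV_nonneg_imp_nondecreasing[of t 0 ?g])
      fix s
      have "(?g has_real_derivative (E' s + C * E s) * exp (C * s)) (at s)"
        by (auto intro!: derivative_eq_intros dE simp: algebra_simps)
      moreover have "0 \<le> (E' s + C * E s) * exp (C * s)"
        using E'[of s] by (intro mult_nonneg_nonneg) auto
      ultimately show "\<exists>v. (?g has_real_derivative v) (at s) \<and> 0 \<le> v" by blast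
    qed (use False in simp)
    then show ?thesis using E0 by (simp add: mult_le_0_iff)
  qed
  moreover have "(y t)\<^sup>2 \<le> E t" by (simp add: E_def)
  ultimately have "(y t)\<^sup>2 \<le> 0" by (rule order_trans[rotated])
  then show ?thesis by simp
qed

lemma fund_ode_unique:
  assumes "fund_ode \<eta> a j y" "fund_ode \<eta> a j z"
  shows "y = z"
proof
  fix t
  obtain y1 y2 y3 where y: "\<And>t. (y has_real_derivative y1 t) (at t)" "\<And>t. (y1 has_real_derivative y2 t) (at t)"
    "\<And>t. (y2 has_real_derivative y3 t) (at t)" "\<And>t. y3 t + \<eta> * a * y2 t + \<eta> * a\<^sup>2 * y1 t + a ^ 3 * y t = 0"
    "y 0 = (if j = 0 then 1 else 0)" "y1 0 = (if j = 1 then 1 else 0)" "y2 0 = (if j = 2 then 1 else 0)"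
    using assms(1) unfolding fund_ode_def by blast
  obtain z1 z2 z3 where z: "\<And>t. (z has_real_derivative z1 t) (at t)" "\<And>t. (z1 has_real_derivative z2 t) (at t)"
    "\<And>t. (z2 has_real_derivative z3 t) (at t)" "\<And>t. z3 t + \<eta> * a * z2 t + \<eta> * a\<^sup>2 * z1 t + a ^ 3 * z t = 0"
    "z 0 = (if j = 0 then 1 else 0)" "z1 0 = (if j = 1 then 1 else 0)" "z2 0 = (if j = 2 then 1 else 0)"
    using assms(2) unfolding fund_ode_def by blast
  have "y t - z t = 0"
  proof (rule ode3_zero[of "\<lambda>t. y t - z t" "\<lambda>t. y1 t - z1 t" "\<lambda>t. y2 t - z2 t" "\<lambda>t. y3 t - z3 t" "\<eta> * a" "\<eta> * a\<^sup>2" "a ^ 3"])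
    show "((\<lambda>t. y t - z t) has_real_derivative (y1 t - z1 t)) (at t)" for t by (intro DERIV_diff y z)
    show "((\<lambda>t. y1 t - z1 t) has_real_derivative (y2 t - z2 t)) (at t)" for t by (intro DERIV_diff y z)
    show "((\<lambda>t. y2 t - z2 t) has_real_derivative (y3 t - z3 t)) (at t)" for t by (intro DERIV_diff y z)
    show "y3 t - z3 t + \<eta> * a * (y2 t - z2 t) + \<eta> * a\<^sup>2 * (y1 t - z1 t) + a ^ 3 * (y t - z t) = 0" for t
      using y(4)[of t] z(4)[of t] by (simp add: algebra_simps)
  qed (use y z in auto)
  then show "y t = z t" by simp
qed

text \<open>The series solves the equation and the energy argument excludes other solutions, so the
  definite description in \<open>Kfun\<close> denotes the series.\<close>

lemma Kfun_eq: "j \<le> 2 \<Longrightarrow> Kfun \<eta> a j = eser (acoef \<eta> a j)"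
  unfolding Kfun_def using fund_ode_eser[of j \<eta> a] by (intro the_equality) (auto intro: fund_ode_unique)

text \<open>The solution of \<open>fund_ode \<eta> a j\<close> is t^j \<open>kap \<eta> j (a t)\<close>; this form also covers a = 0.\<close>

definition kap :: "real \<Rightarrow> nat \<Rightarrow> real \<Rightarrow> real" where
  "kap \<eta> j r = (\<Sum>m. kcoef \<eta> j (m + j) / fact (m + j) * r ^ m)"

lemma kap_summable: "summable (\<lambda>m. kcoef \<eta> j (m + j) / fact (m + j) * r ^ m)"
proof (cases "r = 0")
  case False
  have "\<And>m. \<bar>kcoef \<eta> j m\<bar> \<le> 1 * (2 * \<bar>\<eta>\<bar> + 1) ^ m" using kcoef_bound by simp
  from eser_summable[OF this, of r]
  have "summable (\<lambda>m. (kcoef \<eta> j (m + j) / fact (m + j) * r ^ (m + j)) / r ^ j)"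
    by (intro summable_divide summable_ignore_initial_segment)
  then show ?thesis using False by (simp add: power_add)
next
  case True
  have "summable (\<lambda>m. kcoef \<eta> j (m + j) / fact (m + j) * 0 ^ m)" by (rule summable_zero_power')
  then show ?thesis using True by simp
qed

lemma Kfun_eq_kap:
  assumes j: "j \<le> 2"
  shows "Kfun \<eta> a j t = t ^ j * kap \<eta> j (a * t)"
proof -
  have "eser (acoef \<eta> a j) t = (\<Sum>m. acoef \<eta> a j (m + j) / fact (m + j) * t ^ (m + j)) + (\<Sum>m<j. acoef \<eta> a j m / fact m * t ^ m)"
    unfolding eser_def by (rule suminf_split_initial_segment[OF eser_summable[OF acoef_bound]])
  also have "(\<Sum>m<j. acoef \<eta> a j m / fact m * t ^ m) = 0"
    by (intro sum.neutral) (auto simp: acoef_def kcoef_eq_0[OF j])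
  also have "(\<Sum>m. acoef \<eta> a j (m + j) / fact (m + j) * t ^ (m + j)) = (\<Sum>m. t ^ j * (kcoef \<eta> j (m + j) / fact (m + j) * (a * t) ^ m))"
    by (intro suminf_cong) (simp add: acoef_def power_add power_mult_distrib field_simps)
  also have "\<dots> = t ^ j * kap \<eta> j (a * t)"
    unfolding kap_def by (rule suminf_mult[OF kap_summable])
  finally show ?thesis by (simp add: Kfun_eq[OF j])
qed

section \<open>Continuity and exponential decay of the kernels\<close>

lemma isCont_kap: "isCont (kap \<eta> j) r"
  unfolding kap_def[abs_def] by (rule isCont_powser_converges_everywhere) (rule kap_summable)

lemma continuous_on_kap[continuous_intros]:
  "continuous_on S f \<Longrightarrow> continuous_on S (\<lambda>x. kap \<eta> j (f x))"
  by (rule continuous_on_compose2[of UNIV]) (auto simp: continuous_at_imp_continuous_on isCont_kap)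

text \<open>A Lyapunov function: the cross term 2 \<delta> w w1 transfers the damping from w1 to w.
  No roots are computed, so weak, critical and strong damping need no distinction. The energy decays
  at rate 2 \<delta> / 3, the solution at half of it.\<close>

lemma damped_oscillator_decay:
  fixes w w1 w2 :: "real \<Rightarrow> real"
  assumes q: "0 < q" and d: "\<And>t. (w has_real_derivative w1 t) (at t)" "\<And>t. (w1 has_real_derivative w2 t) (at t)"
    and eq: "\<And>t. w2 t + q * w1 t + w t = 0" and t: "0 \<le> t"
  shows "\<bar>w t\<bar> \<le> sqrt (3 * ((w 0)\<^sup>2 + (w1 0)\<^sup>2)) * exp (- (q / (2 + q\<^sup>2) / 3) * t)"
proof -
  \<comment> \<open>The solution of \<delta> (2 + q^2) = q, which leaves exactly - q w1^2 in the
    bound for the derivative of \<open>L\<close>; moreover \<delta> \<le> 1/2 keeps the cross term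
    below half of the squares.\<close>
  define \<delta> where "\<delta> = q / (2 + q\<^sup>2)"
  have den: "0 < 2 + q\<^sup>2" by (simp add: add_pos_nonneg)
  have \<delta>: "0 < \<delta>" "\<delta> \<le> 1 / 2" "\<delta> * (2 + q\<^sup>2) = q"
  proof -
    show "0 < \<delta>" using q den by (simp add: \<delta>_def)
    show "\<delta> * (2 + q\<^sup>2) = q" using den unfolding \<delta>_def by simp
    have "0 \<le> (q - 1)\<^sup>2 + 1" by simp
    then have "2 * q \<le> 2 + q\<^sup>2" by (simp add: power2_diff)
    then show "\<delta> \<le> 1 / 2" using den by (simp add: \<delta>_def divide_le_eq)
  qed
  have \<delta>q: "\<delta> \<le> q" using \<delta> q den by (simp add: \<delta>_def divide_le_eq)
  define L where "L t = (w t)\<^sup>2 + (w1 t)\<^sup>2 + 2 * \<delta> * (w t * w1 t)" for t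
  define L' where "L' t = 2 * w t * w1 t + 2 * w1 t * w2 t + 2 * \<delta> * (w1 t * w1 t + w t * w2 t)" for t
  have dL: "(L has_real_derivative L' t) (at t)" for t
    unfolding L_def[abs_def] L'_def by (auto intro!: derivative_eq_intros d simp: algebra_simps)
  have cross: "\<bar>2 * \<delta> * (w t * w1 t)\<bar> \<le> 1 / 2 * ((w t)\<^sup>2 + (w1 t)\<^sup>2)" for t
  proof -
    have "2 * \<bar>w t\<bar> * \<bar>w1 t\<bar> \<le> (w t)\<^sup>2 + (w1 t)\<^sup>2" using sum_squares_bound[of "\<bar>w t\<bar>" "\<bar>w1 t\<bar>"] by simp
    then have "\<delta> * (2 * \<bar>w t\<bar> * \<bar>w1 t\<bar>) \<le> 1 / 2 * ((w t)\<^sup>2 + (w1 t)\<^sup>2)"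
      using \<delta> by (intro mult_mono) auto
    then show ?thesis using \<delta> by (simp add: abs_mult ac_simps)
  qed
  have L2: "1 / 2 * ((w t)\<^sup>2 + (w1 t)\<^sup>2) \<le> L t" "L t \<le> 3 / 2 * ((w t)\<^sup>2 + (w1 t)\<^sup>2)" for t
    using cross[of t] unfolding L_def by (auto simp: abs_le_iff)
  have L'le: "L' t \<le> - (2 * \<delta> / 3) * L t" for t
  proof -
    have w2: "w2 t = - q * w1 t - w t" using eq[of t] by simp
    have "L' t = - (2 * q - 2 * \<delta>) * (w1 t)\<^sup>2 - 2 * \<delta> * (w t)\<^sup>2 - \<delta> * (2 * w t * (q * w1 t))"
      unfolding L'_def w2 by (simp add: algebra_simps power2_eq_square)
    also have "\<dots> \<le> - (2 * q - 2 * \<delta>) * (w1 t)\<^sup>2 - 2 * \<delta> * (w t)\<^sup>2 + \<delta> * ((w t)\<^sup>2 + (q * w1 t)\<^sup>2)"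
    proof -
      have "0 \<le> \<delta> * (w t + q * w1 t)\<^sup>2" using \<delta> by simp
      then show ?thesis by (simp add: power2_sum algebra_simps)
    qed
    also have "\<dots> = - (2 * q - \<delta> * (2 + q\<^sup>2)) * (w1 t)\<^sup>2 - \<delta> * (w t)\<^sup>2" by (simp add: algebra_simps power_mult_distrib)
    also have "\<dots> = - q * (w1 t)\<^sup>2 - \<delta> * (w t)\<^sup>2" by (simp add: \<delta>(3))
    also have "\<dots> \<le> - \<delta> * ((w t)\<^sup>2 + (w1 t)\<^sup>2)"
      using mult_right_mono[OF \<delta>q zero_le_power2[of "w1 t"]] by (simp add: algebra_simps)
    also have "\<dots> \<le> - (2 * \<delta> / 3) * L t"
      using mult_left_mono[OF L2(2)[of t], of "2 * \<delta> / 3"] \<delta> by (simp add: algebra_simps)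
    finally show ?thesis .
  qed
  let ?g = "\<lambda>t. L t * exp (2 * \<delta> / 3 * t)"
  have "?g t \<le> ?g 0"
  proof (rule DERIV_nonpos_imp_nonincreasing[OF t])
    fix s
    have "(?g has_real_derivative (L' s + 2 * \<delta> / 3 * L s) * exp (2 * \<delta> / 3 * s)) (at s)"
      by (auto intro!: derivative_eq_intros dL simp: algebra_simps)
    moreover have "(L' s + 2 * \<delta> / 3 * L s) * exp (2 * \<delta> / 3 * s) \<le> 0"
      using L'le[of s] by (intro mult_nonpos_nonneg) auto
    ultimately show "\<exists>v. (?g has_real_derivative v) (at s) \<and> v \<le> 0" by blast
  qed
  then have "L t \<le> L 0 * exp (- (2 * \<delta> / 3 * t))" by (simp add: exp_minus field_simps)
  moreover have "(w t)\<^sup>2 \<le> 2 * L t" using L2(1)[of t] zero_le_power2[of "w1 t"] by argo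
  ultimately have "(w t)\<^sup>2 \<le> 2 * (L 0 * exp (- (2 * \<delta> / 3 * t)))" by linarith
  also have "\<dots> \<le> 2 * (3 / 2 * ((w 0)\<^sup>2 + (w1 0)\<^sup>2) * exp (- (2 * \<delta> / 3 * t)))"
    by (intro mult_left_mono mult_right_mono L2) auto
  also have "\<dots> = (sqrt (3 * ((w 0)\<^sup>2 + (w1 0)\<^sup>2)) * exp (- (\<delta> / 3) * t))\<^sup>2"
    by (simp add: power_mult_distrib flip: exp_double)
  finally have "sqrt ((w t)\<^sup>2) \<le> sqrt ((sqrt (3 * ((w 0)\<^sup>2 + (w1 0)\<^sup>2)) * exp (- (\<delta> / 3) * t))\<^sup>2)"
    by (rule real_sqrt_le_mono)
  then show ?thesis by (simp add: \<delta>_def abs_mult)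
qed

text \<open>Integrating factor \<open>exp t\<close>. The forcing becomes a multiple of exp ((1 - c)
  t), and 1 - c is at least 1/2, which is the origin of the factor 2. The bound is one-sided so that
  it applies to \<open>y\<close> and to \<open>- y\<close>.\<close>

lemma first_order_decay:
  fixes y y1 :: "real \<Rightarrow> real"
  assumes d: "\<And>t. (y has_real_derivative y1 t) (at t)" and c: "0 < c" "c \<le> 1 / 2" and M: "0 \<le> M"
    and w: "\<And>t. 0 \<le> t \<Longrightarrow> y1 t + y t \<le> M * exp (- c * t)" and t: "0 \<le> t"
  shows "y t \<le> (\<bar>y 0\<bar> + 2 * M) * exp (- c * t)"
proof -
  let ?g = "\<lambda>t. exp t * y t - 2 * M * exp ((1 - c) * t)"
  have "?g t \<le> ?g 0"
  proof (rule DERIV_nonpos_imp_nonincreasing[OF t])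
    fix s :: real assume s: "0 \<le> s"
    have "(?g has_real_derivative exp s * (y1 s + y s) - 2 * M * ((1 - c) * exp ((1 - c) * s))) (at s)"
      by (auto intro!: derivative_eq_intros d simp: algebra_simps)
    moreover have "exp s * (y1 s + y s) - 2 * M * ((1 - c) * exp ((1 - c) * s)) \<le> 0"
    proof -
      have "exp s * (y1 s + y s) \<le> exp s * (M * exp (- c * s))" using w[OF s] by (intro mult_left_mono) auto
      also have "\<dots> = M * exp ((1 - c) * s)" by (simp add: exp_add[symmetric] algebra_simps)
      also have "\<dots> \<le> (2 * (1 - c)) * (M * exp ((1 - c) * s))"
        using mult_right_mono[of 1 "2 * (1 - c)" "M * exp ((1 - c) * s)"] c M by simp
      also have "\<dots> = 2 * M * ((1 - c) * exp ((1 - c) * s))" by (simp only: ac_simps)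
      finally show ?thesis by simp
    qed
    ultimately show "\<exists>v. (?g has_real_derivative v) (at s) \<and> v \<le> 0" by blast
  qed
  then have "exp t * y t \<le> \<bar>y 0\<bar> * exp ((1 - c) * t) + 2 * M * exp ((1 - c) * t)"
    using M c t mult_left_mono[of 1 "exp ((1 - c) * t)" "\<bar>y 0\<bar>"] by simp
  also have "\<dots> = exp t * ((\<bar>y 0\<bar> + 2 * M) * exp (- c * t))"
  proof -
    have "exp ((1 - c) * t) = exp t * exp (- c * t)"
      unfolding exp_add[symmetric] by (rule arg_cong[where f = exp]) (simp add: algebra_simps)
    then show ?thesis by (simp only: distrib_left distrib_right ac_simps)
  qed
  finally show ?thesis by simp
qed

text \<open>The rate from \<open>damped_oscillator_decay\<close> with \<open>q = \<eta> - 1\<close>;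
  it stays below the rate 1 of the linear factor x + 1.\<close>

definition kdecay :: "real \<Rightarrow> real" where
  "kdecay \<eta> = (\<eta> - 1) / (2 + (\<eta> - 1)\<^sup>2) / 3"

lemma kdecay_bounds:
  shows "1 < \<eta> \<Longrightarrow> 0 < kdecay \<eta>" "kdecay \<eta> \<le> 1 / 2"
proof -
  have den: "0 < 2 + (\<eta> - 1)\<^sup>2" by (simp add: add_pos_nonneg)
  then show "1 < \<eta> \<Longrightarrow> 0 < kdecay \<eta>" by (simp add: kdecay_def)
  have "0 \<le> (\<eta> - 1 - 1)\<^sup>2 + 1" by simp
  then have "2 * (\<eta> - 1) \<le> 3 * (2 + (\<eta> - 1)\<^sup>2)" using den by (simp add: power2_diff)
  then show "kdecay \<eta> \<le> 1 / 2" using den by (simp add: kdecay_def divide_le_eq)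
qed

text \<open>The characteristic polynomial factors as (x + 1)(x^2 + (\<eta> - 1) x + 1).\<close>

lemma Kfun_decay:
  assumes \<eta>: "1 < \<eta>" and j: "j \<le> 2"
  shows "\<exists>C\<ge>0. \<forall>t\<ge>0. \<bar>Kfun \<eta> 1 j t\<bar> \<le> C * exp (- kdecay \<eta> * t)"
proof -
  have "fund_ode \<eta> 1 j (Kfun \<eta> 1 j)" unfolding Kfun_eq[OF j] by (rule fund_ode_eser[OF j])
  then obtain y1 y2 y3 where y: "\<And>t. (Kfun \<eta> 1 j has_real_derivative y1 t) (at t)" "\<And>t. (y1 has_real_derivative y2 t) (at t)"
    "\<And>t. (y2 has_real_derivative y3 t) (at t)" "\<And>t. y3 t + \<eta> * y2 t + \<eta> * y1 t + Kfun \<eta> 1 j t = 0"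
    unfolding fund_ode_def mult_1_right one_power2 power_one mult_1_left by blast
  let ?y = "Kfun \<eta> 1 j"
  define M where "M = sqrt (3 * ((y1 0 + ?y 0)\<^sup>2 + (y2 0 + y1 0)\<^sup>2))"
  \<comment> \<open>Applying d/dt + 1 to the solution leaves a function governed by the quadratic
    factor alone.\<close>
  have w: "\<bar>y1 t + ?y t\<bar> \<le> M * exp (- kdecay \<eta> * t)" if t: "0 \<le> t" for t
    unfolding M_def kdecay_def
  proof (rule damped_oscillator_decay[where ?w2.0 = "\<lambda>t. y3 t + y2 t"])
    show "((\<lambda>t. y1 t + ?y t) has_real_derivative (y2 t + y1 t)) (at t)" for t by (intro DERIV_add y)
    show "((\<lambda>t. y2 t + y1 t) has_real_derivative (y3 t + y2 t)) (at t)" for t by (intro DERIV_add y)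
    show "y3 t + y2 t + (\<eta> - 1) * (y2 t + y1 t) + (y1 t + ?y t) = 0" for t
      using y(4)[of t] by (simp add: algebra_simps)
  qed (use \<eta> t in auto)
  have M: "0 \<le> M" by (simp add: M_def)
  have "\<bar>?y t\<bar> \<le> (\<bar>?y 0\<bar> + 2 * M) * exp (- kdecay \<eta> * t)" if t: "0 \<le> t" for t
  proof -
    have "?y t \<le> (\<bar>?y 0\<bar> + 2 * M) * exp (- kdecay \<eta> * t)"
      by (rule first_order_decay[OF y(1) kdecay_bounds(1)[OF \<eta>] kdecay_bounds(2) M _ t]) (use w abs_le_D1 in blast)
    moreover have "- ?y t \<le> (\<bar>- ?y 0\<bar> + 2 * M) * exp (- kdecay \<eta> * t)"
    proof (rule first_order_decay[OF DERIV_minus[OF y(1)] kdecay_bounds(1)[OF \<eta>] kdecay_bounds(2) M _ t])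
      fix s :: real assume "0 \<le> s"
      from w[OF this] show "- y1 s + - ?y s \<le> M * exp (- kdecay \<eta> * s)" by (simp add: abs_le_iff)
    qed
    ultimately show ?thesis by (simp add: abs_le_iff)
  qed
  then show ?thesis using M by (intro exI[of _ "\<bar>?y 0\<bar> + 2 * M"]) auto
qed

lemma one_plus_sq_le_exp:
  fixes b r :: real
  assumes b: "0 < b" and r: "0 \<le> r"
  shows "(1 + r)\<^sup>2 \<le> (2 + 4 / b\<^sup>2) * exp (b * r)"
proof -
  have e: "1 + b * r + (b * r)\<^sup>2 / 2 \<le> exp (b * r)" using b r by (intro exp_lower_Taylor_quadratic) simp
  have "0 \<le> b * r" using b r by simp
  then have e1: "1 \<le> exp (b * r)" and e2: "(b * r)\<^sup>2 / 2 \<le> exp (b * r)" using e by (auto intro: order_trans[rotated, OF e])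
  have "(1 + r)\<^sup>2 \<le> 2 + 2 * r\<^sup>2" using zero_le_power2[of "1 - r"] by (simp add: power2_sum power2_diff)
  also have "2 * r\<^sup>2 = 4 / b\<^sup>2 * ((b * r)\<^sup>2 / 2)" using b by (simp add: power_mult_distrib)
  also have "2 + \<dots> \<le> 2 * exp (b * r) + 4 / b\<^sup>2 * exp (b * r)"
    using e1 e2 b by (intro add_mono mult_left_mono) auto
  finally show ?thesis by (simp add: distrib_right)
qed

text \<open>For r \<ge> 1 the factor r^j is at least 1, so \<open>kap\<close> inherits the decay of
  \<open>Kfun\<close>; near 0 this factor degenerates and continuity on a compact interval is used.
  Half of the rate pays for \<open>(1 + r)\<^sup>2\<close>, which will absorb the Sobolev weight:
  |xi|^s t^2 = (a t)^2 with a = |xi|^(s/2).\<close>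

lemma kap_decay:
  assumes \<eta>: "1 < \<eta>" and j: "j \<le> 2"
  shows "\<exists>C\<ge>0. \<forall>r\<ge>0. (1 + r)\<^sup>2 * \<bar>kap \<eta> j r\<bar> \<le> C * exp (- (kdecay \<eta> / 2) * r)"
proof -
  let ?c = "kdecay \<eta>"
  have c: "0 < ?c" by (rule kdecay_bounds(1)[OF \<eta>])
  obtain C where C: "0 \<le> C" "\<And>t. 0 \<le> t \<Longrightarrow> \<bar>Kfun \<eta> 1 j t\<bar> \<le> C * exp (- ?c * t)"
    using Kfun_decay[OF \<eta> j] by blast
  have "compact (kap \<eta> j ` {0..1})"
    by (intro compact_continuous_image continuous_on_kap continuous_on_id compact_Icc)
  then obtain D where D: "\<And>r. r \<in> {0..1} \<Longrightarrow> \<bar>kap \<eta> j r\<bar> \<le> D"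
    using compact_imp_bounded[of "kap \<eta> j ` {0..1}"] unfolding bounded_real by blast
  have D0: "0 \<le> D" using D[of 0] by simp
  have b: "\<bar>kap \<eta> j r\<bar> \<le> (C + D * exp ?c) * exp (- ?c * r)" if r: "0 \<le> r" for r
  proof (cases "r \<le> 1")
    case True
    have "\<bar>kap \<eta> j r\<bar> \<le> D * 1" using D[of r] r True by simp
    also have "\<dots> \<le> D * exp (?c + - ?c * r)"
      using c r True mult_left_mono[of r 1 ?c] D0 by (intro mult_left_mono) auto
    also have "\<dots> = D * exp ?c * exp (- ?c * r)" by (simp only: exp_add mult.assoc)
    also have "\<dots> \<le> (C + D * exp ?c) * exp (- ?c * r)" using C by (intro mult_right_mono) auto
    finally show ?thesis .
  next
    case False
    then have "1 \<le> r ^ j" by simp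
    then have "1 * \<bar>kap \<eta> j r\<bar> \<le> r ^ j * \<bar>kap \<eta> j r\<bar>" by (intro mult_right_mono) auto
    also have "\<dots> = \<bar>Kfun \<eta> 1 j r\<bar>" using r by (simp add: Kfun_eq_kap[OF j] abs_mult)
    also have "\<dots> \<le> C * exp (- ?c * r)" by (rule C(2)[OF r])
    also have "\<dots> \<le> (C + D * exp ?c) * exp (- ?c * r)" using D0 by (intro mult_right_mono) auto
    finally show ?thesis by simp
  qed
  let ?E = "2 + 4 / (?c / 2)\<^sup>2"
  have "(1 + r)\<^sup>2 * \<bar>kap \<eta> j r\<bar> \<le> (?E * (C + D * exp ?c)) * exp (- (?c / 2) * r)" if r: "0 \<le> r" for r
  proof -
    have "(1 + r)\<^sup>2 * \<bar>kap \<eta> j r\<bar> \<le> (?E * exp (?c / 2 * r)) * ((C + D * exp ?c) * exp (- ?c * r))"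
      using c r C D0 by (intro mult_mono one_plus_sq_le_exp b) auto
    also have "\<dots> = (?E * (C + D * exp ?c)) * (exp (?c / 2 * r) * exp (- ?c * r))" by (simp only: ac_simps)
    also have "exp (?c / 2 * r) * exp (- ?c * r) = exp (- (?c / 2) * r)"
      unfolding exp_add[symmetric] by (rule arg_cong[where f = exp]) (simp add: algebra_simps)
    finally show ?thesis .
  qed
  then show ?thesis using C D0 by (intro exI[of _ "?E * (C + D * exp ?c)"]) auto
qed

lemma kap_decay_uniform:
  assumes \<eta>: "1 < \<eta>"
  shows "\<exists>C>0. \<exists>c>0. \<forall>j\<le>2. \<forall>r\<ge>0. (1 + r)\<^sup>2 * \<bar>kap \<eta> j r\<bar> \<le> C * exp (- c * r)"
proof -
  have "\<forall>j\<in>{..2::nat}. \<exists>C\<ge>0. \<forall>r\<ge>0. (1 + r)\<^sup>2 * \<bar>kap \<eta> j r\<bar> \<le> C * exp (- (kdecay \<eta> / 2) * r)"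
    using kap_decay[OF \<eta>] by simp
  then obtain C where C: "\<And>j. j \<le> 2 \<Longrightarrow> 0 \<le> C j"
    "\<And>j r. j \<le> 2 \<Longrightarrow> 0 \<le> r \<Longrightarrow> (1 + r)\<^sup>2 * \<bar>kap \<eta> j r\<bar> \<le> C j * exp (- (kdecay \<eta> / 2) * r)"
    by (auto simp: bchoice_iff)
  have "(1 + r)\<^sup>2 * \<bar>kap \<eta> j r\<bar> \<le> (1 + (\<Sum>i\<le>2. C i)) * exp (- (kdecay \<eta> / 2) * r)" if "j \<le> 2" "0 \<le> r" for j r
  proof -
    have "C j \<le> (\<Sum>i\<le>2. C i)" using that C(1) by (intro member_le_sum) auto
    then show ?thesis using C(2)[OF that] by (intro order_trans[OF C(2)[OF that]] mult_right_mono) auto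
  qed
  moreover have "0 \<le> (\<Sum>i\<le>2. C i)" using C(1) by (intro sum_nonneg) auto
  ultimately show ?thesis using kdecay_bounds(1)[OF \<eta>]
    by (intro exI[of _ "1 + (\<Sum>i\<le>2. C i)"] exI[of _ "kdecay \<eta> / 2"] conjI) auto
qed

section \<open>Radial integrals and the Sobolev inequality\<close>

text \<open>A substitute for polar coordinates: at each point the function is dominated by one
  weighted ball around 0, hence by the sum over all of them.\<close>

lemma nn_integral_ball_cover:
  fixes f :: "'a::euclidean_space \<Rightarrow> real"
  assumes cov: "\<And>\<xi>. \<xi> \<in> S \<Longrightarrow> \<exists>k. norm \<xi> \<le> r k \<and> f \<xi> \<le> c k"
    and nn: "\<And>k. 0 \<le> r k" "\<And>k. 0 \<le> c k" and s: "summable (\<lambda>k. c k * r k ^ DIM('a))"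
  shows "(\<integral>\<^sup>+\<xi>\<in>S. ennreal (f \<xi>) \<partial>lborel) \<le> ennreal (unit_ball_vol (real DIM('a)) * (\<Sum>k. c k * r k ^ DIM('a)))"
proof -
  let ?w = "unit_ball_vol (real DIM('a))"
  have "(\<integral>\<^sup>+\<xi>\<in>S. ennreal (f \<xi>) \<partial>lborel) \<le> (\<integral>\<^sup>+\<xi>. (\<Sum>k. ennreal (c k) * indicator (cball 0 (r k)) (\<xi>::'a)) \<partial>lborel)"
  proof (rule nn_integral_mono)
    fix \<xi> :: 'a
    show "ennreal (f \<xi>) * indicator S \<xi> \<le> (\<Sum>k. ennreal (c k) * indicator (cball 0 (r k)) \<xi>)"
    proof (cases "\<xi> \<in> S")
      case True
      then obtain k where k: "norm \<xi> \<le> r k" "f \<xi> \<le> c k" using cov by blast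
      have "ennreal (f \<xi>) * indicator S \<xi> \<le> ennreal (c k) * indicator (cball 0 (r k)) \<xi>"
        using k True by (simp add: ennreal_leI)
      also have "\<dots> \<le> (\<Sum>k. ennreal (c k) * indicator (cball 0 (r k)) \<xi>)"
      proof -
        have "h k \<le> suminf h" for h :: "nat \<Rightarrow> ennreal" using sum_le_suminf[of h "{k}"] by simp
        then show ?thesis .
      qed
      finally show ?thesis .
    qed simp
  qed
  also have "\<dots> = (\<Sum>k. \<integral>\<^sup>+\<xi>. ennreal (c k) * indicator (cball 0 (r k)) (\<xi>::'a) \<partial>lborel)"
    by (rule nn_integral_suminf) measurable
  also have "\<dots> = (\<Sum>k. ennreal (?w * (c k * r k ^ DIM('a))))"
  proof (rule suminf_cong)
    fix k
    have "(\<integral>\<^sup>+\<xi>. ennreal (c k) * indicator (cball 0 (r k)) (\<xi>::'a) \<partial>lborel) = ennreal (c k) * emeasure lborel (cball (0::'a) (r k))"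
      by (rule nn_integral_cmult_indicator) simp
    also have "\<dots> = ennreal (?w * (c k * r k ^ DIM('a)))"
      unfolding emeasure_cball[OF nn(1)] using nn by (simp add: ennreal_mult'[symmetric] ac_simps)
    finally show "(\<integral>\<^sup>+\<xi>. ennreal (c k) * indicator (cball 0 (r k)) (\<xi>::'a) \<partial>lborel) = ennreal (?w * (c k * r k ^ DIM('a)))" .
  qed
  also have "\<dots> = ennreal (\<Sum>k. ?w * (c k * r k ^ DIM('a)))"
    by (rule suminf_ennreal2) (use nn s in \<open>auto intro!: summable_mult\<close>)
  also have "\<dots> = ennreal (?w * (\<Sum>k. c k * r k ^ DIM('a)))"
    using s by (simp add: suminf_mult)
  finally show ?thesis .
qed

lemma dyadic_down:
  fixes x R :: real
  assumes "0 < x" "x \<le> R"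
  shows "\<exists>k. R * (1/2) ^ Suc k < x \<and> x \<le> R * (1/2) ^ k"
proof -
  have R: "0 < R" using assms by simp
  obtain N where "(1/2) ^ N < x / R" using real_arch_pow_inv[of "x / R" "1/2"] assms R by auto
  then have "R * (1/2) ^ N < x" using R by (simp add: field_simps)
  moreover have "\<not> R * (1/2) ^ 0 < x" using assms by simp
  ultimately obtain k where "\<forall>i\<le>k. \<not> R * (1/2) ^ i < x" "R * (1/2) ^ Suc k < x"
    using ex_least_nat_less[of "\<lambda>k. R * (1/2) ^ k < x" N] by blast
  then show ?thesis by (auto simp: not_less)
qed

lemma dyadic_up:
  fixes x :: real
  assumes "1 \<le> x"
  shows "\<exists>k. 2 ^ k \<le> x \<and> x \<le> 2 ^ Suc k"
proof -
  obtain N where "x < 2 ^ N" using real_arch_pow[of 2 x] by auto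
  moreover have "\<not> x < 2 ^ 0" using assms by simp
  ultimately obtain k where "\<forall>i\<le>k. \<not> x < 2 ^ i" "x < 2 ^ Suc k"
    using ex_least_nat_less[of "\<lambda>k. x < 2 ^ k" N] by blast
  then show ?thesis by (auto simp: not_less less_imp_le)
qed

text \<open>Dyadic shells shrink towards the origin, which lies in none of them and is therefore
  taken out of the ball.\<close>

lemma nn_integral_ball_powr:
  assumes \<alpha>: "0 \<le> \<alpha>" "\<alpha> < real DIM('a::euclidean_space)"
  shows "\<exists>C\<ge>0. \<forall>R>0. (\<integral>\<^sup>+\<xi>\<in>cball (0::'a) R - {0}. ennreal (norm \<xi> powr - \<alpha>) \<partial>lborel) \<le> ennreal (C * R powr (real DIM('a) - \<alpha>))"
proof -
  let ?n = "DIM('a)"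
  \<comment> \<open>The ratio of the geometric series of shell contributions, smaller than 1 because
    \<alpha> is below the dimension.\<close>
  define b where "b = (1/2::real) powr (real ?n - \<alpha>)"
  have b: "0 < b" "b < 1" using \<alpha> powr_less_mono2[of "real ?n - \<alpha>" "1/2" 1] by (auto simp: b_def)
  define C where "C = unit_ball_vol (real ?n) * (2 powr \<alpha> * (1 / (1 - b)))"
  have "(\<integral>\<^sup>+\<xi>\<in>cball (0::'a) R - {0}. ennreal (norm \<xi> powr - \<alpha>) \<partial>lborel) \<le> ennreal (C * R powr (real ?n - \<alpha>))" if R: "0 < R" for R
  proof -
    let ?c = "\<lambda>k. (R * (1/2) ^ Suc k) powr - \<alpha>" and ?r = "\<lambda>k. R * (1/2) ^ k"
    have eq: "?c k * ?r k ^ ?n = R powr (real ?n - \<alpha>) * 2 powr \<alpha> * b ^ k" for k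
    proof -
      have h: "(1/2::real) ^ k = (1/2) powr real k" "(1/2::real) ^ Suc k = (1/2) powr (real k + 1)"
        by (simp_all add: powr_realpow[symmetric] powr_add)
      have "?r k ^ ?n = (R * (1/2) powr real k) powr real ?n"
        unfolding h(1) using R by (intro powr_realpow[symmetric]) simp
      then have "?c k * ?r k ^ ?n = (R powr - \<alpha> * (1/2) powr ((real k + 1) * - \<alpha>)) * (R powr real ?n * (1/2) powr (real k * real ?n))"
        unfolding h(2) using R by (simp add: powr_mult powr_powr)
      also have "\<dots> = (R powr - \<alpha> * R powr real ?n) * ((1/2) powr ((real k + 1) * - \<alpha>) * (1/2) powr (real k * real ?n))" by (simp only: ac_simps)
      also have "\<dots> = R powr (- \<alpha> + real ?n) * (1/2) powr ((real k + 1) * - \<alpha> + real k * real ?n)"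
        by (simp only: powr_add)
      also have "(real k + 1) * - \<alpha> + real k * real ?n = - \<alpha> + (real ?n - \<alpha>) * real k" by (simp add: algebra_simps)
      also have "(1/2::real) powr (- \<alpha> + (real ?n - \<alpha>) * real k) = 2 powr \<alpha> * b ^ k"
      proof -
        have "(1/2::real) powr - \<alpha> = 2 powr \<alpha>" by (simp add: powr_minus_divide powr_divide)
        moreover have "(1/2::real) powr ((real ?n - \<alpha>) * real k) = b ^ k"
          unfolding powr_realpow[OF b(1), symmetric] by (simp add: b_def powr_powr)
        ultimately show ?thesis by (simp only: powr_add)
      qed
      finally show ?thesis by (simp add: add.commute)
    qed
    have sb: "(\<lambda>k. R powr (real ?n - \<alpha>) * 2 powr \<alpha> * b ^ k) sums (R powr (real ?n - \<alpha>) * 2 powr \<alpha> * (1 / (1 - b)))"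
      by (intro sums_mult geometric_sums) (use b in simp)
    have "(\<integral>\<^sup>+\<xi>\<in>cball (0::'a) R - {0}. ennreal (norm \<xi> powr - \<alpha>) \<partial>lborel) \<le> ennreal (unit_ball_vol (real ?n) * (\<Sum>k. ?c k * ?r k ^ ?n))"
    proof (rule nn_integral_ball_cover)
      fix \<xi> :: 'a assume "\<xi> \<in> cball 0 R - {0}"
      then obtain k where k: "R * (1/2) ^ Suc k < norm \<xi>" "norm \<xi> \<le> R * (1/2) ^ k"
        using dyadic_down[of "norm \<xi>" R] by auto
      have "norm \<xi> powr - \<alpha> \<le> ?c k" using k R \<alpha> by (intro powr_mono2') auto
      then show "\<exists>k. norm \<xi> \<le> ?r k \<and> norm \<xi> powr - \<alpha> \<le> ?c k" using k by blast
    next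
      show "summable (\<lambda>k. ?c k * ?r k ^ ?n)" unfolding eq using sb by (rule sums_summable)
    qed (use R in auto)
    also have "(\<Sum>k. ?c k * ?r k ^ ?n) = R powr (real ?n - \<alpha>) * 2 powr \<alpha> * (1 / (1 - b))"
      unfolding eq using sb by (rule sums_unique[symmetric])
    also have "unit_ball_vol (real ?n) * \<dots> = C * R powr (real ?n - \<alpha>)" by (simp add: C_def)
    finally show ?thesis .
  qed
  moreover have "0 \<le> C" using b by (simp add: C_def)
  ultimately show ?thesis by blast
qed

text \<open>A single term of the exponential series suffices, of an index \<open>m\<close> with m q
  \<ge> n.\<close>

lemma exp_powr_le:
  fixes c q :: real
  assumes c: "0 < c" and q: "0 < q"
  shows "\<exists>K\<ge>0. \<forall>x\<ge>1. exp (- c * x powr q) \<le> K / x ^ n"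
proof -
  obtain m :: nat where "real n < real m * q" using ex_less_of_nat_mult[OF q, of "real n"] by blast
  then have m: "real n \<le> real m * q" by simp
  have "exp (- c * x powr q) \<le> (fact m / c ^ m) / x ^ n" if x: "1 \<le> x" for x
  proof -
    have "x ^ n = x powr real n" using x by (simp add: powr_realpow)
    also have "\<dots> \<le> x powr (real m * q)" using x m by (intro powr_mono) auto
    also have "\<dots> = (x powr q) ^ m" using x by (simp add: powr_powr[symmetric] powr_realpow mult.commute)
    finally have xn: "x ^ n \<le> (x powr q) ^ m" .
    have "(c * x powr q) ^ m / fact m \<le> exp (c * x powr q)"
    proof -
      have "(\<Sum>k\<in>{m}. (c * x powr q) ^ k /\<^sub>R fact k) \<le> (\<Sum>k. (c * x powr q) ^ k /\<^sub>R fact k)"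
        by (rule sum_le_suminf) (use c in \<open>auto simp: summable_exp scaleR_conv_of_real of_real_inverse[symmetric]\<close>)
      then show ?thesis by (simp add: exp_def divide_inverse mult.commute)
    qed
    then have "c ^ m * x ^ n / fact m \<le> exp (c * x powr q)"
    proof -
      have "c ^ m * x ^ n / fact m \<le> c ^ m * (x powr q) ^ m / fact m"
        using mult_left_mono[OF xn, of "c ^ m"] c by (intro divide_right_mono) auto
      then show ?thesis using \<open>(c * x powr q) ^ m / fact m \<le> _\<close> by (simp add: power_mult_distrib)
    qed
    then show ?thesis using c x by (simp add: exp_minus field_simps)
  qed
  then show ?thesis using c by (intro exI[of _ "fact m / c ^ m"]) auto
qed

lemma integrable_exp_powr:
  assumes c: "0 < c" and q: "0 < q"
  shows "integrable lborel (\<lambda>\<xi>::'a::euclidean_space. exp (- c * norm \<xi> powr q))"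
proof (rule integrableI_nonneg)
  let ?n = "DIM('a)"
  obtain K where K: "0 \<le> K" "\<And>x. 1 \<le> x \<Longrightarrow> exp (- c * x powr q) \<le> K / x ^ Suc ?n"
    using exp_powr_le[OF c q, of "Suc ?n"] by blast
  \<comment> \<open>Index 0 is the unit ball, index \<open>Suc k\<close> covers the shell from 2^k
    to 2^(k+1). The exponent \<open>Suc ?n\<close> exceeds the dimension by one and leaves a
    geometric series of ratio 1/2.\<close>
  let ?c = "\<lambda>k. case k of 0 \<Rightarrow> 1 | Suc k \<Rightarrow> K / (2 ^ k) ^ Suc ?n" and ?r = "\<lambda>k. 2 ^ k :: real"
  have "(\<integral>\<^sup>+\<xi>\<in>UNIV. ennreal (exp (- c * norm (\<xi>::'a) powr q)) \<partial>lborel) \<le> ennreal (unit_ball_vol (real ?n) * (\<Sum>k. ?c k * ?r k ^ ?n))"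
  proof (rule nn_integral_ball_cover)
    fix \<xi> :: 'a
    show "\<exists>k. norm \<xi> \<le> ?r k \<and> exp (- c * norm \<xi> powr q) \<le> ?c k"
    proof (cases "norm \<xi> \<le> 1")
      case True
      then show ?thesis using c by (intro exI[of _ 0]) auto
    next
      case False
      then obtain k where k: "2 ^ k \<le> norm \<xi>" "norm \<xi> \<le> 2 ^ Suc k" using dyadic_up[of "norm \<xi>"] by auto
      have "exp (- c * norm \<xi> powr q) \<le> K / norm \<xi> ^ Suc ?n" using False by (intro K) auto
      also have "\<dots> \<le> K / (2 ^ k) ^ Suc ?n"
        using k K False by (intro divide_left_mono power_mono mult_pos_pos zero_less_power) auto
      finally show ?thesis using k by (intro exI[of _ "Suc k"]) auto
    qed
    have "summable (\<lambda>k. ?c (Suc k) * ?r (Suc k) ^ ?n)"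
    proof -
      have "?c (Suc k) * ?r (Suc k) ^ ?n = K * 2 ^ ?n * (1/2) ^ k" for k
        by (simp add: power_mult_distrib power_one_over field_simps)
      then show ?thesis by (simp add: summable_mult summable_geometric)
    qed
    then show "summable (\<lambda>k. ?c k * ?r k ^ ?n)" by (rule summable_Suc_iff[THEN iffD1])
  qed (use K in \<open>auto split: nat.split\<close>)
  then show "(\<integral>\<^sup>+\<xi>. ennreal (exp (- c * norm (\<xi>::'a) powr q)) \<partial>lborel) < \<infinity>"
    using le_less_trans[OF _ ennreal_less_top] by simp
qed auto

text \<open>The origin of the decay rate: dilation by t^(2/s) removes t from the exponential, and
  the Jacobian t^(-2n/s) of the squared norm becomes t^(-n/s).\<close>

lemma l2b_exp_powr:
  assumes c: "0 < c" and s: "0 < s"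
  shows "\<exists>C>0. \<forall>t>0. l2b (\<lambda>\<xi>::'a::euclidean_space. complex_of_real (exp (- c * (t * norm \<xi> powr (s / 2))))) (C * t powr (- real DIM('a) / s))"
proof -
  let ?n = "DIM('a)"
  define J where "J = (\<integral>\<xi>. exp (- (2 * c) * norm (\<xi>::'a) powr (s / 2)) \<partial>lborel)"
  have i: "integrable lborel (\<lambda>\<xi>::'a. exp (- (2 * c) * norm \<xi> powr (s / 2)))"
    by (rule integrable_exp_powr) (use c s in auto)
  have J: "0 \<le> J" unfolding J_def by simp
  have "l2b (\<lambda>\<xi>::'a. complex_of_real (exp (- c * (t * norm \<xi> powr (s / 2))))) ((sqrt J + 1) * t powr (- real ?n / s))" if t: "0 < t" for t
  proof -
    let ?l = "t powr (2 / s)"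
    have l: "0 < ?l" using t by simp
    have ls: "?l powr (s / 2) = t" using t s by (simp add: powr_powr)
    have eq: "(norm (complex_of_real (exp (- c * (t * norm \<xi> powr (s / 2))))))\<^sup>2 = exp (- (2 * c) * norm (0 + ?l *\<^sub>R \<xi>) powr (s / 2))" for \<xi> :: 'a
      using l ls by (simp add: powr_mult abs_of_pos flip: exp_double)
    have "l2b (\<lambda>\<xi>::'a. complex_of_real (exp (- c * (t * norm \<xi> powr (s / 2))))) (sqrt J * t powr (- real ?n / s))"
    proof (rule l2bI)
      show "integrable lborel (\<lambda>\<xi>::'a. (norm (complex_of_real (exp (- c * (t * norm \<xi> powr (s / 2))))))\<^sup>2)"
        unfolding eq by (subst integrable_lborel_affine[of ?l "\<lambda>\<xi>::'a. exp (- (2 * c) * norm \<xi> powr (s / 2))"]) (use l i in auto)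
      have "(\<integral>\<xi>. (norm (complex_of_real (exp (- c * (t * norm (\<xi>::'a) powr (s / 2))))))\<^sup>2 \<partial>lborel) = (1 / ?l ^ ?n) * J"
        unfolding eq J_def by (subst integral_lborel_affine[of ?l "\<lambda>\<xi>::'a. exp (- (2 * c) * norm \<xi> powr (s / 2))"]) (use l in auto)
      also have "1 / ?l ^ ?n = (t powr (- real ?n / s))\<^sup>2"
        using t s by (simp add: powr_realpow[symmetric] powr_powr powr_minus_divide power_divide divide_simps mult.commute)
      finally show "(\<integral>\<xi>. (norm (complex_of_real (exp (- c * (t * norm (\<xi>::'a) powr (s / 2))))))\<^sup>2 \<partial>lborel) \<le> (sqrt J * t powr (- real ?n / s))\<^sup>2"
        using J by (simp add: power_mult_distrib mult.commute)
    qed (use J in auto)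
    then show ?thesis by (rule l2b_mono) (simp add: mult_right_mono)
  qed
  then show ?thesis using J by (intro exI[of _ "sqrt J + 1"]) (auto intro: add_nonneg_pos)
qed

text \<open>Inversion bounds \<open>g\<close> by the integral of its transform. Cauchy-Schwarz
  against |xi|^(-\<alpha>), square integrable on balls since 2 \<alpha> is below the dimension,
  brings in the weighted norm.\<close>

lemma frel_low_frequency_bound:
  fixes U :: "'a::euclidean_space \<Rightarrow> complex"
  assumes \<alpha>: "0 \<le> \<alpha>" "2 * \<alpha> < real DIM('a)"
  shows "\<exists>C>0. \<forall>U g A \<rho>. 0 < \<rho> \<longrightarrow> l2 U \<longrightarrow> l2b (\<lambda>\<xi>. complex_of_real (norm (\<xi>::'a) powr \<alpha>) * U \<xi>) A \<longrightarrow>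
    frel g (\<lambda>\<xi>. indicator (cball 0 \<rho>) \<xi> * U \<xi>) \<longrightarrow>
    (AE x in lborel. norm (g x) \<le> C * \<rho> powr (real DIM('a) / 2 - \<alpha>) * A)"
proof -
  let ?n = "DIM('a)" and ?c = "pc TYPE('a)"
  have c: "0 < ?c" by (rule pc_pos)
  obtain D where D: "0 \<le> D" "\<And>R. 0 < R \<Longrightarrow> (\<integral>\<^sup>+\<xi>\<in>cball (0::'a) R - {0}. ennreal (norm \<xi> powr - (2 * \<alpha>)) \<partial>lborel) \<le> ennreal (D * R powr (real ?n - 2 * \<alpha>))"
    using nn_integral_ball_powr[of "2 * \<alpha>", where 'a = 'a] \<alpha> by auto
  have "AE x in lborel. norm (g x) \<le> ((sqrt D + 1) / ?c\<^sup>2) * \<rho> powr (real ?n / 2 - \<alpha>) * A"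
    if \<rho>: "0 < \<rho>" and U: "l2 U" and A: "l2b (\<lambda>\<xi>. complex_of_real (norm \<xi> powr \<alpha>) * U \<xi>) A"
      and g: "frel g (\<lambda>\<xi>. indicator (cball 0 \<rho>) \<xi> * U \<xi>)" for U g :: "'a \<Rightarrow> complex" and A \<rho>
  proof -
    have [measurable]: "U \<in> borel_measurable borel" using U by (rule l2_measurable)
    let ?V = "\<lambda>\<xi>. indicator (cball 0 \<rho>) \<xi> * U \<xi>"
    obtain B where B: "l2b U B" using U by (auto simp: l2_def)
    have iV: "integrable lborel ?V" by (rule l2b_mult_integrable[OF l2b_indicator_cball B])
    have lV: "l2 ?V" by (rule frelD(2)[OF g])
    define h where "h \<xi> = complex_of_real (indicator (cball 0 \<rho> - {0}) \<xi> * norm \<xi> powr - \<alpha>)" for \<xi> :: 'a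
    have hm[measurable]: "h \<in> borel_measurable borel" unfolding h_def[abs_def] by measurable
    have h: "l2b h (sqrt D * \<rho> powr (real ?n / 2 - \<alpha>))"
      unfolding l2b_def
    proof (intro conjI)
      have "(\<integral>\<^sup>+\<xi>. ennreal ((norm (h \<xi>))\<^sup>2) \<partial>lborel) = (\<integral>\<^sup>+\<xi>\<in>cball (0::'a) \<rho> - {0}. ennreal (norm \<xi> powr - (2 * \<alpha>)) \<partial>lborel)"
      proof (rule nn_integral_cong)
        fix \<xi> :: 'a
        show "ennreal ((norm (h \<xi>))\<^sup>2) = ennreal (norm \<xi> powr - (2 * \<alpha>)) * indicator (cball 0 \<rho> - {0}) \<xi>"
          by (cases "\<xi> \<in> cball 0 \<rho> - {0}") (simp_all add: h_def power2_eq_square powr_add[symmetric])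
      qed
      also have "\<dots> \<le> ennreal (D * \<rho> powr (real ?n - 2 * \<alpha>))" by (rule D(2)[OF \<rho>])
      also have "D * \<rho> powr (real ?n - 2 * \<alpha>) = (sqrt D * \<rho> powr (real ?n / 2 - \<alpha>))\<^sup>2"
        using D(1) by (simp add: power_mult_distrib power2_eq_square powr_add[symmetric] algebra_simps)
      finally show "(\<integral>\<^sup>+\<xi>. ennreal ((norm (h \<xi>))\<^sup>2) \<partial>lborel) \<le> ennreal ((sqrt D * \<rho> powr (real ?n / 2 - \<alpha>))\<^sup>2)" .
    qed (use D in auto)
    have "(\<integral>\<xi>. norm (?V \<xi>) \<partial>lborel) = (\<integral>\<xi>. norm (h \<xi>) * norm (complex_of_real (norm \<xi> powr \<alpha>) * U \<xi>) \<partial>lborel)"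
    proof (rule integral_cong_AE)
      have "AE \<xi> in lborel. \<xi> \<noteq> (0::'a)" by (rule AE_lborel_singleton)
      then show "AE \<xi> in lborel. norm (?V \<xi>) = norm (h \<xi>) * norm (complex_of_real (norm \<xi> powr \<alpha>) * U \<xi>)"
      proof eventually_elim
        case (elim \<xi>)
        have "norm \<xi> powr - \<alpha> * norm \<xi> powr \<alpha> = 1" using elim by (simp add: powr_add[symmetric])
        then show ?case using elim by (simp add: h_def norm_mult indicator_def mult.assoc[symmetric])
      qed
    qed measurable
    also have "\<dots> \<le> (sqrt D * \<rho> powr (real ?n / 2 - \<alpha>)) * A"
      by (rule l2b_Cauchy_Schwarz(2)[OF h A])
    also have "\<dots> \<le> ((sqrt D + 1) * \<rho> powr (real ?n / 2 - \<alpha>)) * A"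
      using l2b_nonneg[OF A] by (intro mult_right_mono) auto
    finally have bV: "(\<integral>\<xi>. norm (?V \<xi>) \<partial>lborel) \<le> ((sqrt D + 1) * \<rho> powr (real ?n / 2 - \<alpha>)) * A" .
    have "AE x in lborel. ft ?V x = complex_of_real (?c\<^sup>2) * g (- x)"
      by (rule frel_unique[OF frel_ft[OF iV lV] frel_inversion[OF g]])
    then have "AE x in lborel. norm (g (- x)) \<le> ((sqrt D + 1) / ?c\<^sup>2) * \<rho> powr (real ?n / 2 - \<alpha>) * A"
    proof eventually_elim
      case (elim x)
      have "norm (complex_of_real (?c\<^sup>2) * g (- x)) = ?c\<^sup>2 * norm (g (- x))"
        unfolding norm_mult by (simp add: norm_power)
      then have "?c\<^sup>2 * norm (g (- x)) \<le> ((sqrt D + 1) * \<rho> powr (real ?n / 2 - \<alpha>)) * A"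
        using norm_ft_le[OF iV, of x] bV unfolding elim by simp
      then show ?case using c by (simp add: field_simps)
    qed
    from AE_lborel_reflect[OF this] show ?thesis by simp
  qed
  moreover have "0 < (sqrt D + 1) / ?c\<^sup>2" using D c by (simp add: add_nonneg_pos)
  ultimately show ?thesis by (intro exI[of _ "(sqrt D + 1) / ?c\<^sup>2"]) blast
qed

text \<open>Only heights between y/2 and y are kept, where the integrand is at least its value at
  y/2; the price is the factor 2^Q.\<close>

lemma layer_cake_upper:
  fixes y Q :: real
  assumes y: "0 \<le> y" and Q: "1 \<le> Q"
  shows "ennreal (y powr Q) \<le> ennreal (2 powr Q) * (\<integral>\<^sup>+h. ennreal (h powr (Q - 1)) * indicator {0<..} h * indicator {..<y} h \<partial>lborel)"
proof (cases "y = 0")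
  case False
  then have y: "0 < y" using y by simp
  have "ennreal (y powr Q) = ennreal (2 powr Q) * (ennreal ((y/2) powr (Q - 1)) * ennreal (y / 2))"
  proof -
    have "2 powr Q * ((y/2) powr (Q - 1) * (y / 2)) = 2 powr Q * ((y/2) powr (Q - 1) * (y / 2) powr 1)" using y by simp
    also have "\<dots> = y powr Q" unfolding powr_add[symmetric] using y by (simp add: powr_divide)
    finally show ?thesis using y by (simp add: ennreal_mult'[symmetric])
  qed
  also have "ennreal ((y/2) powr (Q - 1)) * ennreal (y / 2) = (\<integral>\<^sup>+h. ennreal ((y/2) powr (Q - 1)) * indicator {y/2..<y} h \<partial>lborel)"
    using y by (subst nn_integral_cmult_indicator) auto
  also have "\<dots> \<le> (\<integral>\<^sup>+h. ennreal (h powr (Q - 1)) * indicator {0<..} h * indicator {..<y} h \<partial>lborel)"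
  proof (rule nn_integral_mono)
    fix h :: real
    show "ennreal ((y/2) powr (Q - 1)) * indicator {y/2..<y} h \<le> ennreal (h powr (Q - 1)) * indicator {0<..} h * indicator {..<y} h"
      using y Q by (cases "h \<in> {y/2..<y}") (auto intro!: ennreal_leI powr_mono2)
  qed
  finally show ?thesis by (simp add: mult_left_mono)
qed simp

text \<open>The proof of Chemin and Xu: at each level h of the layer-cake formula the frequencies are cut
  at a radius for which the low-frequency part of f is bounded by h/2.\<close>

theorem Sobolev_inequality:
  fixes Q :: real
  assumes Q: "3 \<le> Q"
  defines "\<alpha> \<equiv> real DIM('a::euclidean_space) / 2 - real DIM('a) / Q"
  shows "\<exists>C>0. \<forall>f U A. 0 < A \<longrightarrow> frel f U \<longrightarrow> l2b (\<lambda>\<xi>. complex_of_real (norm (\<xi>::'a) powr \<alpha>) * U \<xi>) A \<longrightarrow>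
    integrable lborel (\<lambda>x. norm (f x) powr Q) \<and> (\<integral>x. norm (f x) powr Q \<partial>lborel) \<le> C * A powr Q"
proof -
  let ?n = "real DIM('a)" and ?c = "pc TYPE('a)"
  have c: "0 < ?c" by (rule pc_pos)
  have n: "0 < ?n" by simp
  have \<alpha>: "0 \<le> \<alpha>" "2 * \<alpha> < ?n"
    using Q n unfolding \<alpha>_def by (auto simp: field_simps)
  define \<kappa> where "\<kappa> = ?n / Q"
  have \<kappa>: "0 < \<kappa>" "?n / 2 - \<alpha> = \<kappa>" "\<kappa> * (Q - 2) = 2 * \<alpha>" using Q n unfolding \<alpha>_def \<kappa>_def by (auto simp: field_simps)
  obtain D where D: "0 < D" "\<And>U g A \<rho>. 0 < \<rho> \<Longrightarrow> l2 U \<Longrightarrow> l2b (\<lambda>\<xi>. complex_of_real (norm (\<xi>::'a) powr \<alpha>) * U \<xi>) A \<Longrightarrow>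
    frel g (\<lambda>\<xi>. indicator (cball 0 \<rho>) \<xi> * U \<xi>) \<Longrightarrow> AE x in lborel. norm (g x) \<le> D * \<rho> powr \<kappa> * A"
    using frel_low_frequency_bound[OF \<alpha>] unfolding \<kappa>(2) by blast
  define E where "E = 2 powr Q * (4 / ?c\<^sup>2 * (2 * D) powr (Q - 2))"
  have E0: "0 < E" using c D by (simp add: E_def)
  have main: "(\<integral>\<^sup>+x. ennreal (norm (f x) powr Q) \<partial>lborel) \<le> ennreal (E * A powr Q)"
    if A: "0 < A" and fU: "frel f U" and UA: "l2b (\<lambda>\<xi>. complex_of_real (norm \<xi> powr \<alpha>) * U \<xi>) A" for f U :: "'a \<Rightarrow> complex" and A
  proof -
    note lU = frelD(2)[OF fU]
    have [measurable]: "U \<in> borel_measurable borel" "f \<in> borel_measurable borel"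
      using frelD(1,2)[OF fU] by (auto intro: l2_measurable)
    \<comment> \<open>With this normalisation the low-frequency bound
      \<open>D * \<rho> h powr \<kappa> * A\<close> equals \<open>h / 2\<close>.\<close>
    define K where "K = 2 * D * A"
    have K: "0 < K" using D A by (simp add: K_def)
    define \<rho> where "\<rho> h = (h / K) powr (1 / \<kappa>)" for h
    have [measurable]: "\<rho> \<in> borel_measurable borel" unfolding \<rho>_def[abs_def] by measurable
    let ?T = "\<lambda>h. \<integral>\<^sup>+\<xi>. ennreal ((norm (U \<xi>))\<^sup>2) * (if \<rho> h < norm \<xi> then 1 else 0) \<partial>lborel"
    \<comment> \<open>Chebyshev's inequality: where |f| exceeds h the high-frequency remainder is at
      least h/2, and Plancherel expresses its norm by the frequencies beyond
      \<open>\<rho> h\<close>.\<close>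
    have level: "(\<integral>\<^sup>+x. indicator {..<norm (f x)} h \<partial>lborel) \<le> ennreal (4 / (?c\<^sup>2 * h\<^sup>2)) * ?T h" if h: "0 < h" for h
    proof -
      have \<rho>: "0 < \<rho> h" using h K by (simp add: \<rho>_def)
      have \<rho>\<kappa>: "D * \<rho> h powr \<kappa> * A = h / 2" using h K \<kappa> D A unfolding \<rho>_def by (simp add: powr_powr K_def)
      obtain B where B: "l2b U B" using lU by (auto simp: l2_def)
      have "l2b (\<lambda>\<xi>. indicator (cball 0 (\<rho> h)) \<xi> * U \<xi>) B"
        by (rule l2b_dominated1[OF B]) (auto simp: indicator_def)
      then obtain g where g: "frel g (\<lambda>\<xi>. indicator (cball 0 (\<rho> h)) \<xi> * U \<xi>)"
        using frel_surj[OF l2b_imp_l2] by blast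
      have [measurable]: "g \<in> borel_measurable borel" using frelD(1)[OF g] by (rule l2_measurable)
      have gb: "AE x in lborel. norm (g x) \<le> h / 2" using D(2)[OF \<rho> lU UA g] unfolding \<rho>\<kappa> .
      note d = frel_diff[OF fU g]
      obtain B' where B': "l2b (\<lambda>x. f x - g x) B'" using frelD(1)[OF d] by (auto simp: l2_def)
      obtain B'' where B'': "l2b (\<lambda>\<xi>. U \<xi> - indicator (cball 0 (\<rho> h)) \<xi> * U \<xi>) B''" using frelD(2)[OF d] by (auto simp: l2_def)
      have "(\<integral>\<^sup>+x. indicator {..<norm (f x)} h \<partial>lborel) \<le> (\<integral>\<^sup>+x. ennreal (4 / h\<^sup>2) * ennreal ((norm (f x - g x))\<^sup>2) \<partial>lborel)"
      proof (rule nn_integral_mono_AE)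
        show "AE x in lborel. indicator {..<norm (f x)} h \<le> ennreal (4 / h\<^sup>2) * ennreal ((norm (f x - g x))\<^sup>2)"
          using gb
        proof eventually_elim
          case (elim x)
          show ?case
          proof (cases "h < norm (f x)")
            case True
            then have "h / 2 \<le> norm (f x - g x)" using elim norm_triangle_ineq2[of "f x" "g x"] by simp
            then have "(h / 2)\<^sup>2 \<le> (norm (f x - g x))\<^sup>2" using h by (intro power_mono) auto
            then have "1 \<le> 4 / h\<^sup>2 * (norm (f x - g x))\<^sup>2" using h by (simp add: field_simps power_divide)
            then show ?thesis using True by (simp add: ennreal_mult'[symmetric])
          qed simp
        qed
      qed
      also have "\<dots> = ennreal (4 / h\<^sup>2) * ennreal (\<integral>x. (norm (f x - g x))\<^sup>2 \<partial>lborel)"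
        by (subst nn_integral_cmult) (auto simp: nn_integral_eq_integral[OF l2b_integrable[OF B']])
      also have "(\<integral>x. (norm (f x - g x))\<^sup>2 \<partial>lborel) = (1 / ?c\<^sup>2) * (\<integral>\<xi>. (norm (U \<xi> - indicator (cball 0 (\<rho> h)) \<xi> * U \<xi>))\<^sup>2 \<partial>lborel)"
        unfolding frel_Plancherel[OF d] using c by simp
      also have "ennreal (4 / h\<^sup>2) * ennreal \<dots> = ennreal (4 / (?c\<^sup>2 * h\<^sup>2)) * ennreal (\<integral>\<xi>. (norm (U \<xi> - indicator (cball 0 (\<rho> h)) \<xi> * U \<xi>))\<^sup>2 \<partial>lborel)"
        by (simp add: ennreal_mult'[symmetric] ac_simps)
      also have "ennreal (\<integral>\<xi>. (norm (U \<xi> - indicator (cball 0 (\<rho> h)) \<xi> * U \<xi>))\<^sup>2 \<partial>lborel) = (\<integral>\<^sup>+\<xi>. ennreal ((norm (U \<xi> - indicator (cball 0 (\<rho> h)) \<xi> * U \<xi>))\<^sup>2) \<partial>lborel)"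
        by (rule nn_integral_eq_integral[symmetric, OF l2b_integrable[OF B'']]) simp
      also have "\<dots> = ?T h"
        by (rule nn_integral_cong) (auto simp: indicator_def)
      finally show ?thesis .
    qed
    have "(\<integral>\<^sup>+x. ennreal (norm (f x) powr Q) \<partial>lborel) \<le> (\<integral>\<^sup>+x. ennreal (2 powr Q) * (\<integral>\<^sup>+h. ennreal (h powr (Q - 1)) * indicator {0<..} h * indicator {..<norm (f x)} h \<partial>lborel) \<partial>lborel)"
      using Q by (intro nn_integral_mono layer_cake_upper) auto
    also have "\<dots> = ennreal (2 powr Q) * (\<integral>\<^sup>+x. (\<integral>\<^sup>+h. ennreal (h powr (Q - 1)) * indicator {0<..} h * indicator {..<norm (f x)} h \<partial>lborel) \<partial>lborel)"
      by (rule nn_integral_cmult) (unfold indicator_def lessThan_iff greaterThan_iff, measurable)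
    also have "(\<integral>\<^sup>+x. (\<integral>\<^sup>+h. ennreal (h powr (Q - 1)) * indicator {0<..} h * indicator {..<norm (f x)} h \<partial>lborel) \<partial>lborel)
      = (\<integral>\<^sup>+h. (\<integral>\<^sup>+x. ennreal (h powr (Q - 1)) * indicator {0<..} h * indicator {..<norm (f x)} h \<partial>lborel) \<partial>lborel)"
      by (rule lborel_pair.Fubini') (unfold indicator_def lessThan_iff greaterThan_iff, measurable)
    also have "\<dots> \<le> (\<integral>\<^sup>+h. (\<integral>\<^sup>+\<xi>. ennreal (4 / ?c\<^sup>2) * ennreal ((norm (U \<xi>))\<^sup>2) * (ennreal (h powr (Q - 3)) * indicator {0<..} h * (if \<rho> h < norm \<xi> then 1 else 0)) \<partial>lborel) \<partial>lborel)"
    proof (rule nn_integral_mono)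
      fix h :: real
      show "(\<integral>\<^sup>+x. ennreal (h powr (Q - 1)) * indicator {0<..} h * indicator {..<norm (f x)} h \<partial>lborel) \<le>
        (\<integral>\<^sup>+\<xi>. ennreal (4 / ?c\<^sup>2) * ennreal ((norm (U \<xi>))\<^sup>2) * (ennreal (h powr (Q - 3)) * indicator {0<..} h * (if \<rho> h < norm \<xi> then 1 else 0)) \<partial>lborel)"
      proof (cases "0 < h")
        case True
        have "(\<integral>\<^sup>+x. ennreal (h powr (Q - 1)) * indicator {0<..} h * indicator {..<norm (f x)} h \<partial>lborel) = ennreal (h powr (Q - 1)) * (\<integral>\<^sup>+x. indicator {..<norm (f x)} h \<partial>lborel)"
          using True by simp (rule nn_integral_cmult, unfold indicator_def lessThan_iff, measurable)
        also have "\<dots> \<le> ennreal (h powr (Q - 1)) * (ennreal (4 / (?c\<^sup>2 * h\<^sup>2)) * ?T h)"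
          by (intro mult_left_mono level True) simp
        also have "\<dots> = (ennreal (4 / ?c\<^sup>2) * ennreal (h powr (Q - 3))) * ?T h"
        proof -
          have "h powr (Q - 1) = h powr (Q - 3) * h powr 2" unfolding powr_add[symmetric] by simp
          also have "h powr 2 = h\<^sup>2" using True powr_realpow[of h 2] by simp
          finally have "h powr (Q - 1) * (4 / (?c\<^sup>2 * h\<^sup>2)) = (4 / ?c\<^sup>2) * h powr (Q - 3)" using True c by (simp add: field_simps)
          then show ?thesis by (simp add: ennreal_mult'[symmetric] mult.assoc[symmetric])
        qed
        also have "\<dots> = (\<integral>\<^sup>+\<xi>. (ennreal (4 / ?c\<^sup>2) * ennreal (h powr (Q - 3))) * (ennreal ((norm (U \<xi>))\<^sup>2) * (if \<rho> h < norm \<xi> then 1 else 0)) \<partial>lborel)"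
          by (rule nn_integral_cmult[symmetric]) measurable
        also have "\<dots> = (\<integral>\<^sup>+\<xi>. ennreal (4 / ?c\<^sup>2) * ennreal ((norm (U \<xi>))\<^sup>2) * (ennreal (h powr (Q - 3)) * indicator {0<..} h * (if \<rho> h < norm \<xi> then 1 else 0)) \<partial>lborel)"
          using True by (intro nn_integral_cong) (simp add: ac_simps)
        finally show ?thesis .
      qed simp
    qed
    also have "\<dots> = (\<integral>\<^sup>+\<xi>. (\<integral>\<^sup>+h. ennreal (4 / ?c\<^sup>2) * ennreal ((norm (U \<xi>))\<^sup>2) * (ennreal (h powr (Q - 3)) * indicator {0<..} h * (if \<rho> h < norm \<xi> then 1 else 0)) \<partial>lborel) \<partial>lborel)"
      by (rule lborel_pair.Fubini'[symmetric]) measurable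
    also have "\<dots> \<le> (\<integral>\<^sup>+\<xi>. ennreal (4 / ?c\<^sup>2 * K powr (Q - 2)) * ennreal ((norm (complex_of_real (norm \<xi> powr \<alpha>) * U \<xi>))\<^sup>2) \<partial>lborel)"
    proof (rule nn_integral_mono)
      fix \<xi> :: 'a
      \<comment> \<open>The condition \<open>\<rho> h < norm \<xi>\<close> restricts h to at most
        \<open>?H\<close>. As Q \<ge> 3 the integrand is monotone in h, so the integral is at most
        the power Q - 2 of \<open>?H\<close>, whose frequency exponent \<kappa> (Q - 2) is exactly 2
        \<alpha>.\<close>
      let ?H = "K * norm \<xi> powr \<kappa>"
      have H: "0 \<le> ?H" using K by simp
      have "(\<integral>\<^sup>+h. ennreal (h powr (Q - 3)) * indicator {0<..} h * (if \<rho> h < norm \<xi> then 1 else 0) \<partial>lborel) \<le> (\<integral>\<^sup>+h. ennreal (?H powr (Q - 3)) * indicator {0..?H} h \<partial>lborel)"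
      proof (rule nn_integral_mono)
        fix h :: real
        show "ennreal (h powr (Q - 3)) * indicator {0<..} h * (if \<rho> h < norm \<xi> then 1 else 0) \<le> ennreal (?H powr (Q - 3)) * indicator {0..?H} h"
        proof (cases "0 < h \<and> \<rho> h < norm \<xi>")
          case True
          then have "\<rho> h powr \<kappa> \<le> norm \<xi> powr \<kappa>" using \<kappa> by (intro powr_mono2) (auto simp: \<rho>_def)
          moreover have "\<rho> h powr \<kappa> = h / K" using True K \<kappa> by (simp add: \<rho>_def powr_powr)
          ultimately have "h \<le> ?H" using K by (simp add: field_simps)
          then show ?thesis using True Q by (simp add: ennreal_leI powr_mono2)
        qed auto
      qed
      also have "\<dots> = ennreal (?H powr (Q - 3)) * ennreal ?H"
        using H by (subst nn_integral_cmult_indicator) auto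
      also have "\<dots> = ennreal (?H powr (Q - 3) * ?H powr 1)"
        using H by (simp add: ennreal_mult'[symmetric])
      also have "?H powr (Q - 3) * ?H powr 1 = ?H powr (Q - 2)"
        unfolding powr_add[symmetric] by simp
      also have "\<dots> = K powr (Q - 2) * norm \<xi> powr (2 * \<alpha>)"
        using K by (simp add: powr_mult powr_powr \<kappa>(3))
      finally have "ennreal (4 / ?c\<^sup>2) * ennreal ((norm (U \<xi>))\<^sup>2) * (\<integral>\<^sup>+h. ennreal (h powr (Q - 3)) * indicator {0<..} h * (if \<rho> h < norm \<xi> then 1 else 0) \<partial>lborel)
        \<le> ennreal (4 / ?c\<^sup>2) * ennreal ((norm (U \<xi>))\<^sup>2) * ennreal (K powr (Q - 2) * norm \<xi> powr (2 * \<alpha>))"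
        by (rule mult_left_mono) simp
      also have "\<dots> = ennreal (4 / ?c\<^sup>2 * K powr (Q - 2)) * ennreal ((norm (complex_of_real (norm \<xi> powr \<alpha>) * U \<xi>))\<^sup>2)"
      proof -
        have "norm \<xi> powr (2 * \<alpha>) = (norm \<xi> powr \<alpha>)\<^sup>2" by (simp add: power2_eq_square powr_add[symmetric])
        then show ?thesis by (simp add: ennreal_mult'[symmetric] norm_mult power_mult_distrib ac_simps)
      qed
      finally show "(\<integral>\<^sup>+h. ennreal (4 / ?c\<^sup>2) * ennreal ((norm (U \<xi>))\<^sup>2) * (ennreal (h powr (Q - 3)) * indicator {0<..} h * (if \<rho> h < norm \<xi> then 1 else 0)) \<partial>lborel)
        \<le> ennreal (4 / ?c\<^sup>2 * K powr (Q - 2)) * ennreal ((norm (complex_of_real (norm \<xi> powr \<alpha>) * U \<xi>))\<^sup>2)"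
        by (subst nn_integral_cmult) auto
    qed
    also have "\<dots> = ennreal (4 / ?c\<^sup>2 * K powr (Q - 2)) * (\<integral>\<^sup>+\<xi>. ennreal ((norm (complex_of_real (norm \<xi> powr \<alpha>) * U \<xi>))\<^sup>2) \<partial>lborel)"
      by (rule nn_integral_cmult) measurable
    also have "\<dots> \<le> ennreal (4 / ?c\<^sup>2 * K powr (Q - 2)) * ennreal (A\<^sup>2)"
      using UA by (intro mult_left_mono) (auto simp: l2b_def)
    also have "ennreal (2 powr Q) * (ennreal (4 / ?c\<^sup>2 * K powr (Q - 2)) * ennreal (A\<^sup>2)) = ennreal (E * A powr Q)"
    proof -
      have "A powr Q = A powr (Q - 2) * A powr 2" unfolding powr_add[symmetric] by simp
      also have "A powr 2 = A\<^sup>2" using A powr_realpow[of A 2] by simp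
      finally have "A powr Q = A powr (Q - 2) * A\<^sup>2" .
      then show ?thesis using A D c by (simp add: E_def K_def powr_mult ennreal_mult'[symmetric] ac_simps)
    qed
    finally show ?thesis by (simp add: mult_left_mono)
  qed
  have "integrable lborel (\<lambda>x. norm (f x) powr Q) \<and> (\<integral>x. norm (f x) powr Q \<partial>lborel) \<le> E * A powr Q"
    if A: "0 < A" and fU: "frel f U" and UA: "l2b (\<lambda>\<xi>. complex_of_real (norm \<xi> powr \<alpha>) * U \<xi>) A" for f U :: "'a \<Rightarrow> complex" and A
  proof
    have [measurable]: "f \<in> borel_measurable borel" using frelD(1)[OF fU] by (rule l2_measurable)
    note m = main[OF A fU UA]
    show i: "integrable lborel (\<lambda>x. norm (f x) powr Q)"
      by (rule integrableI_nonneg) (use le_less_trans[OF m ennreal_less_top] in auto)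
    show "(\<integral>x. norm (f x) powr Q \<partial>lborel) \<le> E * A powr Q"
      using m E0 unfolding nn_integral_eq_integral[OF i AE_I2[OF powr_ge_zero]] by (subst (asm) ennreal_le_iff) auto
  qed
  then show ?thesis using E0 by blast
qed

section \<open>The nonlinearity in scale-dependent Sobolev norms\<close>

definition wt :: "real \<Rightarrow> real \<Rightarrow> 'a::euclidean_space \<Rightarrow> real" where
  "wt s \<Lambda> \<xi> = 1 / \<Lambda>\<^sup>2 + norm \<xi> powr s"

lemma wt_measurable[measurable]: "wt s \<Lambda> \<in> borel_measurable borel"
  unfolding wt_def[abs_def] by measurable

lemma wt_nonneg: "0 \<le> wt s \<Lambda> \<xi>"
  by (simp add: wt_def)

text \<open>At the natural scale \<Lambda> = 1 + t of the equation, \<open>wt\<close> measures \<Lambda>^-2 times the L2 norm plus the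
  homogeneous Sobolev norm of order s, up to constants.\<close>

definition hb :: "real \<Rightarrow> real \<Rightarrow> ('a::euclidean_space \<Rightarrow> real) \<Rightarrow> real \<Rightarrow> bool" where
  "hb s \<Lambda> f A \<longleftrightarrow> L2 f \<and> l2b (\<lambda>\<xi>. complex_of_real (wt s \<Lambda> \<xi>) * FT f \<xi>) A"

lemma hbD: "hb s \<Lambda> f A \<Longrightarrow> L2 f" "hb s \<Lambda> f A \<Longrightarrow> l2b (\<lambda>\<xi>. complex_of_real (wt s \<Lambda> \<xi>) * FT f \<xi>) A" "hb s \<Lambda> f A \<Longrightarrow> 0 \<le> A"
  by (auto simp: hb_def dest: l2b_nonneg)

text \<open>\<open>hb\<close> refers to the chosen representative \<open>FT f\<close>. By uniqueness
  any transform of \<open>f\<close> may take its place, here for introduction and in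
  \<open>hbD2\<close> for elimination.\<close>

lemma hbI:
  assumes "frel (\<lambda>x. complex_of_real (f x)) U" "l2b (\<lambda>\<xi>. complex_of_real (wt s \<Lambda> \<xi>) * U \<xi>) A"
  shows "hb s \<Lambda> f A"
proof -
  have L: "L2 f" using frelD(1)[OF assms(1)] by (simp add: L2_iff_l2)
  have [measurable]: "FT f \<in> borel_measurable borel" using frelD(2)[OF FT_frel[OF L]] by (rule l2_measurable)
  have "AE \<xi> in lborel. complex_of_real (wt s \<Lambda> \<xi>) * FT f \<xi> = complex_of_real (wt s \<Lambda> \<xi>) * U \<xi>"
    using FT_eq_AE[OF assms(1)] by eventually_elim simp
  then have "l2b (\<lambda>\<xi>. complex_of_real (wt s \<Lambda> \<xi>) * FT f \<xi>) A"
    by (rule l2b_cong_AE[OF assms(2), rotated]) measurable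
  then show ?thesis using L by (simp add: hb_def)
qed

lemma hbD2:
  assumes "hb s \<Lambda> f A" "frel (\<lambda>x. complex_of_real (f x)) U"
  shows "l2b (\<lambda>\<xi>. complex_of_real (wt s \<Lambda> \<xi>) * U \<xi>) A"
proof -
  have [measurable]: "U \<in> borel_measurable borel" using frelD(2)[OF assms(2)] by (rule l2_measurable)
  have "AE \<xi> in lborel. complex_of_real (wt s \<Lambda> \<xi>) * U \<xi> = complex_of_real (wt s \<Lambda> \<xi>) * FT f \<xi>"
    using FT_eq_AE[OF assms(2)] by eventually_elim simp
  then show ?thesis
    by (rule l2b_cong_AE[OF hbD(2)[OF assms(1)], rotated]) measurable
qed

lemma hb_mono: "hb s \<Lambda> f A \<Longrightarrow> A \<le> B \<Longrightarrow> hb s \<Lambda> f B"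
  by (auto simp: hb_def intro: l2b_mono)

lemma frel_diff_real:
  assumes "frel (\<lambda>x. complex_of_real (f x)) U" "frel (\<lambda>x. complex_of_real (g x)) V"
  shows "frel (\<lambda>x. complex_of_real (f x - g x)) (\<lambda>\<xi>. U \<xi> - V \<xi>)"
  using frel_diff[OF assms] by simp

lemma hb_diff:
  assumes f: "hb s \<Lambda> f A" and g: "hb s \<Lambda> g B"
  shows "hb s \<Lambda> (\<lambda>x. f x - g x) (A + B)"
proof (rule hbI[OF frel_diff_real[OF FT_frel[OF hbD(1)[OF f]] FT_frel[OF hbD(1)[OF g]]]])
  show "l2b (\<lambda>\<xi>. complex_of_real (wt s \<Lambda> \<xi>) * (FT f \<xi> - FT g \<xi>)) (A + B)"
    using l2b_diff[OF hbD(2)[OF f] hbD(2)[OF g]] by (simp add: right_diff_distrib)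
qed

lemma hb_uminus_diff:
  assumes "hb s \<Lambda> (\<lambda>x. f x - g x) A" "L2 f" "L2 g"
  shows "hb s \<Lambda> (\<lambda>x. g x - f x) A"
proof (rule hbI[OF frel_diff_real[OF FT_frel[OF assms(3)] FT_frel[OF assms(2)]]])
  have "l2b (\<lambda>\<xi>. - (complex_of_real (wt s \<Lambda> \<xi>) * (FT f \<xi> - FT g \<xi>))) A"
    by (rule l2b_minus[OF hbD2[OF assms(1) frel_diff_real[OF FT_frel[OF assms(2)] FT_frel[OF assms(3)]]]])
  then show "l2b (\<lambda>\<xi>. complex_of_real (wt s \<Lambda> \<xi>) * (FT g \<xi> - FT f \<xi>)) A"
    by (simp add: right_diff_distrib)
qed

lemma hb_triangle:
  assumes "hb s \<Lambda> (\<lambda>x. f x - g x) A" "hb s \<Lambda> (\<lambda>x. g x - h x) B" "L2 f" "L2 g" "L2 h"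
  shows "hb s \<Lambda> (\<lambda>x. f x - h x) (A + B)"
proof -
  note F = FT_frel[OF assms(3)] FT_frel[OF assms(4)] FT_frel[OF assms(5)]
  have "l2b (\<lambda>\<xi>. complex_of_real (wt s \<Lambda> \<xi>) * (FT f \<xi> - FT g \<xi>) + complex_of_real (wt s \<Lambda> \<xi>) * (FT g \<xi> - FT h \<xi>)) (A + B)"
    by (intro l2b_add hbD2[OF assms(1) frel_diff_real] hbD2[OF assms(2) frel_diff_real] F)
  then show ?thesis
    by (intro hbI[OF frel_diff_real[OF F(1) F(3)]]) (simp add: algebra_simps)
qed

lemma hb_0: "0 \<le> A \<Longrightarrow> hb s \<Lambda> (\<lambda>x. 0) A"
proof (rule hbI[of _ "\<lambda>_. 0"])
  show "frel (\<lambda>x::'a. complex_of_real 0) (\<lambda>_. 0)"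
    using l2b_zero[of 0] by (auto simp: frel_def l2_def)
qed (simp add: l2b_zero)

lemma hb_scale_change:
  assumes "hb s \<Lambda> f A" "0 < \<Lambda>" "0 < \<mu>" "0 \<le> c" "1 / \<mu>\<^sup>2 \<le> c * (1 / \<Lambda>\<^sup>2)" "1 \<le> c"
  shows "hb s \<mu> f (c * A)"
proof -
  have [measurable]: "FT f \<in> borel_measurable borel" using frelD(2)[OF FT_frel[OF hbD(1)[OF assms(1)]]] by (rule l2_measurable)
  have "l2b (\<lambda>\<xi>. complex_of_real (wt s \<mu> \<xi>) * FT f \<xi>) (c * A)"
  proof (rule l2b_dominated[OF hbD(2)[OF assms(1)]])
    have "wt s \<mu> \<xi> \<le> c * wt s \<Lambda> \<xi>" for \<xi> :: 'a
    proof -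
      have "1 * norm \<xi> powr s \<le> c * norm \<xi> powr s" using assms by (intro mult_right_mono) auto
      then show ?thesis using assms(5) by (simp add: wt_def distrib_left)
    qed
    note wle = this
    show "AE \<xi> in lborel. norm (complex_of_real (wt s \<mu> \<xi>) * FT f \<xi>) \<le> c * norm (complex_of_real (wt s \<Lambda> \<xi>) * FT f \<xi>)"
    proof (intro AE_I2)
      fix \<xi> :: 'a
      show "norm (complex_of_real (wt s \<mu> \<xi>) * FT f \<xi>) \<le> c * norm (complex_of_real (wt s \<Lambda> \<xi>) * FT f \<xi>)"
        using mult_right_mono[OF wle, of "norm (FT f \<xi>)"]
        by (simp add: norm_mult abs_of_nonneg[OF wt_nonneg] mult.assoc)
    qed
  qed (use assms in auto)
  then show ?thesis using hbD(1)[OF assms(1)] by (simp add: hb_def)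
qed

lemma hb_scale_down: "hb s \<Lambda> f A \<Longrightarrow> 1 \<le> \<Lambda> \<Longrightarrow> hb s 1 f (\<Lambda>\<^sup>2 * A)"
  by (rule hb_scale_change) auto

text \<open>Compares the weight at scale 1 with the one in \<open>Hsnorm\<close>, so that scale 1
  carries the topology in which mild solutions are continuous. The second bound splits at |xi| =
  1.\<close>

lemma bessel_weight_bounds:
  assumes s: "0 < s"
  shows "(wt s 1 \<xi>)\<^sup>2 \<le> 4 * (1 + (norm \<xi>)\<^sup>2) powr s"
    and "(1 + (norm \<xi>)\<^sup>2) powr s \<le> 2 powr s * (wt s 1 \<xi>)\<^sup>2"
proof -
  let ?x = "norm \<xi>"
  have pos: "0 < 1 + ?x\<^sup>2" by (simp add: add_pos_nonneg)
  have pp: "(1 + ?x\<^sup>2) powr s = ((1 + ?x\<^sup>2) powr (s/2))\<^sup>2" by (simp add: power2_eq_square powr_add[symmetric])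
  have xs: "?x powr s = (?x\<^sup>2) powr (s/2)"
  proof (cases "?x = 0")
    case False
    then have "?x\<^sup>2 = ?x powr 2" using powr_realpow[of ?x 2] by simp
    then show ?thesis by (simp only: powr_powr) simp
  qed simp
  have "1 \<le> (1 + ?x\<^sup>2) powr (s/2)" using s by (intro ge_one_powr_ge_zero) auto
  moreover have "?x powr s \<le> (1 + ?x\<^sup>2) powr (s/2)" unfolding xs using s by (intro powr_mono2) auto
  ultimately have "wt s 1 \<xi> \<le> 2 * (1 + ?x\<^sup>2) powr (s/2)" by (simp add: wt_def)
  then have "(wt s 1 \<xi>)\<^sup>2 \<le> (2 * (1 + ?x\<^sup>2) powr (s/2))\<^sup>2" by (intro power_mono wt_nonneg)
  then show "(wt s 1 \<xi>)\<^sup>2 \<le> 4 * (1 + ?x\<^sup>2) powr s" by (simp add: pp power_mult_distrib)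
  have "(1 + ?x\<^sup>2) powr (s/2) \<le> 2 powr (s/2) * wt s 1 \<xi>"
  proof (cases "?x \<le> 1")
    case True
    then have "?x\<^sup>2 \<le> 1" using power_mono[of ?x 1 2] by simp
    then have "(1 + ?x\<^sup>2) powr (s/2) \<le> 2 powr (s/2) * 1" using s pos by (auto intro!: powr_mono2)
    also have "\<dots> \<le> 2 powr (s/2) * wt s 1 \<xi>" by (intro mult_left_mono) (auto simp: wt_def)
    finally show ?thesis .
  next
    case False
    then have "1 \<le> ?x\<^sup>2" using power_mono[of 1 ?x 2] by simp
    then have "(1 + ?x\<^sup>2) powr (s/2) \<le> (2 * ?x\<^sup>2) powr (s/2)" using s pos by (intro powr_mono2) auto
    also have "\<dots> = 2 powr (s/2) * ?x powr s" unfolding xs by (simp add: powr_mult)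
    also have "\<dots> \<le> 2 powr (s/2) * wt s 1 \<xi>" by (intro mult_left_mono) (auto simp: wt_def)
    finally show ?thesis .
  qed
  then have "((1 + ?x\<^sup>2) powr (s/2))\<^sup>2 \<le> (2 powr (s/2) * wt s 1 \<xi>)\<^sup>2" by (intro power_mono) auto
  moreover have "(2 powr (s/2))\<^sup>2 = 2 powr s" by (simp add: power2_eq_square powr_add[symmetric])
  ultimately show "(1 + ?x\<^sup>2) powr s \<le> 2 powr s * (wt s 1 \<xi>)\<^sup>2" unfolding pp by (simp add: power_mult_distrib)
qed

lemma hb_imp_Hs:
  assumes s: "0 < s" and h: "hb s 1 f A"
  shows "Hs s f" "Hsnorm s f \<le> 2 powr (s/2) * A"
proof -
  have [measurable]: "FT f \<in> borel_measurable borel" using frelD(2)[OF FT_frel[OF hbD(1)[OF h]]] by (rule l2_measurable)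
  note i = l2b_integrable[OF hbD(2)[OF h]]
  have le: "(1 + (norm \<xi>)\<^sup>2) powr s * (cmod (FT f \<xi>))\<^sup>2 \<le> 2 powr s * (norm (complex_of_real (wt s 1 \<xi>) * FT f \<xi>))\<^sup>2" for \<xi>
    using mult_right_mono[OF bessel_weight_bounds(2)[OF s], of "(cmod (FT f \<xi>))\<^sup>2" \<xi>]
    by (simp add: norm_mult power_mult_distrib mult.assoc)
  have ii: "integrable lborel (\<lambda>\<xi>. (1 + (norm \<xi>)\<^sup>2) powr s * (cmod (FT f \<xi>))\<^sup>2)"
  proof (rule Bochner_Integration.integrable_bound[OF integrable_mult_right[OF i, of "2 powr s"]])
    show "AE \<xi> in lborel. norm ((1 + (norm \<xi>)\<^sup>2) powr s * (cmod (FT f \<xi>))\<^sup>2) \<le> norm (2 powr s * (norm (complex_of_real (wt s 1 \<xi>) * FT f \<xi>))\<^sup>2)"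
      using le by (intro AE_I2) simp
  qed measurable
  then show "Hs s f" using hbD(1)[OF h] by (simp add: Hs_def)
  have "(\<integral>\<xi>. (1 + (norm \<xi>)\<^sup>2) powr s * (cmod (FT f \<xi>))\<^sup>2 \<partial>lborel) \<le> (\<integral>\<xi>. 2 powr s * (norm (complex_of_real (wt s 1 \<xi>) * FT f \<xi>))\<^sup>2 \<partial>lborel)"
    by (rule integral_mono[OF ii integrable_mult_right[OF i] le])
  also have "\<dots> = 2 powr s * (\<integral>\<xi>. (norm (complex_of_real (wt s 1 \<xi>) * FT f \<xi>))\<^sup>2 \<partial>lborel)"
    by (rule integral_mult_right_zero)
  also have "\<dots> \<le> 2 powr s * A\<^sup>2" by (intro mult_left_mono l2b_integral hbD(2)[OF h]) auto
  also have "\<dots> = (2 powr (s/2) * A)\<^sup>2" by (simp add: power2_eq_square powr_add[symmetric])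
  finally show "Hsnorm s f \<le> 2 powr (s/2) * A"
    unfolding Hsnorm_def using hbD(3)[OF h] by (intro real_le_lsqrt) auto
qed

lemma Hs_imp_hb:
  assumes s: "0 < s" and H: "Hs s f"
  shows "hb s 1 f (2 * Hsnorm s f)"
proof -
  have L: "L2 f" using H by (simp add: Hs_def)
  have [measurable]: "FT f \<in> borel_measurable borel" using frelD(2)[OF FT_frel[OF L]] by (rule l2_measurable)
  have i: "integrable lborel (\<lambda>\<xi>. (1 + (norm \<xi>)\<^sup>2) powr s * (cmod (FT f \<xi>))\<^sup>2)" using H by (simp add: Hs_def)
  have le: "(norm (complex_of_real (wt s 1 \<xi>) * FT f \<xi>))\<^sup>2 \<le> 4 * ((1 + (norm \<xi>)\<^sup>2) powr s * (cmod (FT f \<xi>))\<^sup>2)" for \<xi>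
    using mult_right_mono[OF bessel_weight_bounds(1)[OF s], of "(cmod (FT f \<xi>))\<^sup>2" \<xi>]
    by (simp add: norm_mult power_mult_distrib mult.assoc)
  have ii: "integrable lborel (\<lambda>\<xi>. (norm (complex_of_real (wt s 1 \<xi>) * FT f \<xi>))\<^sup>2)"
  proof (rule Bochner_Integration.integrable_bound[OF integrable_mult_right[OF i, of 4]])
    show "AE \<xi> in lborel. norm ((norm (complex_of_real (wt s 1 \<xi>) * FT f \<xi>))\<^sup>2) \<le> norm (4 * ((1 + (norm \<xi>)\<^sup>2) powr s * (cmod (FT f \<xi>))\<^sup>2))"
      using le by (intro AE_I2) simp
  qed measurable
  have nn: "0 \<le> (\<integral>\<xi>. (1 + (norm \<xi>)\<^sup>2) powr s * (cmod (FT f \<xi>))\<^sup>2 \<partial>lborel)" by simp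
  have "l2b (\<lambda>\<xi>. complex_of_real (wt s 1 \<xi>) * FT f \<xi>) (2 * Hsnorm s f)"
  proof (rule l2bI[OF _ _ ii])
    have "(\<integral>\<xi>. (norm (complex_of_real (wt s 1 \<xi>) * FT f \<xi>))\<^sup>2 \<partial>lborel) \<le> (\<integral>\<xi>. 4 * ((1 + (norm \<xi>)\<^sup>2) powr s * (cmod (FT f \<xi>))\<^sup>2) \<partial>lborel)"
      by (rule integral_mono[OF ii integrable_mult_right[OF i] le])
    then show "(\<integral>\<xi>. (norm (complex_of_real (wt s 1 \<xi>) * FT f \<xi>))\<^sup>2 \<partial>lborel) \<le> (2 * Hsnorm s f)\<^sup>2"
      using nn by (simp add: Hsnorm_def power_mult_distrib)
  qed (use nn in \<open>simp_all add: Hsnorm_def\<close>)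
  then show ?thesis using L by (simp add: hb_def)
qed

section \<open>Pointwise inequalities for the power nonlinearity\<close>

lemma powr_diff_le:
  fixes a b p :: real
  assumes p: "1 \<le> p"
  shows "\<bar>\<bar>a\<bar> powr p - \<bar>b\<bar> powr p\<bar> \<le> p * \<bar>a - b\<bar> * (\<bar>a\<bar> + \<bar>b\<bar>) powr (p - 1)"
proof -
  have *: "\<bar>x powr p - y powr p\<bar> \<le> p * \<bar>x - y\<bar> * (x + y) powr (p - 1)" if "0 \<le> x" "x \<le> y" for x y
  proof (cases "x = 0")
    case True
    show ?thesis
    proof (cases "y = 0")
      case False
      have "y powr p = y * y powr (p - 1)" using False that powr_add[of y 1 "p - 1"] by simp
      then show ?thesis using True that p mult_right_mono[of 1 p "y * y powr (p - 1)"] by (simp add: mult.assoc)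
    qed (use True in simp)
  next
    case False
    then have x: "0 < x" using that by simp
    show ?thesis
    proof (cases "x = y")
      case False
      then have xy: "x < y" using that by simp
      have "\<exists>z. x < z \<and> z < y \<and> y powr p - x powr p = (y - x) * (p * z powr (p - 1))"
        by (rule MVT2[OF xy]) (use x in \<open>auto intro!: derivative_eq_intros\<close>)
      then obtain z where z: "x < z" "z < y" "y powr p - x powr p = (y - x) * (p * z powr (p - 1))" by blast
      have "z powr (p - 1) \<le> (x + y) powr (p - 1)" using z x p by (intro powr_mono2) auto
      then have "(y - x) * (p * z powr (p - 1)) \<le> (y - x) * (p * (x + y) powr (p - 1))"
        using xy p by (intro mult_left_mono) auto
      moreover have "0 \<le> (y - x) * (p * z powr (p - 1))" using xy p by simp
      ultimately show ?thesis using z(3) xy by (simp add: abs_if ac_simps)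
    qed simp
  qed
  have "\<bar>\<bar>a\<bar> powr p - \<bar>b\<bar> powr p\<bar> \<le> p * \<bar>\<bar>a\<bar> - \<bar>b\<bar>\<bar> * (\<bar>a\<bar> + \<bar>b\<bar>) powr (p - 1)"
    using *[of "\<bar>a\<bar>" "\<bar>b\<bar>"] *[of "\<bar>b\<bar>" "\<bar>a\<bar>"] by (cases "\<bar>a\<bar> \<le> \<bar>b\<bar>") (auto simp: abs_minus_commute add.commute)
  also have "\<dots> \<le> p * \<bar>a - b\<bar> * (\<bar>a\<bar> + \<bar>b\<bar>) powr (p - 1)"
    using p by (intro mult_right_mono mult_left_mono) auto
  finally show ?thesis .
qed

text \<open>The split is at d = \<theta> W. If d has relative size \<theta>, both terms are of order
  \<theta>^r W^(r+q), so products turn into pure powers without losing the smallness of the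
  difference.\<close>

lemma max_split:
  fixes d W \<theta> q r :: real
  assumes "0 \<le> d" "0 \<le> W" "0 < \<theta>" "0 \<le> q" "0 \<le> r"
  shows "d powr r * W powr q \<le> \<theta> powr (- q) * d powr (r + q) + \<theta> powr r * W powr (r + q)"
proof (cases "\<theta> * W \<le> d")
  case True
  then have "W \<le> d / \<theta>" using assms by (simp add: field_simps)
  then have "W powr q \<le> (d / \<theta>) powr q" using assms by (intro powr_mono2) auto
  also have "\<dots> = \<theta> powr (- q) * d powr q" using assms by (simp add: powr_divide powr_minus_divide)
  finally have "d powr r * W powr q \<le> d powr r * (\<theta> powr (- q) * d powr q)" by (intro mult_left_mono) auto
  also have "\<dots> = \<theta> powr (- q) * d powr (r + q)" by (simp add: powr_add)
  also have "\<dots> \<le> \<theta> powr (- q) * d powr (r + q) + \<theta> powr r * W powr (r + q)" by simp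
  finally show ?thesis .
next
  case False
  then have "d powr r \<le> (\<theta> * W) powr r" using assms by (intro powr_mono2) auto
  then have "d powr r * W powr q \<le> (\<theta> * W) powr r * W powr q" by (intro mult_right_mono) auto
  also have "\<dots> = \<theta> powr r * W powr (r + q)" using assms by (simp add: powr_mult powr_add)
  also have "\<dots> \<le> \<theta> powr (- q) * d powr (r + q) + \<theta> powr r * W powr (r + q)" by simp
  finally show ?thesis .
qed

text \<open>Interpolation between L2 and L^(2p) in pointwise form: below the height h the square
  dominates, above it the power 2p.\<close>

lemma powr_interpolate:
  fixes x h p :: real
  assumes "0 \<le> x" "0 < h" "2 \<le> p"
  shows "x powr p \<le> h powr (p - 2) * x\<^sup>2 + h powr (- p) * x powr (2 * p)"
proof (cases "x \<le> h")
  case True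
  show ?thesis
  proof (cases "x = 0")
    case False
    then have "x powr p = x powr (p - 2) * x powr 2" by (simp add: powr_add[symmetric])
    also have "\<dots> = x powr (p - 2) * x\<^sup>2" using False assms powr_realpow[of x 2] by simp
    also have "\<dots> \<le> h powr (p - 2) * x\<^sup>2" using True assms by (intro mult_right_mono powr_mono2) auto
    finally show ?thesis by (simp add: add_increasing2)
  qed simp
next
  case False
  have "1 \<le> (x / h) powr p" using False assms by (intro ge_one_powr_ge_zero) auto
  then have "x powr p * 1 \<le> x powr p * (x / h) powr p" by (intro mult_left_mono) auto
  also have "\<dots> = h powr (- p) * x powr (2 * p)" using assms by (simp add: powr_divide powr_minus_divide powr_add[symmetric])
  finally show ?thesis by (simp add: add_increasing)
qed

lemma powr_add_le:
  fixes a b q :: real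
  assumes "0 \<le> a" "0 \<le> b" "0 \<le> q"
  shows "(a + b) powr q \<le> 2 powr q * (a powr q + b powr q)"
proof -
  have "(a + b) powr q \<le> (2 * max a b) powr q" using assms by (intro powr_mono2) auto
  also have "\<dots> = 2 powr q * max a b powr q" using assms by (simp add: powr_mult)
  also have "\<dots> \<le> 2 powr q * (a powr q + b powr q)" by (intro mult_left_mono) (auto simp: max_def)
  finally show ?thesis .
qed

text \<open>\<theta> is the relative size of the difference and h a height at which to interpolate.
  Every product is split by \<open>max_split\<close> before integration, so the bounds retain the
  factor \<theta>, squared in the second one, that makes the iteration contract.\<close>

lemma power_nonlinearity_difference:
  fixes f g :: "'a::euclidean_space \<Rightarrow> real"
  assumes p: "2 \<le> p" and \<theta>: "0 < \<theta>" and h: "0 < h"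
    and [measurable]: "f \<in> borel_measurable borel" "g \<in> borel_measurable borel"
    and i2: "integrable lborel (\<lambda>x. (f x)\<^sup>2)" "integrable lborel (\<lambda>x. (g x)\<^sup>2)" "integrable lborel (\<lambda>x. (f x - g x)\<^sup>2)"
    and ip: "integrable lborel (\<lambda>x. \<bar>f x\<bar> powr (2 * p))" "integrable lborel (\<lambda>x. \<bar>g x\<bar> powr (2 * p))" "integrable lborel (\<lambda>x. \<bar>f x - g x\<bar> powr (2 * p))"
    and b2: "(\<integral>x. (f x)\<^sup>2 \<partial>lborel) \<le> P" "(\<integral>x. (g x)\<^sup>2 \<partial>lborel) \<le> P" "(\<integral>x. (f x - g x)\<^sup>2 \<partial>lborel) \<le> \<theta>\<^sup>2 * P"
    and bp: "(\<integral>x. \<bar>f x\<bar> powr (2 * p) \<partial>lborel) \<le> R" "(\<integral>x. \<bar>g x\<bar> powr (2 * p) \<partial>lborel) \<le> R"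
      "(\<integral>x. \<bar>f x - g x\<bar> powr (2 * p) \<partial>lborel) \<le> \<theta> powr (2 * p) * R"
  defines "F \<equiv> \<lambda>x. \<bar>f x\<bar> powr p - \<bar>g x\<bar> powr p"
  shows "integrable lborel F" "(\<integral>x. \<bar>F x\<bar> \<partial>lborel) \<le> p * \<theta> * (5 * (h powr (p - 2) * P) + (1 + 2 * 2 powr (2 * p)) * (h powr (- p) * R))"
    and "integrable lborel (\<lambda>x. (F x)\<^sup>2)" "(\<integral>x. (F x)\<^sup>2 \<partial>lborel) \<le> p\<^sup>2 * \<theta>\<^sup>2 * ((1 + 2 * 2 powr (2 * p)) * R)"
proof -
  let ?d = "\<lambda>x. \<bar>f x - g x\<bar>" and ?W = "\<lambda>x. \<bar>f x\<bar> + \<bar>g x\<bar>"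
  define W2 where "W2 x = 2 * ((f x)\<^sup>2 + (g x)\<^sup>2)" for x
  define Wp where "Wp x = 2 powr (2 * p) * (\<bar>f x\<bar> powr (2 * p) + \<bar>g x\<bar> powr (2 * p))" for x
  have [measurable]: "F \<in> borel_measurable borel" unfolding F_def by measurable
  have W2: "(?W x)\<^sup>2 \<le> W2 x" for x
    unfolding W2_def using sum_squares_bound[of "\<bar>f x\<bar>" "\<bar>g x\<bar>"] by (simp add: power2_sum)
  have Wp: "?W x powr (2 * p) \<le> Wp x" for x
    unfolding Wp_def using p by (intro powr_add_le) auto
  have iW: "integrable lborel W2" "integrable lborel Wp"
    unfolding W2_def[abs_def] Wp_def[abs_def] using i2 ip by auto
  have bW2: "(\<integral>x. W2 x \<partial>lborel) \<le> 4 * P"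
    unfolding W2_def using i2 b2 by simp
  have bWp: "(\<integral>x. Wp x \<partial>lborel) \<le> 2 * 2 powr (2 * p) * R"
  proof -
    have "(\<integral>x. Wp x \<partial>lborel) = 2 powr (2 * p) * ((\<integral>x. \<bar>f x\<bar> powr (2 * p) \<partial>lborel) + (\<integral>x. \<bar>g x\<bar> powr (2 * p) \<partial>lborel))"
      unfolding Wp_def using ip by simp
    also have "\<dots> \<le> 2 powr (2 * p) * (R + R)" by (intro mult_left_mono add_mono bp) auto
    finally show ?thesis by simp
  qed
  have \<theta>p: "\<theta> powr 2 = \<theta>\<^sup>2" using \<theta> powr_realpow[of \<theta> 2] by simp
  have F0: "\<bar>F x\<bar> \<le> p * (?d x * ?W x powr (p - 1))" for x
    unfolding F_def using powr_diff_le[of p "f x" "g x"] p by (simp add: mult.assoc)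
  \<comment> \<open>The majorant from \<open>max_split\<close> with exponents 2 and 2 p - 2, which
    leaves only powers 2 p.\<close>
  define G2 where "G2 x = p\<^sup>2 * (\<theta> powr (2 - 2 * p) * ?d x powr (2 * p) + \<theta>\<^sup>2 * Wp x)" for x
  have FG2: "(F x)\<^sup>2 \<le> G2 x" for x
  proof -
    have "(F x)\<^sup>2 = \<bar>F x\<bar>\<^sup>2" by simp
    also have "\<dots> \<le> (p * (?d x * ?W x powr (p - 1)))\<^sup>2" by (intro power_mono F0) auto
    also have "\<dots> = p\<^sup>2 * (?d x powr 2 * ?W x powr (2 * p - 2))"
    proof -
      have "(?d x)\<^sup>2 = ?d x powr 2" by (cases "?d x = 0") (simp_all add: powr_realpow[of _ 2, simplified])
      moreover have "(?W x powr (p - 1))\<^sup>2 = ?W x powr (2 * p - 2)" by (simp add: power2_eq_square powr_add[symmetric])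
      ultimately show ?thesis by (simp add: power_mult_distrib)
    qed
    also have "\<dots> \<le> p\<^sup>2 * (\<theta> powr (- (2 * p - 2)) * ?d x powr (2 + (2 * p - 2)) + \<theta> powr 2 * ?W x powr (2 + (2 * p - 2)))"
      using p \<theta> by (intro mult_left_mono max_split) auto
    also have "\<dots> \<le> G2 x"
      unfolding G2_def \<theta>p using Wp[of x] by (intro mult_left_mono add_mono) (auto intro: mult_left_mono)
    finally show ?thesis .
  qed
  have iG2: "integrable lborel G2" unfolding G2_def[abs_def] using ip iW by auto
  show iF2: "integrable lborel (\<lambda>x. (F x)\<^sup>2)"
    by (rule Bochner_Integration.integrable_bound[OF iG2]) (use FG2 in \<open>auto intro!: AE_I2 intro: order_trans[OF _ abs_ge_self]\<close>)
  have "(\<integral>x. (F x)\<^sup>2 \<partial>lborel) \<le> (\<integral>x. G2 x \<partial>lborel)" by (rule integral_mono[OF iF2 iG2 FG2])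
  also have "\<dots> = p\<^sup>2 * (\<theta> powr (2 - 2 * p) * (\<integral>x. ?d x powr (2 * p) \<partial>lborel) + \<theta>\<^sup>2 * (\<integral>x. Wp x \<partial>lborel))"
    unfolding G2_def using ip iW by simp
  also have "\<dots> \<le> p\<^sup>2 * (\<theta> powr (2 - 2 * p) * (\<theta> powr (2 * p) * R) + \<theta>\<^sup>2 * (2 * 2 powr (2 * p) * R))"
    by (intro mult_left_mono add_mono bp bWp) auto
  also have "\<dots> = p\<^sup>2 * \<theta>\<^sup>2 * ((1 + 2 * 2 powr (2 * p)) * R)"
  proof -
    have "\<theta> powr (2 - 2 * p) * \<theta> powr (2 * p) = \<theta>\<^sup>2" unfolding powr_add[symmetric] by (simp add: \<theta>p)
    then show ?thesis by (simp add: mult.assoc[symmetric]) (simp add: algebra_simps)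
  qed
  finally show "(\<integral>x. (F x)\<^sup>2 \<partial>lborel) \<le> p\<^sup>2 * \<theta>\<^sup>2 * ((1 + 2 * 2 powr (2 * p)) * R)" .
  \<comment> \<open>Here \<open>max_split\<close> leaves powers p, which are interpolated with
    threshold \<theta> h for the difference and h for the sum; this brings both parts to the same
    order \<theta>.\<close>
  define G1 where "G1 x = p * (\<theta> powr (1 - p) * ((\<theta> * h) powr (p - 2) * (f x - g x)\<^sup>2 + (\<theta> * h) powr (- p) * ?d x powr (2 * p))
    + \<theta> * (h powr (p - 2) * W2 x + h powr (- p) * Wp x))" for x
  have FG1: "\<bar>F x\<bar> \<le> G1 x" for x
  proof -
    note F0[of x]
    also have "?d x * ?W x powr (p - 1) = ?d x powr 1 * ?W x powr (p - 1)" by simp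
    also have "\<dots> \<le> \<theta> powr (- (p - 1)) * ?d x powr (1 + (p - 1)) + \<theta> powr 1 * ?W x powr (1 + (p - 1))"
      using p \<theta> by (intro max_split) auto
    also have "\<dots> = \<theta> powr (1 - p) * ?d x powr p + \<theta> * ?W x powr p" using \<theta> by simp
    also have "\<dots> \<le> \<theta> powr (1 - p) * ((\<theta> * h) powr (p - 2) * (?d x)\<^sup>2 + (\<theta> * h) powr (- p) * ?d x powr (2 * p))
      + \<theta> * (h powr (p - 2) * (?W x)\<^sup>2 + h powr (- p) * ?W x powr (2 * p))"
      using p \<theta> h by (intro add_mono mult_left_mono powr_interpolate) auto
    also have "\<dots> \<le> \<theta> powr (1 - p) * ((\<theta> * h) powr (p - 2) * (?d x)\<^sup>2 + (\<theta> * h) powr (- p) * ?d x powr (2 * p))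
      + \<theta> * (h powr (p - 2) * W2 x + h powr (- p) * Wp x)"
      using \<theta> by (intro add_mono mult_left_mono W2 Wp) auto
    finally show ?thesis using p by (simp add: G1_def mult_left_mono)
  qed
  have iG1: "integrable lborel G1" unfolding G1_def[abs_def] using i2 ip iW by auto
  show iF: "integrable lborel F"
    by (rule Bochner_Integration.integrable_bound[OF iG1]) (use FG1 in \<open>auto intro!: AE_I2 intro: order_trans[OF _ abs_ge_self]\<close>)
  have "(\<integral>x. \<bar>F x\<bar> \<partial>lborel) \<le> (\<integral>x. G1 x \<partial>lborel)" by (rule integral_mono[OF integrable_abs[OF iF] iG1 FG1])
  also have "\<dots> = p * (\<theta> powr (1 - p) * ((\<theta> * h) powr (p - 2) * (\<integral>x. (f x - g x)\<^sup>2 \<partial>lborel) + (\<theta> * h) powr (- p) * (\<integral>x. ?d x powr (2 * p) \<partial>lborel))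
    + \<theta> * (h powr (p - 2) * (\<integral>x. W2 x \<partial>lborel) + h powr (- p) * (\<integral>x. Wp x \<partial>lborel)))"
    unfolding G1_def using i2 ip iW by simp
  also have "\<dots> \<le> p * (\<theta> powr (1 - p) * ((\<theta> * h) powr (p - 2) * (\<theta>\<^sup>2 * P) + (\<theta> * h) powr (- p) * (\<theta> powr (2 * p) * R))
    + \<theta> * (h powr (p - 2) * (4 * P) + h powr (- p) * (2 * 2 powr (2 * p) * R)))"
    using p \<theta> by (intro mult_left_mono add_mono b2 bp bW2 bWp) auto
  also have "\<dots> = p * \<theta> * (5 * (h powr (p - 2) * P) + (1 + 2 * 2 powr (2 * p)) * (h powr (- p) * R))"
  proof -
    have e1: "\<theta> powr (1 - p) * ((\<theta> * h) powr (p - 2) * (\<theta>\<^sup>2 * P)) = \<theta> * (h powr (p - 2) * P)"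
    proof -
      have "\<theta> powr (1 - p) * \<theta> powr (p - 2) * \<theta> powr 2 = \<theta> powr 1" unfolding powr_add[symmetric] by simp
      then have "\<theta> powr (1 - p) * \<theta> powr (p - 2) * \<theta>\<^sup>2 = \<theta>" using \<theta> by (simp add: \<theta>p)
      moreover have "\<theta> powr (1 - p) * ((\<theta> * h) powr (p - 2) * (\<theta>\<^sup>2 * P)) = (\<theta> powr (1 - p) * \<theta> powr (p - 2) * \<theta>\<^sup>2) * (h powr (p - 2) * P)"
        using \<theta> h by (simp add: powr_mult ac_simps)
      ultimately show ?thesis by simp
    qed
    have e2: "\<theta> powr (1 - p) * ((\<theta> * h) powr (- p) * (\<theta> powr (2 * p) * R)) = \<theta> * (h powr (- p) * R)"
    proof -
      have "\<theta> powr (1 - p) * \<theta> powr (- p) * \<theta> powr (2 * p) = \<theta> powr 1" unfolding powr_add[symmetric] by simp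
      then have "\<theta> powr (1 - p) * \<theta> powr (- p) * \<theta> powr (2 * p) = \<theta>" using \<theta> by simp
      moreover have "\<theta> powr (1 - p) * ((\<theta> * h) powr (- p) * (\<theta> powr (2 * p) * R)) = (\<theta> powr (1 - p) * \<theta> powr (- p) * \<theta> powr (2 * p)) * (h powr (- p) * R)"
        using \<theta> h by (simp add: powr_mult ac_simps)
      ultimately show ?thesis by simp
    qed
    show ?thesis unfolding distrib_left e1 e2 by (simp add: algebra_simps)
  qed
  finally show "(\<integral>x. \<bar>F x\<bar> \<partial>lborel) \<le> p * \<theta> * (5 * (h powr (p - 2) * P) + (1 + 2 * 2 powr (2 * p)) * (h powr (- p) * R))" .
qed

text \<open>The two summands of \<open>wt\<close> cross at |xi|^s = \<Lambda>^(-2), and on either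
  side the larger one alone controls the intermediate power.\<close>

lemma weighted_interpolation:
  assumes "0 < \<Lambda>" "0 \<le> \<alpha>" "\<alpha> \<le> s" "0 < s"
  shows "norm \<xi> powr \<alpha> \<le> \<Lambda> powr (2 - 2 * \<alpha> / s) * wt s \<Lambda> \<xi>"
proof (cases "1 / \<Lambda>\<^sup>2 \<le> norm \<xi> powr s")
  case True
  have \<Lambda>2: "\<Lambda>\<^sup>2 = \<Lambda> powr 2" using assms powr_realpow[of \<Lambda> 2] by simp

  have "\<Lambda> powr (- (2 - 2 * \<alpha> / s)) = (1 / \<Lambda>\<^sup>2) powr ((s - \<alpha>) / s)"
  proof -
    have "1 / \<Lambda>\<^sup>2 = \<Lambda> powr - 2" unfolding \<Lambda>2 by (rule powr_minus_divide[symmetric])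
    moreover have "- 2 * ((s - \<alpha>) / s) = - (2 - 2 * \<alpha> / s)" using assms by (simp add: field_simps)
    ultimately show ?thesis by (simp only: powr_powr)
  qed
  also have "\<dots> \<le> (norm \<xi> powr s) powr ((s - \<alpha>) / s)" using True assms by (intro powr_mono2) auto
  also have "\<dots> = norm \<xi> powr (s - \<alpha>)" using assms by (simp add: powr_powr)
  finally have "\<Lambda> powr (- (2 - 2 * \<alpha> / s)) * norm \<xi> powr \<alpha> \<le> norm \<xi> powr (s - \<alpha>) * norm \<xi> powr \<alpha>"
    by (intro mult_right_mono) auto
  also have "\<dots> = norm \<xi> powr s" by (simp add: powr_add[symmetric])
  also have "\<dots> \<le> wt s \<Lambda> \<xi>" by (simp add: wt_def)
  finally have "\<Lambda> powr (2 - 2 * \<alpha> / s) * (\<Lambda> powr (- (2 - 2 * \<alpha> / s)) * norm \<xi> powr \<alpha>) \<le> \<Lambda> powr (2 - 2 * \<alpha> / s) * wt s \<Lambda> \<xi>"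
    by (intro mult_left_mono) auto
  then show ?thesis using assms by (simp add: mult.assoc[symmetric] powr_add[symmetric])
next
  case False
  have \<Lambda>2: "\<Lambda>\<^sup>2 = \<Lambda> powr 2" using assms powr_realpow[of \<Lambda> 2] by simp
  have "norm \<xi> powr \<alpha> = (norm \<xi> powr s) powr (\<alpha> / s)" using assms by (simp add: powr_powr)
  also have "\<dots> \<le> (1 / \<Lambda>\<^sup>2) powr (\<alpha> / s)" using False assms by (intro powr_mono2) auto
  also have "\<dots> = \<Lambda> powr (- 2 * \<alpha> / s)"
  proof -
    have "1 / \<Lambda>\<^sup>2 = \<Lambda> powr - 2" unfolding \<Lambda>2 by (rule powr_minus_divide[symmetric])
    then show ?thesis by (simp only: powr_powr times_divide_eq_right)
  qed
  also have "\<dots> = \<Lambda> powr (2 - 2 * \<alpha> / s) * \<Lambda> powr (- 2)" unfolding powr_add[symmetric] by simp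
  also have "\<dots> \<le> \<Lambda> powr (2 - 2 * \<alpha> / s) * wt s \<Lambda> \<xi>"
    unfolding wt_def \<Lambda>2 by (intro mult_left_mono) (auto simp: powr_minus_divide)
  finally show ?thesis .
qed

locale scaling =
  fixes s p \<nu> \<gamma> :: real and dim :: "'a::euclidean_space itself"
  assumes s: "0 < s" and p: "2 \<le> p" and \<nu>: "\<nu> = real DIM('a) / s"
    and subcritical: "\<nu> * (1 - 1 / p) \<le> 2" and \<gamma>: "\<gamma> = 2 * (p - 1) * \<nu> - 2 * p" and \<gamma>_gt: "1 < \<gamma>"
begin

lemma hb_Lebesgue_bounds:
  "\<exists>C>0. \<forall>\<Lambda>>0. \<forall>A>0. \<forall>f::'a \<Rightarrow> real. hb s \<Lambda> f A \<longrightarrow> (\<integral>x. (f x)\<^sup>2 \<partial>lborel) \<le> (C * \<Lambda>\<^sup>2 * A)\<^sup>2 \<and>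
     integrable lborel (\<lambda>x. \<bar>f x\<bar> powr (2 * p)) \<and>
     (\<integral>x. \<bar>f x\<bar> powr (2 * p) \<partial>lborel) \<le> C * (\<Lambda> powr (2 - \<nu> * (1 - 1 / p)) * A) powr (2 * p)"
proof -
  let ?n = "real DIM('a)" and ?c = "pc TYPE('a)"
  \<comment> \<open>The Sobolev order for the exponent 2 p; \<open>subcritical\<close> says that it
    does not exceed s.\<close>
  define \<alpha> where "\<alpha> = ?n / 2 - ?n / (2 * p)"
  have c: "0 < ?c" by (rule pc_pos)
  have \<alpha>s: "2 * \<alpha> / s = \<nu> * (1 - 1 / p)" unfolding \<alpha>_def \<nu> using s p by (simp add: field_simps)
  have \<alpha>: "0 \<le> \<alpha>" "\<alpha> \<le> s"
  proof -
    have "?n * 1 \<le> ?n * p" using p by (intro mult_left_mono) auto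
    then show "0 \<le> \<alpha>" using p unfolding \<alpha>_def by (simp add: field_simps)
    show "\<alpha> \<le> s" using subcritical s unfolding \<alpha>s[symmetric] by (simp add: field_simps)
  qed
  obtain C where C: "0 < C" "\<And>f U A. 0 < A \<Longrightarrow> frel f U \<Longrightarrow> l2b (\<lambda>\<xi>. complex_of_real (norm (\<xi>::'a) powr \<alpha>) * U \<xi>) A \<Longrightarrow>
    integrable lborel (\<lambda>x. norm (f x) powr (2 * p)) \<and> (\<integral>x. norm (f x) powr (2 * p) \<partial>lborel) \<le> C * A powr (2 * p)"
    using Sobolev_inequality[of "2 * p", where 'a = 'a] p unfolding \<alpha>_def by auto
  have "(\<integral>x. (f x)\<^sup>2 \<partial>lborel) \<le> ((C + 1 / ?c) * \<Lambda>\<^sup>2 * A)\<^sup>2 \<and>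
     integrable lborel (\<lambda>x. \<bar>f x\<bar> powr (2 * p)) \<and>
     (\<integral>x. \<bar>f x\<bar> powr (2 * p) \<partial>lborel) \<le> (C + 1 / ?c) * (\<Lambda> powr (2 - \<nu> * (1 - 1 / p)) * A) powr (2 * p)"
    if \<Lambda>: "0 < \<Lambda>" and A: "0 < A" and h: "hb s \<Lambda> f A" for \<Lambda> A and f :: "'a \<Rightarrow> real"
  proof -
    note F = FT_frel[OF hbD(1)[OF h]]
    have [measurable]: "FT f \<in> borel_measurable borel" using frelD(2)[OF F] by (rule l2_measurable)
    have "l2b (FT f) (\<Lambda>\<^sup>2 * A)"
    proof (rule l2b_dominated[OF hbD(2)[OF h]])
      show "AE \<xi> in lborel. norm (FT f \<xi>) \<le> \<Lambda>\<^sup>2 * norm (complex_of_real (wt s \<Lambda> \<xi>) * FT f \<xi>)"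
      proof (rule AE_I2)
        fix \<xi> :: 'a
        have "1 \<le> \<Lambda>\<^sup>2 * wt s \<Lambda> \<xi>" using \<Lambda> by (simp add: wt_def distrib_left)
        from mult_right_mono[OF this, of "norm (FT f \<xi>)"]
        show "norm (FT f \<xi>) \<le> \<Lambda>\<^sup>2 * norm (complex_of_real (wt s \<Lambda> \<xi>) * FT f \<xi>)"
          by (simp add: norm_mult abs_of_nonneg[OF wt_nonneg] mult.assoc)
      qed
    qed auto
    then have "l2b (FT f) (?c * (\<Lambda>\<^sup>2 * A / ?c))" using c by simp
    then have fl: "l2b (\<lambda>x. complex_of_real (f x)) (\<Lambda>\<^sup>2 * A / ?c)"
      by (rule frel_l2b'[OF F]) (use A c in simp)
    have "(\<integral>x. (f x)\<^sup>2 \<partial>lborel) \<le> (\<Lambda>\<^sup>2 * A / ?c)\<^sup>2" using l2b_integral[OF fl] by simp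
    also have "\<dots> \<le> ((C + 1 / ?c) * \<Lambda>\<^sup>2 * A)\<^sup>2"
    proof (rule power_mono)
      have "1 / ?c * (\<Lambda>\<^sup>2 * A) \<le> (C + 1 / ?c) * (\<Lambda>\<^sup>2 * A)" using C A by (intro mult_right_mono) auto
      then show "\<Lambda>\<^sup>2 * A / ?c \<le> (C + 1 / ?c) * \<Lambda>\<^sup>2 * A" by (simp add: mult.assoc)
    qed (use A c in simp)
    finally have 1: "(\<integral>x. (f x)\<^sup>2 \<partial>lborel) \<le> ((C + 1 / ?c) * \<Lambda>\<^sup>2 * A)\<^sup>2" .
    let ?A = "\<Lambda> powr (2 - \<nu> * (1 - 1 / p)) * A"
    have "l2b (\<lambda>\<xi>. complex_of_real (norm \<xi> powr \<alpha>) * FT f \<xi>) ?A"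
    proof (rule l2b_dominated[OF hbD(2)[OF h]])
      show "AE \<xi> in lborel. norm (complex_of_real (norm \<xi> powr \<alpha>) * FT f \<xi>) \<le> \<Lambda> powr (2 - \<nu> * (1 - 1 / p)) * norm (complex_of_real (wt s \<Lambda> \<xi>) * FT f \<xi>)"
      proof (rule AE_I2)
        fix \<xi> :: 'a
        from mult_right_mono[OF weighted_interpolation[OF \<Lambda> \<alpha> s, of \<xi>], of "norm (FT f \<xi>)"]
        show "norm (complex_of_real (norm \<xi> powr \<alpha>) * FT f \<xi>) \<le> \<Lambda> powr (2 - \<nu> * (1 - 1 / p)) * norm (complex_of_real (wt s \<Lambda> \<xi>) * FT f \<xi>)"
          unfolding \<alpha>s by (simp add: norm_mult abs_of_nonneg[OF wt_nonneg] mult.assoc)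
      qed
    qed auto
    then have 2: "integrable lborel (\<lambda>x. \<bar>f x\<bar> powr (2 * p))" "(\<integral>x. \<bar>f x\<bar> powr (2 * p) \<partial>lborel) \<le> C * ?A powr (2 * p)"
      using C(2)[OF _ F, of ?A] \<Lambda> A by auto
    have "C * ?A powr (2 * p) \<le> (C + 1 / ?c) * ?A powr (2 * p)" using c by (intro mult_right_mono) auto
    then show ?thesis using 1 2 by auto
  qed
  moreover have "0 < C + 1 / ?c" using C c by (simp add: add_pos_pos)
  ultimately show ?thesis by (intro exI[of _ "C + 1 / ?c"]) blast
qed

text \<open>Heuristically a function of size M \<Lambda>^(-\<nu>) at scale \<Lambda> has height M
  \<Lambda>^(2-2\<nu>) on a ball of volume \<Lambda>^(2\<nu>), and - \<gamma> and - \<gamma> - \<nu>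
  are the exponents of the L1 and L2 norms of its p-th power. The difference is measured separately
  by \<open>D\<close>, so that g = 0 yields bounds for |f|^p and the general case yields the
  contraction.\<close>

lemma nonlinear_estimate:
  "\<exists>C>0. \<forall>\<Lambda>>0. \<forall>M>0. \<forall>D>0. \<forall>f g::'a \<Rightarrow> real. hb s \<Lambda> f (M * \<Lambda> powr - \<nu>) \<longrightarrow> hb s \<Lambda> g (M * \<Lambda> powr - \<nu>) \<longrightarrow>
     hb s \<Lambda> (\<lambda>x. f x - g x) (D * \<Lambda> powr - \<nu>) \<longrightarrow>
     integrable lborel (\<lambda>x. \<bar>f x\<bar> powr p - \<bar>g x\<bar> powr p) \<and>
     (\<integral>x. \<bar>\<bar>f x\<bar> powr p - \<bar>g x\<bar> powr p\<bar> \<partial>lborel) \<le> C * D * M powr (p - 1) * \<Lambda> powr - \<gamma> \<and>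
     l2b (\<lambda>x. complex_of_real (\<bar>f x\<bar> powr p - \<bar>g x\<bar> powr p)) (C * D * M powr (p - 1) * \<Lambda> powr (- \<gamma> - \<nu>))"
proof -
  obtain C where C: "0 < C" "\<And>\<Lambda> A f. 0 < \<Lambda> \<Longrightarrow> 0 < A \<Longrightarrow> hb s \<Lambda> f A \<Longrightarrow> (\<integral>x. (f (x::'a))\<^sup>2 \<partial>lborel) \<le> (C * \<Lambda>\<^sup>2 * A)\<^sup>2 \<and>
     integrable lborel (\<lambda>x. \<bar>f x\<bar> powr (2 * p)) \<and>
     (\<integral>x. \<bar>f x\<bar> powr (2 * p) \<partial>lborel) \<le> C * (\<Lambda> powr (2 - \<nu> * (1 - 1 / p)) * A) powr (2 * p)"
    using hb_Lebesgue_bounds by blast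
  define K where "K = 1 + 2 * 2 powr (2 * p)"
  have K: "0 < K" by (simp add: K_def add_pos_nonneg)
  define C' where "C' = p * (5 * C\<^sup>2 + K * C) + p * sqrt (K * C)"
  have p0: "0 < p" using p by simp
  have Cp: "p * (5 * C\<^sup>2 + K * C) \<le> C'" "p * sqrt (K * C) \<le> C'" "0 < C'"
    using p0 C K by (auto simp: C'_def intro!: add_pos_nonneg mult_pos_pos add_nonneg_pos)
  have "integrable lborel (\<lambda>x. \<bar>f x\<bar> powr p - \<bar>g x\<bar> powr p) \<and>
     (\<integral>x. \<bar>\<bar>f x\<bar> powr p - \<bar>g x\<bar> powr p\<bar> \<partial>lborel) \<le> C' * D * M powr (p - 1) * \<Lambda> powr - \<gamma> \<and>
     l2b (\<lambda>x. complex_of_real (\<bar>f x\<bar> powr p - \<bar>g x\<bar> powr p)) (C' * D * M powr (p - 1) * \<Lambda> powr (- \<gamma> - \<nu>))"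
    if \<Lambda>: "0 < \<Lambda>" and M: "0 < M" and D: "0 < D" and f: "hb s \<Lambda> f (M * \<Lambda> powr - \<nu>)" and g: "hb s \<Lambda> g (M * \<Lambda> powr - \<nu>)"
      and d: "hb s \<Lambda> (\<lambda>x. f x - g x) (D * \<Lambda> powr - \<nu>)" for \<Lambda> M D and f g :: "'a \<Rightarrow> real"
  proof -
    let ?e = "2 - \<nu> * (1 - 1 / p)"
    define M' where "M' = M * \<Lambda> powr - \<nu>"
    define \<theta> where "\<theta> = D / M"
    \<comment> \<open>The heuristic height. With it the L2 and the L^(2p) contributions to the
      interpolation are both of order M^p \<Lambda>^(-\<gamma>).\<close>
    define h where "h = M * \<Lambda> powr (2 - 2 * \<nu>)"
    define P where "P = (C * \<Lambda>\<^sup>2 * M')\<^sup>2"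
    define R where "R = C * (\<Lambda> powr ?e * M') powr (2 * p)"
    have pos: "0 < \<theta>" "0 < h" "0 < M'" using \<Lambda> M D by (auto simp: \<theta>_def h_def M'_def)
    have dM: "D * \<Lambda> powr - \<nu> = \<theta> * M'" using M by (simp add: \<theta>_def M'_def)
    note bf = C(2)[OF \<Lambda> pos(3) f[folded M'_def]] note bg = C(2)[OF \<Lambda> pos(3) g[folded M'_def]]
    have \<theta>M: "0 < \<theta> * M'" using pos by simp
    note bd = C(2)[OF \<Lambda> \<theta>M d[unfolded dM]]
    have L: "L2 f" "L2 g" "L2 (\<lambda>x. f x - g x)" using hbD(1) f g d by blast+
    have fm: "f \<in> borel_measurable borel" "g \<in> borel_measurable borel" using L by (auto simp: L2_def)
    have i2: "integrable lborel (\<lambda>x. (f x)\<^sup>2)" "integrable lborel (\<lambda>x. (g x)\<^sup>2)" "integrable lborel (\<lambda>x. (f x - g x)\<^sup>2)"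
      using L by (auto simp: L2_def)
    have b2: "(\<integral>x. (f x)\<^sup>2 \<partial>lborel) \<le> P" "(\<integral>x. (g x)\<^sup>2 \<partial>lborel) \<le> P" "(\<integral>x. (f x - g x)\<^sup>2 \<partial>lborel) \<le> \<theta>\<^sup>2 * P"
      using bf bg bd by (auto simp: P_def power_mult_distrib ac_simps)
    have bp: "(\<integral>x. \<bar>f x\<bar> powr (2 * p) \<partial>lborel) \<le> R" "(\<integral>x. \<bar>g x\<bar> powr (2 * p) \<partial>lborel) \<le> R"
      using bf bg by (auto simp: R_def)
    have bp3: "(\<integral>x. \<bar>f x - g x\<bar> powr (2 * p) \<partial>lborel) \<le> \<theta> powr (2 * p) * R"
    proof -
      have "C * (\<Lambda> powr ?e * (\<theta> * M')) powr (2 * p) = \<theta> powr (2 * p) * R"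
        using pos \<Lambda> by (simp add: R_def powr_mult ac_simps)
      then show ?thesis using bd by simp
    qed
    note N = power_nonlinearity_difference[OF p pos(1,2) fm i2 bf[THEN conjunct2, THEN conjunct1] bg[THEN conjunct2, THEN conjunct1]
      bd[THEN conjunct2, THEN conjunct1] b2 bp bp3, folded K_def]
    have \<theta>Mp: "\<theta> * M powr p = D * M powr (p - 1)"
    proof -
      have "M powr p = M powr (p - 1) * M powr 1" unfolding powr_add[symmetric] by simp
      then show ?thesis using M by (simp add: \<theta>_def)
    qed
    have P: "h powr (p - 2) * P = C\<^sup>2 * (M powr p * \<Lambda> powr - \<gamma>)"
    proof -
      have l2: "\<Lambda>\<^sup>2 = \<Lambda> powr 2" using \<Lambda> powr_realpow[of \<Lambda> 2] by simp
      have m2: "M\<^sup>2 = M powr 2" using M powr_realpow[of M 2] by simp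
      have "P = C\<^sup>2 * (M powr 2 * \<Lambda> powr (4 - 2 * \<nu>))"
      proof -
        have "(\<Lambda>\<^sup>2)\<^sup>2 * (\<Lambda> powr - \<nu>)\<^sup>2 = \<Lambda> powr (4 - 2 * \<nu>)"
        proof -
          have "\<Lambda> powr (4 - 2 * \<nu>) = (\<Lambda> powr 2 * \<Lambda> powr 2) * (\<Lambda> powr - \<nu> * \<Lambda> powr - \<nu>)"
            unfolding powr_add[symmetric] by (rule arg_cong[where f = "\<lambda>z. \<Lambda> powr z"]) simp
          then show ?thesis by (simp only: l2 power2_eq_square[of "\<Lambda> powr 2"] power2_eq_square[of "\<Lambda> powr - \<nu>"])
        qed
        then show ?thesis unfolding P_def M'_def power_mult_distrib m2 by (simp add: ac_simps)
      qed
      moreover have "h powr (p - 2) = M powr (p - 2) * \<Lambda> powr ((2 - 2 * \<nu>) * (p - 2))"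
        using M \<Lambda> by (simp add: h_def powr_mult powr_powr)
      ultimately have "h powr (p - 2) * P = C\<^sup>2 * ((M powr (p - 2) * M powr 2) * (\<Lambda> powr ((2 - 2 * \<nu>) * (p - 2)) * \<Lambda> powr (4 - 2 * \<nu>)))"
        by (simp only: ac_simps)
      also have "\<dots> = C\<^sup>2 * (M powr p * \<Lambda> powr ((2 - 2 * \<nu>) * (p - 2) + (4 - 2 * \<nu>)))"
        unfolding powr_add[symmetric] by simp
      also have "(2 - 2 * \<nu>) * (p - 2) + (4 - 2 * \<nu>) = - \<gamma>" unfolding \<gamma> by (simp add: algebra_simps)
      finally show ?thesis .
    qed
    have eM: "(\<Lambda> powr ?e * M') powr (2 * p) = M powr (2 * p) * \<Lambda> powr (2 * (- \<gamma> - \<nu>))"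
    proof -
      have "(\<Lambda> powr ?e * M') powr (2 * p) = (M * (\<Lambda> powr ?e * \<Lambda> powr - \<nu>)) powr (2 * p)" by (simp add: M'_def ac_simps)
      also have "\<dots> = M powr (2 * p) * \<Lambda> powr ((?e + - \<nu>) * (2 * p))"
        unfolding powr_add[symmetric] using M by (simp add: powr_mult powr_powr)
      also have "(?e + - \<nu>) * (2 * p) = 2 * (- \<gamma> - \<nu>)" unfolding \<gamma> using p by (simp add: field_simps)
      finally show ?thesis .
    qed
    have R: "h powr (- p) * R = C * (M powr p * \<Lambda> powr - \<gamma>)"
    proof -
      have "h powr (- p) = M powr (- p) * \<Lambda> powr ((2 - 2 * \<nu>) * (- p))"
        using M \<Lambda> by (simp add: h_def powr_mult powr_powr)
      then have "h powr (- p) * R = C * ((M powr (- p) * M powr (2 * p)) * (\<Lambda> powr ((2 - 2 * \<nu>) * (- p)) * \<Lambda> powr (2 * (- \<gamma> - \<nu>))))"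
        unfolding R_def eM by (simp only: ac_simps)
      also have "\<dots> = C * (M powr p * \<Lambda> powr ((2 - 2 * \<nu>) * (- p) + 2 * (- \<gamma> - \<nu>)))"
        unfolding powr_add[symmetric] by simp
      also have "(2 - 2 * \<nu>) * (- p) + 2 * (- \<gamma> - \<nu>) = - \<gamma>" unfolding \<gamma> by (simp add: algebra_simps)
      finally show ?thesis .
    qed
    have "(\<integral>x. \<bar>\<bar>f x\<bar> powr p - \<bar>g x\<bar> powr p\<bar> \<partial>lborel) \<le> p * \<theta> * (5 * (h powr (p - 2) * P) + K * (h powr (- p) * R))"
      by (rule N(2))
    also have "\<dots> = (p * (5 * C\<^sup>2 + K * C)) * ((\<theta> * M powr p) * \<Lambda> powr - \<gamma>)"
      unfolding P R by (simp add: algebra_simps)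
    also have "\<dots> \<le> C' * ((\<theta> * M powr p) * \<Lambda> powr - \<gamma>)"
      using pos by (intro mult_right_mono Cp) auto
    also have "\<dots> = C' * D * M powr (p - 1) * \<Lambda> powr - \<gamma>" unfolding \<theta>Mp by (simp add: mult.assoc)
    finally have n1: "(\<integral>x. \<bar>\<bar>f x\<bar> powr p - \<bar>g x\<bar> powr p\<bar> \<partial>lborel) \<le> C' * D * M powr (p - 1) * \<Lambda> powr - \<gamma>" .
    have "l2b (\<lambda>x. complex_of_real (\<bar>f x\<bar> powr p - \<bar>g x\<bar> powr p)) (p * sqrt (K * C) * (\<theta> * M powr p) * \<Lambda> powr (- \<gamma> - \<nu>))"
    proof (rule l2bI)
      have "M powr (2 * p) = (M powr p)\<^sup>2" "\<Lambda> powr (2 * (- \<gamma> - \<nu>)) = (\<Lambda> powr (- \<gamma> - \<nu>))\<^sup>2"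
        unfolding power2_eq_square powr_add[symmetric] by simp_all
      then have "p\<^sup>2 * \<theta>\<^sup>2 * (K * R) = (p * sqrt (K * C) * (\<theta> * M powr p) * \<Lambda> powr (- \<gamma> - \<nu>))\<^sup>2"
        unfolding R_def eM using K C by (simp add: power_mult_distrib ac_simps)
      then show "(\<integral>x. (norm (complex_of_real (\<bar>f x\<bar> powr p - \<bar>g x\<bar> powr p)))\<^sup>2 \<partial>lborel) \<le> (p * sqrt (K * C) * (\<theta> * M powr p) * \<Lambda> powr (- \<gamma> - \<nu>))\<^sup>2"
        using N(4) by (simp only: norm_of_real power2_abs)
      show "integrable lborel (\<lambda>x. (norm (complex_of_real (\<bar>f x\<bar> powr p - \<bar>g x\<bar> powr p)))\<^sup>2)"
        using N(3) by (simp only: norm_of_real power2_abs)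
      show "(\<lambda>x. complex_of_real (\<bar>f x\<bar> powr p - \<bar>g x\<bar> powr p)) \<in> borel_measurable borel"
        using fm by measurable
    qed (use p0 K C pos in auto)
    then have "l2b (\<lambda>x. complex_of_real (\<bar>f x\<bar> powr p - \<bar>g x\<bar> powr p)) (C' * (\<theta> * M powr p) * \<Lambda> powr (- \<gamma> - \<nu>))"
      by (rule l2b_mono) (intro mult_right_mono Cp; use pos in auto)
    then have n2: "l2b (\<lambda>x. complex_of_real (\<bar>f x\<bar> powr p - \<bar>g x\<bar> powr p)) (C' * D * M powr (p - 1) * \<Lambda> powr (- \<gamma> - \<nu>))"
      unfolding \<theta>Mp by (simp add: mult.assoc)
    show ?thesis using N(1) n1 n2 by blast
  qed
  then show ?thesis using Cp(3) by (intro exI[of _ C']) blast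
qed

end

section \<open>Estimates for the linear evolution and the Duhamel term\<close>

lemma nn_integral_powr_tail:
  fixes \<gamma> t :: real
  assumes \<gamma>: "1 < \<gamma>" and t: "0 \<le> t"
  shows "(\<integral>\<^sup>+\<tau>\<in>{0..t}. ennreal ((1 + \<tau>) powr - \<gamma>) \<partial>lborel) \<le> ennreal (1 / (\<gamma> - 1))"
proof -
  let ?F = "\<lambda>\<tau>. - ((1 + \<tau>) powr (1 - \<gamma>) / (\<gamma> - 1))"
  have "(\<integral>\<^sup>+\<tau>. ennreal ((1 + \<tau>) powr - \<gamma>) * indicator {0..t} \<tau> \<partial>lborel) = ennreal (?F t - ?F 0)"
  proof (rule nn_integral_FTC_Icc)
    fix \<tau> assume "\<tau> \<in> {0..t}"
    then have "0 < 1 + \<tau>" by simp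
    then show "(?F has_real_derivative (1 + \<tau>) powr - \<gamma>) (at \<tau>)"
    proof -
      have "((\<lambda>\<tau>. (1 + \<tau>) powr (1 - \<gamma>)) has_real_derivative (1 - \<gamma>) * (1 + \<tau>) powr (1 - \<gamma> - of_nat 1) * 1) (at \<tau>)"
        by (rule DERIV_fun_powr) (use \<open>0 < 1 + \<tau>\<close> in \<open>auto intro!: derivative_eq_intros\<close>)
      from DERIV_minus[OF DERIV_cdivide[OF this, of "\<gamma> - 1"]] show ?thesis
        by (rule DERIV_cong) (use \<gamma> in \<open>simp add: field_simps\<close>)
    qed
  qed (use t in auto)
  also have "?F t - ?F 0 \<le> 1 / (\<gamma> - 1)" using \<gamma> by simp
  finally show ?thesis by (simp add: ennreal_leI)
qed

text \<open>Freezing the time variable outside [0, T] gives a function continuous on the whole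
  space, hence jointly Borel measurable, and leaves Duhamel integrals over [0, T] unchanged.\<close>

lemma continuous_clamp:
  fixes F :: "real \<Rightarrow> 'a::topological_space \<Rightarrow> 'b::topological_space"
  assumes "continuous_on ({0..T} \<times> UNIV) (\<lambda>(\<tau>, \<xi>). F \<tau> \<xi>)" "0 \<le> T"
  shows "continuous_on UNIV (\<lambda>(\<tau>, \<xi>). F (max 0 (min T \<tau>)) \<xi>)"
proof -
  have "continuous_on UNIV (\<lambda>z. (\<lambda>(\<tau>, \<xi>). F \<tau> \<xi>) (max 0 (min T (fst z)), snd z))"
    by (rule continuous_on_compose2[OF assms(1)]) (use assms(2) in \<open>auto intro!: continuous_intros\<close>)
  then show ?thesis by (simp add: case_prod_beta)
qed

lemma continuous_borel_pair:
  fixes F :: "real \<Rightarrow> 'a::euclidean_space \<Rightarrow> 'b::euclidean_space"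
  assumes "continuous_on UNIV (\<lambda>(\<tau>, \<xi>). F \<tau> \<xi>)"
  shows "(\<lambda>(\<tau>, \<xi>). F \<tau> \<xi>) \<in> borel_measurable (borel \<Otimes>\<^sub>M borel)"
  unfolding borel_prod by (rule borel_measurable_continuous_onI[OF assms])

lemma set_nn_integral_cmult_real:
  fixes w :: "real \<Rightarrow> real"
  assumes "0 \<le> A" "w \<in> borel_measurable borel"
  shows "(\<integral>\<^sup>+\<tau>\<in>{a..b}. ennreal (A * w \<tau>) \<partial>lborel) = ennreal A * (\<integral>\<^sup>+\<tau>\<in>{a..b}. ennreal (w \<tau>) \<partial>lborel)"
  using assms by (subst nn_integral_cmult[symmetric]) (auto simp: ennreal_mult' mult.assoc)

locale evolution = scaling +
  fixes \<eta> :: real and Ck ck :: real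
  assumes Ck: "0 < Ck" and ck: "0 < ck"
    and kap: "\<And>j r. j \<le> 2 \<Longrightarrow> 0 \<le> r \<Longrightarrow> (1 + r)\<^sup>2 * \<bar>kap \<eta> j r\<bar> \<le> Ck * exp (- ck * r)"
begin

section \<open>Bounds for the Fourier multipliers\<close>

definition K :: "nat \<Rightarrow> real \<Rightarrow> 'a \<Rightarrow> real" where
  "K j r \<xi> = r ^ j * kap \<eta> j (norm \<xi> powr (s / 2) * r)"

lemma K_even: "K j r (- \<xi>) = K j r \<xi>"
  by (simp add: K_def)

lemma continuous_K: "continuous_on UNIV (\<lambda>(r, \<xi>). K j r \<xi>)"
  unfolding K_def case_prod_beta
  by (intro continuous_intros continuous_on_powr') (use s in auto)

lemma continuous_K_compose[continuous_intros]:
  assumes "continuous_on S f" "continuous_on S g"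
  shows "continuous_on S (\<lambda>x. K j (f x) (g x))"
  using continuous_on_compose2[OF continuous_K continuous_on_Pair[OF assms]] by simp

lemma K_measurable[measurable]: "K j r \<in> borel_measurable borel"
  by (intro borel_measurable_continuous_onI continuous_intros)

text \<open>The weights of the three data spaces.\<close>

definition dwt :: "nat \<Rightarrow> 'a \<Rightarrow> real" where
  "dwt j \<xi> = (if j = 0 then wt s 1 \<xi> else if j = 1 then wt (s / 2) 1 \<xi> else 1)"

lemma dwt_ge: "1 \<le> dwt j \<xi>"
  by (simp add: dwt_def wt_def)

lemma dwt_measurable[measurable]: "dwt j \<in> borel_measurable borel"
  unfolding dwt_def[abs_def] by measurable

lemma norm_powr_s: "norm (\<xi>::'a) powr s = (norm \<xi> powr (s / 2))\<^sup>2"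
  by (simp add: power2_eq_square powr_add[symmetric])

text \<open>With a = |xi|^(s/2) the weight times r^2 is (r/\<Lambda>)^2 + (a r)^2, at most (1 + a
  r)^2, which the decay of \<open>kap\<close> absorbs. The last condition ensures that r^j is at
  most r^2.\<close>

lemma multiplier_bound_scaled:
  assumes "j \<le> 2" "0 \<le> r" "r \<le> \<Lambda>" "0 < \<Lambda>" "1 \<le> r \<or> j = 2"
  shows "wt s \<Lambda> \<xi> * \<bar>K j r \<xi>\<bar> \<le> Ck * exp (- ck * (r * norm \<xi> powr (s / 2)))"
proof -
  let ?a = "norm \<xi> powr (s / 2)"
  have "r ^ j \<le> r\<^sup>2" using assms by (auto intro: power_increasing)
  then have "wt s \<Lambda> \<xi> * r ^ j \<le> wt s \<Lambda> \<xi> * r\<^sup>2" by (intro mult_left_mono wt_nonneg)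
  also have "\<dots> = (r / \<Lambda>)\<^sup>2 + (?a * r)\<^sup>2" by (simp add: wt_def norm_powr_s power_divide power_mult_distrib distrib_right)
  also have "\<dots> \<le> 1 + (?a * r)\<^sup>2" using assms power_mono[of "r / \<Lambda>" 1 2] by simp
  also have "\<dots> \<le> (1 + ?a * r)\<^sup>2" using assms by (simp add: power2_sum)
  finally have "wt s \<Lambda> \<xi> * r ^ j * \<bar>kap \<eta> j (?a * r)\<bar> \<le> (1 + ?a * r)\<^sup>2 * \<bar>kap \<eta> j (?a * r)\<bar>"
    by (rule mult_right_mono) simp
  also have "\<dots> \<le> Ck * exp (- ck * (?a * r))" using assms by (intro kap) auto
  finally show ?thesis using assms by (simp add: K_def abs_mult mult.assoc mult.commute[of ?a])
qed

text \<open>On bounded time intervals regularity of the data makes up for the missing powers of r: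
  each unit of 2 - j costs s/2 derivatives, which is what \<open>dwt\<close> provides.\<close>

lemma multiplier_bound_local:
  assumes j: "j \<le> 2" and r: "0 \<le> r" "r \<le> T"
  shows "wt s 1 \<xi> * \<bar>K j r \<xi>\<bar> \<le> (1 + T)\<^sup>2 * Ck * dwt j \<xi>"
proof -
  let ?a = "norm \<xi> powr (s / 2)" and ?k = "\<bar>kap \<eta> j (norm \<xi> powr (s / 2) * r)\<bar>"
  have T: "0 \<le> T" using r by simp
  have a: "0 \<le> ?a * r" using r by simp
  have k: "(1 + ?a * r)\<^sup>2 * ?k \<le> Ck"
  proof -
    have "Ck * exp (- ck * (?a * r)) \<le> Ck * 1" using Ck ck a by (intro mult_left_mono) auto
    then show ?thesis using kap[OF j a] by simp
  qed
  have w: "wt s 1 \<xi> * r ^ j \<le> (1 + T)\<^sup>2 * dwt j \<xi> * (1 + ?a * r)\<^sup>2"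
  proof -
    consider "j = 0" | "j = 1" | "j = 2" using j by linarith
    then show ?thesis
    proof cases
      case 1
      have "1 * (wt s 1 \<xi> * 1) \<le> (1 + T)\<^sup>2 * (wt s 1 \<xi> * (1 + ?a * r)\<^sup>2)"
        using T a by (intro mult_mono mult_left_mono) (auto simp: wt_nonneg one_le_power)
      then show ?thesis using 1 by (simp add: dwt_def mult.assoc)
    next
      case 2
      have "r + ?a * (?a * r) \<le> (1 + T) * ((1 + ?a) * (1 + ?a * r))"
      proof -
        have "r \<le> (1 + T) * (1 * 1)" using r by simp
        also have "\<dots> \<le> (1 + T) * ((1 + ?a) * (1 + ?a * r))" using T a by (intro mult_left_mono mult_mono) auto
        finally have "r \<le> (1 + T) * ((1 + ?a) * (1 + ?a * r))" .
        have "r + ?a * (?a * r) \<le> (1 + T) + (1 + T) * (?a * (?a * r))" using r T a by (intro add_mono) (auto simp: algebra_simps)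
        also have "\<dots> \<le> (1 + T) * ((1 + ?a) * (1 + ?a * r))"
          using T a by (simp add: algebra_simps)
        finally show ?thesis .
      qed
      also have "\<dots> \<le> (1 + T)\<^sup>2 * ((1 + ?a) * (1 + ?a * r)\<^sup>2)"
        using T a by (intro mult_mono mult_left_mono) (auto simp: power2_eq_square intro!: mult_right_mono mult_left_mono)
      finally show ?thesis using 2 by (simp add: dwt_def wt_def norm_powr_s power2_eq_square algebra_simps)
    next
      case 3
      have "r\<^sup>2 + (?a * r)\<^sup>2 \<le> (1 + T)\<^sup>2 * (1 + ?a * r)\<^sup>2"
      proof -
        have "r\<^sup>2 \<le> (1 + T)\<^sup>2" using r by (intro power_mono) auto
        moreover have "1 * (?a * r)\<^sup>2 \<le> (1 + T)\<^sup>2 * (?a * r)\<^sup>2" using T by (intro mult_right_mono) (auto simp: one_le_power)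
        ultimately have "r\<^sup>2 + (?a * r)\<^sup>2 \<le> (1 + T)\<^sup>2 * (1 + (?a * r)\<^sup>2)" by (simp add: distrib_left)
        also have "\<dots> \<le> (1 + T)\<^sup>2 * (1 + ?a * r)\<^sup>2" using a by (intro mult_left_mono zero_le_power2) (auto simp: power2_sum)
        finally show ?thesis .
      qed
      then show ?thesis using 3 by (simp add: dwt_def wt_def norm_powr_s power_mult_distrib distrib_right)
    qed
  qed
  have "wt s 1 \<xi> * \<bar>K j r \<xi>\<bar> = wt s 1 \<xi> * r ^ j * ?k" using r by (simp add: K_def abs_mult)
  also have "\<dots> \<le> (1 + T)\<^sup>2 * dwt j \<xi> * (1 + ?a * r)\<^sup>2 * ?k" by (intro mult_right_mono w) simp
  also have "\<dots> = (1 + T)\<^sup>2 * dwt j \<xi> * ((1 + ?a * r)\<^sup>2 * ?k)" by (simp only: mult.assoc)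
  also have "\<dots> \<le> (1 + T)\<^sup>2 * dwt j \<xi> * Ck" using k dwt_ge[of j \<xi>] by (intro mult_left_mono) auto
  finally show ?thesis by (simp add: ac_simps)
qed

section \<open>The Duhamel integral\<close>

definition duh :: "(real \<Rightarrow> 'a \<Rightarrow> complex) \<Rightarrow> real \<Rightarrow> 'a \<Rightarrow> complex" where
  "duh F t \<xi> = set_lebesgue_integral lborel {0..t} (\<lambda>\<tau>. complex_of_real (K 2 (t - \<tau>) \<xi>) * F \<tau> \<xi>)"

lemma duh_cong: "(\<And>\<tau>. \<tau> \<in> {0..t} \<Longrightarrow> F \<tau> \<xi> = G \<tau> \<xi>) \<Longrightarrow> duh F t \<xi> = duh G t \<xi>"
  unfolding duh_def by (intro set_lebesgue_integral_cong) auto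

lemma wt_duh: "complex_of_real (wt s \<Lambda> \<xi>) * duh F t \<xi> =
    set_lebesgue_integral lborel {0..t} (\<lambda>\<tau>. complex_of_real (wt s \<Lambda> \<xi> * K 2 (t - \<tau>) \<xi>) * F \<tau> \<xi>)"
  unfolding duh_def by (subst set_integral_mult_right[symmetric]) (simp add: mult.assoc)

lemma duh_integrable:
  assumes "continuous_on UNIV (\<lambda>(\<tau>, \<xi>). F \<tau> \<xi>)"
  shows "set_integrable lborel {0..t} (\<lambda>\<tau>. complex_of_real (K 2 (t - \<tau>) \<xi>) * F \<tau> \<xi>)"
proof (rule borel_integrable_atLeastAtMost')
  have "continuous_on {0..t} (\<lambda>\<tau>. (\<lambda>(\<tau>, \<xi>). F \<tau> \<xi>) (\<tau>, \<xi>))"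
    by (rule continuous_on_compose2[OF assms]) (auto intro!: continuous_intros)
  then show "continuous_on {0..t} (\<lambda>\<tau>. complex_of_real (K 2 (t - \<tau>) \<xi>) * F \<tau> \<xi>)"
    by (auto intro!: continuous_intros)
qed

lemma duh_diff:
  assumes "continuous_on UNIV (\<lambda>(\<tau>, \<xi>). F \<tau> \<xi>)" "continuous_on UNIV (\<lambda>(\<tau>, \<xi>). G \<tau> \<xi>)"
  shows "duh (\<lambda>\<tau> \<xi>. F \<tau> \<xi> - G \<tau> \<xi>) t \<xi> = duh F t \<xi> - duh G t \<xi>"
  unfolding duh_def right_diff_distrib
  by (rule set_integral_diff(2)[OF duh_integrable[OF assms(1)] duh_integrable[OF assms(2)]])

lemma duh_Minkowski:
  assumes F: "continuous_on UNIV (\<lambda>(\<tau>, \<xi>). F \<tau> \<xi>)" and t: "0 \<le> t" and w: "w \<in> borel_measurable borel"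
    and b: "\<And>\<tau>. \<tau> \<in> {0..t} \<Longrightarrow> l2b (\<lambda>\<xi>. complex_of_real (wt s \<Lambda> \<xi> * K 2 (t - \<tau>) \<xi>) * F \<tau> \<xi>) (w \<tau>)"
    and W: "(\<integral>\<^sup>+\<tau>\<in>{0..t}. ennreal (w \<tau>) \<partial>lborel) \<le> ennreal W" "0 \<le> W"
  shows "l2b (\<lambda>\<xi>. complex_of_real (wt s \<Lambda> \<xi>) * duh F t \<xi>) W"
  unfolding wt_duh
proof (rule l2b_Minkowski_integral[OF _ w _ b W t])
  have Fm: "(\<lambda>(\<tau>, \<xi>). F \<tau> \<xi>) \<in> borel_measurable (borel \<Otimes>\<^sub>M borel)" by (rule continuous_borel_pair[OF F])
  have "continuous_on UNIV (\<lambda>(\<tau>, \<xi>). K 2 (t - \<tau>) \<xi>)"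
    unfolding case_prod_beta by (intro continuous_intros)
  then have Km: "(\<lambda>(\<tau>, \<xi>). K 2 (t - \<tau>) \<xi>) \<in> borel_measurable (borel \<Otimes>\<^sub>M borel)" by (rule continuous_borel_pair)
  show "(\<lambda>(\<tau>, \<xi>). complex_of_real (wt s \<Lambda> \<xi> * K 2 (t - \<tau>) \<xi>) * F \<tau> \<xi>) \<in> borel_measurable (borel \<Otimes>\<^sub>M borel)"
    using Fm Km unfolding case_prod_beta by measurable
  show "0 \<le> w \<tau>" if "\<tau> \<in> {0..t}" for \<tau> using b[OF that] by (rule l2b_nonneg)
qed

text \<open>For sources at times \<tau> \<ge> t/2, or if t \<le> 1, the L2 bound on \<open>F\<close>
  has the rate already, as 1 + \<tau> is at least (1 + t) / 2. For earlier sources the sup bound on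
  \<open>F\<close> is used and the rate comes from the L2 norm of the kernel, as t - \<tau> is at
  least (1 + t) / 4. In both cases (1 + \<tau>)^(-\<gamma>) remains, with integral at most 1 /
  (\<gamma> - 1).\<close>

lemma Duhamel_decay:
  "\<exists>C>0. \<forall>F S t. 0 \<le> t \<longrightarrow> 0 \<le> S \<longrightarrow> continuous_on UNIV (\<lambda>(\<tau>, \<xi>). F \<tau> \<xi>) \<longrightarrow>
     (\<forall>\<tau>\<in>{0..t}. \<forall>\<xi>. norm (F \<tau> \<xi>) \<le> S * (1 + \<tau>) powr - \<gamma>) \<longrightarrow>
     (\<forall>\<tau>\<in>{0..t}. l2b (F \<tau>) (S * (1 + \<tau>) powr (- \<gamma> - \<nu>))) \<longrightarrow>
     l2b (\<lambda>\<xi>. complex_of_real (wt s (1 + t) \<xi>) * duh F t \<xi>) (C * S * (1 + t) powr - \<nu>)"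
proof -
  obtain Ce where Ce: "0 < Ce" "\<And>r. 0 < r \<Longrightarrow> l2b (\<lambda>\<xi>::'a. complex_of_real (exp (- ck * (r * norm \<xi> powr (s / 2))))) (Ce * r powr - \<nu>)"
    using l2b_exp_powr[OF ck s, where 'a = 'a] unfolding \<nu> by auto
  have \<nu>0: "0 < \<nu>" using s by (simp add: \<nu>)
  define C where "C = Ck * (2 powr \<nu> + Ce * 4 powr \<nu>)"
  have C: "0 < C" using Ck Ce by (simp add: C_def add_pos_pos)
  have "l2b (\<lambda>\<xi>. complex_of_real (wt s (1 + t) \<xi>) * duh F t \<xi>) (C / (\<gamma> - 1) * S * (1 + t) powr - \<nu>)"
    if t: "0 \<le> t" and S: "0 \<le> S" and F: "continuous_on UNIV (\<lambda>(\<tau>, \<xi>). F \<tau> \<xi>)"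
      and F1: "\<And>\<tau> \<xi>. \<tau> \<in> {0..t} \<Longrightarrow> norm (F \<tau> \<xi>) \<le> S * (1 + \<tau>) powr - \<gamma>"
      and F2: "\<And>\<tau>. \<tau> \<in> {0..t} \<Longrightarrow> l2b (F \<tau>) (S * (1 + \<tau>) powr (- \<gamma> - \<nu>))" for F S t
  proof (rule duh_Minkowski[OF F t, of "\<lambda>\<tau>. C * S * (1 + t) powr - \<nu> * (1 + \<tau>) powr - \<gamma>"])
    fix \<tau> assume \<tau>: "\<tau> \<in> {0..t}"
    have [measurable]: "F \<tau> \<in> borel_measurable borel" using F2[OF \<tau>] by (rule l2b_measurable)
    have m: "(\<lambda>\<xi>. complex_of_real (wt s (1 + t) \<xi> * K 2 (t - \<tau>) \<xi>) * F \<tau> \<xi>) \<in> borel_measurable borel" by measurable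
    have kb: "wt s (1 + t) \<xi> * \<bar>K 2 (t - \<tau>) \<xi>\<bar> \<le> Ck * exp (- ck * ((t - \<tau>) * norm \<xi> powr (s / 2)))" for \<xi>
      using \<tau> by (intro multiplier_bound_scaled) auto
    have n: "norm (complex_of_real (wt s (1 + t) \<xi> * K 2 (t - \<tau>) \<xi>) * F \<tau> \<xi>) \<le> Ck * exp (- ck * ((t - \<tau>) * norm \<xi> powr (s / 2))) * norm (F \<tau> \<xi>)" for \<xi>
      using mult_right_mono[OF kb[of \<xi>], of "norm (F \<tau> \<xi>)"] by (simp add: norm_mult abs_mult abs_of_nonneg[OF wt_nonneg])
    show "l2b (\<lambda>\<xi>. complex_of_real (wt s (1 + t) \<xi> * K 2 (t - \<tau>) \<xi>) * F \<tau> \<xi>) (C * S * (1 + t) powr - \<nu> * (1 + \<tau>) powr - \<gamma>)"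
    proof (cases "t / 2 \<le> \<tau> \<or> t \<le> 1")
      case True
      have "l2b (\<lambda>\<xi>. complex_of_real (wt s (1 + t) \<xi> * K 2 (t - \<tau>) \<xi>) * F \<tau> \<xi>) (Ck * (S * (1 + \<tau>) powr (- \<gamma> - \<nu>)))"
      proof (rule l2b_dominated[OF F2[OF \<tau>] m])
        show "AE \<xi> in lborel. norm (complex_of_real (wt s (1 + t) \<xi> * K 2 (t - \<tau>) \<xi>) * F \<tau> \<xi>) \<le> Ck * norm (F \<tau> \<xi>)"
        proof (rule AE_I2)
          fix \<xi>
          have "Ck * exp (- ck * ((t - \<tau>) * norm \<xi> powr (s / 2))) * norm (F \<tau> \<xi>) \<le> Ck * 1 * norm (F \<tau> \<xi>)"
            using Ck ck \<tau> by (intro mult_right_mono mult_left_mono) auto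
          then show "norm (complex_of_real (wt s (1 + t) \<xi> * K 2 (t - \<tau>) \<xi>) * F \<tau> \<xi>) \<le> Ck * norm (F \<tau> \<xi>)" using n[of \<xi>] by simp
        qed
      qed (use Ck in simp)
      then show ?thesis
      proof (rule l2b_mono)
        have "(1 + t) / 2 \<le> 1 + \<tau>" using True \<tau> by auto
        then have "(1 + \<tau>) powr - \<nu> \<le> ((1 + t) / 2) powr - \<nu>" using t \<nu>0 by (intro powr_mono2') auto
        also have "\<dots> = 2 powr \<nu> * (1 + t) powr - \<nu>" using t by (simp add: powr_divide powr_minus_divide)
        finally have "Ck * (S * (1 + \<tau>) powr - \<gamma> * (1 + \<tau>) powr - \<nu>) \<le> Ck * (S * (1 + \<tau>) powr - \<gamma> * (2 powr \<nu> * (1 + t) powr - \<nu>))"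
          using Ck S by (intro mult_left_mono) auto
        also have "\<dots> = (Ck * 2 powr \<nu>) * (S * (1 + t) powr - \<nu> * (1 + \<tau>) powr - \<gamma>)" by (simp only: ac_simps)
        also have "\<dots> \<le> C * (S * (1 + t) powr - \<nu> * (1 + \<tau>) powr - \<gamma>)"
          using S Ck Ce by (intro mult_right_mono) (auto simp: C_def distrib_left)
        finally show "Ck * (S * (1 + \<tau>) powr (- \<gamma> - \<nu>)) \<le> C * S * (1 + t) powr - \<nu> * (1 + \<tau>) powr - \<gamma>"
          using powr_add[of "1 + \<tau>" "- \<gamma>" "- \<nu>"] by (simp add: mult.assoc)
      qed
    next
      case False
      then have r: "0 < t - \<tau>" "(1 + t) / 4 \<le> t - \<tau>" using \<tau> by auto
      have "l2b (\<lambda>\<xi>. complex_of_real (wt s (1 + t) \<xi> * K 2 (t - \<tau>) \<xi>) * F \<tau> \<xi>) ((Ck * (S * (1 + \<tau>) powr - \<gamma>)) * (Ce * (t - \<tau>) powr - \<nu>))"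
      proof (rule l2b_dominated[OF Ce(2)[OF r(1)] m])
        show "AE \<xi> in lborel. norm (complex_of_real (wt s (1 + t) \<xi> * K 2 (t - \<tau>) \<xi>) * F \<tau> \<xi>) \<le> (Ck * (S * (1 + \<tau>) powr - \<gamma>)) * norm (complex_of_real (exp (- ck * ((t - \<tau>) * norm \<xi> powr (s / 2)))))"
        proof (rule AE_I2)
          fix \<xi>
          have "Ck * exp (- ck * ((t - \<tau>) * norm \<xi> powr (s / 2))) * norm (F \<tau> \<xi>) \<le> Ck * exp (- ck * ((t - \<tau>) * norm \<xi> powr (s / 2))) * (S * (1 + \<tau>) powr - \<gamma>)"
            using Ck by (intro mult_left_mono F1[OF \<tau>]) auto
          then show "norm (complex_of_real (wt s (1 + t) \<xi> * K 2 (t - \<tau>) \<xi>) * F \<tau> \<xi>) \<le> (Ck * (S * (1 + \<tau>) powr - \<gamma>)) * norm (complex_of_real (exp (- ck * ((t - \<tau>) * norm \<xi> powr (s / 2)))))"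
            using n[of \<xi>] by (simp add: norm_of_real ac_simps)
        qed
      qed (use Ck S in simp)
      then show ?thesis
      proof (rule l2b_mono)
        have "(t - \<tau>) powr - \<nu> \<le> ((1 + t) / 4) powr - \<nu>" using r t \<nu>0 by (intro powr_mono2') auto
        also have "\<dots> = 4 powr \<nu> * (1 + t) powr - \<nu>" using t by (simp add: powr_divide powr_minus_divide)
        finally have "(Ck * (S * (1 + \<tau>) powr - \<gamma>)) * (Ce * (t - \<tau>) powr - \<nu>) \<le> (Ck * (S * (1 + \<tau>) powr - \<gamma>)) * (Ce * (4 powr \<nu> * (1 + t) powr - \<nu>))"
          using Ck S Ce by (intro mult_left_mono) auto
        also have "\<dots> = (Ck * (Ce * 4 powr \<nu>)) * (S * (1 + t) powr - \<nu> * (1 + \<tau>) powr - \<gamma>)" by (simp only: ac_simps)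
        also have "\<dots> \<le> C * (S * (1 + t) powr - \<nu> * (1 + \<tau>) powr - \<gamma>)"
          using S Ck by (intro mult_right_mono) (auto simp: C_def distrib_left)
        finally show "(Ck * (S * (1 + \<tau>) powr - \<gamma>)) * (Ce * (t - \<tau>) powr - \<nu>) \<le> C * S * (1 + t) powr - \<nu> * (1 + \<tau>) powr - \<gamma>"
          by (simp add: mult.assoc)
      qed
    qed
  next
    let ?A = "C * S * (1 + t) powr - \<nu>"
    have A: "0 \<le> ?A" using C S by simp
    have "(\<integral>\<^sup>+\<tau>\<in>{0..t}. ennreal (?A * (1 + \<tau>) powr - \<gamma>) \<partial>lborel) = ennreal ?A * (\<integral>\<^sup>+\<tau>\<in>{0..t}. ennreal ((1 + \<tau>) powr - \<gamma>) \<partial>lborel)"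
      by (rule set_nn_integral_cmult_real[OF A]) measurable
    also have "\<dots> \<le> ennreal ?A * ennreal (1 / (\<gamma> - 1))" by (intro mult_left_mono nn_integral_powr_tail \<gamma>_gt t) simp
    also have "\<dots> = ennreal (C / (\<gamma> - 1) * S * (1 + t) powr - \<nu>)"
      unfolding ennreal_mult'[OF A, symmetric] by (simp add: ac_simps)
    finally show "(\<integral>\<^sup>+\<tau>\<in>{0..t}. ennreal (?A * (1 + \<tau>) powr - \<gamma>) \<partial>lborel) \<le> ennreal (C / (\<gamma> - 1) * S * (1 + t) powr - \<nu>)" .
  qed (use C S \<gamma>_gt in auto)
  moreover have "0 < C / (\<gamma> - 1)" using C \<gamma>_gt by simp
  ultimately show ?thesis by (intro exI[of _ "C / (\<gamma> - 1)"]) blast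
qed

lemma K2_local_l2b:
  assumes F: "l2b F A" and r: "0 \<le> r" "r \<le> T"
  shows "l2b (\<lambda>\<xi>. complex_of_real (wt s 1 \<xi> * K 2 r \<xi>) * F \<xi>) ((1 + T)\<^sup>2 * Ck * A)"
proof (rule l2b_dominated[OF F])
  have [measurable]: "F \<in> borel_measurable borel" using F by (rule l2b_measurable)
  show "(\<lambda>\<xi>. complex_of_real (wt s 1 \<xi> * K 2 r \<xi>) * F \<xi>) \<in> borel_measurable borel" by measurable
  show "AE \<xi> in lborel. norm (complex_of_real (wt s 1 \<xi> * K 2 r \<xi>) * F \<xi>) \<le> (1 + T)\<^sup>2 * Ck * norm (F \<xi>)"
  proof (rule AE_I2)
    fix \<xi> :: 'a
    show "norm (complex_of_real (wt s 1 \<xi> * K 2 r \<xi>) * F \<xi>) \<le> (1 + T)\<^sup>2 * Ck * norm (F \<xi>)"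
      using mult_right_mono[OF multiplier_bound_local[OF _ r, of 2 \<xi>], of "norm (F \<xi>)"]
      by (simp add: dwt_def norm_mult abs_mult abs_of_nonneg[OF wt_nonneg])
  qed
qed (use Ck in auto)

text \<open>The estimate at the fixed scale 1, which works from L2 bounds on the source alone; it
  serves continuity in time and uniqueness.\<close>

lemma Duhamel_local:
  assumes F: "continuous_on UNIV (\<lambda>(\<tau>, \<xi>). F \<tau> \<xi>)" and t: "0 \<le> t" "t \<le> T" and w: "w \<in> borel_measurable borel"
    and b: "\<And>\<tau>. \<tau> \<in> {0..t} \<Longrightarrow> l2b (F \<tau>) (w \<tau>)"
    and W: "(\<integral>\<^sup>+\<tau>\<in>{0..t}. ennreal (w \<tau>) \<partial>lborel) \<le> ennreal W" "0 \<le> W"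
  shows "l2b (\<lambda>\<xi>. complex_of_real (wt s 1 \<xi>) * duh F t \<xi>) ((1 + T)\<^sup>2 * Ck * W)"
proof (rule duh_Minkowski[OF F t(1), of "\<lambda>\<tau>. (1 + T)\<^sup>2 * Ck * w \<tau>"])
  let ?A = "(1 + T)\<^sup>2 * Ck"
  have A: "0 \<le> ?A" using Ck by simp
  show "l2b (\<lambda>\<xi>. complex_of_real (wt s 1 \<xi> * K 2 (t - \<tau>) \<xi>) * F \<tau> \<xi>) (?A * w \<tau>)" if "\<tau> \<in> {0..t}" for \<tau>
    using that t by (intro K2_local_l2b b) auto
  have "(\<integral>\<^sup>+\<tau>\<in>{0..t}. ennreal (?A * w \<tau>) \<partial>lborel) = ennreal ?A * (\<integral>\<^sup>+\<tau>\<in>{0..t}. ennreal (w \<tau>) \<partial>lborel)"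
    by (rule set_nn_integral_cmult_real[OF A w])
  also have "\<dots> \<le> ennreal ?A * ennreal W" by (intro mult_left_mono W) simp
  finally show "(\<integral>\<^sup>+\<tau>\<in>{0..t}. ennreal (?A * w \<tau>) \<partial>lborel) \<le> ennreal (?A * W)" using A by (simp add: ennreal_mult')
qed (use w W Ck in auto)

text \<open>Dominated convergence in \<tau>. The second bound is uniform in \<open>k\<close> and
  serves as the majorant for dominated convergence in \<xi>.\<close>

lemma duh_tendsto:
  assumes F: "continuous_on UNIV (\<lambda>(\<tau>, \<xi>). F \<tau> \<xi>)" and u: "u \<longlonglongrightarrow> t" and uT: "\<And>k. 0 \<le> u k" "\<And>k. u k \<le> T"
  shows "(\<lambda>k. duh F (u k) \<xi>) \<longlonglongrightarrow> duh F t \<xi>"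
    and "norm (complex_of_real (wt s 1 \<xi>) * duh F (u k) \<xi>) \<le> (1 + T)\<^sup>2 * Ck * set_lebesgue_integral lborel {0..T} (\<lambda>\<tau>. norm (F \<tau> \<xi>))"
proof -
  let ?B = "(1 + T)\<^sup>2 * Ck"
  have Fc: "continuous_on A (\<lambda>\<tau>. F \<tau> \<xi>)" for A
  proof -
    have "continuous_on A (\<lambda>\<tau>. (\<lambda>(\<tau>, \<xi>). F \<tau> \<xi>) (\<tau>, \<xi>))"
      by (rule continuous_on_compose2[OF F]) (auto intro!: continuous_intros)
    then show ?thesis by simp
  qed
  note [measurable] = borel_measurable_continuous_onI[OF Fc]
  have Km: "(\<lambda>\<tau>. K 2 (r - \<tau>) \<xi>) \<in> borel_measurable borel" for r
    by (intro borel_measurable_continuous_onI continuous_intros)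
  note [measurable] = this
  have iF: "integrable lborel (\<lambda>\<tau>. indicator {0..T} \<tau> *\<^sub>R norm (F \<tau> \<xi>))"
    using borel_integrable_atLeastAtMost'[of 0 T "\<lambda>\<tau>. norm (F \<tau> \<xi>)"] continuous_on_norm[OF Fc]
    by (simp add: set_integrable_def)
  have b: "wt s 1 \<xi> * norm (indicator {0..u k} \<tau> *\<^sub>R (complex_of_real (K 2 (u k - \<tau>) \<xi>) * F \<tau> \<xi>)) \<le> ?B * (indicator {0..T} \<tau> *\<^sub>R norm (F \<tau> \<xi>))" for k \<tau>
  proof (cases "\<tau> \<in> {0..u k}")
    case True
    then have "wt s 1 \<xi> * \<bar>K 2 (u k - \<tau>) \<xi>\<bar> \<le> ?B" using uT(2)[of k] multiplier_bound_local[of 2 "u k - \<tau>" T \<xi>] by (simp add: dwt_def)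
    from mult_right_mono[OF this, of "norm (F \<tau> \<xi>)"] show ?thesis using True uT(2)[of k] by (simp add: norm_mult mult.assoc)
  qed (use Ck in simp)
  have w1: "1 \<le> wt s 1 \<xi>" by (simp add: wt_def)
  have b1: "norm (indicator {0..u k} \<tau> *\<^sub>R (complex_of_real (K 2 (u k - \<tau>) \<xi>) * F \<tau> \<xi>)) \<le> ?B * (indicator {0..T} \<tau> *\<^sub>R norm (F \<tau> \<xi>))" for k \<tau>
    by (rule order_trans[OF _ b[of k \<tau>]], rule order_trans[OF eq_refl[OF mult_1[symmetric]] mult_right_mono[OF w1 norm_ge_zero]])
  show "(\<lambda>k. duh F (u k) \<xi>) \<longlonglongrightarrow> duh F t \<xi>"
    unfolding duh_def set_lebesgue_integral_def
  proof (rule integral_dominated_convergence[where w = "\<lambda>\<tau>. ?B * (indicator {0..T} \<tau> *\<^sub>R norm (F \<tau> \<xi>))"])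
    show "AE \<tau> in lborel. (\<lambda>k. indicator {0..u k} \<tau> *\<^sub>R (complex_of_real (K 2 (u k - \<tau>) \<xi>) * F \<tau> \<xi>)) \<longlonglongrightarrow> indicator {0..t} \<tau> *\<^sub>R (complex_of_real (K 2 (t - \<tau>) \<xi>) * F \<tau> \<xi>)"
      \<comment> \<open>At \<tau> = t the indicators of \<open>{0..u k}\<close> need not
        converge.\<close>
      using AE_lborel_singleton[of t]
    proof eventually_elim
      case (elim \<tau>)
      have "\<forall>\<^sub>F k in sequentially. indicator {0..u k} \<tau> = (indicator {0..t} \<tau> :: real)"
      proof (cases "\<tau> < t")
        case True
        from order_tendstoD(1)[OF u this] show ?thesis by eventually_elim (use True in \<open>auto simp: indicator_def\<close>)
      next
        case False
        then have "t < \<tau>" using elim by simp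
        from order_tendstoD(2)[OF u this] show ?thesis by eventually_elim (use False elim in \<open>auto simp: indicator_def\<close>)
      qed
      then have "(\<lambda>k. indicator {0..u k} \<tau> :: real) \<longlonglongrightarrow> indicator {0..t} \<tau>" by (rule tendsto_eventually)
      moreover have "(\<lambda>k. K 2 (u k - \<tau>) \<xi>) \<longlonglongrightarrow> K 2 (t - \<tau>) \<xi>"
      proof -
        have "continuous_on UNIV (\<lambda>r. K 2 (r - \<tau>) \<xi>)" by (intro continuous_intros)
        then show ?thesis using u by (auto simp: continuous_on_sequentially comp_def)
      qed
      ultimately show ?case by (intro tendsto_intros)
    qed
  qed (use iF b1 in auto)
  have w0: "0 \<le> wt s 1 \<xi>" by (rule wt_nonneg)
  have "norm (duh F (u k) \<xi>) \<le> (\<integral>\<tau>. norm (indicator {0..u k} \<tau> *\<^sub>R (complex_of_real (K 2 (u k - \<tau>) \<xi>) * F \<tau> \<xi>)) \<partial>lborel)"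
    unfolding duh_def set_lebesgue_integral_def by (rule integral_norm_bound)
  from mult_left_mono[OF this w0]
  have "norm (complex_of_real (wt s 1 \<xi>) * duh F (u k) \<xi>) \<le> (\<integral>\<tau>. wt s 1 \<xi> * norm (indicator {0..u k} \<tau> *\<^sub>R (complex_of_real (K 2 (u k - \<tau>) \<xi>) * F \<tau> \<xi>)) \<partial>lborel)"
    unfolding integral_mult_right_zero by (simp add: norm_mult w0)
  also have "\<dots> \<le> (\<integral>\<tau>. ?B * (indicator {0..T} \<tau> *\<^sub>R norm (F \<tau> \<xi>)) \<partial>lborel)"
    by (rule integral_mono_AE'[OF _ AE_I2[OF b]]) (use iF Ck in \<open>auto intro!: AE_I2\<close>)
  finally show "norm (complex_of_real (wt s 1 \<xi>) * duh F (u k) \<xi>) \<le> ?B * set_lebesgue_integral lborel {0..T} (\<lambda>\<tau>. norm (F \<tau> \<xi>))"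
    by (simp add: set_lebesgue_integral_def)
qed

text \<open>The majorant from \<open>duh_tendsto\<close> is square integrable in \<xi> by
  Minkowski's integral inequality, so dominated convergence applies in L2.\<close>

lemma duh_continuous_in_time:
  assumes F: "continuous_on UNIV (\<lambda>(\<tau>, \<xi>). F \<tau> \<xi>)" and u: "u \<longlonglongrightarrow> t" and uT: "\<And>k. 0 \<le> u k" "\<And>k. u k \<le> T"
    and A: "\<And>\<tau>. \<tau> \<in> {0..T} \<Longrightarrow> l2b (F \<tau>) A" and e: "0 < e"
  shows "\<forall>\<^sub>F k in sequentially. l2b (\<lambda>\<xi>. complex_of_real (wt s 1 \<xi>) * duh F (u k) \<xi> - complex_of_real (wt s 1 \<xi>) * duh F t \<xi>) e"
proof -
  have T: "0 \<le> T" using uT(1)[of 0] uT(2)[of 0] by simp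
  have t: "0 \<le> t" "t \<le> T" using u uT by (auto intro: LIMSEQ_le_const LIMSEQ_le_const2)
  have A0: "0 \<le> A" using A[of 0] T by (auto dest: l2b_nonneg)
  have W: "(\<integral>\<^sup>+\<tau>\<in>{0..r}. ennreal A \<partial>lborel) \<le> ennreal (A * T)" if "0 \<le> r" "r \<le> T" for r
    using A0 that by (subst nn_integral_cmult_indicator) (auto simp: ennreal_mult'[symmetric] intro!: ennreal_leI mult_left_mono)
  have m: "(\<lambda>\<xi>. complex_of_real (wt s 1 \<xi>) * duh F r \<xi>) \<in> borel_measurable borel" if "0 \<le> r" "r \<le> T" for r
    by (rule l2b_measurable[OF Duhamel_local[OF F that _ _ W[OF that]]]) (use A A0 T that in auto)
  have "l2b (\<lambda>\<xi>. set_lebesgue_integral lborel {0..T} (\<lambda>\<tau>. norm (F \<tau> \<xi>))) (A * T)"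
  proof (rule l2b_Minkowski_integral[OF _ _ _ _ W[OF T order_refl] _ T])
    show "(\<lambda>(\<tau>, \<xi>). norm (F \<tau> \<xi>)) \<in> borel_measurable (borel \<Otimes>\<^sub>M borel)"
      using continuous_borel_pair[OF F] unfolding case_prod_beta by measurable
    show "l2b (\<lambda>\<xi>. norm (F \<tau> \<xi>)) A" if "\<tau> \<in> {0..T}" for \<tau>
      using A[OF that] by (auto simp: l2b_def)
  qed (use A0 T in auto)
  from l2b_scaleR[OF this, of "(1 + T)\<^sup>2 * Ck"]
  have H: "l2b (\<lambda>\<xi>. (1 + T)\<^sup>2 * Ck * set_lebesgue_integral lborel {0..T} (\<lambda>\<tau>. norm (F \<tau> \<xi>))) ((1 + T)\<^sup>2 * Ck * (A * T))"
    using Ck by simp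
  have Hc: "l2b (\<lambda>\<xi>. complex_of_real ((1 + T)\<^sup>2 * Ck * set_lebesgue_integral lborel {0..T} (\<lambda>\<tau>. norm (F \<tau> \<xi>)))) ((1 + T)\<^sup>2 * Ck * (A * T))"
    using H by (auto simp only: l2b_def norm_of_real real_norm_def intro!: measurable_compose[OF _ borel_measurable_of_real])
  have lim: "AE \<xi> in lborel. (\<lambda>k. complex_of_real (wt s 1 \<xi>) * duh F (u k) \<xi>) \<longlonglongrightarrow> complex_of_real (wt s 1 \<xi>) * duh F t \<xi>"
    by (intro AE_I2 tendsto_intros duh_tendsto(1)[OF F u uT])
  have dom: "AE \<xi> in lborel. norm (complex_of_real (wt s 1 \<xi>) * duh F (u k) \<xi>) \<le> norm (complex_of_real ((1 + T)\<^sup>2 * Ck * set_lebesgue_integral lborel {0..T} (\<lambda>\<tau>. norm (F \<tau> \<xi>))))" for k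
    by (rule AE_I2, rule order_trans[OF duh_tendsto(2)[OF F u uT]]) (simp only: norm_of_real abs_ge_self)
  note dc = l2b_dominated_convergence[OF m m[OF t] lim Hc dom]
  show ?thesis
    by (rule eventually_l2b[OF _ dc(2) dc(1) e]) (use m t uT in auto)
qed

text \<open>For t \<le> 1 the regularity of the data is spent, and afterwards the boundedness of
  their transforms, the rate then coming from the L2 norm of the kernel. The threshold 1 is where
  r^j \<le> r^2 starts to hold for every j \<le> 2.\<close>

lemma linear_decay:
  "\<exists>C>0. \<forall>j\<le>2. \<forall>g B t. 0 \<le> t \<longrightarrow> 0 \<le> B \<longrightarrow> (\<forall>\<xi>. norm (g \<xi>) \<le> B) \<longrightarrow> l2b (\<lambda>\<xi>. complex_of_real (dwt j \<xi>) * g \<xi>) B \<longrightarrow>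
     g \<in> borel_measurable borel \<longrightarrow>
     l2b (\<lambda>\<xi>. complex_of_real (wt s (1 + t) \<xi>) * (complex_of_real (K j t \<xi>) * g \<xi>)) (C * B * (1 + t) powr - \<nu>)"
proof -
  obtain Ce where Ce: "0 < Ce" "\<And>r. 0 < r \<Longrightarrow> l2b (\<lambda>\<xi>::'a. complex_of_real (exp (- ck * (r * norm \<xi> powr (s / 2))))) (Ce * r powr - \<nu>)"
    using l2b_exp_powr[OF ck s, where 'a = 'a] unfolding \<nu> by auto
  have \<nu>0: "0 < \<nu>" using s by (simp add: \<nu>)
  define C where "C = Ck * (4 + Ce) * 2 powr \<nu>"
  have C: "0 < C" using Ck Ce by (simp add: C_def)
  have "l2b (\<lambda>\<xi>. complex_of_real (wt s (1 + t) \<xi>) * (complex_of_real (K j t \<xi>) * g \<xi>)) (C * B * (1 + t) powr - \<nu>)"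
    if j: "j \<le> 2" and t: "0 \<le> t" and B: "0 \<le> B" and g1: "\<And>\<xi>. norm (g \<xi>) \<le> B" and g2: "l2b (\<lambda>\<xi>. complex_of_real (dwt j \<xi>) * g \<xi>) B"
      and [measurable]: "g \<in> borel_measurable borel" for j g B t
  proof (cases "t \<le> 1")
    case True
    have "l2b (\<lambda>\<xi>. complex_of_real (wt s (1 + t) \<xi>) * (complex_of_real (K j t \<xi>) * g \<xi>)) (4 * Ck * B)"
    proof (rule l2b_dominated[OF g2])
      show "AE \<xi> in lborel. norm (complex_of_real (wt s (1 + t) \<xi>) * (complex_of_real (K j t \<xi>) * g \<xi>)) \<le> 4 * Ck * norm (complex_of_real (dwt j \<xi>) * g \<xi>)"
      proof (rule AE_I2)
        fix \<xi> :: 'a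
        have "wt s (1 + t) \<xi> \<le> wt s 1 \<xi>" using t by (simp add: wt_def divide_le_eq_1)
        then have "wt s (1 + t) \<xi> * \<bar>K j t \<xi>\<bar> \<le> wt s 1 \<xi> * \<bar>K j t \<xi>\<bar>" by (rule mult_right_mono) simp
        also have "\<dots> \<le> 4 * Ck * dwt j \<xi>" using multiplier_bound_local[OF j t True, of \<xi>] by simp
        finally have "wt s (1 + t) \<xi> * \<bar>K j t \<xi>\<bar> * norm (g \<xi>) \<le> 4 * Ck * dwt j \<xi> * norm (g \<xi>)" by (rule mult_right_mono) simp
        then show "norm (complex_of_real (wt s (1 + t) \<xi>) * (complex_of_real (K j t \<xi>) * g \<xi>)) \<le> 4 * Ck * norm (complex_of_real (dwt j \<xi>) * g \<xi>)"
          using dwt_ge[of j \<xi>] by (simp add: norm_mult abs_of_nonneg[OF wt_nonneg] mult.assoc)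
      qed
    qed (use Ck in auto)
    then show ?thesis
    proof (rule l2b_mono)
      have "2 powr \<nu> * (1 + t) powr - \<nu> = (2 / (1 + t)) powr \<nu>" using t by (simp add: powr_divide powr_minus_divide)
      moreover have "1 \<le> (2 / (1 + t)) powr \<nu>" using t True \<nu>0 by (intro ge_one_powr_ge_zero) auto
      ultimately have "4 * Ck * B * 1 \<le> 4 * Ck * B * (2 powr \<nu> * (1 + t) powr - \<nu>)" using Ck B by (intro mult_left_mono) auto
      also have "\<dots> \<le> (Ck * (4 + Ce)) * B * (2 powr \<nu> * (1 + t) powr - \<nu>)" using Ck Ce B by (intro mult_right_mono) auto
      finally show "4 * Ck * B \<le> C * B * (1 + t) powr - \<nu>" by (simp add: C_def ac_simps)
    qed
  next
    case False
    then have t1: "1 \<le> t" by simp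
    have "l2b (\<lambda>\<xi>. complex_of_real (wt s (1 + t) \<xi>) * (complex_of_real (K j t \<xi>) * g \<xi>)) (Ck * B * (Ce * t powr - \<nu>))"
    proof (rule l2b_dominated[OF Ce(2)])
      show "AE \<xi> in lborel. norm (complex_of_real (wt s (1 + t) \<xi>) * (complex_of_real (K j t \<xi>) * g \<xi>)) \<le> Ck * B * norm (complex_of_real (exp (- ck * (t * norm \<xi> powr (s / 2)))))"
      proof (rule AE_I2)
        fix \<xi> :: 'a
        have "wt s (1 + t) \<xi> * \<bar>K j t \<xi>\<bar> * norm (g \<xi>) \<le> Ck * exp (- ck * (t * norm \<xi> powr (s / 2))) * B"
          using t1 j Ck by (intro mult_mono multiplier_bound_scaled g1) auto
        then show "norm (complex_of_real (wt s (1 + t) \<xi>) * (complex_of_real (K j t \<xi>) * g \<xi>)) \<le> Ck * B * norm (complex_of_real (exp (- ck * (t * norm \<xi> powr (s / 2)))))"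
          by (simp add: norm_mult norm_of_real abs_of_nonneg[OF wt_nonneg] ac_simps)
      qed
    qed (use Ck B t1 in auto)
    then show ?thesis
    proof (rule l2b_mono)
      have "t powr - \<nu> \<le> ((1 + t) / 2) powr - \<nu>" using t1 \<nu>0 by (intro powr_mono2') auto
      also have "\<dots> = 2 powr \<nu> * (1 + t) powr - \<nu>" using t by (simp add: powr_divide powr_minus_divide)
      finally have "Ck * B * (Ce * t powr - \<nu>) \<le> Ck * B * (Ce * (2 powr \<nu> * (1 + t) powr - \<nu>))" using Ck B Ce by (intro mult_left_mono) auto
      also have "\<dots> \<le> Ck * B * ((4 + Ce) * (2 powr \<nu> * (1 + t) powr - \<nu>))" using Ck B by (intro mult_left_mono mult_right_mono) auto
      finally show "Ck * B * (Ce * t powr - \<nu>) \<le> C * B * (1 + t) powr - \<nu>" by (simp add: C_def ac_simps)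
    qed
  qed
  then show ?thesis using C by (intro exI[of _ C]) blast
qed

lemma linear_continuous_in_time:
  assumes j: "j \<le> 2" and g: "l2b (\<lambda>\<xi>. complex_of_real (dwt j \<xi>) * g \<xi>) B" and [measurable]: "g \<in> borel_measurable borel"
    and u: "u \<longlonglongrightarrow> t" and uT: "\<And>k. 0 \<le> u k" "\<And>k. u k \<le> T" and e: "0 < e"
  shows "\<forall>\<^sub>F k in sequentially. l2b (\<lambda>\<xi>. complex_of_real (wt s 1 \<xi>) * (complex_of_real (K j (u k) \<xi>) * g \<xi>) - complex_of_real (wt s 1 \<xi>) * (complex_of_real (K j t \<xi>) * g \<xi>)) e"
proof -
  let ?B = "(1 + T)\<^sup>2 * Ck"
  have m: "(\<lambda>\<xi>. complex_of_real (wt s 1 \<xi>) * (complex_of_real (K j r \<xi>) * g \<xi>)) \<in> borel_measurable borel" for r by measurable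
  have lim: "AE \<xi> in lborel. (\<lambda>k. complex_of_real (wt s 1 \<xi>) * (complex_of_real (K j (u k) \<xi>) * g \<xi>)) \<longlonglongrightarrow> complex_of_real (wt s 1 \<xi>) * (complex_of_real (K j t \<xi>) * g \<xi>)"
  proof (rule AE_I2)
    fix \<xi> :: 'a
    have "continuous_on UNIV (\<lambda>r. K j r \<xi>)" by (intro continuous_intros)
    then have "(\<lambda>k. K j (u k) \<xi>) \<longlonglongrightarrow> K j t \<xi>" using u by (auto simp: continuous_on_sequentially comp_def)
    then show "(\<lambda>k. complex_of_real (wt s 1 \<xi>) * (complex_of_real (K j (u k) \<xi>) * g \<xi>)) \<longlonglongrightarrow> complex_of_real (wt s 1 \<xi>) * (complex_of_real (K j t \<xi>) * g \<xi>)"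
      by (intro tendsto_intros)
  qed
  have dom: "AE \<xi> in lborel. norm (complex_of_real (wt s 1 \<xi>) * (complex_of_real (K j (u k) \<xi>) * g \<xi>)) \<le> norm (complex_of_real ?B * (complex_of_real (dwt j \<xi>) * g \<xi>))" for k
  proof (rule AE_I2)
    fix \<xi> :: 'a
    show "norm (complex_of_real (wt s 1 \<xi>) * (complex_of_real (K j (u k) \<xi>) * g \<xi>)) \<le> norm (complex_of_real ?B * (complex_of_real (dwt j \<xi>) * g \<xi>))"
      using mult_right_mono[OF multiplier_bound_local[OF j uT(1)[of k] uT(2)[of k], of \<xi>], of "norm (g \<xi>)"] dwt_ge[of j \<xi>] Ck
      by (simp only: norm_mult norm_of_real) (simp add: abs_of_nonneg[OF wt_nonneg] mult.assoc)
  qed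
  note dc = l2b_dominated_convergence[OF m m lim l2b_cmult[OF g] dom]
  show ?thesis by (rule eventually_l2b[OF _ dc(2) dc(1) e]) measurable
qed

end

section \<open>Existence and uniqueness of mild solutions\<close>

lemma l2b_0_AE:
  assumes "\<And>e. 0 < e \<Longrightarrow> l2b d e"
  shows "AE x in lborel. d x = 0"
proof -
  have z: "l2b d 0" by (rule l2b_limit) (use assms in auto)
  have "(\<integral>x. (norm (d x))\<^sup>2 \<partial>lborel) = 0"
    using l2b_integral[OF z] by (intro antisym) auto
  then have "AE x in lborel. (norm (d x))\<^sup>2 = 0"
    using l2b_integrable[OF z] by (subst (asm) integral_nonneg_eq_0_iff_AE) auto
  then show ?thesis by eventually_elim simp
qed

lemma hb_l2b_FT_diff:
  assumes "hb s \<Lambda> (\<lambda>x. f x - g x) e" "L2 f" "L2 g"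
  shows "l2b (\<lambda>\<xi>. complex_of_real (wt s \<Lambda> \<xi>) * (FT f \<xi> - FT g \<xi>)) e"
  by (rule hbD2[OF assms(1) frel_diff_real[OF FT_frel[OF assms(2)] FT_frel[OF assms(3)]]])

lemma l2b_div_wt:
  fixes g :: "'a::euclidean_space \<Rightarrow> complex"
  assumes g: "l2b (\<lambda>\<xi>. complex_of_real (wt s \<Lambda> \<xi>) * g \<xi>) A" and \<Lambda>: "0 < \<Lambda>"
  shows "l2b g (\<Lambda>\<^sup>2 * A)"
proof (rule l2b_dominated[OF g])
  have w: "wt s \<Lambda> \<xi> \<noteq> 0" for \<xi> :: 'a using \<Lambda> by (simp add: wt_def add_pos_nonneg less_imp_neq[symmetric])
  have [measurable]: "(\<lambda>\<xi>. complex_of_real (wt s \<Lambda> \<xi>) * g \<xi>) \<in> borel_measurable borel" using g by (rule l2b_measurable)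
  have "(\<lambda>\<xi>. (complex_of_real (wt s \<Lambda> \<xi>) * g \<xi>) / complex_of_real (wt s \<Lambda> \<xi>)) \<in> borel_measurable borel" by measurable
  then show "g \<in> borel_measurable borel" by (simp add: w)
  show "AE \<xi> in lborel. norm (g \<xi>) \<le> \<Lambda>\<^sup>2 * norm (complex_of_real (wt s \<Lambda> \<xi>) * g \<xi>)"
  proof (rule AE_I2)
    fix \<xi> :: 'a
    have "1 \<le> \<Lambda>\<^sup>2 * wt s \<Lambda> \<xi>" using \<Lambda> by (simp add: wt_def distrib_left)
    from mult_right_mono[OF this, of "norm (g \<xi>)"] show "norm (g \<xi>) \<le> \<Lambda>\<^sup>2 * norm (complex_of_real (wt s \<Lambda> \<xi>) * g \<xi>)"
      by (simp add: norm_mult abs_of_nonneg[OF wt_nonneg] mult.assoc)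
  qed
qed auto

text \<open>The weighted transforms converge in L2, and \<open>frel_surj\<close> takes the limit
  with the weight removed back to a function. This function is real because its L2 distance to real
  functions is arbitrarily small.\<close>

lemma hb_complete:
  fixes f :: "nat \<Rightarrow> 'a::euclidean_space \<Rightarrow> real"
  assumes L: "\<And>k. L2 (f k)" and \<Lambda>: "0 < \<Lambda>"
    and cauchy: "\<And>e. 0 < e \<Longrightarrow> \<exists>N. \<forall>m\<ge>N. \<forall>n\<ge>N. hb s \<Lambda> (\<lambda>x. f m x - f n x) e"
  shows "\<exists>F. L2 F \<and> (\<forall>e>0. \<exists>N. \<forall>n\<ge>N. hb s \<Lambda> (\<lambda>x. f n x - F x) e)"
proof -
  let ?w = "\<lambda>\<xi>. complex_of_real (wt s \<Lambda> \<xi>)" and ?c = "pc TYPE('a)"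
  note fr = FT_frel[OF L]
  have [measurable]: "FT (f k) \<in> borel_measurable borel" for k using frelD(2)[OF fr] by (rule l2_measurable)
  have w: "wt s \<Lambda> \<xi> \<noteq> 0" for \<xi> :: 'a using \<Lambda> by (simp add: wt_def add_pos_nonneg less_imp_neq[symmetric])
  have "\<exists>h\<in>borel_measurable borel. \<forall>e>0. \<exists>N. \<forall>n\<ge>N. l2b (\<lambda>\<xi>. ?w \<xi> * FT (f n) \<xi> - h \<xi>) e"
  proof (rule l2_complete)
    fix e :: real assume "0 < e"
    then show "\<exists>N. \<forall>m\<ge>N. \<forall>n\<ge>N. l2b (\<lambda>\<xi>. ?w \<xi> * FT (f m) \<xi> - ?w \<xi> * FT (f n) \<xi>) e"
      using cauchy[of e] hb_l2b_FT_diff[OF _ L L] unfolding right_diff_distrib by blast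
  qed measurable
  then obtain h where hm[measurable]: "h \<in> borel_measurable borel" and h: "\<And>e. 0 < e \<Longrightarrow> \<exists>N. \<forall>n\<ge>N. l2b (\<lambda>\<xi>. ?w \<xi> * FT (f n) \<xi> - h \<xi>) e"
    by auto
  define U where "U \<xi> = h \<xi> / ?w \<xi>" for \<xi>
  have hU: "?w \<xi> * FT (f n) \<xi> - h \<xi> = ?w \<xi> * (FT (f n) \<xi> - U \<xi>)" for n \<xi>
    using w by (simp add: U_def right_diff_distrib)
  have U: "\<exists>N. \<forall>n\<ge>N. l2b (\<lambda>\<xi>. ?w \<xi> * (FT (f n) \<xi> - U \<xi>)) e" if "0 < e" for e
    using h[OF that] unfolding hU .
  obtain N where "l2b (\<lambda>\<xi>. ?w \<xi> * (FT (f N) \<xi> - U \<xi>)) 1" using U[of 1] by auto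
  from l2_diff[OF frelD(2)[OF fr[of N]] l2b_imp_l2[OF l2b_div_wt[OF this \<Lambda>]]] have "l2 U" by simp
  then obtain g where g: "frel g U" using frel_surj by blast
  have [measurable]: "g \<in> borel_measurable borel" using frelD(1)[OF g] by (rule l2_measurable)
  have "AE x in lborel. complex_of_real (Im (g x)) = 0"
  proof (rule l2b_0_AE)
    fix e :: real assume e: "0 < e"
    have c: "0 < ?c" by (rule pc_pos)
    obtain n where n: "l2b (\<lambda>\<xi>. ?w \<xi> * (FT (f n) \<xi> - U \<xi>)) (?c * e / \<Lambda>\<^sup>2)" using U[of "?c * e / \<Lambda>\<^sup>2"] e c \<Lambda> by auto
    then have "l2b (\<lambda>\<xi>. FT (f n) \<xi> - U \<xi>) (?c * e)" using l2b_div_wt[OF n \<Lambda>] \<Lambda> by simp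
    then have "l2b (\<lambda>x. complex_of_real (f n x) - g x) e" by (rule frel_l2b'[OF frel_diff[OF fr g]]) (use e in simp)
    then show "l2b (\<lambda>x. complex_of_real (Im (g x))) e"
    proof (rule l2b_dominated1)
      show "norm (complex_of_real (Im (g x))) \<le> norm (complex_of_real (f n x) - g x)" for x
        using abs_Im_le_cmod[of "complex_of_real (f n x) - g x"] by simp
    qed measurable
  qed
  then have "AE x in lborel. g x = complex_of_real (Re (g x))" by eventually_elim (simp add: complex_eq_iff)
  then have F: "frel (\<lambda>x. complex_of_real (Re (g x))) U"
    by (rule frel_cong_AE[OF g]) (use l2_measurable[OF frelD(2)[OF g]] in auto)
  have "\<exists>N. \<forall>n\<ge>N. hb s \<Lambda> (\<lambda>x. f n x - Re (g x)) e" if "0 < e" for e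
    using U[OF that] hbI[OF frel_diff_real[OF fr F]] by blast
  moreover have "L2 (\<lambda>x. Re (g x))" using frelD(1)[OF F] by (simp add: L2_iff_l2)
  ultimately show ?thesis by blast
qed

text \<open>The smallest bound in \<open>hb\<close> at scale 1. Continuity in time and maxima over
  time need a number, where \<open>hb\<close> is only a predicate.\<close>

definition hn :: "real \<Rightarrow> ('a::euclidean_space \<Rightarrow> real) \<Rightarrow> real" where
  "hn s f = sqrt (\<integral>\<xi>. (norm (complex_of_real (wt s 1 \<xi>) * FT f \<xi>))\<^sup>2 \<partial>lborel)"

lemma hb_hn:
  assumes "hb s 1 f A" shows "hb s 1 f (hn s f)" "hn s f \<le> A" "0 \<le> hn s f"
proof -
  note l = hbD(2)[OF assms]
  show "hb s 1 f (hn s f)" unfolding hb_def hn_def using hbD(1)[OF assms] l2bI_sqrt[OF l2b_measurable[OF l] l2b_integrable[OF l]] by simp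
  show "hn s f \<le> A" unfolding hn_def by (rule real_le_lsqrt) (use l2b_integral[OF l] l2b_nonneg[OF l] in auto)
  show "0 \<le> hn s f" by (simp add: hn_def)
qed

lemma hb_add_diff:
  assumes "hb s \<Lambda> (\<lambda>x. f x - g x) e" "hb s \<Lambda> g A" "L2 f" shows "hb s \<Lambda> f (e + A)"
proof -
  have "L2 (\<lambda>x::'a. 0)" using hbD(1)[OF hb_0[of 0]] by blast
  from hb_triangle[OF assms(1) _ assms(3) hbD(1)[OF assms(2)] this] assms(2) show ?thesis by simp
qed

lemma hn_diff_le:
  assumes "hb s 1 (\<lambda>x. f x - g x) e" "hb s 1 f A" "hb s 1 g B" shows "\<bar>hn s f - hn s g\<bar> \<le> e"
proof -
  note L = hbD(1)[OF assms(2)] hbD(1)[OF assms(3)]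
  have "hn s f \<le> e + hn s g" by (rule hb_hn(2)[OF hb_add_diff[OF assms(1) hb_hn(1)[OF assms(3)] L(1)]])
  moreover have "hn s g \<le> e + hn s f"
    by (rule hb_hn(2)[OF hb_add_diff[OF hb_uminus_diff[OF assms(1) L] hb_hn(1)[OF assms(2)] L(2)]])
  ultimately show ?thesis by (simp add: abs_le_iff)
qed

text \<open>Continuity with values in the Sobolev space, in sequential form and at the fixed scale
  1, to which the scales 1 + t are equivalent on bounded time intervals. \<open>hcont_iff_Hs\<close>
  identifies it with the continuity required of mild solutions.\<close>

definition hcont :: "real \<Rightarrow> real set \<Rightarrow> (real \<Rightarrow> 'a::euclidean_space \<Rightarrow> real) \<Rightarrow> bool" where
  "hcont s I u \<longleftrightarrow> (\<forall>t\<in>I. \<exists>A. hb s 1 (u t) A) \<and>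
     (\<forall>t\<in>I. \<forall>r. (\<forall>k. r k \<in> I) \<longrightarrow> r \<longlonglongrightarrow> t \<longrightarrow> (\<forall>e>0. \<forall>\<^sub>F k in sequentially. hb s 1 (\<lambda>x. u (r k) x - u t x) e))"

lemma hcontD:
  assumes "hcont s I u"
  shows "t \<in> I \<Longrightarrow> \<exists>A. hb s 1 (u t) A" "t \<in> I \<Longrightarrow> L2 (u t)"
    "t \<in> I \<Longrightarrow> (\<And>k. r k \<in> I) \<Longrightarrow> r \<longlonglongrightarrow> t \<Longrightarrow> 0 < e \<Longrightarrow> \<forall>\<^sub>F k in sequentially. hb s 1 (\<lambda>x. u (r k) x - u t x) e"
  using assms hbD(1) unfolding hcont_def by blast+

lemma hcont_subset: "hcont s I u \<Longrightarrow> J \<subseteq> I \<Longrightarrow> hcont s J u"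
  unfolding hcont_def by blast

lemma hcont_diff_continuous:
  assumes u: "hcont s I u" and v: "hcont s I v"
  shows "continuous_on I (\<lambda>t. hn s (\<lambda>x. u t x - v t x))"
proof (rule continuous_on_sequentiallyI)
  fix r t assume r: "\<forall>n. r n \<in> I" "t \<in> I" "r \<longlonglongrightarrow> t"
  show "(\<lambda>n. hn s (\<lambda>x. u (r n) x - v (r n) x)) \<longlonglongrightarrow> hn s (\<lambda>x. u t x - v t x)"
  proof (rule LIMSEQ_I)
    fix e :: real assume e: "0 < e"
    have "\<forall>\<^sub>F k in sequentially. hb s 1 (\<lambda>x. u (r k) x - u t x) (e/3) \<and> hb s 1 (\<lambda>x. v (r k) x - v t x) (e/3)"
      using r e by (intro eventually_conj hcontD(3)[OF u] hcontD(3)[OF v]) auto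
    then have "\<forall>\<^sub>F k in sequentially. norm (hn s (\<lambda>x. u (r k) x - v (r k) x) - hn s (\<lambda>x. u t x - v t x)) < e"
    proof eventually_elim
      case (elim k)
      obtain A1 A2 A3 A4 where A: "hb s 1 (u (r k)) A1" "hb s 1 (v (r k)) A2" "hb s 1 (u t) A3" "hb s 1 (v t) A4"
        using hcontD(1)[OF u] hcontD(1)[OF v] r by meson
      have "hb s 1 (\<lambda>x. (u (r k) x - u t x) - (v (r k) x - v t x)) (e/3 + e/3)" using elim by (intro hb_diff) auto
      then have "hb s 1 (\<lambda>x. (u (r k) x - v (r k) x) - (u t x - v t x)) (e/3 + e/3)" by (simp add: algebra_simps)
      from hn_diff_le[OF this hb_diff[OF A(1,2)] hb_diff[OF A(3,4)]] show ?case using e by simp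
    qed
    then show "\<exists>no. \<forall>n\<ge>no. norm (hn s (\<lambda>x. u (r n) x - v (r n) x) - hn s (\<lambda>x. u t x - v t x)) < e"
      by (simp add: eventually_sequentially)
  qed
qed

lemma hcont_0: "hcont s I (\<lambda>t x. 0)"
  unfolding hcont_def using hb_0[of 0] by (auto intro!: always_eventually hb_0)

lemma hcont_bounded:
  assumes u: "hcont s {0..T} u" shows "\<exists>M>0. \<forall>t\<in>{0..T}. hb s 1 (u t) M"
proof -
  have "continuous_on {0..T} (\<lambda>t. hn s (u t))" using hcont_diff_continuous[OF u hcont_0] by simp
  then have "bounded ((\<lambda>t. hn s (u t)) ` {0..T})" by (intro compact_imp_bounded compact_continuous_image) auto
  then obtain M where M: "0 < M" "\<And>t. t \<in> {0..T} \<Longrightarrow> \<bar>hn s (u t)\<bar> \<le> M" unfolding bounded_pos by auto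
  have "hb s 1 (u t) M" if t: "t \<in> {0..T}" for t
  proof -
    obtain A where "hb s 1 (u t) A" using hcontD(1)[OF u t] by blast
    from hb_mono[OF hb_hn(1)[OF this]] M(2)[OF t] show ?thesis by simp
  qed
  then show ?thesis using M(1) by blast
qed

text \<open>Names the constants of \<open>nonlinear_estimate\<close> and
  \<open>Duhamel_decay\<close>, so that all that follows is uniform in the data, in \<epsilon> and
  in time.\<close>

locale picard = evolution s p \<nu> \<gamma> dim \<eta> Ck ck
  for s p \<nu> \<gamma> and dim :: "'a::euclidean_space itself" and \<eta> Ck ck +
  fixes CN CD :: real
  assumes CN: "0 < CN" and CD: "0 < CD"
    and nonlin: "\<And>\<Lambda> M D f g. 0 < \<Lambda> \<Longrightarrow> 0 < M \<Longrightarrow> 0 < D \<Longrightarrow> hb s \<Lambda> (f::'a \<Rightarrow> real) (M * \<Lambda> powr - \<nu>) \<Longrightarrow> hb s \<Lambda> g (M * \<Lambda> powr - \<nu>) \<Longrightarrow>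
       hb s \<Lambda> (\<lambda>x. f x - g x) (D * \<Lambda> powr - \<nu>) \<Longrightarrow>
       integrable lborel (\<lambda>x. \<bar>f x\<bar> powr p - \<bar>g x\<bar> powr p) \<and>
       (\<integral>x. \<bar>\<bar>f x\<bar> powr p - \<bar>g x\<bar> powr p\<bar> \<partial>lborel) \<le> CN * D * M powr (p - 1) * \<Lambda> powr - \<gamma> \<and>
       l2b (\<lambda>x. complex_of_real (\<bar>f x\<bar> powr p - \<bar>g x\<bar> powr p)) (CN * D * M powr (p - 1) * \<Lambda> powr (- \<gamma> - \<nu>))"
    and duhamel: "\<And>F S t. 0 \<le> t \<Longrightarrow> 0 \<le> S \<Longrightarrow> continuous_on UNIV (\<lambda>(\<tau>, \<xi>). F \<tau> \<xi>) \<Longrightarrow>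
       (\<And>\<tau> \<xi>. \<tau> \<in> {0..t} \<Longrightarrow> norm (F \<tau> \<xi>) \<le> S * (1 + \<tau>) powr - \<gamma>) \<Longrightarrow>
       (\<And>\<tau>. \<tau> \<in> {0..t} \<Longrightarrow> l2b (F \<tau>) (S * (1 + \<tau>) powr (- \<gamma> - \<nu>))) \<Longrightarrow>
       l2b (\<lambda>\<xi>. complex_of_real (wt s (1 + t) \<xi>) * duh F t \<xi>) (CD * S * (1 + t) powr - \<nu>)"
begin

definition nl :: "('a \<Rightarrow> real) \<Rightarrow> 'a \<Rightarrow> complex" where
  "nl f = ft1 (\<lambda>x. \<bar>f x\<bar> powr p)"

text \<open>One constant for both bounds on the transform: factor 1 from L1 to bounded functions,
  factor \<open>pc\<close> from L2 to L2.\<close>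

definition CM :: real where "CM = CN * (1 + pc TYPE('a))"

lemma CM_pos: "0 < CM"
  using CN pc_pos[where 'a='a] by (simp add: CM_def add_pos_pos)

lemma integrable_power:
  fixes f :: "'a \<Rightarrow> real"
  assumes "0 < \<Lambda>" "hb s \<Lambda> f A"
  shows "integrable lborel (\<lambda>x. complex_of_real (\<bar>f x\<bar> powr p))"
proof -
  \<comment> \<open>\<open>A + 1\<close> in place of \<open>A\<close>, since the estimate asks for a
    positive bound.\<close>
  define M where "M = (A + 1) / \<Lambda> powr - \<nu>"
  have M: "0 < M" "M * \<Lambda> powr - \<nu> = A + 1" using assms(1) hbD(3)[OF assms(2)] by (auto simp: M_def intro!: divide_pos_pos)
  have h: "hb s \<Lambda> f (M * \<Lambda> powr - \<nu>)" unfolding M by (rule hb_mono[OF assms(2)]) simp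
  have "hb s \<Lambda> (\<lambda>x::'a. 0) (M * \<Lambda> powr - \<nu>)" using M hbD(3)[OF assms(2)] by (intro hb_0) auto
  from nonlin[OF assms(1) M(1) M(1) h this] h have "integrable lborel (\<lambda>x. \<bar>f x\<bar> powr p)" using p by simp
  then show ?thesis by (rule integrable_of_real)
qed

lemma nl_estimate:
  assumes "0 < \<Lambda>" "0 < M" "0 < D" "hb s \<Lambda> f (M * \<Lambda> powr - \<nu>)" "hb s \<Lambda> g (M * \<Lambda> powr - \<nu>)" "hb s \<Lambda> (\<lambda>x. f x - g x) (D * \<Lambda> powr - \<nu>)"
  shows "norm (nl f \<xi> - nl g \<xi>) \<le> CM * D * M powr (p - 1) * \<Lambda> powr - \<gamma>"
    and "l2b (\<lambda>\<xi>. nl f \<xi> - nl g \<xi>) (CM * D * M powr (p - 1) * \<Lambda> powr (- \<gamma> - \<nu>))"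
proof -
  let ?d = "\<lambda>x. complex_of_real (\<bar>f x\<bar> powr p - \<bar>g x\<bar> powr p)"
  note N = nonlin[OF assms]
  have i: "integrable lborel ?d" using N by (intro integrable_of_real) auto
  have eq: "nl f \<xi> - nl g \<xi> = ft ?d \<xi>" for \<xi>
    unfolding nl_def ft1_eq_ft using ft_diff[OF integrable_power[OF assms(1,4)] integrable_power[OF assms(1,5)]] by simp
  have le: "CN * y \<le> CM * y" "pc TYPE('a) * (CN * y) \<le> CM * y" if "0 \<le> y" for y
    using that CN pc_pos[where 'a='a] by (auto simp: CM_def algebra_simps)
  have y: "0 \<le> D * M powr (p - 1) * \<Lambda> powr z" for z using assms by simp
  have "norm (nl f \<xi> - nl g \<xi>) \<le> (\<integral>x. norm (?d x) \<partial>lborel)" unfolding eq by (rule norm_ft_le[OF i])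
  also have "\<dots> \<le> CN * (D * M powr (p - 1) * \<Lambda> powr - \<gamma>)" using N by (simp only: norm_of_real mult.assoc)
  also note le(1)[OF y]
  finally show "norm (nl f \<xi> - nl g \<xi>) \<le> CM * D * M powr (p - 1) * \<Lambda> powr - \<gamma>" by (simp add: mult.assoc)
  have "l2b (ft ?d) (pc TYPE('a) * (CN * (D * M powr (p - 1) * \<Lambda> powr (- \<gamma> - \<nu>))))"
    using N by (intro ft_l2b[OF i]) (simp only: mult.assoc)
  from l2b_mono[OF this le(2)[OF y]] show "l2b (\<lambda>\<xi>. nl f \<xi> - nl g \<xi>) (CM * D * M powr (p - 1) * \<Lambda> powr (- \<gamma> - \<nu>))"
    unfolding eq by (simp add: mult.assoc)
qed

lemma nl_0: "nl (\<lambda>x. 0) \<xi> = 0"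
  using p by (simp add: nl_def ft1_def)

text \<open>As time varies, the transforms of |u|^p converge uniformly in \<xi> by the L1 estimate,
  and each of them is continuous in \<xi>. Joint continuity provides the joint measurability that
  the Duhamel estimates require.\<close>

lemma nl_continuous:
  assumes u: "hcont s {0..T} u"
  shows "continuous_on ({0..T} \<times> UNIV) (\<lambda>(\<tau>, \<xi>). nl (u \<tau>) \<xi>)"
proof (rule continuous_on_sequentiallyI)
  fix z :: "nat \<Rightarrow> real \<times> 'a" and a assume z: "\<forall>n. z n \<in> {0..T} \<times> UNIV" and a: "a \<in> {0..T} \<times> UNIV" and lim: "z \<longlonglongrightarrow> a"
  obtain \<tau> \<xi> where [simp]: "a = (\<tau>, \<xi>)" by force
  obtain M where M: "0 < M" "\<And>t. t \<in> {0..T} \<Longrightarrow> hb s 1 (u t) M" using hcont_bounded[OF u] by blast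
  have l1: "(\<lambda>n. fst (z n)) \<longlonglongrightarrow> \<tau>" "(\<lambda>n. snd (z n)) \<longlonglongrightarrow> \<xi>" using tendsto_fst[OF lim] tendsto_snd[OF lim] by auto
  have t: "\<tau> \<in> {0..T}" "\<And>n. fst (z n) \<in> {0..T}" using a z by (auto simp: mem_Times_iff)
  have c: "continuous_on UNIV (nl (u \<tau>))"
    unfolding nl_def ft1_eq_ft by (intro continuous_ft integrable_power[OF zero_less_one M(2)[OF t(1)]])
  have l2: "(\<lambda>n. nl (u \<tau>) (snd (z n))) \<longlonglongrightarrow> nl (u \<tau>) \<xi>" using c l1(2) by (auto simp: continuous_on_sequentially comp_def)
  have "(\<lambda>n. nl (u (fst (z n))) (snd (z n))) \<longlonglongrightarrow> nl (u \<tau>) \<xi>"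
  proof (rule LIMSEQ_I)
    fix e :: real assume e: "0 < e"
    define C where "C = CM * M powr (p - 1)"
    have C: "0 < C" using CM_pos M by (simp add: C_def)
    have "\<forall>\<^sub>F n in sequentially. hb s 1 (\<lambda>x. u (fst (z n)) x - u \<tau> x) (e / (2 * C))"
      by (rule hcontD(3)[OF u t l1(1)]) (use e C in simp)
    moreover have "\<forall>\<^sub>F n in sequentially. norm (nl (u \<tau>) (snd (z n)) - nl (u \<tau>) \<xi>) < e / 2"
      using tendstoD[OF l2, of "e/2"] e by (simp add: dist_norm)
    ultimately have "\<forall>\<^sub>F n in sequentially. norm (nl (u (fst (z n))) (snd (z n)) - nl (u \<tau>) \<xi>) < e"
    proof eventually_elim
      case (elim n)
      have "norm (nl (u (fst (z n))) (snd (z n)) - nl (u \<tau>) (snd (z n))) \<le> CM * (e / (2 * C)) * M powr (p - 1) * 1 powr - \<gamma>"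
        using elim(1) M t e C by (intro nl_estimate) auto
      also have "\<dots> = e / 2" using C M CM_pos by (simp add: C_def field_simps)
      finally show ?case using elim(2) norm_triangle_lt[of "nl (u (fst (z n))) (snd (z n)) - nl (u \<tau>) (snd (z n))" "nl (u \<tau>) (snd (z n)) - nl (u \<tau>) \<xi>" e] by simp
    qed
    then show "\<exists>no. \<forall>n\<ge>no. norm (nl (u (fst (z n))) (snd (z n)) - nl (u \<tau>) \<xi>) < e" by (simp add: eventually_sequentially)
  qed
  then show "(\<lambda>n. (\<lambda>(\<tau>, \<xi>). nl (u \<tau>) \<xi>) (z n)) \<longlonglongrightarrow> (\<lambda>(\<tau>, \<xi>). nl (u \<tau>) \<xi>) a" by (simp add: case_prod_beta)
qed

definition clamp0 :: "real \<Rightarrow> real \<Rightarrow> real" where "clamp0 T \<tau> = max 0 (min T \<tau>)"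

lemma nl_clamp_continuous:
  assumes "hcont s {0..T} u" "0 \<le> T"
  shows "continuous_on UNIV (\<lambda>(\<tau>, \<xi>). nl (u (clamp0 T \<tau>)) \<xi>)"
  unfolding clamp0_def using continuous_clamp[OF nl_continuous[OF assms(1)] assms(2)] by simp

lemma clamp0: "\<tau> \<in> {0..T} \<Longrightarrow> clamp0 T \<tau> = \<tau>" "0 \<le> T \<Longrightarrow> clamp0 T \<tau> \<in> {0..T}"
  by (auto simp: clamp0_def)

abbreviation duhn :: "(real \<Rightarrow> 'a \<Rightarrow> real) \<Rightarrow> real \<Rightarrow> 'a \<Rightarrow> complex" where
  "duhn u \<equiv> duh (\<lambda>\<tau>. nl (u \<tau>))"

lemma duhn_clamp:
  "t \<le> T \<Longrightarrow> duhn u t \<xi> = duh (\<lambda>\<tau>. nl (u (clamp0 T \<tau>))) t \<xi>"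
  by (rule duh_cong) (simp add: clamp0)

lemma duhn_diff:
  assumes "hcont s {0..T} u" "hcont s {0..T} v" "0 \<le> t" "t \<le> T"
  shows "duhn u t \<xi> - duhn v t \<xi> = duh (\<lambda>\<tau> \<xi>. nl (u (clamp0 T \<tau>)) \<xi> - nl (v (clamp0 T \<tau>)) \<xi>) t \<xi>"
proof -
  have T: "0 \<le> T" using assms by simp
  show ?thesis unfolding duhn_clamp[OF assms(4), of u] duhn_clamp[OF assms(4), of v]
    by (rule duh_diff[symmetric, OF nl_clamp_continuous[OF assms(1) T] nl_clamp_continuous[OF assms(2) T]])
qed

lemma continuous_diff_pair:
  fixes F G :: "real \<Rightarrow> 'a \<Rightarrow> complex"
  assumes "continuous_on UNIV (\<lambda>(\<tau>, \<xi>). F \<tau> \<xi>)" "continuous_on UNIV (\<lambda>(\<tau>, \<xi>). G \<tau> \<xi>)"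
  shows "continuous_on UNIV (\<lambda>(\<tau>, \<xi>). F \<tau> \<xi> - G \<tau> \<xi>)"
  using continuous_on_diff[OF assms] by (simp add: case_prod_beta)

text \<open>The ball of radius \<open>M\<close> in a solution space whose norm has the linear decay
  rate built in; the iteration leaves it invariant.\<close>

definition inv :: "real \<Rightarrow> (real \<Rightarrow> 'a \<Rightarrow> real) \<Rightarrow> bool" where
  "inv M u \<longleftrightarrow> hcont s {0..} u \<and> (\<forall>t\<ge>0. hb s (1 + t) (u t) (M * (1 + t) powr - \<nu>))"

lemma duhn_diff_decay:
  assumes u: "inv M u" and v: "inv M v" and M: "0 < M" and D: "0 < D"
    and d: "\<And>t. 0 \<le> t \<Longrightarrow> hb s (1 + t) (\<lambda>x. u t x - v t x) (D * (1 + t) powr - \<nu>)" and t: "0 \<le> t"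
  shows "l2b (\<lambda>\<xi>. complex_of_real (wt s (1 + t) \<xi>) * (duhn u t \<xi> - duhn v t \<xi>)) (CD * (CM * D * M powr (p - 1)) * (1 + t) powr - \<nu>)"
proof -
  have h: "hcont s {0..t} u" "hcont s {0..t} v" using u v hcont_subset[of s "{0..}" _ "{0..t}"] by (auto simp: inv_def)
  show ?thesis
    unfolding duhn_diff[OF h t order_refl]
  proof (rule duhamel[OF t])
    show "continuous_on UNIV (\<lambda>(\<tau>, \<xi>). nl (u (clamp0 t \<tau>)) \<xi> - nl (v (clamp0 t \<tau>)) \<xi>)"
      by (intro continuous_diff_pair nl_clamp_continuous h t)
    fix \<tau> assume \<tau>: "\<tau> \<in> {0..t}"
    have b: "0 < 1 + \<tau>" "hb s (1 + \<tau>) (u \<tau>) (M * (1 + \<tau>) powr - \<nu>)" "hb s (1 + \<tau>) (v \<tau>) (M * (1 + \<tau>) powr - \<nu>)"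
      using u v \<tau> by (auto simp: inv_def)
    note e = nl_estimate[OF b(1) M D b(2,3) d]
    show "norm (nl (u (clamp0 t \<tau>)) \<xi> - nl (v (clamp0 t \<tau>)) \<xi>) \<le> CM * D * M powr (p - 1) * (1 + \<tau>) powr - \<gamma>" for \<xi>
      using e(1) \<tau> by (simp add: clamp0)
    show "l2b (\<lambda>\<xi>. nl (u (clamp0 t \<tau>)) \<xi> - nl (v (clamp0 t \<tau>)) \<xi>) (CM * D * M powr (p - 1) * (1 + \<tau>) powr (- \<gamma> - \<nu>))"
      using e(2) \<tau> by (simp add: clamp0)
  qed (use CM_pos D in simp)
qed

lemma nl_l2b_local:
  assumes "0 < M" "hb s 1 f M"
  shows "l2b (nl f) (CM * M powr p)"
proof -
  have "l2b (\<lambda>\<xi>. nl f \<xi> - nl (\<lambda>x. 0) \<xi>) (CM * M * M powr (p - 1) * 1 powr (- \<gamma> - \<nu>))"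
    using assms by (intro nl_estimate(2)) (auto intro: hb_0)
  moreover have "M * M powr (p - 1) = M powr p"
  proof -
    have "M powr 1 * M powr (p - 1) = M powr p" unfolding powr_add[symmetric] by simp
    then show ?thesis using assms(1) by simp
  qed
  ultimately show ?thesis by (simp add: nl_0 mult.assoc)
qed

lemma duhn_continuous_in_time:
  assumes u: "hcont s {0..T} u" and r: "r \<longlonglongrightarrow> t" "\<And>k. 0 \<le> r k" "\<And>k. r k \<le> T" and e: "0 < e"
  shows "\<forall>\<^sub>F k in sequentially. l2b (\<lambda>\<xi>. complex_of_real (wt s 1 \<xi>) * duhn u (r k) \<xi> - complex_of_real (wt s 1 \<xi>) * duhn u t \<xi>) e"
proof -
  have T: "0 \<le> T" "t \<le> T" using order_trans[OF r(2)[of 0] r(3)[of 0]] LIMSEQ_le_const2[OF r(1), of T] r(3) by auto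
  obtain M where M: "0 < M" "\<And>t. t \<in> {0..T} \<Longrightarrow> hb s 1 (u t) M" using hcont_bounded[OF u] by blast
  show ?thesis
    unfolding duhn_clamp[OF r(3), of u] duhn_clamp[OF T(2), of u]
    by (rule duh_continuous_in_time[OF nl_clamp_continuous[OF u T(1)] r _ e, of "CM * M powr p"])
       (use M T in \<open>auto intro!: nl_l2b_local simp: clamp0\<close>)
qed

lemma nl_uminus: "nl f (- \<xi>) = cnj (nl f \<xi>)"
proof -
  have "ft (\<lambda>x. cnj (complex_of_real (\<bar>f x\<bar> powr p))) (- \<xi>) = cnj (ft (\<lambda>x. complex_of_real (\<bar>f x\<bar> powr p)) (- (- \<xi>)))"
    by (rule ft_cnj)
  then show ?thesis by (simp only: nl_def ft1_eq_ft complex_cnj_complex_of_real minus_minus)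
qed

lemma duhn_uminus: "duhn u t (- \<xi>) = cnj (duhn u t \<xi>)"
proof -
  have "duhn u t (- \<xi>) = (\<integral>\<tau>. cnj (indicator {0..t} \<tau> *\<^sub>R (complex_of_real (K 2 (t - \<tau>) \<xi>) * nl (u \<tau>) \<xi>)) \<partial>lborel)"
    unfolding duh_def set_lebesgue_integral_def
    by (rule Bochner_Integration.integral_cong) (simp_all add: nl_uminus K_even)
  also have "\<dots> = cnj (duhn u t \<xi>)"
    unfolding duh_def set_lebesgue_integral_def by (rule Bochner_Integration.integral_cnj)
  finally show ?thesis .
qed

end

section \<open>The fixed-point argument\<close>

lemma hb_limit: "(\<And>e. 0 < e \<Longrightarrow> hb s \<Lambda> f (A + e)) \<Longrightarrow> 0 \<le> A \<Longrightarrow> hb s \<Lambda> f A"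
  unfolding hb_def using l2b_limit zero_less_one by blast

lemma hb_limit_le:
  assumes "\<And>e. 0 < e \<Longrightarrow> \<exists>B\<le>A + e. hb s \<Lambda> f B" "0 \<le> A" shows "hb s \<Lambda> f A"
  by (rule hb_limit[OF _ assms(2)]) (use assms(1) hb_mono in blast)

lemma half_power_small:
  fixes e :: real assumes "0 < e" "0 < c" shows "\<exists>k. c * (1/2) ^ k < e"
  using real_arch_pow_inv[of "e / c" "1/2"] assms by (auto simp: field_simps)

lemma nn_integral_exp_le:
  fixes L t :: real
  assumes "0 < L" "0 \<le> t"
  shows "(\<integral>\<^sup>+\<tau>\<in>{0..t}. ennreal (exp (2 * L * \<tau>)) \<partial>lborel) \<le> ennreal (exp (2 * L * t) / (2 * L))"
proof -
  have "(\<integral>\<^sup>+\<tau>. ennreal (exp (2 * L * \<tau>)) * indicator {0..t} \<tau> \<partial>lborel) = ennreal (exp (2 * L * t) / (2 * L) - exp (2 * L * 0) / (2 * L))"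
    by (rule nn_integral_FTC_Icc) (use assms in \<open>auto intro!: derivative_eq_intros\<close>)
  also have "\<dots> \<le> ennreal (exp (2 * L * t) / (2 * L))" using assms by (intro ennreal_leI) simp
  finally show ?thesis .
qed

text \<open>The linear evolution enters the fixed-point argument only through its decay, its
  continuity in time and its Hermitian symmetry; \<open>m\<close> is its size.\<close>

locale mild_problem = picard s p \<nu> \<gamma> dim \<eta> Ck ck CN CD
  for s p \<nu> \<gamma> and dim :: "'a::euclidean_space itself" and \<eta> Ck ck CN CD +
  fixes L :: "real \<Rightarrow> 'a \<Rightarrow> complex" and m :: real
  assumes m: "0 \<le> m"
    and L_decay: "\<And>t. 0 \<le> t \<Longrightarrow> l2b (\<lambda>\<xi>. complex_of_real (wt s (1 + t) \<xi>) * L t \<xi>) (m * (1 + t) powr - \<nu>)"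
    and L_cont: "\<And>r t T e. r \<longlonglongrightarrow> t \<Longrightarrow> (\<And>k. 0 \<le> r k) \<Longrightarrow> (\<And>k. r k \<le> T) \<Longrightarrow> 0 < e \<Longrightarrow>
      \<forall>\<^sub>F k in sequentially. l2b (\<lambda>\<xi>. complex_of_real (wt s 1 \<xi>) * L (r k) \<xi> - complex_of_real (wt s 1 \<xi>) * L t \<xi>) e"
    and L_uminus: "\<And>t \<xi>. L t (- \<xi>) = cnj (L t \<xi>)"
begin

definition rhs :: "(real \<Rightarrow> 'a \<Rightarrow> real) \<Rightarrow> real \<Rightarrow> 'a \<Rightarrow> complex" where
  "rhs u t \<xi> = L t \<xi> + duhn u t \<xi>"

text \<open>On invariant balls of admissible radius \<open>frel_surj_real\<close> provides a real
  function with this transform, unique almost everywhere, so the choice does not matter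
  there.\<close>

definition \<Phi> :: "(real \<Rightarrow> 'a \<Rightarrow> real) \<Rightarrow> real \<Rightarrow> 'a \<Rightarrow> real" where
  "\<Phi> u t = (SOME f. frel (\<lambda>x. complex_of_real (f x)) (rhs u t))"

text \<open>The linear part takes at most half of the radius. The last condition makes the Duhamel
  term a contraction with factor 1/2, which also keeps it within the other half.\<close>

definition small :: "real \<Rightarrow> bool" where
  "small M \<longleftrightarrow> 0 < M \<and> 2 * m \<le> M \<and> CD * CM * M powr (p - 1) \<le> 1 / 2"

lemma contraction_factor:
  assumes "small M" "0 \<le> D" shows "CD * (CM * D * M powr (p - 1)) * y powr - \<nu> \<le> D / 2 * y powr - \<nu>"
proof (rule mult_right_mono)
  have "D * (CD * CM * M powr (p - 1)) \<le> D * (1 / 2)" using assms by (intro mult_left_mono) (auto simp: small_def)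
  then show "CD * (CM * D * M powr (p - 1)) \<le> D / 2" by (simp add: ac_simps)
qed simp

lemma inv_0: "0 < M \<Longrightarrow> inv M (\<lambda>t x. 0)"
  by (auto simp: inv_def hcont_0 intro: hb_0)

lemma duhn_0: "duhn (\<lambda>t x. 0) t \<xi> = 0"
  by (simp add: duh_def nl_0 set_lebesgue_integral_def)

text \<open>The Duhamel term is bounded by the difference estimate against the zero function, with
  \<open>D = M\<close>.\<close>

lemma rhs_decay:
  assumes u: "inv M u" and M: "small M" and t: "0 \<le> t"
  shows "l2b (\<lambda>\<xi>. complex_of_real (wt s (1 + t) \<xi>) * rhs u t \<xi>) (M * (1 + t) powr - \<nu>)"
proof -
  have M0: "0 < M" using M by (simp add: small_def)
  have d: "hb s (1 + t) (\<lambda>x. u t x - 0) (M * (1 + t) powr - \<nu>)" if "0 \<le> t" for t using u that by (simp add: inv_def)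
  from l2b_mono[OF duhn_diff_decay[OF u inv_0[OF M0] M0 M0 d t] contraction_factor[OF M less_imp_le[OF M0]]]
  have "l2b (\<lambda>\<xi>. complex_of_real (wt s (1 + t) \<xi>) * duhn u t \<xi>) (M / 2 * (1 + t) powr - \<nu>)" by (simp add: duhn_0)
  from l2b_add[OF L_decay[OF t] this]
  have "l2b (\<lambda>\<xi>. complex_of_real (wt s (1 + t) \<xi>) * rhs u t \<xi>) (m * (1 + t) powr - \<nu> + M / 2 * (1 + t) powr - \<nu>)"
    by (simp add: rhs_def distrib_left)
  then show ?thesis
  proof (rule l2b_mono)
    have "(m + M / 2) * (1 + t) powr - \<nu> \<le> M * (1 + t) powr - \<nu>" using M by (intro mult_right_mono) (auto simp: small_def)
    then show "m * (1 + t) powr - \<nu> + M / 2 * (1 + t) powr - \<nu> \<le> M * (1 + t) powr - \<nu>" by (simp add: distrib_right)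
  qed
qed

lemma \<Phi>_frel:
  assumes "inv M u" "small M" "0 \<le> t" shows "frel (\<lambda>x. complex_of_real (\<Phi> u t x)) (rhs u t)"
proof -
  have "l2 (rhs u t)" by (rule l2b_imp_l2[OF l2b_div_wt[OF rhs_decay[OF assms]]]) (use assms(3) in simp)
  moreover have "AE \<xi> in lborel. rhs u t (- \<xi>) = cnj (rhs u t \<xi>)" by (simp add: rhs_def L_uminus duhn_uminus)
  ultimately have "\<exists>f. frel (\<lambda>x. complex_of_real (f x)) (rhs u t)" by (rule frel_surj_real)
  then show ?thesis unfolding \<Phi>_def by (rule someI_ex)
qed

lemma \<Phi>_inv:
  assumes u: "inv M u" and M: "small M" shows "inv M (\<Phi> u)"
proof -
  have b: "hb s (1 + t) (\<Phi> u t) (M * (1 + t) powr - \<nu>)" if "0 \<le> t" for t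
    by (rule hbI[OF \<Phi>_frel[OF u M that] rhs_decay[OF u M that]])
  have "hcont s {0..} (\<Phi> u)"
    unfolding hcont_def
  proof (intro conjI ballI allI impI)
    fix t :: real assume t: "t \<in> {0..}"
    then show "\<exists>A. hb s 1 (\<Phi> u t) A" using hb_scale_down[OF b[of t]] by auto
    fix r e assume r: "\<forall>k. r k \<in> {0..}" "r \<longlonglongrightarrow> t" and e: "0 < (e::real)"
    obtain T where "\<And>k. norm (r k) \<le> T" using convergent_imp_Bseq[of r] r(2) by (auto simp: convergent_def Bseq_def)
    then have T: "\<And>k. r k \<le> T" by (simp add: abs_le_iff)
    have r0: "\<And>k. 0 \<le> r k" using r by simp
    have hu: "hcont s {0..T} u" using u hcont_subset[of s "{0..}" u "{0..T}"] by (auto simp: inv_def)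
    have e2: "0 < e / 2" using e by simp
    from eventually_conj[OF L_cont[OF r(2) r0 T e2] duhn_continuous_in_time[OF hu r(2) r0 T e2]]
    show "\<forall>\<^sub>F k in sequentially. hb s 1 (\<lambda>x. \<Phi> u (r k) x - \<Phi> u t x) e"
    proof eventually_elim
      case (elim k)
      from l2b_add[OF conjunct1[OF elim] conjunct2[OF elim]]
      have "l2b (\<lambda>\<xi>. complex_of_real (wt s 1 \<xi>) * (rhs u (r k) \<xi> - rhs u t \<xi>)) e"
        by (simp add: rhs_def algebra_simps)
      then show ?case
        using t r0 by (intro hbI[OF frel_diff_real[OF \<Phi>_frel[OF u M] \<Phi>_frel[OF u M]]]) auto
    qed
  qed
  then show ?thesis using b by (simp add: inv_def)
qed

lemma \<Phi>_contraction:
  assumes u: "inv M u" and v: "inv M v" and M: "small M" and D: "0 < D"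
    and d: "\<And>t. 0 \<le> t \<Longrightarrow> hb s (1 + t) (\<lambda>x. u t x - v t x) (D * (1 + t) powr - \<nu>)" and t: "0 \<le> t"
  shows "l2b (\<lambda>\<xi>. complex_of_real (wt s (1 + t) \<xi>) * (rhs u t \<xi> - rhs v t \<xi>)) (D / 2 * (1 + t) powr - \<nu>)"
proof -
  have "0 < M" using M by (simp add: small_def)
  from l2b_mono[OF duhn_diff_decay[OF u v this D d t] contraction_factor[OF M less_imp_le[OF D]]]
  show ?thesis by (simp add: rhs_def)
qed

primrec iter :: "nat \<Rightarrow> real \<Rightarrow> 'a \<Rightarrow> real" where
  "iter 0 = (\<lambda>t x. 0)"
| "iter (Suc k) = \<Phi> (iter k)"

lemma iter_inv: "small M \<Longrightarrow> inv M (iter k)"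
  by (induction k) (auto intro: \<Phi>_inv inv_0 simp: small_def)

lemma inv_L2: "inv M u \<Longrightarrow> 0 \<le> t \<Longrightarrow> L2 (u t)"
  by (auto simp: inv_def dest: hcontD(2))

lemma iter_step:
  assumes M: "small M" and t: "0 \<le> t"
  shows "hb s (1 + t) (\<lambda>x. iter (Suc k) t x - iter k t x) (((1/2) ^ k * M) * (1 + t) powr - \<nu>)"
  using t
proof (induction k arbitrary: t)
  case 0
  then show ?case using iter_inv[OF M, of 1] by (simp add: inv_def)
next
  case (Suc k)
  have D: "0 < (1/2) ^ k * M" using M by (simp add: small_def)
  note i = iter_inv[OF M]
  show ?case
    using \<Phi>_contraction[OF i i M D Suc.IH Suc.prems] unfolding iter.simps(2)[of "Suc k"] iter.simps(2)[of k]
    by (intro hbI[OF frel_diff_real[OF \<Phi>_frel[OF i[of "Suc k", unfolded iter.simps] M Suc.prems] \<Phi>_frel[OF i M Suc.prems]]]) simp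
qed

text \<open>The factor 2 - 2 (1/2)^n is the partial sum of the geometric series of steps; in this
  closed form the induction goes through.\<close>

lemma iter_Cauchy:
  assumes M: "small M" and t: "0 \<le> t"
  shows "hb s (1 + t) (\<lambda>x. iter (k + n) t x - iter k t x) (((2 - 2 * (1/2) ^ n) * (1/2) ^ k * M) * (1 + t) powr - \<nu>)"
proof (induction n)
  case 0
  then show ?case by (simp add: hb_0)
next
  case (Suc n)
  have LL: "L2 (iter j t)" for j by (rule inv_L2[OF iter_inv[OF M] t])
  from hb_triangle[OF iter_step[OF M t, of "k + n"] Suc LL LL LL]
  show ?case by (simp add: algebra_simps power_add)
qed

text \<open>The iterates start at 0 and do not depend on the radius, so a single limit lies in every
  admissible ball. This later yields a bound proportional to the data, although convergence is shown
  with one fixed radius.\<close>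

theorem Picard_limit:
  assumes M0: "small M0"
  shows "\<exists>u. (\<forall>M. small M \<longrightarrow> inv M u) \<and> (\<forall>t\<ge>0. AE \<xi> in lborel. FT (u t) \<xi> = rhs u t \<xi>)"
proof -
  have M0': "0 < M0" using M0 by (simp add: small_def)
  let ?a = "\<lambda>t::real. (1 + t) powr - \<nu>"
  have a: "0 < ?a t" "?a t \<le> 1" if "0 \<le> t" for t
  proof -
    have "0 \<le> \<nu>" using s by (simp add: \<nu>)
    then show "0 < ?a t" "?a t \<le> 1" using that powr_mono2'[of "- \<nu>" 1 "1 + t"] by auto
  qed
  have LL: "L2 (iter j t)" if "0 \<le> t" for j t by (rule inv_L2[OF iter_inv[OF M0] that])
  have C: "hb s (1 + t) (\<lambda>x. iter j t x - iter k t x) ((2 * M0 * (1/2) ^ k) * ?a t)" if t: "0 \<le> t" and "k \<le> j" for t j k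
  proof -
    obtain n where j: "j = k + n" using \<open>k \<le> j\<close> by (auto simp: le_iff_add)
    show ?thesis
      unfolding j using iter_Cauchy[OF M0 t, of k n]
      by (rule hb_mono) (use a[OF t] M0' in \<open>auto intro!: mult_right_mono simp: algebra_simps\<close>)
  qed
  have "\<exists>F. L2 F \<and> (\<forall>e>0. \<exists>N. \<forall>n\<ge>N. hb s (1 + t) (\<lambda>x. iter n t x - F x) e)" if t: "0 \<le> t" for t
  proof (rule hb_complete)
    fix e :: real assume e: "0 < e"
    obtain N where N: "4 * M0 * (1/2) ^ N < e" using half_power_small[OF e, of "4 * M0"] M0' by auto
    have "hb s (1 + t) (\<lambda>x. iter i t x - iter j t x) e" if "N \<le> i" "N \<le> j" for i j
    proof -
      from hb_triangle[OF C[OF t that(1)] hb_uminus_diff[OF C[OF t that(2)] LL[OF t] LL[OF t]] LL[OF t] LL[OF t] LL[OF t]]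
      show ?thesis
      proof (rule hb_mono)
        have "(4 * M0 * (1/2) ^ N) * ?a t \<le> (4 * M0 * (1/2) ^ N) * 1" using a[OF t] M0' by (intro mult_left_mono) auto
        moreover have "2 * M0 * (1/2) ^ N * ?a t + 2 * M0 * (1/2) ^ N * ?a t = (4 * M0 * (1/2) ^ N) * ?a t" by (simp add: distrib_right[symmetric])
        ultimately show "2 * M0 * (1/2) ^ N * ?a t + 2 * M0 * (1/2) ^ N * ?a t \<le> e" using N by linarith
      qed
    qed
    then show "\<exists>N. \<forall>m\<ge>N. \<forall>n\<ge>N. hb s (1 + t) (\<lambda>x. iter m t x - iter n t x) e" by blast
  qed (use LL t in auto)
  then have "\<forall>t. \<exists>F. 0 \<le> t \<longrightarrow> L2 F \<and> (\<forall>e>0. \<exists>N. \<forall>n\<ge>N. hb s (1 + t) (\<lambda>x. iter n t x - F x) e)" by blast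
  then obtain u where "\<forall>t. 0 \<le> t \<longrightarrow> L2 (u t) \<and> (\<forall>e>0. \<exists>N. \<forall>n\<ge>N. hb s (1 + t) (\<lambda>x. iter n t x - u t x) e)"
    by (rule choice[THEN exE]) blast
  then have uL: "\<And>t. 0 \<le> t \<Longrightarrow> L2 (u t)" and ul: "\<And>t e. 0 \<le> t \<Longrightarrow> 0 < e \<Longrightarrow> \<exists>N. \<forall>n\<ge>N. hb s (1 + t) (\<lambda>x. iter n t x - u t x) e"
    by blast+
  have lim: "hb s (1 + t) (\<lambda>x. u t x - iter k t x) ((2 * M0 * (1/2) ^ k) * ?a t)" if t: "0 \<le> t" for k t
  proof (rule hb_limit_le)
    fix e :: real assume "0 < e"
    then obtain N where N: "\<forall>n\<ge>N. hb s (1 + t) (\<lambda>x. iter n t x - u t x) e" using ul[OF t] by blast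
    then have "hb s (1 + t) (\<lambda>x. iter (N + k) t x - u t x) e" by simp
    from hb_triangle[OF hb_uminus_diff[OF this LL[OF t] uL[OF t]] C[OF t, of k "N + k"] uL[OF t] LL[OF t] LL[OF t]]
    show "\<exists>B\<le>(2 * M0 * (1/2) ^ k) * ?a t + e. hb s (1 + t) (\<lambda>x. u t x - iter k t x) B"
      by (intro exI[of _ "e + (2 * M0 * (1/2) ^ k) * ?a t"]) simp
  qed (use M0' in simp)
  have small_lim: "\<exists>k. (2 * M0 * (1/2) ^ k) * c < e" if "0 < e" "0 < c" for c e :: real
    using half_power_small[OF that(1), of "2 * M0 * c"] M0' that(2) by (auto simp: ac_simps)
  have bd: "hb s (1 + t) (u t) (M * ?a t)" if M: "small M" and t: "0 \<le> t" for M t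
  proof (rule hb_limit_le)
    fix e :: real assume "0 < e"
    then obtain k where k: "(2 * M0 * (1/2) ^ k) * ?a t < e" using small_lim a[OF t] by blast
    have "hb s (1 + t) (iter k t) (M * ?a t)" using iter_inv[OF M, of k] t by (simp add: inv_def)
    from hb_add_diff[OF lim[OF t] this uL[OF t]] k
    show "\<exists>B\<le>M * ?a t + e. hb s (1 + t) (u t) B" by (intro exI[of _ "(2 * M0 * (1/2) ^ k) * ?a t + M * ?a t"]) simp
  qed (use M in \<open>simp add: small_def\<close>)
  have hc: "hcont s {0..} u"
    unfolding hcont_def
  proof (intro conjI ballI allI impI)
    fix t :: real assume t: "t \<in> {0..}"
    then show "\<exists>A. hb s 1 (u t) A" using hb_scale_down[OF bd[OF M0, of t]] by auto
    fix r e assume r: "\<forall>k. r k \<in> {0..}" "r \<longlonglongrightarrow> t" and e: "0 < (e::real)"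
    obtain T where "\<And>k. norm (r k) \<le> T" using convergent_imp_Bseq[of r] r(2) by (auto simp: convergent_def Bseq_def)
    then have T: "\<And>k. r k \<le> T" by (simp add: abs_le_iff)
    have r0: "\<And>k. 0 \<le> r k" using r by simp
    have tT: "0 \<le> t" "t \<le> T" using t LIMSEQ_le_const2[OF r(2), of T] T by auto
    have e3: "0 < e / 3" using e by simp
    \<comment> \<open>One index serves all times in [0, T], because passing from scale 1 + \<tau> to
      scale 1 costs at most (1 + T)^2.\<close>
    obtain K where K: "(2 * M0 * (1/2) ^ K) * (1 + T)\<^sup>2 < e / 3" using small_lim[OF e3, of "(1 + T)\<^sup>2"] tT by auto
    have ap: "hb s 1 (\<lambda>x. u \<tau> x - iter K \<tau> x) (e / 3)" if \<tau>: "0 \<le> \<tau>" "\<tau> \<le> T" for \<tau>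
    proof (rule hb_mono[OF hb_scale_down[OF lim[OF \<tau>(1)]]])
      have "(1 + \<tau>)\<^sup>2 * (2 * M0 * (1/2) ^ K * ?a \<tau>) \<le> (1 + T)\<^sup>2 * (2 * M0 * (1/2) ^ K * 1)"
        using \<tau> a[OF \<tau>(1)] M0' by (intro mult_mono mult_left_mono power_mono) auto
      moreover have "(1 + T)\<^sup>2 * (2 * M0 * (1/2) ^ K * 1) = (2 * M0 * (1/2) ^ K) * (1 + T)\<^sup>2" by (simp only: ac_simps mult_1_right)
      ultimately show "(1 + \<tau>)\<^sup>2 * (2 * M0 * (1/2) ^ K * ?a \<tau>) \<le> e / 3" using K by linarith
    qed (use \<tau> in simp)
    have "hcont s {0..} (iter K)" using iter_inv[OF M0] by (simp add: inv_def)
    from hcontD(3)[OF this t _ r(2) e3] r(1)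
    have "\<forall>\<^sub>F k in sequentially. hb s 1 (\<lambda>x. iter K (r k) x - iter K t x) (e / 3)" by blast
    then show "\<forall>\<^sub>F k in sequentially. hb s 1 (\<lambda>x. u (r k) x - u t x) e"
    proof eventually_elim
      case (elim k)
      note l = uL[OF r0[of k]] LL[OF r0[of k], of K] LL[OF tT(1), of K] uL[OF tT(1)]
      from hb_triangle[OF hb_triangle[OF ap[OF r0 T] elim l(1-3)] hb_uminus_diff[OF ap[OF tT] l(4,3)] l(1,3,4)]
      show ?case by simp
    qed
  qed
  have inv: "inv M u" if "small M" for M using hc bd[OF that] by (simp add: inv_def)
  have "AE \<xi> in lborel. FT (u t) \<xi> = rhs u t \<xi>" if t: "0 \<le> t" for t
  proof -
    have w: "wt s (1 + t) \<xi> \<noteq> 0" for \<xi> :: 'a using t by (simp add: wt_def add_pos_nonneg less_imp_neq[symmetric])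
    have "AE \<xi> in lborel. complex_of_real (wt s (1 + t) \<xi>) * (FT (u t) \<xi> - rhs u t \<xi>) = 0"
    proof (rule l2b_0_AE)
      fix e :: real assume e: "0 < e"
      obtain k where k: "(2 * M0 * (1/2) ^ k) * (2 * ?a t) < e" using small_lim[OF e, of "2 * ?a t"] a[OF t] by auto
      have D: "0 < 2 * M0 * (1/2) ^ k" using M0' by simp
      note i = iter_inv[OF M0]
      have d: "hb s (1 + t) (\<lambda>x. iter k t x - u t x) ((2 * M0 * (1/2) ^ k) * ?a t)" if "0 \<le> t" for t
        by (rule hb_uminus_diff[OF lim[OF that] uL[OF that] LL[OF that]])
      \<comment> \<open>Both the transform of the limit and \<open>rhs u t\<close> are close to
        \<open>rhs\<close> of the k-th iterate: the first since this is the transform of the next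
        iterate, the second by contraction.\<close>
      note c1 = \<Phi>_contraction[OF i inv[OF M0] M0 D d t]
      have c2: "l2b (\<lambda>\<xi>. complex_of_real (wt s (1 + t) \<xi>) * (FT (u t) \<xi> - rhs (iter k) t \<xi>)) ((2 * M0 * (1/2) ^ Suc k) * ?a t)"
        by (rule hbD2[OF lim[OF t, of "Suc k"] frel_diff_real[OF FT_frel[OF uL[OF t]]]]) (use \<Phi>_frel[OF i M0 t] in simp)
      from l2b_add[OF c2 c1]
      have "l2b (\<lambda>\<xi>. complex_of_real (wt s (1 + t) \<xi>) * (FT (u t) \<xi> - rhs u t \<xi>)) ((2 * M0 * (1/2) ^ Suc k) * ?a t + 2 * M0 * (1/2) ^ k / 2 * ?a t)"
        by (simp add: algebra_simps)
      then show "l2b (\<lambda>\<xi>. complex_of_real (wt s (1 + t) \<xi>) * (FT (u t) \<xi> - rhs u t \<xi>)) e"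
      proof (rule l2b_mono)
        have "0 \<le> (2 * M0 * (1/2) ^ k) * ?a t" using D by simp
        moreover have "(2 * M0 * (1/2) ^ Suc k) * ?a t + 2 * M0 * (1/2) ^ k / 2 * ?a t = (2 * M0 * (1/2) ^ k) * ?a t" by simp
        ultimately show "(2 * M0 * (1/2) ^ Suc k) * ?a t + 2 * M0 * (1/2) ^ k / 2 * ?a t \<le> e" using k by linarith
      qed
    qed
    then show ?thesis by eventually_elim (use w in simp)
  qed
  then show ?thesis using inv by blast
qed

text \<open>The solutions may be large, so the contraction is gained from time: with the weight exp
  (- 2 l t) the Duhamel term has Lipschitz constant 1/2 for whatever common bound \<open>M\<close>.
  The comparison is made at the time where the weighted difference is largest.\<close>

theorem mild_unique:
  assumes u: "hcont s {0..T} u" and v: "hcont s {0..T} v" and T: "0 \<le> T"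
    and eu: "\<And>t. t \<in> {0..T} \<Longrightarrow> AE \<xi> in lborel. FT (u t) \<xi> = rhs u t \<xi>"
    and ev: "\<And>t. t \<in> {0..T} \<Longrightarrow> AE \<xi> in lborel. FT (v t) \<xi> = rhs v t \<xi>" and t: "t \<in> {0..T}"
  shows "AE x in lborel. v t x = u t x"
proof -
  obtain M1 M2 where M1: "0 < M1" "\<And>t. t \<in> {0..T} \<Longrightarrow> hb s 1 (u t) M1" and M2: "0 < M2" "\<And>t. t \<in> {0..T} \<Longrightarrow> hb s 1 (v t) M2"
    using hcont_bounded[OF u] hcont_bounded[OF v] by blast
  define M where "M = M1 + M2"
  have M: "0 < M" "hb s 1 (u \<tau>) M" "hb s 1 (v \<tau>) M" if "\<tau> \<in> {0..T}" for \<tau>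
    using M1(1) M2(1) hb_mono[OF M1(2)[OF that], of M] hb_mono[OF M2(2)[OF that], of M] by (auto simp: M_def)
  have M0: "0 < M" using M1(1) M2(1) by (simp add: M_def)
  define \<phi> where "\<phi> t = hn s (\<lambda>x. u t x - v t x)" for t
  have \<phi>c: "continuous_on {0..T} \<phi>" unfolding \<phi>_def by (rule hcont_diff_continuous[OF u v])
  have h\<phi>: "hb s 1 (\<lambda>x. u \<tau> x - v \<tau> x) (\<phi> \<tau>)" if "\<tau> \<in> {0..T}" for \<tau>
    unfolding \<phi>_def by (rule hb_hn(1)[OF hb_diff[OF M(2,3)[OF that]]])
  define B where "B = CM * M powr (p - 1)"
  have B: "0 < B" using CM_pos M0 by (simp add: B_def)
  \<comment> \<open>The Lipschitz constant of the Duhamel term on [0, T] with respect to the time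
    integral of the difference. Integrating exp (2 l \<tau>) divides by 2 l, which leaves
    1/2.\<close>
  define l where "l = (1 + T)\<^sup>2 * Ck * B"
  have l: "0 < l" using B Ck T by (simp add: l_def)
  have "continuous_on {0..T} (\<lambda>t. \<phi> t * exp (- (2 * l * t)))" by (intro continuous_intros \<phi>c)
  then obtain t0 where t0: "t0 \<in> {0..T}" and mx: "\<And>\<tau>. \<tau> \<in> {0..T} \<Longrightarrow> \<phi> \<tau> * exp (- (2 * l * \<tau>)) \<le> \<phi> t0 * exp (- (2 * l * t0))"
    using continuous_attains_sup[of "{0..T}" "\<lambda>t. \<phi> t * exp (- (2 * l * t))"] T by auto
  define S where "S = \<phi> t0 * exp (- (2 * l * t0))"
  have \<phi>S: "\<phi> \<tau> \<le> S * exp (2 * l * \<tau>)" if "\<tau> \<in> {0..T}" for \<tau>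
    using mx[OF that] unfolding S_def[symmetric] by (simp add: exp_minus field_simps)
  have "S \<le> 0"
  proof (rule ccontr)
    assume "\<not> S \<le> 0"
    then have S: "0 < S" by simp
    have t0': "0 \<le> t0" "t0 \<le> T" using t0 by auto
    have hu: "hcont s {0..t0} u" "hcont s {0..t0} v" using u v t0 by (auto intro: hcont_subset)
    let ?W = "B * S * (exp (2 * l * t0) / (2 * l))"
    have "l2b (\<lambda>\<xi>. complex_of_real (wt s 1 \<xi>) * (duhn u t0 \<xi> - duhn v t0 \<xi>)) ((1 + T)\<^sup>2 * Ck * ?W)"
      unfolding duhn_diff[OF hu t0'(1) order_refl]
    proof (rule Duhamel_local[OF _ t0', where w = "\<lambda>\<tau>. B * S * exp (2 * l * \<tau>)"])
      show "continuous_on UNIV (\<lambda>(\<tau>, \<xi>). nl (u (clamp0 t0 \<tau>)) \<xi> - nl (v (clamp0 t0 \<tau>)) \<xi>)"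
        by (intro continuous_diff_pair nl_clamp_continuous hu t0')
      show "l2b (\<lambda>\<xi>. nl (u (clamp0 t0 \<tau>)) \<xi> - nl (v (clamp0 t0 \<tau>)) \<xi>) (B * S * exp (2 * l * \<tau>))" if \<tau>: "\<tau> \<in> {0..t0}" for \<tau>
      proof -
        have \<tau>T: "\<tau> \<in> {0..T}" using \<tau> t0' by simp
        have "hb s 1 (\<lambda>x. u \<tau> x - v \<tau> x) (S * exp (2 * l * \<tau>))" by (rule hb_mono[OF h\<phi>[OF \<tau>T] \<phi>S[OF \<tau>T]])
        then have "l2b (\<lambda>\<xi>. nl (u \<tau>) \<xi> - nl (v \<tau>) \<xi>) (CM * (S * exp (2 * l * \<tau>)) * M powr (p - 1) * 1 powr (- \<gamma> - \<nu>))"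
          using M[OF \<tau>T] S by (intro nl_estimate(2)) auto
        then show ?thesis using \<tau> by (simp add: clamp0 B_def ac_simps)
      qed
      have BS: "0 \<le> B * S" using B S by simp
      have "(\<integral>\<^sup>+\<tau>\<in>{0..t0}. ennreal (B * S * exp (2 * l * \<tau>)) \<partial>lborel) = ennreal (B * S) * (\<integral>\<^sup>+\<tau>\<in>{0..t0}. ennreal (exp (2 * l * \<tau>)) \<partial>lborel)"
        by (rule set_nn_integral_cmult_real[OF BS]) measurable
      also have "\<dots> \<le> ennreal (B * S) * ennreal (exp (2 * l * t0) / (2 * l))"
        by (intro mult_left_mono nn_integral_exp_le l t0') simp
      also have "\<dots> = ennreal ?W" unfolding ennreal_mult'[OF BS] ..
      finally show "(\<integral>\<^sup>+\<tau>\<in>{0..t0}. ennreal (B * S * exp (2 * l * \<tau>)) \<partial>lborel) \<le> ennreal ?W" .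
    qed (use B S l in auto)
    moreover have "(1 + T)\<^sup>2 * Ck * ?W = l * (S * (exp (2 * l * t0) / (2 * l)))" unfolding l_def by (simp only: ac_simps)
    moreover have "\<dots> = S * exp (2 * l * t0) / 2" using l by simp
    ultimately have d: "l2b (\<lambda>\<xi>. complex_of_real (wt s 1 \<xi>) * (duhn u t0 \<xi> - duhn v t0 \<xi>)) (S * exp (2 * l * t0) / 2)" by (simp only:)
    have LL: "L2 (u t0)" "L2 (v t0)" using hcontD(2)[OF u t0] hcontD(2)[OF v t0] by auto
    note F = FT_frel[OF LL(1)] FT_frel[OF LL(2)]
    have [measurable]: "FT (u t0) \<in> borel_measurable borel" "FT (v t0) \<in> borel_measurable borel"
      using frelD(2)[OF F(1)] frelD(2)[OF F(2)] by (auto intro: l2_measurable)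
    have ae: "AE \<xi> in lborel. complex_of_real (wt s 1 \<xi>) * (FT (u t0) \<xi> - FT (v t0) \<xi>) = complex_of_real (wt s 1 \<xi>) * (duhn u t0 \<xi> - duhn v t0 \<xi>)"
      using eu[OF t0] ev[OF t0] by eventually_elim (simp add: rhs_def)
    have "l2b (\<lambda>\<xi>. complex_of_real (wt s 1 \<xi>) * (FT (u t0) \<xi> - FT (v t0) \<xi>)) (S * exp (2 * l * t0) / 2)"
      by (rule l2b_cong_AE[OF d _ ae]) measurable
    then have "\<phi> t0 \<le> S * exp (2 * l * t0) / 2"
      unfolding \<phi>_def by (rule hb_hn(2)[OF hbI[OF frel_diff_real[OF F]]])
    moreover have "S * exp (2 * l * t0) = \<phi> t0" by (simp add: S_def mult.assoc exp_add[symmetric])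
    ultimately have "S * exp (2 * l * t0) \<le> S * exp (2 * l * t0) / 2" by simp
    moreover have "0 < S * exp (2 * l * t0)" using S by simp
    ultimately show False by linarith
  qed
  then have "S * exp (2 * l * t) \<le> 0" by (simp add: mult_nonpos_nonneg)
  then have z: "hb s 1 (\<lambda>x. u t x - v t x) 0" using \<phi>S[OF t] by (intro hb_mono[OF h\<phi>[OF t]]) simp
  have "l2b (FT (\<lambda>x. u t x - v t x)) (pc TYPE('a) * 0)" using l2b_div_wt[OF hbD(2)[OF z]] by simp
  from frel_l2b'[OF FT_frel[OF hbD(1)[OF z]] this]
  have "l2b (\<lambda>x. complex_of_real (u t x - v t x)) 0" by simp
  then have "AE x in lborel. complex_of_real (u t x - v t x) = 0" by (intro l2b_0_AE) (rule l2b_mono, auto)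
  then show ?thesis by eventually_elim simp
qed

end

section \<open>Global solutions for small data\<close>

lemma hcont_iff_Hs:
  fixes u :: "real \<Rightarrow> 'a::euclidean_space \<Rightarrow> real"
  assumes s: "0 < s"
  shows "hcont s I u \<longleftrightarrow> (\<forall>t\<in>I. Hs s (u t)) \<and>
    (\<forall>t\<in>I. ((\<lambda>r. Hsnorm s (\<lambda>x. u r x - u t x)) \<longlongrightarrow> 0) (at t within I))"
proof
  assume u: "hcont s I u"
  have "((\<lambda>r. Hsnorm s (\<lambda>x. u r x - u t x)) \<longlongrightarrow> 0) (at t within I)" if t: "t \<in> I" for t
    unfolding tendsto_at_iff_sequentially
  proof (intro allI impI)
    fix X assume X: "\<forall>i. X i \<in> I - {t}" "X \<longlonglongrightarrow> t"
    show "((\<lambda>r. Hsnorm s (\<lambda>x. u r x - u t x)) \<circ> X) \<longlonglongrightarrow> 0"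
    proof (rule LIMSEQ_I)
      fix e :: real assume e: "0 < e"
      have "\<forall>\<^sub>F k in sequentially. hb s 1 (\<lambda>x. u (X k) x - u t x) (e / 2 / 2 powr (s/2))"
        by (rule hcontD(3)[OF u t _ X(2)]) (use X e in auto)
      then have "\<forall>\<^sub>F k in sequentially. norm (((\<lambda>r. Hsnorm s (\<lambda>x. u r x - u t x)) \<circ> X) k - 0) < e"
      proof eventually_elim
        case (elim k)
        have "0 \<le> Hsnorm s (\<lambda>x. u (X k) x - u t x)" by (simp add: Hsnorm_def)
        then show ?case using hb_imp_Hs(2)[OF s elim] e by simp
      qed
      then show "\<exists>no. \<forall>n\<ge>no. norm (((\<lambda>r. Hsnorm s (\<lambda>x. u r x - u t x)) \<circ> X) n - 0) < e"
        by (simp add: eventually_sequentially)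
    qed
  qed
  moreover have "Hs s (u t)" if "t \<in> I" for t using hcontD(1)[OF u that] hb_imp_Hs(1)[OF s] by blast
  ultimately show "(\<forall>t\<in>I. Hs s (u t)) \<and> (\<forall>t\<in>I. ((\<lambda>r. Hsnorm s (\<lambda>x. u r x - u t x)) \<longlongrightarrow> 0) (at t within I))"
    by blast
next
  assume a: "(\<forall>t\<in>I. Hs s (u t)) \<and> (\<forall>t\<in>I. ((\<lambda>r. Hsnorm s (\<lambda>x. u r x - u t x)) \<longlongrightarrow> 0) (at t within I))"
  have h: "hb s 1 (u t) (2 * Hsnorm s (u t))" if "t \<in> I" for t using a that Hs_imp_hb[OF s] by blast
  show "hcont s I u"
    unfolding hcont_def
  proof (intro conjI ballI allI impI)
    fix t assume t: "t \<in> I"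
    then show "\<exists>A. hb s 1 (u t) A" using h by blast
    let ?g = "\<lambda>r. Hsnorm s (\<lambda>x. u r x - u t x)"
    fix r e assume r: "\<forall>k. r k \<in> I" "r \<longlonglongrightarrow> t" and e: "0 < (e::real)"
    \<comment> \<open>The limit within \<open>I\<close> leaves out t itself, whereas the sequences
      in \<open>hcont\<close> may take the value t, so the value at t has to be identified as
      0.\<close>
    have "Hsnorm s (\<lambda>x::'a. 0) \<le> 2 powr (s/2) * 0" by (rule hb_imp_Hs(2)[OF s hb_0]) simp
    moreover have "0 \<le> Hsnorm s (\<lambda>x::'a. 0)" by (simp add: Hsnorm_def)
    ultimately have g0: "?g t = 0" by simp
    then have "continuous (at t within I) ?g" using a t by (simp add: continuous_within)
    then have "(?g \<circ> r) \<longlonglongrightarrow> ?g t" using r by (simp add: continuous_within_sequentially)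
    then have "\<forall>\<^sub>F k in sequentially. ?g (r k) < e / 2" using g0 e order_tendstoD(2)[of "?g \<circ> r" "?g t" sequentially "e/2"] by simp
    then show "\<forall>\<^sub>F k in sequentially. hb s 1 (\<lambda>x. u (r k) x - u t x) e"
    proof eventually_elim
      case (elim k)
      have "Hs s (\<lambda>x. u (r k) x - u t x)" using hb_imp_Hs(1)[OF s hb_diff[OF h h]] r(1) t by blast
      from hb_mono[OF Hs_imp_hb[OF s this]] elim show ?case by simp
    qed
  qed
qed

section \<open>The linear evolution of the data\<close>

lemma ft1_uminus: "ft1 f (- \<xi>) = cnj (ft1 f \<xi>)"
proof -
  have "ft (\<lambda>x. cnj (complex_of_real (f x))) (- \<xi>) = cnj (ft (\<lambda>x. complex_of_real (f x)) (- (- \<xi>)))"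
    by (rule ft_cnj)
  then show ?thesis by (simp only: ft1_eq_ft complex_cnj_complex_of_real minus_minus)
qed

lemma L1_ft1:
  assumes "L1 f"
  shows "integrable lborel (\<lambda>x. complex_of_real (f x))" "norm (ft1 f \<xi>) \<le> L1norm f" "ft1 f \<in> borel_measurable borel" "0 \<le> L1norm f"
proof -
  show i: "integrable lborel (\<lambda>x. complex_of_real (f x))" using assms by (simp add: L1_def)
  show "norm (ft1 f \<xi>) \<le> L1norm f" using norm_ft_le[OF i, of \<xi>] by (simp add: ft1_eq_ft L1norm_def)
  show "ft1 f \<in> borel_measurable borel" unfolding ft1_eq_ft using i by (rule ft_measurable)
  show "0 \<le> L1norm f" by (simp add: L1norm_def)
qed

text \<open>The data enter the solution formula through the Fourier integral \<open>ft1\<close> but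
  their Sobolev norms through \<open>FT\<close>. By \<open>frel_ft\<close> both are transforms of
  the same function, so the weighted bound passes from one to the other.\<close>

lemma weighted_ft1_l2b:
  assumes s: "0 < s" and H: "Hs s f" and L: "L1 f"
  shows "l2b (\<lambda>\<xi>. complex_of_real (wt s 1 \<xi>) * ft1 f \<xi>) (2 * Hsnorm s f)"
  by (rule hbD2[OF Hs_imp_hb[OF s H]], unfold ft1_eq_ft, rule frel_ft)
     (use H L1_ft1(1)[OF L] in \<open>simp_all add: Hs_def L2_iff_l2\<close>)

locale wave = picard s p \<nu> \<gamma> dim \<eta> Ck ck CN CD
  for s p \<nu> \<gamma> and dim :: "'a::euclidean_space itself" and \<eta> Ck ck CN CD +
  fixes CL \<sigma> :: real
  assumes CL: "0 < CL" and s_eq: "s = 4 * \<sigma> / 3"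
    and linear: "\<And>j g B t. j \<le> 2 \<Longrightarrow> 0 \<le> t \<Longrightarrow> 0 \<le> B \<Longrightarrow> (\<And>\<xi>. norm (g \<xi>) \<le> B) \<Longrightarrow> l2b (\<lambda>\<xi>. complex_of_real (dwt j \<xi>) * g \<xi>) B \<Longrightarrow>
     g \<in> borel_measurable borel \<Longrightarrow>
     l2b (\<lambda>\<xi>. complex_of_real (wt s (1 + t) \<xi>) * (complex_of_real (K j t \<xi>) * g \<xi>)) (CL * B * (1 + t) powr - \<nu>)"
begin

lemma hatE_eq_K: "j \<le> 2 \<Longrightarrow> hatE \<sigma> \<eta> j t \<xi> = K j t \<xi>"
proof -
  assume j: "j \<le> 2"
  have e: "2 * \<sigma> / 3 = s / 2" using s_eq by simp
  show ?thesis unfolding hatE_def K_def Kfun_eq_kap[OF j] e ..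
qed

definition lin :: "real \<Rightarrow> ('a \<Rightarrow> real) \<Rightarrow> ('a \<Rightarrow> real) \<Rightarrow> ('a \<Rightarrow> real) \<Rightarrow> real \<Rightarrow> 'a \<Rightarrow> complex" where
  "lin \<epsilon> u0 u1 u2 t \<xi> = complex_of_real \<epsilon> * (complex_of_real (K 0 t \<xi>) * ft1 u0 \<xi> + complex_of_real (K 1 t \<xi>) * ft1 u1 \<xi> + complex_of_real (K 2 t \<xi>) * ft1 u2 \<xi>)"

text \<open>There are three data, each controlled by 2 + pc times the data norm: 2 from
  \<open>Hs_imp_hb\<close> for the first two, \<open>pc\<close> from Plancherel for the
  third.\<close>

definition CB :: real where "CB = 3 * CL * (2 + pc TYPE('a))"

lemma CB_pos: "0 < CB"
  using CL pc_pos[where 'a='a] by (simp add: CB_def add_pos_pos)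

lemma mild_problem:
  fixes u0 u1 u2 :: "'a \<Rightarrow> real"
  assumes B: "in_B \<sigma> u0 u1 u2" and \<epsilon>: "0 < \<epsilon>"
  shows "mild_problem s p \<nu> \<gamma> \<eta> Ck ck CN CD (lin \<epsilon> u0 u1 u2) (\<epsilon> * CB * B_norm \<sigma> u0 u1 u2)"
    and "0 \<le> B_norm \<sigma> u0 u1 u2"
proof -
  let ?N = "B_norm \<sigma> u0 u1 u2" and ?c = "pc TYPE('a)"
  let ?g = "\<lambda>j::nat. ft1 (if j = 0 then u0 else if j = 1 then u1 else u2)"
  have c: "0 < ?c" by (rule pc_pos)
  have s2: "2 * \<sigma> / 3 = s / 2" "4 * \<sigma> / 3 = s" using s_eq by simp_all
  have L: "L1 u0" "L1 u1" "L1 u2" "L2 u2" "Hs s u0" "Hs (s / 2) u1" using B unfolding in_B_def s2 by auto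
  have s': "0 < s / 2" using s by simp
  note w0 = weighted_ft1_l2b[OF s L(5,1)] note w1 = weighted_ft1_l2b[OF s' L(6,2)]
  have l2u: "l2b (\<lambda>x. complex_of_real (u2 x)) (L2norm u2)"
    unfolding L2norm_def by (rule l2bI) (use L(4) in \<open>auto simp: L2_def\<close>)
  note w2 = ft_l2b[OF L1_ft1(1)[OF L(3)] l2u, folded ft1_eq_ft]
  have nn: "0 \<le> Hsnorm s u0" "0 \<le> L1norm u0" "0 \<le> Hsnorm (s / 2) u1" "0 \<le> L1norm u1" "0 \<le> L2norm u2" "0 \<le> L1norm u2"
    by (simp_all add: Hsnorm_def L1norm_def L2norm_def)
  have N: "?N = Hsnorm s u0 + L1norm u0 + Hsnorm (s / 2) u1 + L1norm u1 + L2norm u2 + L1norm u2"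
    unfolding B_norm_def s2 ..
  show N0: "0 \<le> ?N" unfolding N using nn by simp
  let ?B = "(2 + ?c) * ?N"
  have B0: "0 \<le> ?B" using N0 c by simp
  have NB: "?N \<le> ?B" "2 * ?N \<le> ?B" "?c * ?N \<le> ?B" using N0 c by (auto simp: algebra_simps)
  have g1: "norm (?g j \<xi>) \<le> ?B" for j \<xi>
    using L1_ft1(2)[OF L(1), of \<xi>] L1_ft1(2)[OF L(2), of \<xi>] L1_ft1(2)[OF L(3), of \<xi>] nn NB(1) unfolding N by auto
  have gm: "?g j \<in> borel_measurable borel" for j using L1_ft1(3) L by auto
  have g2: "l2b (\<lambda>\<xi>. complex_of_real (dwt j \<xi>) * ?g j \<xi>) ?B" if "j \<le> 2" for j
  proof -
    have "2 * Hsnorm s u0 \<le> ?B" "2 * Hsnorm (s / 2) u1 \<le> ?B" using NB(2) nn unfolding N by auto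
    moreover have "?c * L2norm u2 \<le> ?c * ?N" using c nn unfolding N by (intro mult_left_mono) auto
    ultimately show ?thesis
      using l2b_mono[OF w0] l2b_mono[OF w1] l2b_mono[OF w2] NB(3) by (auto simp: dwt_def)
  qed
  have lin: "lin \<epsilon> u0 u1 u2 t \<xi> = complex_of_real \<epsilon> * (complex_of_real (K 0 t \<xi>) * ?g 0 \<xi> + complex_of_real (K 1 t \<xi>) * ?g 1 \<xi> + complex_of_real (K 2 t \<xi>) * ?g 2 \<xi>)" for t \<xi>
    by (simp add: lin_def)
  show "mild_problem s p \<nu> \<gamma> \<eta> Ck ck CN CD (lin \<epsilon> u0 u1 u2) (\<epsilon> * CB * ?N)"
  proof (unfold_locales)
    show "0 \<le> \<epsilon> * CB * ?N" using \<epsilon> CB_pos N0 by simp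
    show "lin \<epsilon> u0 u1 u2 t (- \<xi>) = cnj (lin \<epsilon> u0 u1 u2 t \<xi>)" for t \<xi> by (simp add: lin_def K_even ft1_uminus)
    fix t :: real assume t: "0 \<le> t"
    have l: "l2b (\<lambda>\<xi>. complex_of_real (wt s (1 + t) \<xi>) * (complex_of_real (K j t \<xi>) * ?g j \<xi>)) (CL * ?B * (1 + t) powr - \<nu>)" if "j \<le> 2" for j
      by (rule linear[OF that t B0 g1 g2[OF that] gm])
    from l2b_cmult[OF l2b_add[OF l2b_add[OF l[of 0] l[of 1]] l[of 2]], of "complex_of_real \<epsilon>"]
    show "l2b (\<lambda>\<xi>. complex_of_real (wt s (1 + t) \<xi>) * lin \<epsilon> u0 u1 u2 t \<xi>) (\<epsilon> * CB * ?N * (1 + t) powr - \<nu>)"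
      using \<epsilon> by (simp add: lin CB_def algebra_simps)
  next
    fix r :: "nat \<Rightarrow> real" and t T e :: real assume r: "r \<longlonglongrightarrow> t" "\<And>k. 0 \<le> r k" "\<And>k. r k \<le> T" and e: "0 < e"
    have e3: "0 < e / (3 * \<epsilon>)" using e \<epsilon> by simp
    let ?d = "\<lambda>j k \<xi>. complex_of_real (wt s 1 \<xi>) * (complex_of_real (K j (r k) \<xi>) * ?g j \<xi>) - complex_of_real (wt s 1 \<xi>) * (complex_of_real (K j t \<xi>) * ?g j \<xi>)"
    have l: "\<forall>\<^sub>F k in sequentially. l2b (?d j k) (e / (3 * \<epsilon>))" if "j \<le> 2" for j
      by (rule linear_continuous_in_time[OF that g2[OF that] gm r e3])
    have "\<forall>\<^sub>F k in sequentially. l2b (?d 0 k) (e / (3 * \<epsilon>)) \<and> l2b (?d 1 k) (e / (3 * \<epsilon>)) \<and> l2b (?d 2 k) (e / (3 * \<epsilon>))"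
      by (intro eventually_conj l) auto
    then show "\<forall>\<^sub>F k in sequentially. l2b (\<lambda>\<xi>. complex_of_real (wt s 1 \<xi>) * lin \<epsilon> u0 u1 u2 (r k) \<xi> - complex_of_real (wt s 1 \<xi>) * lin \<epsilon> u0 u1 u2 t \<xi>) e"
    proof eventually_elim
      case (elim k)
      then have "l2b (\<lambda>\<xi>. complex_of_real \<epsilon> * (?d 0 k \<xi> + ?d 1 k \<xi> + ?d 2 k \<xi>)) (cmod (complex_of_real \<epsilon>) * (e / (3 * \<epsilon>) + e / (3 * \<epsilon>) + e / (3 * \<epsilon>)))"
        by (intro l2b_cmult l2b_add) auto
      moreover have "cmod (complex_of_real \<epsilon>) * (e / (3 * \<epsilon>) + e / (3 * \<epsilon>) + e / (3 * \<epsilon>)) = e" using \<epsilon> by (simp add: field_simps)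
      ultimately show ?case by (simp add: lin algebra_simps)
    qed
  qed
qed

lemma solution_decay:
  assumes h: "hb s (1 + t) u (A * (1 + t) powr - \<nu>)" and t: "0 \<le> t"
  shows "L2norm u \<le> A / pc TYPE('a) * (1 + t) powr (2 - \<nu>)" "Hdotnorm s (u::'a \<Rightarrow> real) \<le> A * (1 + t) powr - \<nu>"
proof -
  let ?c = "pc TYPE('a)"
  have c: "0 < ?c" by (rule pc_pos)
  have A: "0 \<le> A * (1 + t) powr - \<nu>" using hbD(3)[OF h] .
  note F = FT_frel[OF hbD(1)[OF h]]
  have [measurable]: "FT u \<in> borel_measurable borel" using frelD(2)[OF F] by (rule l2_measurable)
  have pw: "(1 + t)\<^sup>2 * (1 + t) powr - \<nu> = (1 + t) powr (2 - \<nu>)"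
  proof -
    have "(1 + t)\<^sup>2 = (1 + t) powr 2" using t powr_realpow[of "1 + t" 2] by simp
    then show ?thesis using powr_add[of "1 + t" 2 "- \<nu>"] by simp
  qed
  have "l2b (FT u) (?c * (A / ?c * (1 + t) powr (2 - \<nu>)))"
    using l2b_div_wt[OF hbD(2)[OF h]] t c unfolding pw[symmetric] by (simp add: ac_simps)
  then have "l2b (\<lambda>x. complex_of_real (u x)) (A / ?c * (1 + t) powr (2 - \<nu>))"
    by (rule frel_l2b'[OF F]) (use A c t in \<open>simp add: zero_le_mult_iff\<close>)
  from l2b_integral[OF this] l2b_nonneg[OF this] show "L2norm u \<le> A / ?c * (1 + t) powr (2 - \<nu>)"
    unfolding L2norm_def by (intro real_le_lsqrt) auto
  have "l2b (\<lambda>\<xi>. complex_of_real (norm \<xi> powr s) * FT u \<xi>) (A * (1 + t) powr - \<nu>)"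
  proof (rule l2b_dominated1[OF hbD(2)[OF h]])
    fix \<xi> :: 'a
    have "norm \<xi> powr s \<le> wt s (1 + t) \<xi>" by (simp add: wt_def)
    from mult_right_mono[OF this, of "norm (FT u \<xi>)"]
    show "norm (complex_of_real (norm \<xi> powr s) * FT u \<xi>) \<le> norm (complex_of_real (wt s (1 + t) \<xi>) * FT u \<xi>)"
      by (simp add: norm_mult abs_of_nonneg[OF wt_nonneg])
  qed measurable
  note l = l2b_integral[OF this]
  have "norm \<xi> powr (2 * s) * (cmod (FT u \<xi>))\<^sup>2 = (norm (complex_of_real (norm \<xi> powr s) * FT u \<xi>))\<^sup>2" for \<xi> :: 'a
    by (simp add: norm_mult power_mult_distrib power2_eq_square powr_add[symmetric])
  then show "Hdotnorm s u \<le> A * (1 + t) powr - \<nu>"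
    unfolding Hdotnorm_def using l A by (intro real_le_lsqrt) auto
qed

lemma mild_sol_iff:
  assumes "I \<subseteq> {0..}"
  shows "mild_sol \<sigma> \<eta> p \<epsilon> u0 u1 u2 I u \<longleftrightarrow> hcont s I u \<and> (\<forall>t\<in>I. AE \<xi> in lborel. FT (u t) \<xi> = lin \<epsilon> u0 u1 u2 t \<xi> + duhn u t \<xi>)"
  unfolding hcont_iff_Hs[OF s] mild_sol_def s_eq[symmetric] lin_def duh_def nl_def by (simp add: hatE_eq_K)

theorem global_solution:
  fixes u0 u1 u2 :: "'a \<Rightarrow> real"
  assumes B: "in_B \<sigma> u0 u1 u2" and \<epsilon>: "0 < \<epsilon>" and M0: "0 < M0" "CD * CM * M0 powr (p - 1) \<le> 1 / 2"
    and small_data: "2 * (\<epsilon> * CB * B_norm \<sigma> u0 u1 u2) \<le> M0"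
  shows "\<exists>u. mild_sol \<sigma> \<eta> p \<epsilon> u0 u1 u2 {0..} u \<and>
    (\<forall>T v. T > 0 \<and> mild_sol \<sigma> \<eta> p \<epsilon> u0 u1 u2 {0..T} v \<longrightarrow> (\<forall>t\<in>{0..T}. AE x in lborel. v t x = u t x)) \<and>
    lifespan \<sigma> \<eta> p \<epsilon> u0 u1 u2 = \<infinity> \<and>
    (\<forall>t\<ge>0. L2norm (u t) \<le> 2 * (\<epsilon> * CB * B_norm \<sigma> u0 u1 u2) / pc TYPE('a) * (1 + t) powr (2 - \<nu>) \<and>
       Hdotnorm s (u t) \<le> 2 * (\<epsilon> * CB * B_norm \<sigma> u0 u1 u2) * (1 + t) powr - \<nu>)"
proof -
  let ?m = "\<epsilon> * CB * B_norm \<sigma> u0 u1 u2"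
  let ?sol = "mild_sol \<sigma> \<eta> p \<epsilon> u0 u1 u2"
  interpret mild_problem s p \<nu> \<gamma> dim \<eta> Ck ck CN CD "lin \<epsilon> u0 u1 u2" ?m
    by (rule mild_problem(1)[OF B \<epsilon>])
  have p1: "0 < p - 1" using p by simp
  \<comment> \<open>Every positive radius between twice the linear size and \<open>M0\<close> is
    admissible, which is what the bound \<open>hbm\<close> exploits.\<close>
  have small: "small M" if "0 < M" "2 * ?m \<le> M" "M \<le> M0" for M
  proof -
    have "CD * CM * M powr (p - 1) \<le> CD * CM * M0 powr (p - 1)"
      using that p1 CD CM_pos by (intro mult_left_mono powr_mono2) auto
    then show ?thesis using that M0 by (simp add: small_def)
  qed
  obtain u where inv: "\<And>M. small M \<Longrightarrow> inv M u" and eq: "\<And>t. 0 \<le> t \<Longrightarrow> AE \<xi> in lborel. FT (u t) \<xi> = rhs u t \<xi>"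
    using Picard_limit[OF small[OF M0(1) small_data order_refl]] by blast
  have hc: "hcont s {0..} u" using inv[OF small[OF M0(1) small_data order_refl]] by (simp add: inv_def)
  have sol: "?sol I u" if "I \<subseteq> {0..}" for I
    unfolding mild_sol_iff[OF that] using hcont_subset[OF hc that] eq that by (auto simp: rhs_def)
  have uniq: "AE x in lborel. v t x = u t x" if v: "?sol I v" and I: "I \<subseteq> {0..}" "{0..t} \<subseteq> I" and t: "0 \<le> t" for v I t
  proof (rule mild_unique[OF _ _ t])
    show "hcont s {0..t} u" by (rule hcont_subset[OF hc]) auto
    show "hcont s {0..t} v" using v I(2) unfolding mild_sol_iff[OF I(1)] by (auto intro: hcont_subset)
    show "AE \<xi> in lborel. FT (u r) \<xi> = rhs u r \<xi>" if "r \<in> {0..t}" for r using eq that by simp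
    show "AE \<xi> in lborel. FT (v r) \<xi> = rhs v r \<xi>" if "r \<in> {0..t}" for r
      using v I(2) that unfolding mild_sol_iff[OF I(1)] rhs_def by blast
  qed (use t in simp)
  have u1: "AE x in lborel. v t x = u t x" if "?sol {0..T} v" "t \<in> {0..T}" for T v t
    by (rule uniq[OF that(1)]) (use that(2) in auto)
  have u2: "AE x in lborel. v t x = u t x" if "?sol {0..<T} v" "t \<in> {0..<T}" for T v t
    by (rule uniq[OF that(1)]) (use that(2) in auto)
  have life: "lifespan \<sigma> \<eta> p \<epsilon> u0 u1 u2 = \<infinity>"
  proof (rule ereal_top)
    fix b :: real
    \<comment> \<open>The maximum with 1 makes the time positive, as \<open>lifespan\<close>
      demands.\<close>
    have "ereal (max 1 b) \<le> lifespan \<sigma> \<eta> p \<epsilon> u0 u1 u2"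
      unfolding lifespan_def
    proof (rule Sup_upper, intro CollectI exI conjI)
      show "?sol {0..<max 1 b} u" by (rule sol) auto
    qed (use u2 in auto)
    then show "ereal b \<le> lifespan \<sigma> \<eta> p \<epsilon> u0 u1 u2" by (rule order_trans[rotated]) simp
  qed
  \<comment> \<open>The radius \<open>2 * ?m\<close> is approached from above: it vanishes for zero
    data, while \<open>small\<close> asks for a positive radius. The minimum with \<open>M0\<close>
    keeps the approximating radii admissible.\<close>
  have hbm: "hb s (1 + t) (u t) (2 * ?m * (1 + t) powr - \<nu>)" if t: "0 \<le> t" for t
  proof (rule hb_limit_le)
    have "0 \<le> \<nu>" using s by (simp add: \<nu>)
    then have a: "(1 + t) powr - \<nu> \<le> 1" using t powr_mono2'[of "- \<nu>" 1 "1 + t"] by simp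
    fix e :: real assume e: "0 < e"
    have "small (min M0 (2 * ?m + e))" by (rule small) (use M0 e m small_data in auto)
    from inv[OF this] t have h: "hb s (1 + t) (u t) (min M0 (2 * ?m + e) * (1 + t) powr - \<nu>)" by (simp add: inv_def)
    have "min M0 (2 * ?m + e) * (1 + t) powr - \<nu> \<le> (2 * ?m + e) * (1 + t) powr - \<nu>" by (intro mult_right_mono) auto
    also have "\<dots> \<le> 2 * ?m * (1 + t) powr - \<nu> + e" using mult_left_mono[OF a, of e] e by (simp add: distrib_right)
    finally show "\<exists>B\<le>2 * ?m * (1 + t) powr - \<nu> + e. hb s (1 + t) (u t) B" using h by blast
  qed (use m in simp)
  show ?thesis
    using sol[of "{0..}"] u1 life solution_decay[OF hbm] by (intro exI[of _ u]) blast
qed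

end

section \<open>Exponents, constants and the decay rates\<close>

theorem theorem2p1:
  fixes \<sigma> \<eta> p :: real
  assumes "\<sigma> > 0"
    and "4 / 3 * \<sigma> < real CARD('n::finite)" and "real CARD('n) \<le> 10 / 3 * \<sigma>"
    and "\<eta> > 1" and "p > 1"
    and "p_crit (real CARD('n)) \<sigma> < ereal p" and "ereal p \<le> p_upper (real CARD('n)) \<sigma>"
  shows "\<exists>C > 0. \<exists>\<epsilon>0 > 0. \<exists>K > 0. \<forall>\<epsilon> \<in> {0<..\<epsilon>0}.
     \<forall>u0 u1 u2 :: real^'n \<Rightarrow> real.
       in_B \<sigma> u0 u1 u2 \<and> B_norm \<sigma> u0 u1 u2 \<le> C \<longrightarrow>
       (\<exists>u. mild_sol \<sigma> \<eta> p \<epsilon> u0 u1 u2 {0..} u \<and>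
          (\<forall>T v. T > 0 \<and> mild_sol \<sigma> \<eta> p \<epsilon> u0 u1 u2 {0..T} v \<longrightarrow>
             (\<forall>t\<in>{0..T}. AE x in lborel. v t x = u t x)) \<and>
          lifespan \<sigma> \<eta> p \<epsilon> u0 u1 u2 = \<infinity> \<and>
          (\<forall>t \<ge> 0.
             L2norm (u t) \<le> K * (if real CARD('n) = 8 / 3 * \<sigma> \<and> \<eta> > 3
                 then \<epsilon> * ln (exp 1 + t) * B_norm \<sigma> u0 u1 u2
                 else \<epsilon> * (1 + t) powr (- (3 * real CARD('n) - 8 * \<sigma>) / (4 * \<sigma>)) * B_norm \<sigma> u0 u1 u2) \<and>
             Hdotnorm (4 * \<sigma> / 3) (u t) \<le>
               K * \<epsilon> * (1 + t) powr (- (3 * real CARD('n)) / (4 * \<sigma>)) * B_norm \<sigma> u0 u1 u2))"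
proof -
  let ?n = "real CARD('n)"
  define s where "s = 4 * \<sigma> / 3"
  define \<nu> where "\<nu> = ?n / s"
  define \<gamma> where "\<gamma> = 2 * (p - 1) * \<nu> - 2 * p"
  have \<sigma>: "0 < \<sigma>" by fact
  have \<nu>n: "\<nu> = 3 * ?n / (4 * \<sigma>)" by (simp add: \<nu>_def s_def)
  \<comment> \<open>The condition p > p_crit cleared of its denominator, which is positive by the
    lower bound on n.\<close>
  have pc: "6 * \<sigma> < (p - 1) * (3 * ?n - 4 * \<sigma>)"
    using assms(2,6) \<sigma> by (simp add: p_crit_def split: if_splits) (simp add: field_simps)
  \<comment> \<open>As n \<le> 10 \<sigma> / 3 gives 3 n - 4 \<sigma> \<le> 6 \<sigma>, the critical
    exponent is at least 2.\<close>
  have p: "2 \<le> p"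
  proof (rule ccontr)
    assume "\<not> 2 \<le> p"
    then have "(p - 1) * (3 * ?n - 4 * \<sigma>) \<le> 1 * (6 * \<sigma>)" using assms(2,3,5) by (intro mult_mono) auto
    then show False using pc by simp
  qed
  \<comment> \<open>If 3 n \<le> 8 \<sigma> then \<nu> \<le> 2 and the bound holds for every such p;
    otherwise it is the upper bound on p, rearranged.\<close>
  have sub: "\<nu> * (1 - 1 / p) \<le> 2"
  proof (cases "3 * ?n - 8 * \<sigma> \<le> 0")
    case True
    then have "\<nu> \<le> 2" using \<sigma> by (simp add: \<nu>n divide_le_eq)
    then have "\<nu> * (1 - 1 / p) \<le> 2 * 1" using p \<sigma> by (intro mult_mono) (auto simp: \<nu>n)
    then show ?thesis by simp
  next
    case False
    then have "p \<le> 3 * ?n / (3 * ?n - 8 * \<sigma>)" using assms(7) by (simp add: p_upper_def)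
    then have "p * (3 * ?n - 8 * \<sigma>) \<le> 3 * ?n" using False by (simp add: field_simps)
    then show ?thesis using p \<sigma> by (simp add: \<nu>n field_simps)
  qed
  have \<gamma>1: "1 < \<gamma>"
  proof -
    have "\<gamma> = (p - 1) * (3 * ?n - 4 * \<sigma>) / (2 * \<sigma>) - 2" using \<sigma> by (simp add: \<gamma>_def \<nu>n field_simps)
    moreover have "3 < (p - 1) * (3 * ?n - 4 * \<sigma>) / (2 * \<sigma>)" using pc \<sigma> by (simp add: less_divide_eq)
    ultimately show ?thesis by simp
  qed
  interpret scaling s p \<nu> \<gamma> "TYPE(real^'n)"
    by unfold_locales (use \<sigma> p sub \<gamma>1 in \<open>auto simp: s_def \<nu>_def \<gamma>_def\<close>)
  obtain Ck ck where k: "0 < Ck" "0 < ck" "\<And>j r. j \<le> 2 \<Longrightarrow> 0 \<le> r \<Longrightarrow> (1 + r)\<^sup>2 * \<bar>kap \<eta> j r\<bar> \<le> Ck * exp (- ck * r)"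
    using kap_decay_uniform[OF assms(4)] by blast
  interpret evolution s p \<nu> \<gamma> "TYPE(real^'n)" \<eta> Ck ck
    by unfold_locales (use k in auto)
  obtain CN where CN: "0 < CN" and nonlin: "\<forall>\<Lambda>>0. \<forall>M>0. \<forall>D>0. \<forall>f g::real^'n \<Rightarrow> real. hb s \<Lambda> f (M * \<Lambda> powr - \<nu>) \<longrightarrow> hb s \<Lambda> g (M * \<Lambda> powr - \<nu>) \<longrightarrow>
     hb s \<Lambda> (\<lambda>x. f x - g x) (D * \<Lambda> powr - \<nu>) \<longrightarrow>
     integrable lborel (\<lambda>x. \<bar>f x\<bar> powr p - \<bar>g x\<bar> powr p) \<and>
     (\<integral>x. \<bar>\<bar>f x\<bar> powr p - \<bar>g x\<bar> powr p\<bar> \<partial>lborel) \<le> CN * D * M powr (p - 1) * \<Lambda> powr - \<gamma> \<and>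
     l2b (\<lambda>x. complex_of_real (\<bar>f x\<bar> powr p - \<bar>g x\<bar> powr p)) (CN * D * M powr (p - 1) * \<Lambda> powr (- \<gamma> - \<nu>))"
    using nonlinear_estimate by (elim exE conjE)
  obtain CD where CD: "0 < CD" and duhamel: "\<forall>F S t. 0 \<le> t \<longrightarrow> 0 \<le> S \<longrightarrow> continuous_on UNIV (\<lambda>(\<tau>, \<xi>). F \<tau> \<xi>) \<longrightarrow>
     (\<forall>\<tau>\<in>{0..t}. \<forall>\<xi>. norm (F \<tau> \<xi>) \<le> S * (1 + \<tau>) powr - \<gamma>) \<longrightarrow>
     (\<forall>\<tau>\<in>{0..t}. l2b (F \<tau>) (S * (1 + \<tau>) powr (- \<gamma> - \<nu>))) \<longrightarrow>
     l2b (\<lambda>\<xi>::real^'n. complex_of_real (wt s (1 + t) \<xi>) * duh F t \<xi>) (CD * S * (1 + t) powr - \<nu>)"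
    using Duhamel_decay by (elim exE conjE)
  obtain CL where CL: "0 < CL" and linear: "\<forall>j\<le>2. \<forall>g B t. 0 \<le> t \<longrightarrow> 0 \<le> B \<longrightarrow> (\<forall>\<xi>. norm (g \<xi>) \<le> B) \<longrightarrow> l2b (\<lambda>\<xi>. complex_of_real (dwt j \<xi>) * g \<xi>) B \<longrightarrow>
     g \<in> borel_measurable borel \<longrightarrow>
     l2b (\<lambda>\<xi>::real^'n. complex_of_real (wt s (1 + t) \<xi>) * (complex_of_real (K j t \<xi>) * g \<xi>)) (CL * B * (1 + t) powr - \<nu>)"
    using linear_decay by (elim exE conjE)
  interpret picard s p \<nu> \<gamma> "TYPE(real^'n)" \<eta> Ck ck CN CD
    by unfold_locales (fact CN CD | rule nonlin[rule_format] duhamel[rule_format]; assumption)+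
  interpret wave s p \<nu> \<gamma> "TYPE(real^'n)" \<eta> Ck ck CN CD CL \<sigma>
    by unfold_locales (fact CL s_def | rule linear[rule_format]; assumption)+
  \<comment> \<open>The radius at which the contraction condition holds with equality.\<close>
  define M0 where "M0 = (1 / (2 * CD * CM)) powr (1 / (p - 1))"
  have M0: "0 < M0" "CD * CM * M0 powr (p - 1) \<le> 1 / 2"
    using CD CM_pos p by (auto simp: M0_def powr_powr)
  define c where "c = pc TYPE(real^'n)"
  have c: "0 < c" unfolding c_def by (rule pc_pos)
  \<comment> \<open>For data of norm at most 1 this keeps twice the size of the linear part below
    \<open>M0\<close>.\<close>
  define e0 where "e0 = M0 / (2 * CB)"
  have e0: "0 < e0" using M0 CB_pos by (simp add: e0_def)
  \<comment> \<open>Dominates both constants of \<open>global_solution\<close>: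
    \<open>2 * CB / c\<close> for the L2 norm and \<open>2 * CB\<close> for the homogeneous
    norm.\<close>
  define K0 where "K0 = 2 * CB * (1 + 1 / c)"
  have K0: "0 < K0" "2 * CB / c \<le> K0" "2 * CB \<le> K0" using CB_pos c by (auto simp: K0_def add_pos_pos field_simps)
  have ex: "- (3 * ?n - 8 * \<sigma>) / (4 * \<sigma>) = 2 - \<nu>" "- (3 * ?n) / (4 * \<sigma>) = - \<nu>"
    using \<sigma> by (simp_all add: \<nu>n field_simps)
  have main: "\<exists>u. mild_sol \<sigma> \<eta> p \<epsilon> u0 u1 u2 {0..} u \<and>
          (\<forall>T v. T > 0 \<and> mild_sol \<sigma> \<eta> p \<epsilon> u0 u1 u2 {0..T} v \<longrightarrow> (\<forall>t\<in>{0..T}. AE x in lborel. v t x = u t x)) \<and>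
          lifespan \<sigma> \<eta> p \<epsilon> u0 u1 u2 = \<infinity> \<and>
          (\<forall>t \<ge> 0.
             L2norm (u t) \<le> K0 * (if ?n = 8 / 3 * \<sigma> \<and> \<eta> > 3 then \<epsilon> * ln (exp 1 + t) * B_norm \<sigma> u0 u1 u2
                 else \<epsilon> * (1 + t) powr (2 - \<nu>) * B_norm \<sigma> u0 u1 u2) \<and>
             Hdotnorm s (u t) \<le> K0 * \<epsilon> * (1 + t) powr - \<nu> * B_norm \<sigma> u0 u1 u2)"
    if \<epsilon>: "\<epsilon> \<in> {0<..e0}" and B: "in_B \<sigma> u0 u1 u2" and N1: "B_norm \<sigma> u0 u1 u2 \<le> 1" for \<epsilon> and u0 u1 u2 :: "real^'n \<Rightarrow> real"
  proof -
    let ?N = "B_norm \<sigma> u0 u1 u2"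
    have \<epsilon>0: "0 < \<epsilon>" using \<epsilon> by simp
    have N0: "0 \<le> ?N" by (rule mild_problem(2)[OF B \<epsilon>0])
    have "\<epsilon> * ?N \<le> e0 * 1" using \<epsilon> N1 N0 by (intro mult_mono) auto
    then have sm: "2 * (\<epsilon> * CB * ?N) \<le> M0" using CB_pos by (simp add: e0_def field_simps)
    from global_solution[OF B \<epsilon>0 M0 sm] obtain u where u: "mild_sol \<sigma> \<eta> p \<epsilon> u0 u1 u2 {0..} u"
      "\<forall>T v. T > 0 \<and> mild_sol \<sigma> \<eta> p \<epsilon> u0 u1 u2 {0..T} v \<longrightarrow> (\<forall>t\<in>{0..T}. AE x in lborel. v t x = u t x)"
      "lifespan \<sigma> \<eta> p \<epsilon> u0 u1 u2 = \<infinity>"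
      "\<And>t. 0 \<le> t \<Longrightarrow> L2norm (u t) \<le> 2 * (\<epsilon> * CB * ?N) / c * (1 + t) powr (2 - \<nu>)"
      "\<And>t. 0 \<le> t \<Longrightarrow> Hdotnorm s (u t) \<le> 2 * (\<epsilon> * CB * ?N) * (1 + t) powr - \<nu>"
      unfolding c_def by blast
    have "L2norm (u t) \<le> K0 * (if ?n = 8 / 3 * \<sigma> \<and> \<eta> > 3 then \<epsilon> * ln (exp 1 + t) * ?N else \<epsilon> * (1 + t) powr (2 - \<nu>) * ?N)" if t: "0 \<le> t" for t
    proof -
      have "L2norm (u t) \<le> (2 * CB / c) * (\<epsilon> * (1 + t) powr (2 - \<nu>) * ?N)" using u(4)[OF t] by (simp add: ac_simps)
      also have "\<dots> \<le> K0 * (\<epsilon> * (1 + t) powr (2 - \<nu>) * ?N)" using \<epsilon>0 N0 by (intro mult_right_mono K0) auto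
      also have "\<dots> \<le> K0 * (if ?n = 8 / 3 * \<sigma> \<and> \<eta> > 3 then \<epsilon> * ln (exp 1 + t) * ?N else \<epsilon> * (1 + t) powr (2 - \<nu>) * ?N)"
      proof (rule mult_left_mono)
        \<comment> \<open>In this dimension the exponent 2 - \<nu> vanishes, so the bound is
          constant in time and lies below the logarithm, which is at least 1.\<close>
        have "\<nu> = 2" if "?n = 8 / 3 * \<sigma>" using \<sigma> that by (simp add: \<nu>n divide_eq_eq)
        moreover have "ln (exp 1) \<le> ln (exp 1 + t)" using t by (subst ln_le_cancel_iff) (auto intro: add_pos_nonneg)
        ultimately show "\<epsilon> * (1 + t) powr (2 - \<nu>) * ?N \<le> (if ?n = 8 / 3 * \<sigma> \<and> \<eta> > 3 then \<epsilon> * ln (exp 1 + t) * ?N else \<epsilon> * (1 + t) powr (2 - \<nu>) * ?N)"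
          using \<epsilon>0 N0 t mult_right_mono[OF _ N0, of 1 "ln (exp 1 + t)"] by auto
      qed (use K0 in simp)
      finally show ?thesis .
    qed
    moreover have "Hdotnorm s (u t) \<le> K0 * \<epsilon> * (1 + t) powr - \<nu> * ?N" if t: "0 \<le> t" for t
    proof -
      have "Hdotnorm s (u t) \<le> (2 * CB) * (\<epsilon> * (1 + t) powr - \<nu> * ?N)" using u(5)[OF t] by (simp add: ac_simps)
      also have "\<dots> \<le> K0 * (\<epsilon> * (1 + t) powr - \<nu> * ?N)" using \<epsilon>0 N0 by (intro mult_right_mono K0) auto
      finally show ?thesis by (simp add: ac_simps)
    qed
    ultimately show ?thesis using u(1-3) by (intro exI[of _ u]) blast
  qed
  show ?thesis
    unfolding ex s_def[symmetric]
    \<comment> \<open>The data are normalised to norm at most 1, so that \<epsilon> alone carries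
      the smallness.\<close>
    by (rule exI[of _ 1], rule conjI, simp, rule exI[of _ e0], rule conjI, rule e0, rule exI[of _ K0], rule conjI, rule K0(1))
       (use main in blast)
qed

end
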